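(* Suppose that assumptions (FS1), (SS1), (PI1) and (PI2) (written out in the context) hold, and that $d_2(p_I,p_{rI})\to0$. Suppose that the first-stage variance component of $\hat\theta$ does not degenerate, i.e. there exists a constant $m_3$ such that $$n_IV_1(\hat\theta)\ge m_3>0,$$ where $V_1(\hat\theta)$ denotes the first-stage variance component computed with the linearized variable $l$. Then $$\frac{\hat\theta-\theta}{\sqrt{V(\hat\theta)}}\longrightarrow\mathcal N(0,1)\ \text{ in distribution,}$$ and also $$E\left[A^{-2}n_I\left|\hat V_{HAJ}(\hat\theta)-V(\hat\theta)\right|\right]=o(1),\qquad\frac{\hat V_{HAJ}(\hat\theta)}{V(\hat\theta)}\longrightarrow1\ \text{ in probability.}$$
   Context: Setting. $\mathcal F\subset\mathbb R^d$ is a fixed bounded measurable set of Lebesgue measure $A>0$. We consider a sequence (index suppressed) of partitions of $\mathcal F$ into $N_I$ disjoint measurable sub-regions (primary sampling units, PSUs) forming $U_I=\{u_1,\dots,u_{N_I}\}$; $A_i$ is the measure of $u_i$. Asymptotics: $A$ is fixed, $N_I\to\infty$, the partition becomes increasingly fine (PSU diameters shrink to $0$), and $n_I\to\infty$. Constants in the assumptions do not depend on the position in the sequence; $o(\cdot)$ and limits are along this sequence. Sampling. First stage: a random sample $S_I\subset U_I$ of fixed size $n_I$ is selected according to a design $p_I(\cdot)$ (a probability distribution on subsets of $U_I$) with inclusion probabilities $\pi_{Ii}=P(u_i\in S_I)$, $\pi_{Iij}=P(u_i,u_j\in S_I)$ (so $\pi_{Iii}=\pi_{Ii}$), $\Delta_{Iij}=\pi_{Iij}-\pi_{Ii}\pi_{Ij}$.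 Let $p_{rI}(\cdot)$ be the rejective (conditional Poisson) sampling design of size $n_I$ on $U_I$ with the same inclusion probabilities $\pi_{Ii}$, i.e. a Poisson sampling design (independent selection of the units) conditioned on the sample size being $n_I$, with parameters such that the resulting first-order inclusion probabilities equal $\pi_{Ii}$. Define $$d_2(p_I,p_{rI})=\sum_{s_I\subset U_I;\ p_{rI}(s_I)>0}\frac{\{p_I(s_I)-p_{rI}(s_I)\}^2}{p_{rI}(s_I)}.$$ Second stage: conditionally on $S_I$, for each $u_i\in S_I$ a sample $S_{IIi}$ of $n_{IIi}$ points is drawn independently from a probability density $f_{IIi}$ supported on $u_i$; the second-stage mechanism does not depend on the realization of $S_I$, and the samples $S_{IIi}$ are conditionally independent across PSUs given $S_I$. Put $\pi_{IIi}(x)=n_{IIi}f_{IIi}(x)$ and $n_{II0}=N_I^{-1}\sum_{i=1}^{N_I}n_{IIi}$. For a scalar function $\rho:\mathcal F\to\mathbb R$: $\tau_{\rho i}=\int_{u_i}\rho(x)\,dx$, $\hat\tau_{\rho i}=\sum_{x\in S_{IIi}}\rho(x)/\pi_{IIi}(x)$, the Horvitz–Thompson estimator of $\tau_\rho=\int_{\mathcal F}\rho(x)\,dx$ is $\hat\tau_\rho=\sum_{u_i\in S_I}\hat\tau_{\rho i}/\pi_{Ii}$, the first-stage variance component is $V_1(\hat\tau_\rho)=\sum_{u_i\in U_I}\sum_{u_j\in U_I}\Delta_{Iij}\frac{\tau_{\rho i}}{\pi_{Ii}}\frac{\tau_{\rho j}}{\pi_{Ij}}$, and the Hájek variance estimator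 is $$\hat V_{HAJ}(\hat\tau_\rho)=\sum_{u_i\in S_I}(1-\pi_{Ii})\left(\frac{\hat\tau_{\rho i}}{\pi_{Ii}}-\hat{\hat R}_{\pi}\right)^2+\sum_{u_i\in S_I}\frac{\hat V_i}{\pi_{Ii}},\quad \hat{\hat R}_{\pi}=\frac{\sum_{u_i\in S_I}(1-\pi_{Ii})\hat\tau_{\rho i}/\pi_{Ii}}{\sum_{u_i\in S_I}(1-\pi_{Ii})},$$ $$\hat V_i=\frac{n_{IIi}}{n_{IIi}-1}\sum_{x\in S_{IIi}}\left\{\frac{\rho(x)}{\pi_{IIi}(x)}-\frac{\hat\tau_{\rho i}}{n_{IIi}}\right\}^2.$$ Plug-in. $\boldsymbol\rho:\mathcal F\to\mathbb R^Q$ is a measurable vector function, $g:\mathbb R^Q\to\mathbb R$, $\boldsymbol\tau_{\boldsymbol\rho}=\int_{\mathcal F}\boldsymbol\rho(x)\,dx$, $\hat{\boldsymbol\tau}_{\boldsymbol\rho}$ is the vector of Horvitz–Thompson estimators, $\theta=g(\boldsymbol\tau_{\boldsymbol\rho})$, $\hat\theta=g(\hat{\boldsymbol\tau}_{\boldsymbol\rho})$; $\mathbf g'$ is the gradient of $g$. The linearized variable is $l(x)=\{\mathbf g'(\boldsymbol\tau_{\boldsymbol\rho})\}^{\top}\boldsymbol\rho(x)$ and its estimated version is $\hat l(x)=\{\mathbf g'(\hat{\boldsymbol\tau}_{\boldsymbol\rho})\}^{\top}\boldsymbol\rho(x)$. $V_1(\hat\theta)$ is $V_1(\hat\tau_\rho)$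 with $\rho$ replaced by $l$; $V(\hat\theta)$ is the variance of $\hat\theta$ under the two-stage design; $\hat V_{HAJ}(\hat\theta)$ is $\hat V_{HAJ}(\hat\tau_\rho)$ with $\rho$ replaced by $\hat l$. Assumptions. (FS1) There exist constants $f_{I0}<1$ and $0<c_{I1}\le C_{I1}<\infty$ with $n_I/N_I\le f_{I0}$ and $c_{I1}\le (N_I/n_I)\pi_{Ii}\le C_{I1}$ for all $i$. (SS1) There exist constants $0<\lambda_1\le\Lambda_1<\infty$, $0<\phi_1\le\Phi_1<\infty$, $0<c_1\le C_1<\infty$ such that for every PSU $u_i$: $\lambda_1n_{II0}\le n_{IIi}\le\Lambda_1n_{II0}$; $\phi_1A/N_I\le A_i\le\Phi_1A/N_I$; $c_1/A_i\le f_{IIi}(x)\le C_1/A_i$ for all $x\in u_i$; and $n_{IIi}\ge2$. (PI1) $g$ is homogeneous of degree $0$: $g(r\mathbf a)=g(\mathbf a)$ for every real $r>0$ and $\mathbf a\in\mathbb R^Q$. (PI2) $\boldsymbol\rho$ takes values in a convex compact set $\mathcal C\subset\mathbb R^Q$, and $\boldsymbol\mu_{\boldsymbol\rho}=A^{-1}\boldsymbol\tau_{\boldsymbol\rho}$ is an interior point of $\mathcal C$. The function $g$ is differentiable on $\mathcal C$ (at every point of $\mathcal C$), and there exists $K_g>0$ such that $\|\mathbf g'(\mathbf b)-\mathbf g'(\mathbf a)\|\le K_g\|\mathbf b-\mathbf a\|$ for all $\mathbf a,\mathbf b\in\mathcal C$ (Euclidean norm). *)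

theory Defs
  imports "HOL-Probability.Probability" "HOL-Probability.Product_PMF"
begin

text \<open>The gradient is a junk value where the function is not differentiable.\<close>

definition gradient :: "('q::euclidean_space \<Rightarrow> real) \<Rightarrow> 'q \<Rightarrow> 'q" where
  "gradient g a = (THE D. GDERIV g a :> D)"

text \<open>One member of the sequence of populations, designs and samples. The PSUs are
  \<open>psu D i\<close> for \<open>i < psu_count D\<close>, and a subset of the set of PSUs is represented by the set of
  its indices. \<open>point D i k\<close>, for \<open>k < size2 D i\<close>, is the \<open>k\<close>-th point sampled in PSU \<open>i\<close>; it is
  only meaningful at outcomes where PSU \<open>i\<close> belongs to the first-stage sample. Indexing the points
  (rather than collecting them in a set) only matters on the null event of ties.\<close>

record ('a, 'w) two_stage =
  psu_count :: nat
  psu :: "nat \<Rightarrow> 'a set"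
  size1 :: nat
  design1 :: "nat set pmf"
  size2 :: "nat \<Rightarrow> nat"
  density2 :: "nat \<Rightarrow> 'a \<Rightarrow> real"
  outcomes :: "'w measure"
  sample1 :: "'w \<Rightarrow> nat set"
  point :: "nat \<Rightarrow> nat \<Rightarrow> 'w \<Rightarrow> 'a"

definition psu_partition :: "'a::euclidean_space set \<Rightarrow> ('a, 'w) two_stage \<Rightarrow> bool" where
  "psu_partition F D \<longleftrightarrow>
     (\<forall>i<psu_count D. psu D i \<in> sets lebesgue) \<and>
     disjoint_family_on (psu D) {..<psu_count D} \<and>
     (\<Union>i<psu_count D. psu D i) = F"

definition fixed_size_samples :: "nat \<Rightarrow> nat \<Rightarrow> nat set set" where
  "fixed_size_samples N n = {s. s \<subseteq> {..<N} \<and> card s = n}"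

definition first_stage_sampling :: "('a, 'w) two_stage \<Rightarrow> bool" where
  "first_stage_sampling D \<longleftrightarrow>
     sample1 D \<in> measurable (outcomes D)
       (count_space (fixed_size_samples (psu_count D) (size1 D))) \<and>
     distr (outcomes D) (count_space UNIV) (sample1 D) = measure_pmf (design1 D)"

definition given_sample1 :: "('a, 'w) two_stage \<Rightarrow> nat set \<Rightarrow> 'w measure" where
  "given_sample1 D s =
     uniform_measure (outcomes D) {\<omega> \<in> space (outcomes D). sample1 D \<omega> = s}"

text \<open>Conditionally on the first-stage sample being \<open>s\<close>, all the points drawn in the PSUs of \<open>s\<close> are
  independent, within and across PSUs, and those of PSU \<open>i\<close> have density \<open>density2 D i\<close>. Neither the
  densities nor the sample sizes depend on \<open>s\<close>.\<close>

definition second_stage_sampling :: "('a::euclidean_space, 'w) two_stage \<Rightarrow> bool" where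
  "second_stage_sampling D \<longleftrightarrow>
     (\<forall>i<psu_count D.
        density2 D i \<in> borel_measurable lebesgue \<and>
        (\<forall>x. 0 \<le> density2 D i x) \<and>
        (\<forall>x. x \<notin> psu D i \<longrightarrow> density2 D i x = 0) \<and>
        (\<integral>\<^sup>+ x. ennreal (density2 D i x) \<partial>lebesgue) = 1) \<and>
     (\<forall>\<omega> \<in> space (outcomes D). \<forall>i \<in> sample1 D \<omega>. \<forall>k<size2 D i. point D i k \<omega> \<in> psu D i) \<and>
     (\<forall>s \<in> set_pmf (design1 D).
        prob_space.indep_vars (given_sample1 D s) (\<lambda>_. lebesgue) (\<lambda>(i, k). point D i k)
          (SIGMA i:s. {..<size2 D i}) \<and>
        (\<forall>i\<in>s. \<forall>k<size2 D i.
           distributed (given_sample1 D s) lebesgue (point D i k) (\<lambda>x. ennreal (density2 D i x))))"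

definition two_stage_sampling :: "'a::euclidean_space set \<Rightarrow> ('a, 'w) two_stage \<Rightarrow> bool" where
  "two_stage_sampling F D \<longleftrightarrow>
     psu_partition F D \<and> prob_space (outcomes D) \<and>
     first_stage_sampling D \<and> second_stage_sampling D"

definition psu_measure :: "('a::euclidean_space, 'w) two_stage \<Rightarrow> nat \<Rightarrow> real" where
  "psu_measure D i = measure lebesgue (psu D i)"

definition incl_prob :: "nat set pmf \<Rightarrow> nat \<Rightarrow> real" where
  "incl_prob p i = measure_pmf.prob p {s. i \<in> s}"

definition incl_prob2 :: "nat set pmf \<Rightarrow> nat \<Rightarrow> nat \<Rightarrow> real" where
  "incl_prob2 p i j = measure_pmf.prob p {s. i \<in> s \<and> j \<in> s}"

definition incl_cov :: "nat set pmf \<Rightarrow> nat \<Rightarrow> nat \<Rightarrow> real" where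
  "incl_cov p i j = incl_prob2 p i j - incl_prob p i * incl_prob p j"

abbreviation pi1 :: "('a, 'w) two_stage \<Rightarrow> nat \<Rightarrow> real" where
  "pi1 D i \<equiv> incl_prob (design1 D) i"

definition pi2 :: "('a, 'w) two_stage \<Rightarrow> nat \<Rightarrow> 'a \<Rightarrow> real" where
  "pi2 D i x = real (size2 D i) * density2 D i x"

definition mean_size2 :: "('a, 'w) two_stage \<Rightarrow> real" where
  "mean_size2 D = (\<Sum>i<psu_count D. real (size2 D i)) / real (psu_count D)"

definition poisson_design :: "nat \<Rightarrow> (nat \<Rightarrow> real) \<Rightarrow> nat set pmf" where
  "poisson_design N q =
     map_pmf (\<lambda>b. {i. i < N \<and> b i}) (Pi_pmf {..<N} False (\<lambda>i. bernoulli_pmf (q i)))"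

text \<open>Parameters equal to 1 are allowed, so that units may be selected with certainty.
  \<open>cond_pmf\<close> is meaningful only if the conditioning event has positive probability.\<close>

definition is_rejective_design :: "nat \<Rightarrow> nat \<Rightarrow> nat set pmf \<Rightarrow> bool" where
  "is_rejective_design N n p \<longleftrightarrow>
     (\<exists>q. (\<forall>i<N. 0 \<le> q i \<and> q i \<le> 1) \<and>
          set_pmf (poisson_design N q) \<inter> {s. card s = n} \<noteq> {} \<and>
          p = cond_pmf (poisson_design N q) {s. card s = n})"

definition design_d2 :: "nat \<Rightarrow> nat set pmf \<Rightarrow> nat set pmf \<Rightarrow> real" where
  "design_d2 N p pr =
     (\<Sum>s | s \<subseteq> {..<N} \<and> pmf pr s > 0. (pmf p s - pmf pr s)\<^sup>2 / pmf pr s)"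

definition total :: "'a::euclidean_space set \<Rightarrow> ('a \<Rightarrow> 'b::euclidean_space) \<Rightarrow> 'b" where
  "total B r = integral\<^sup>L (lebesgue_on B) r"

definition psu_total_est ::
    "('a, 'w) two_stage \<Rightarrow> ('a \<Rightarrow> 'b::euclidean_space) \<Rightarrow> nat \<Rightarrow> 'w \<Rightarrow> 'b" where
  "psu_total_est D r i \<omega> =
     (\<Sum>k<size2 D i. r (point D i k \<omega>) /\<^sub>R pi2 D i (point D i k \<omega>))"

definition horvitz_thompson ::
    "('a, 'w) two_stage \<Rightarrow> ('a \<Rightarrow> 'b::euclidean_space) \<Rightarrow> 'w \<Rightarrow> 'b" where
  "horvitz_thompson D r \<omega> = (\<Sum>i\<in>sample1 D \<omega>. psu_total_est D r i \<omega> /\<^sub>R pi1 D i)"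

definition first_stage_var :: "('a::euclidean_space, 'w) two_stage \<Rightarrow> ('a \<Rightarrow> real) \<Rightarrow> real" where
  "first_stage_var D r =
     (\<Sum>i<psu_count D. \<Sum>j<psu_count D. incl_cov (design1 D) i j *
        (total (psu D i) r / pi1 D i) * (total (psu D j) r / pi1 D j))"

definition hajek_ratio :: "('a, 'w) two_stage \<Rightarrow> ('a \<Rightarrow> real) \<Rightarrow> 'w \<Rightarrow> real" where
  "hajek_ratio D r \<omega> =
     (\<Sum>i\<in>sample1 D \<omega>. (1 - pi1 D i) * (psu_total_est D r i \<omega> / pi1 D i)) /
     (\<Sum>i\<in>sample1 D \<omega>. 1 - pi1 D i)"

definition second_stage_var_est :: "('a, 'w) two_stage \<Rightarrow> ('a \<Rightarrow> real) \<Rightarrow> nat \<Rightarrow> 'w \<Rightarrow> real" where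
  "second_stage_var_est D r i \<omega> =
     real (size2 D i) / (real (size2 D i) - 1) *
     (\<Sum>k<size2 D i. (r (point D i k \<omega>) / pi2 D i (point D i k \<omega>)
                        - psu_total_est D r i \<omega> / real (size2 D i))\<^sup>2)"

definition hajek_var_est :: "('a, 'w) two_stage \<Rightarrow> ('a \<Rightarrow> real) \<Rightarrow> 'w \<Rightarrow> real" where
  "hajek_var_est D r \<omega> =
     (\<Sum>i\<in>sample1 D \<omega>. (1 - pi1 D i) * (psu_total_est D r i \<omega> / pi1 D i - hajek_ratio D r \<omega>)\<^sup>2) +
     (\<Sum>i\<in>sample1 D \<omega>. second_stage_var_est D r i \<omega> / pi1 D i)"

definition plugin_param ::
    "'a::euclidean_space set \<Rightarrow> ('a \<Rightarrow> 'q::euclidean_space) \<Rightarrow> ('q \<Rightarrow> real) \<Rightarrow> real" where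
  "plugin_param F \<rho> g = g (total F \<rho>)"

definition plugin_est ::
    "('a, 'w) two_stage \<Rightarrow> ('a \<Rightarrow> 'q::euclidean_space) \<Rightarrow> ('q \<Rightarrow> real) \<Rightarrow> 'w \<Rightarrow> real" where
  "plugin_est D \<rho> g \<omega> = g (horvitz_thompson D \<rho> \<omega>)"

definition lin_var ::
    "'a::euclidean_space set \<Rightarrow> ('a \<Rightarrow> 'q::euclidean_space) \<Rightarrow> ('q \<Rightarrow> real) \<Rightarrow> 'a \<Rightarrow> real" where
  "lin_var F \<rho> g x = gradient g (total F \<rho>) \<bullet> \<rho> x"

definition lin_var_est ::
    "('a, 'w) two_stage \<Rightarrow> ('a \<Rightarrow> 'q::euclidean_space) \<Rightarrow> ('q \<Rightarrow> real) \<Rightarrow> 'w \<Rightarrow> 'a \<Rightarrow> real" where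
  "lin_var_est D \<rho> g \<omega> x = gradient g (horvitz_thompson D \<rho> \<omega>) \<bullet> \<rho> x"

definition plugin_var ::
    "('a, 'w) two_stage \<Rightarrow> ('a \<Rightarrow> 'q::euclidean_space) \<Rightarrow> ('q \<Rightarrow> real) \<Rightarrow> real" where
  "plugin_var D \<rho> g = prob_space.variance (outcomes D) (plugin_est D \<rho> g)"

definition plugin_hajek ::
    "('a, 'w) two_stage \<Rightarrow> ('a \<Rightarrow> 'q::euclidean_space) \<Rightarrow> ('q \<Rightarrow> real) \<Rightarrow> 'w \<Rightarrow> real" where
  "plugin_hajek D \<rho> g \<omega> = hajek_var_est D (lin_var_est D \<rho> g \<omega>) \<omega>"

definition first_stage_regular :: "(nat \<Rightarrow> ('a, 'w) two_stage) \<Rightarrow> bool" where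
  "first_stage_regular D \<longleftrightarrow>
     (\<exists>f0 c C. f0 < 1 \<and> 0 < c \<and> c \<le> C \<and>
        (\<forall>t. real (size1 (D t)) / real (psu_count (D t)) \<le> f0 \<and>
             (\<forall>i<psu_count (D t).
                c \<le> real (psu_count (D t)) / real (size1 (D t)) * pi1 (D t) i \<and>
                real (psu_count (D t)) / real (size1 (D t)) * pi1 (D t) i \<le> C)))"

definition second_stage_regular ::
    "'a::euclidean_space set \<Rightarrow> (nat \<Rightarrow> ('a, 'w) two_stage) \<Rightarrow> bool" where
  "second_stage_regular F D \<longleftrightarrow>
     (\<exists>\<kappa>1 K1 \<phi>1 \<Phi>1 c1 C1.
        0 < \<kappa>1 \<and> \<kappa>1 \<le> K1 \<and> 0 < \<phi>1 \<and> \<phi>1 \<le> \<Phi>1 \<and> 0 < c1 \<and> c1 \<le> C1 \<and>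
        (\<forall>t. \<forall>i<psu_count (D t).
           \<kappa>1 * mean_size2 (D t) \<le> real (size2 (D t) i) \<and>
           real (size2 (D t) i) \<le> K1 * mean_size2 (D t) \<and>
           \<phi>1 * measure lebesgue F / real (psu_count (D t)) \<le> psu_measure (D t) i \<and>
           psu_measure (D t) i \<le> \<Phi>1 * measure lebesgue F / real (psu_count (D t)) \<and>
           (\<forall>x \<in> psu (D t) i.
              c1 / psu_measure (D t) i \<le> density2 (D t) i x \<and>
              density2 (D t) i x \<le> C1 / psu_measure (D t) i) \<and>
           2 \<le> size2 (D t) i))"

definition homogeneous_degree_0 :: "('q::euclidean_space \<Rightarrow> real) \<Rightarrow> bool" where
  "homogeneous_degree_0 g \<longleftrightarrow> (\<forall>r a. 0 < r \<longrightarrow> g (r *\<^sub>R a) = g a)"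

definition plugin_regular ::
    "'a::euclidean_space set \<Rightarrow> ('a \<Rightarrow> 'q::euclidean_space) \<Rightarrow> ('q \<Rightarrow> real) \<Rightarrow> 'q set \<Rightarrow> bool" where
  "plugin_regular F \<rho> g C \<longleftrightarrow>
     convex C \<and> compact C \<and> (\<forall>x\<in>F. \<rho> x \<in> C) \<and>
     total F \<rho> /\<^sub>R measure lebesgue F \<in> interior C \<and>
     (\<forall>a\<in>C. g differentiable (at a)) \<and>
     (\<exists>K>0. \<forall>a\<in>C. \<forall>b\<in>C. norm (gradient g b - gradient g a) \<le> K * norm (b - a))"

text \<open>The random variables may live on a different probability space for each index.\<close>

definition converges_in_prob :: "(nat \<Rightarrow> 'w measure) \<Rightarrow> (nat \<Rightarrow> 'w \<Rightarrow> real) \<Rightarrow> real \<Rightarrow> bool" where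
  "converges_in_prob M Y c \<longleftrightarrow>
     (\<forall>t. Y t \<in> borel_measurable (M t)) \<and>
     (\<forall>\<epsilon>>0. (\<lambda>t. measure (M t) {\<omega> \<in> space (M t). \<bar>Y t \<omega> - c\<bar> > \<epsilon>}) \<longlonglongrightarrow> 0)"

end

theory Submission
  imports Defs
begin

text \<open>A rejective design is a Poisson design conditioned on its size. The size of a Poisson sample has a
  log-concave distribution, so the odds can be tilted until the prescribed size is a mode; its
  probability is then at least of the order of \<open>1 / sqrt d\<close>, where \<open>d\<close> is the variance of the size.
  Fourier inversion over the size gives, with an error of the order of \<open>1 / sqrt d\<close>, the
  characteristic function of a conditioned sum of independent contributions of the units, and the
  Cauchy--Schwarz inequality with the divergence \<open>design_d2\<close> transfers this and fourth moment bounds to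
  the actual first-stage design. Conditionally on the first stage the samples within the PSUs are
  independent with a law that does not depend on the first stage, so the Horvitz--Thompson estimator
  of a bounded variable is such a sum.

  Expanding the characteristic function at small arguments and using the fourth moments, one
  identifies the limit of the variance; fourth moments also give the law of large numbers behind the
  Hajek estimator. For the plug-in estimator, homogeneity replaces the vector of estimated totals by
  the ratio of the estimated totals to the estimated measure of \<open>F\<close>. This ratio is a convex combination
  of values of \<open>\<rho>\<close>, hence always lies in \<open>C\<close>, where the gradient is Lipschitz; so the error of
  linearization has a second moment of the order of \<open>1 / n\<^sup>2\<close>.\<close>

section \<open>The size of a Poisson sample\<close>

text \<open>The inclusion probabilities are given, but the drawing probabilities of the Poisson
  design are defined only implicitly, and a common tilt of the odds leaves the conditioned design
  unchanged. No asymptotic formula for them is derived: fixing the tilt by the mode gives an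
  explicit lower bound for the conditioning probability, and it then suffices that the two families
  of probabilities differ by \<open>O(sqrt n)\<close> in total. Conditioning couples the sum with
  the size through their covariance; subtracting one regression coefficient from every unit removes
  this coupling and only shifts the sum by a constant, because the sample size is fixed. The
  conclusion concerns the true variance of a nonlinear estimator, so convergence in distribution is
  not enough: uniform fourth moments and pathwise bounds for the linearization error are needed. All
  bounds carry explicit constants, crude but independent of the position in the sequence; a free
  argument \<theta> of the characteristic function is sent to 0 only after n has gone to
  infinity.\<close>

definition poisson_weight :: "'i set \<Rightarrow> ('i \<Rightarrow> real) \<Rightarrow> 'i set \<Rightarrow> real" where
  "poisson_weight A q s = (\<Prod>i\<in>s. q i) * (\<Prod>i\<in>A - s. 1 - q i)"

text \<open>Sizes are integers so that the neighbours \<open>k - 1\<close> and \<open>l + 1\<close>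
  exist without boundary cases; sizes that cannot occur get the value 0.\<close>

definition size_prob :: "'i set \<Rightarrow> ('i \<Rightarrow> real) \<Rightarrow> int \<Rightarrow> real" where
  "size_prob A q k = (\<Sum>s\<in>Pow A. poisson_weight A q s * of_bool (int (card s) = k))"

definition poisson_var :: "'i set \<Rightarrow> ('i \<Rightarrow> real) \<Rightarrow> real" where
  "poisson_var A q = (\<Sum>i\<in>A. q i * (1 - q i))"

lemma sum_Pow_insert:
  fixes f :: "'i set \<Rightarrow> 'b::comm_monoid_add"
  assumes "finite A" "j \<notin> A"
  shows "(\<Sum>s\<in>Pow (insert j A). f s) = (\<Sum>s\<in>Pow A. f s) + (\<Sum>s\<in>Pow A. f (insert j s))"
proof -
  have "inj_on (insert j) (Pow A)" using assms by (auto simp: inj_on_def)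
  then have "sum f (insert j ` Pow A) = (\<Sum>s\<in>Pow A. f (insert j s))"
    by (simp add: sum.reindex)
  moreover have "Pow A \<inter> insert j ` Pow A = {}" using assms by auto
  ultimately show ?thesis using assms by (simp add: Pow_insert sum.union_disjoint)
qed

lemma poisson_weight_insert:
  assumes "finite A" "j \<notin> A" "s \<subseteq> A"
  shows "poisson_weight (insert j A) q s = (1 - q j) * poisson_weight A q s"
    and "poisson_weight (insert j A) q (insert j s) = q j * poisson_weight A q s"
proof -
  have fs: "finite s" and js: "j \<notin> s" using assms by (auto intro: finite_subset)
  have "insert j A - s = insert j (A - s)" "insert j A - insert j s = A - s"
    using assms js by auto
  then show "poisson_weight (insert j A) q s = (1 - q j) * poisson_weight A q s"
    and "poisson_weight (insert j A) q (insert j s) = q j * poisson_weight A q s"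
    using assms fs js by (simp_all add: poisson_weight_def)
qed

lemma poisson_sum_insert:
  fixes F :: "'i set \<Rightarrow> real"
  assumes "finite A" "j \<notin> A"
  shows "(\<Sum>s\<in>Pow (insert j A). poisson_weight (insert j A) q s * F s) =
    (1 - q j) * (\<Sum>s\<in>Pow A. poisson_weight A q s * F s) +
    q j * (\<Sum>s\<in>Pow A. poisson_weight A q s * F (insert j s))"
  unfolding sum_Pow_insert[OF assms] sum_distrib_left
  by (intro arg_cong2[where f = "(+)"] sum.cong refl)
     (use poisson_weight_insert[OF assms] in auto)

lemma poisson_weight_nonneg:
  assumes "\<And>i. i \<in> A \<Longrightarrow> 0 \<le> q i \<and> q i \<le> 1" "s \<subseteq> A"
  shows "0 \<le> poisson_weight A q s"
  using assms unfolding poisson_weight_def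
  by (intro mult_nonneg_nonneg prod_nonneg) (auto dest!: subsetD)

lemma size_prob_nonneg:
  assumes "\<And>i. i \<in> A \<Longrightarrow> 0 \<le> q i \<and> q i \<le> 1"
  shows "0 \<le> size_prob A q k"
  unfolding size_prob_def using poisson_weight_nonneg[OF assms] by (intro sum_nonneg) auto

lemma poisson_var_nonneg:
  assumes "\<And>i. i \<in> A \<Longrightarrow> 0 \<le> q i \<and> q i \<le> 1"
  shows "0 \<le> poisson_var A q"
  unfolding poisson_var_def using assms by (intro sum_nonneg) auto

lemma size_prob_insert:
  assumes "finite A" "j \<notin> A"
  shows "size_prob (insert j A) q k = (1 - q j) * size_prob A q k + q j * size_prob A q (k - 1)"
proof -
  have "(\<Sum>s\<in>Pow A. poisson_weight A q s * of_bool (int (card (insert j s)) = k)) =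
      (\<Sum>s\<in>Pow A. poisson_weight A q s * of_bool (int (card s) = k - 1))"
  proof (rule sum.cong[OF refl])
    fix s assume "s \<in> Pow A"
    then have "finite s" "j \<notin> s" using assms by (auto intro: finite_subset)
    then show "poisson_weight A q s * of_bool (int (card (insert j s)) = k) =
        poisson_weight A q s * of_bool (int (card s) = k - 1)"
      by (simp add: of_bool_def algebra_simps)
  qed
  then show ?thesis unfolding size_prob_def by (simp only: poisson_sum_insert[OF assms])
qed

lemma size_prob_empty: "size_prob {} q k = of_bool (k = 0)"
  by (simp add: size_prob_def poisson_weight_def)

text \<open>Induction on the units. With one more unit the difference of the two products is a
  combination, with coefficients \<open>(1 - q j)\<^sup>2\<close>, \<open>(q j)\<^sup>2\<close> and
  \<open>q j * (1 - q j)\<close>, of three differences of the old sequence; the remaining mixed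
  products cancel. Allowing \<open>k < l\<close>, and not only \<open>k = l\<close>, makes the
  induction hypothesis strong enough for the third one.\<close>

lemma size_prob_log_concave:
  assumes "finite A" "\<And>i. i \<in> A \<Longrightarrow> 0 \<le> q i \<and> q i \<le> 1" "k \<le> l"
  shows "size_prob A q (k - 1) * size_prob A q (l + 1) \<le> size_prob A q k * size_prob A q l"
  using assms
proof (induction A arbitrary: k l rule: finite_induct)
  case empty
  then show ?case by (auto simp: size_prob_empty)
next
  case (insert j A)
  let ?a = "size_prob A q"
  have q: "0 \<le> q j" "q j \<le> 1" using insert.prems(1)[of j] by auto
  have IH: "?a (k - 1) * ?a (l + 1) \<le> ?a k * ?a l" if "k \<le> l" for k l
    using insert.IH[of k l] insert.prems that by auto
  have 1: "?a (k - 1) * ?a (l + 1) \<le> ?a k * ?a l" using IH insert.prems by blast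
  have 2: "?a (k - 2) * ?a l \<le> ?a (k - 1) * ?a (l - 1)"
    using IH[of "k - 1" "l - 1"] insert.prems by (simp add: algebra_simps)
  \<comment> \<open>Here the indices move apart by two. For \<open>k < l\<close> the hypothesis is
    used twice, passing through \<open>?a (k - 1) * ?a l\<close>; for \<open>k = l\<close> a single
    use already gives the claim.\<close>
  have 3: "?a (k - 2) * ?a (l + 1) \<le> ?a k * ?a (l - 1)"
  proof (cases "k = l")
    case True
    then show ?thesis using IH[of "k - 1" l] by (simp add: algebra_simps)
  next
    case False
    then have "k \<le> l - 1" using insert.prems by simp
    then have "?a (k - 1) * ?a l \<le> ?a k * ?a (l - 1)" using IH[of k "l - 1"] by simp
    moreover have "?a (k - 2) * ?a (l + 1) \<le> ?a (k - 1) * ?a l"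
      using IH[of "k - 1" l] insert.prems by simp
    ultimately show ?thesis by linarith
  qed
  have "0 \<le> (1 - q j)^2 * (?a k * ?a l - ?a (k - 1) * ?a (l + 1))
      + (q j)^2 * (?a (k - 1) * ?a (l - 1) - ?a (k - 2) * ?a l)
      + (q j * (1 - q j)) * (?a k * ?a (l - 1) - ?a (k - 2) * ?a (l + 1))"
    using 1 2 3 q by (intro add_nonneg_nonneg mult_nonneg_nonneg) auto
  then show ?case
    using insert.hyps by (simp add: size_prob_insert power2_eq_square algebra_simps)
qed

text \<open>The three moments are proved together, one unit at a time, since each of them needs the
  lower ones. Centering at \<open>\<Sum>i\<in>A. q i\<close> makes the variances of the units add
  up.\<close>

lemma poisson_moments:
  assumes "finite A"
  shows "(\<Sum>s\<in>Pow A. poisson_weight A q s) = 1"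
    and "(\<Sum>s\<in>Pow A. poisson_weight A q s * (real (card s) - (\<Sum>i\<in>A. q i))) = 0"
    and "(\<Sum>s\<in>Pow A. poisson_weight A q s * (real (card s) - (\<Sum>i\<in>A. q i))\<^sup>2) = poisson_var A q"
  using assms
proof (induction A rule: finite_induct)
  case empty
  { case 1 then show ?case by (simp add: poisson_weight_def) }
  { case 2 then show ?case by (simp add: poisson_weight_def) }
  { case 3 then show ?case by (simp add: poisson_weight_def poisson_var_def) }
next
  case (insert j A)
  let ?w = "poisson_weight A q" and ?m = "\<Sum>i\<in>A. q i"
  have c: "real (card (insert j s)) = real (card s) + 1" if "s \<in> Pow A" for s
    using that insert.hyps by (subst card_insert_disjoint) (auto intro: finite_subset)
  have cc: "(\<Sum>s\<in>Pow A. ?w s * f (real (card (insert j s)))) =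
      (\<Sum>s\<in>Pow A. ?w s * f (real (card s) + 1))" for f
    by (rule sum.cong[OF refl]) (simp only: c)
  { case 1
    then show ?case using insert.IH(1) poisson_sum_insert[OF insert.hyps, of q "\<lambda>_. 1"] by simp }
  { case 2
    have "(\<Sum>s\<in>Pow A. ?w s * (real (card s) - (q j + ?m))) = - q j"
      using insert.IH(1,2) by (simp add: algebra_simps sum.distrib sum_subtractf flip: sum_distrib_left)
    moreover have "(\<Sum>s\<in>Pow A. ?w s * (real (card (insert j s)) - (q j + ?m))) = 1 - q j"
      using insert.IH(1,2) unfolding cc[of "\<lambda>x. x - (q j + ?m)"]
      by (simp add: algebra_simps sum.distrib sum_subtractf flip: sum_distrib_left)
    ultimately show ?case
      unfolding sum.insert[OF insert.hyps] poisson_sum_insert[OF insert.hyps]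
      by (simp only:) (simp add: algebra_simps) }
  { case 3
    \<comment> \<open>The first centered moment vanishes, so moving the centre by \<open>x\<close>
      adds exactly \<open>x\<^sup>2\<close>; the relevant moves are \<open>- q j\<close> and
      \<open>1 - q j\<close>.\<close>
    have *: "(\<Sum>s\<in>Pow A. ?w s * (real (card s) - ?m + x)\<^sup>2) = poisson_var A q + x\<^sup>2" for x
    proof -
      have "(\<Sum>s\<in>Pow A. ?w s * (real (card s) - ?m + x)\<^sup>2) =
        (\<Sum>s\<in>Pow A. ?w s * (real (card s) - ?m)\<^sup>2 + 2 * x * (?w s * (real (card s) - ?m)) + x\<^sup>2 * ?w s)"
        by (intro sum.cong) (auto simp: power2_eq_square algebra_simps)
      then show ?thesis using insert.IH by (simp add: sum.distrib flip: sum_distrib_left)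
    qed
    have "(\<Sum>s\<in>Pow A. ?w s * (real (card s) - (q j + ?m))\<^sup>2) = poisson_var A q + (- q j)\<^sup>2"
      using *[of "- q j"] by (simp add: algebra_simps)
    moreover have "(\<Sum>s\<in>Pow A. ?w s * (real (card (insert j s)) - (q j + ?m))\<^sup>2) = poisson_var A q + (1 - q j)\<^sup>2"
      using *[of "1 - q j"] unfolding cc[of "\<lambda>x. (x - (q j + ?m))\<^sup>2"] by (simp add: algebra_simps)
    ultimately show ?case
      using insert.hyps
      unfolding sum.insert[OF insert.hyps] poisson_sum_insert[OF insert.hyps]
      by (simp only:) (simp add: poisson_var_def algebra_simps power2_eq_square) }
qed

text \<open>By Chebyshev's inequality a window of about two standard deviations around the mean
  carries probability at least 3/4. It contains at most \<open>3 * r\<close> integers, each of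
  probability at most \<open>p\<close>.\<close>

lemma size_prob_mode_ge:
  assumes "finite A" and q: "\<And>i. i \<in> A \<Longrightarrow> 0 \<le> q i \<and> q i \<le> 1"
    and mode: "\<And>k. size_prob A q k \<le> p"
  shows "1 \<le> 8 * sqrt (poisson_var A q + 1) * p"
proof -
  let ?w = "poisson_weight A q" and ?m = "\<Sum>i\<in>A. q i" and ?d = "poisson_var A q"
  \<comment> \<open>The summand 1 forces \<open>2 \<le> r\<close> even for a tiny variance, so that
    the number \<open>2 * r + 1\<close> of integers in the window is at most
    \<open>3 * r\<close>.\<close>
  define r where "r = 2 * sqrt (?d + 1)"
  have d0: "0 \<le> ?d" using poisson_var_nonneg q by blast
  then have r2: "2 \<le> r" and rsq: "r\<^sup>2 = 4 * (?d + 1)" by (auto simp: r_def power_mult_distrib)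
  have w0: "0 \<le> ?w s" if "s \<in> Pow A" for s using poisson_weight_nonneg q that by blast
  define K where "K = {\<lceil>?m - r\<rceil>..\<lfloor>?m + r\<rfloor>}"
  have "real (card K) \<le> 2 * r + 1"
  proof -
    have "real (card K) = real_of_int (max 0 (\<lfloor>?m + r\<rfloor> - \<lceil>?m - r\<rceil> + 1))" by (simp add: K_def)
    then show ?thesis using r2 by (simp add: max_def) linarith
  qed
  then have cK: "real (card K) \<le> 3 * r" using r2 by linarith
  have p0: "0 \<le> p" using mode[of 0] size_prob_nonneg[of A q 0] q by force
  have "1 = (\<Sum>s\<in>Pow A. ?w s)" using poisson_moments(1)[OF assms(1), of q] by simp
  also have "\<dots> \<le> (\<Sum>s\<in>Pow A. ?w s * (\<Sum>k\<in>K. of_bool (int (card s) = k)) + (?w s * (real (card s) - ?m)\<^sup>2) / r\<^sup>2)"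
  proof (rule sum_mono)
    fix s assume s: "s \<in> Pow A"
    show "?w s \<le> ?w s * (\<Sum>k\<in>K. of_bool (int (card s) = k)) + (?w s * (real (card s) - ?m)\<^sup>2) / r\<^sup>2"
    proof (cases "int (card s) \<in> K")
      case True
      then have "(\<Sum>k\<in>K. of_bool (int (card s) = k) :: real) = 1"
        by (simp add: K_def of_bool_def)
      then show ?thesis using w0[OF s] by simp
    next
      case False
      then have "\<bar>real (card s) - ?m\<bar> > r"
        unfolding K_def by (simp add: ceiling_le_iff le_floor_iff) linarith
      then have "r\<^sup>2 \<le> (real (card s) - ?m)\<^sup>2" using r2 by (simp add: abs_le_square_iff[symmetric])
      then have "1 \<le> (real (card s) - ?m)\<^sup>2 / r\<^sup>2" using r2 by simp
      then have "?w s * 1 \<le> ?w s * ((real (card s) - ?m)\<^sup>2 / r\<^sup>2)"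
        using w0[OF s] by (rule mult_left_mono)
      moreover have "(\<Sum>k\<in>K. of_bool (int (card s) = k) :: real) = 0"
        using False by (intro sum.neutral) auto
      ultimately show ?thesis by simp
    qed
  qed
  also have "\<dots> = (\<Sum>k\<in>K. size_prob A q k) + ?d / r\<^sup>2"
  proof -
    have "(\<Sum>k\<in>K. size_prob A q k) = (\<Sum>s\<in>Pow A. \<Sum>k\<in>K. ?w s * of_bool (int (card s) = k))"
      unfolding size_prob_def by (rule sum.swap)
    moreover have "(\<Sum>s\<in>Pow A. ?w s * (real (card s) - ?m)\<^sup>2 / r\<^sup>2) = ?d / r\<^sup>2"
      using poisson_moments(3)[OF assms(1), of q] by (simp flip: sum_divide_distrib)
    ultimately show ?thesis by (simp only: sum.distrib sum_distrib_left)
  qed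
  also have "\<dots> \<le> real (card K) * p + 1 / 4"
  proof (rule add_mono)
    show "(\<Sum>k\<in>K. size_prob A q k) \<le> real (card K) * p"
      using mode sum_bounded_above[of K "size_prob A q" p] by simp
    show "?d / r\<^sup>2 \<le> 1 / 4" using d0 by (simp add: rsq field_simps)
  qed
  also have "\<dots> \<le> 3 * r * p + 1 / 4" using cK p0 by (simp add: mult_right_mono)
  finally have "1 \<le> 4 * r * p" by linarith
  then show ?thesis by (simp add: r_def)
qed

text \<open>Tilting multiplies the odds of all units by the weights \<open>c i\<close>.\<close>

definition tilted :: "('i \<Rightarrow> real) \<Rightarrow> ('i \<Rightarrow> real) \<Rightarrow> 'i \<Rightarrow> real" where
  "tilted c q i = c i * q i / (1 - q i + c i * q i)"

lemma tilted_denominator_pos: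
  fixes c q :: "'i \<Rightarrow> real"
  assumes "0 \<le> q i" "q i \<le> 1" "0 < c i"
  shows "0 < 1 - q i + c i * q i"
proof (cases "q i = 1")
  case False
  then have "0 < 1 - q i" using assms by simp
  moreover have "0 \<le> c i * q i" using assms by simp
  ultimately show ?thesis by linarith
qed (use assms in simp)

lemma tilted_complement:
  assumes "0 \<le> q i" "q i \<le> 1" "0 < c i"
  shows "1 - tilted c q i = (1 - q i) / (1 - q i + c i * q i)"
proof -
  define z where "z = 1 - q i + c i * q i"
  have "z \<noteq> 0" using tilted_denominator_pos[of q i c, OF assms] by (simp add: z_def)
  then have "1 - c i * q i / z = (z - c i * q i) / z" by (simp add: diff_divide_distrib)
  then show ?thesis by (simp add: tilted_def z_def)
qed

lemma tilted_bounds: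
  assumes "0 \<le> q i" "q i \<le> 1" "0 < c i"
  shows "0 \<le> tilted c q i" "tilted c q i \<le> 1"
proof -
  have d: "0 < 1 - q i + c i * q i" using tilted_denominator_pos[of q i c, OF assms] .
  show "0 \<le> tilted c q i"
    unfolding tilted_def using d assms by (intro divide_nonneg_pos mult_nonneg_nonneg) auto
  have "0 \<le> 1 - tilted c q i"
    unfolding tilted_complement[of q i c, OF assms] using d assms by (intro divide_nonneg_pos) auto
  then show "tilted c q i \<le> 1" by simp
qed

text \<open>Exponential change of measure: reweighting a sample by the product of the
  \<open>c i\<close> over its units gives, up to a normalization that is the same for all samples,
  again a Poisson design.\<close>

lemma poisson_weight_tilted:
  assumes "finite A" and q: "\<And>i. i \<in> A \<Longrightarrow> 0 \<le> q i \<and> q i \<le> 1" and c: "\<And>i. i \<in> A \<Longrightarrow> 0 < c i"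
    and s: "s \<subseteq> A"
  shows "(\<Prod>i\<in>s. c i) * poisson_weight A q s =
    (\<Prod>i\<in>A. 1 - q i + c i * q i) * poisson_weight A (tilted c q) s"
proof -
  let ?z = "\<lambda>i. 1 - q i + c i * q i"
  have z: "0 < ?z i" if "i \<in> A" for i using tilted_denominator_pos[of q i c] q c that by auto
  have A: "(\<Prod>i\<in>A. ?z i) = (\<Prod>i\<in>s. ?z i) * (\<Prod>i\<in>A - s. ?z i)"
    using prod.subset_diff[OF s assms(1), of ?z] by (simp only: mult.commute)
  have "(\<Prod>i\<in>s. ?z i) * (\<Prod>i\<in>s. tilted c q i) = (\<Prod>i\<in>s. c i) * (\<Prod>i\<in>s. q i)"
    unfolding prod.distrib[symmetric]
  proof (rule prod.cong[OF refl])
    fix i assume "i \<in> s"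
    then have "?z i \<noteq> 0" using z[of i] s by auto
    then show "?z i * tilted c q i = c i * q i"
      unfolding tilted_def by (subst times_divide_eq_right) (rule nonzero_mult_div_cancel_left)
  qed
  moreover have "(\<Prod>i\<in>A - s. ?z i) * (\<Prod>i\<in>A - s. 1 - tilted c q i) = (\<Prod>i\<in>A - s. 1 - q i)"
    unfolding prod.distrib[symmetric]
  proof (rule prod.cong[OF refl])
    fix i assume "i \<in> A - s"
    then have "?z i \<noteq> 0" and "1 - tilted c q i = (1 - q i) / ?z i"
      using z[of i] q[of i] c[of i] tilted_complement[of q i c] by auto
    then show "?z i * (1 - tilted c q i) = 1 - q i"
      by (metis nonzero_mult_div_cancel_left times_divide_eq_right)
  qed
  ultimately have "(\<Prod>i\<in>s. c i) * (\<Prod>i\<in>s. q i) * (\<Prod>i\<in>A - s. 1 - q i) =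
    (\<Prod>i\<in>s. ?z i) * (\<Prod>i\<in>s. tilted c q i) * ((\<Prod>i\<in>A - s. ?z i) * (\<Prod>i\<in>A - s. 1 - tilted c q i))"
    by simp
  then show ?thesis unfolding A poisson_weight_def by (simp only: mult_ac)
qed

text \<open>Evaluates the exponential moments of a sum over the sample on the event that the size is
  \<open>k\<close>: they become a size probability of another Poisson design, to which the local
  upper bound applies.\<close>

lemma size_prob_tilted:
  assumes "finite A" "\<And>i. i \<in> A \<Longrightarrow> 0 \<le> q i \<and> q i \<le> 1" "\<And>i. i \<in> A \<Longrightarrow> 0 < c i"
  shows "(\<Sum>s\<in>Pow A. poisson_weight A q s * of_bool (int (card s) = k) * (\<Prod>i\<in>s. c i)) =
    (\<Prod>i\<in>A. 1 - q i + c i * q i) * size_prob A (tilted c q) k"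
  unfolding size_prob_def sum_distrib_left
  by (rule sum.cong[OF refl], insert poisson_weight_tilted[OF assms])
     (force simp: mult_ac)

section \<open>Fourier inversion over the sample size\<close>

lemma integral_exp_int:
  fixes k :: int
  shows "((\<lambda>u. exp (\<i> * of_real u * of_int k)) has_integral (if k = 0 then 2 * of_real pi else 0)) {-pi..pi}"
proof (cases "k = 0")
  case True
  show ?thesis using True has_integral_const_real[of "1::complex" "-pi" pi] by (simp add: scaleR_conv_of_real)
next
  case False
  define F where "F = (\<lambda>u::real. exp (\<i> * of_real u * of_int k) / (\<i> * of_int k) :: complex)"
  have "(F has_vector_derivative exp (\<i> * of_real u * of_int k)) (at u within {-pi..pi})" for u
    unfolding F_def using False
    by (auto intro!: derivative_eq_intros has_vector_derivative_real_field simp: field_simps)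
  then have "((\<lambda>u. exp (\<i> * of_real u * of_int k)) has_integral (F pi - F (-pi))) {-pi..pi}"
    by (intro fundamental_theorem_of_calculus) auto
  moreover have "F pi = F (-pi)"
  proof -
    have "exp (\<i> * of_real pi * of_int k) = exp (\<i> * of_real (- pi) * of_int k)"
      unfolding exp_eq by (intro exI[of _ k]) (simp add: algebra_simps)
    then show ?thesis by (simp add: F_def)
  qed
  ultimately show ?thesis using False by simp
qed

text \<open>Expanding the product over the subsets of \<open>A\<close> turns the integrand into a
  trigonometric polynomial in which the sample \<open>s\<close> has frequency
  \<open>card s - k\<close>; integration over a period keeps the samples of size \<open>k\<close>.
  The factors \<open>h i\<close> pass through untouched, so the identity gives sums and sizes
  jointly.\<close>

lemma size_fourier_inversion:
  fixes h :: "'i \<Rightarrow> complex"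
  assumes "finite A"
  shows "((\<lambda>u. exp (- (\<i> * of_real u * of_int k)) *
      (\<Prod>i\<in>A. of_real (1 - q i) + of_real (q i) * h i * exp (\<i> * of_real u)))
    has_integral (2 * of_real pi *
      (\<Sum>s\<in>Pow A. of_real (poisson_weight A q s * of_bool (int (card s) = k)) * (\<Prod>i\<in>s. h i)))) {-pi..pi}"
proof -
  let ?W = "\<lambda>s. of_real (poisson_weight A q s) * (\<Prod>i\<in>s. h i)"
  have eq: "exp (- (\<i> * of_real u * of_int k)) *
      (\<Prod>i\<in>A. of_real (1 - q i) + of_real (q i) * h i * exp (\<i> * of_real u)) =
      (\<Sum>s\<in>Pow A. ?W s * exp (\<i> * of_real u * of_int (int (card s) - k)))" for u
  proof -
    have "(\<Prod>i\<in>A. of_real (1 - q i) + of_real (q i) * h i * exp (\<i> * of_real u)) =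
        (\<Prod>i\<in>A. of_real (q i) * h i * exp (\<i> * of_real u) + of_real (1 - q i))"
      by (simp add: add.commute)
    also have "\<dots> = (\<Sum>s\<in>Pow A. (\<Prod>i\<in>s. of_real (q i) * h i * exp (\<i> * of_real u)) * (\<Prod>i\<in>A - s. of_real (1 - q i)))"
      by (rule prod_add[OF assms])
    also have "\<dots> = (\<Sum>s\<in>Pow A. ?W s * exp (\<i> * of_real u * of_nat (card s)))"
      by (rule sum.cong) (auto simp: prod.distrib poisson_weight_def exp_of_nat2_mult of_real_prod)
    finally show ?thesis
      by (simp add: sum_distrib_left exp_diff exp_minus algebra_simps divide_simps)
  qed
  have "((\<lambda>u. \<Sum>s\<in>Pow A. ?W s * exp (\<i> * of_real u * of_int (int (card s) - k))) has_integral
      (\<Sum>s\<in>Pow A. ?W s * (if int (card s) - k = 0 then 2 * of_real pi else 0))) {-pi..pi}"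
    using assms by (intro has_integral_sum has_integral_mult_right integral_exp_int) auto
  moreover have "(\<Sum>s\<in>Pow A. ?W s * (if int (card s) - k = 0 then 2 * of_real pi else 0)) =
      2 * of_real pi *
      (\<Sum>s\<in>Pow A. of_real (poisson_weight A q s * of_bool (int (card s) = k)) * (\<Prod>i\<in>s. h i))"
    unfolding sum_distrib_left by (rule sum.cong) auto
  ultimately show ?thesis unfolding eq by simp
qed

text \<open>From \<open>sin x \<ge> x / 3\<close> on the interval from 0 to 2 and
  \<open>1 - cos u = 2 * (sin (u / 2))\<^sup>2\<close>. The range up to 4 covers the whole period
  because \<open>pi < 4\<close>.\<close>

lemma one_minus_cos_ge:
  fixes u :: real
  assumes "\<bar>u\<bar> \<le> 4"
  shows "u\<^sup>2 / 18 \<le> 1 - cos u"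
proof -
  have sin3: "x / 3 \<le> sin x" if "0 \<le> x" "x \<le> 2" for x :: real
  proof -
    have "cmod (iexp x - (\<Sum>k\<le>2. (\<i> * x)^k / fact k)) \<le> \<bar>x\<bar>^3 / 6"
      using iexp_approx1[of x 2] by (simp add: eval_nat_numeral)
    then have "\<bar>Im (iexp x - (\<Sum>k\<le>2. (\<i> * x)^k / fact k))\<bar> \<le> \<bar>x\<bar>^3 / 6"
      using abs_Im_le_cmod order_trans by blast
    then have "\<bar>sin x - x\<bar> \<le> x ^ 3 / 6"
      using that by (simp add: eval_nat_numeral Im_exp Re_exp)
    then have "x - x ^ 3 / 6 \<le> sin x" by linarith
    moreover have "x ^ 3 \<le> 4 * x"
    proof -
      have "x * x \<le> 2 * 2" using that by (intro mult_mono) auto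
      then have "x * (x * x) \<le> x * 4" using that by (intro mult_left_mono) auto
      then show ?thesis by (simp add: power3_eq_cube mult.assoc)
    qed
    ultimately show ?thesis by linarith
  qed
  have "\<bar>u\<bar> / 6 \<le> sin (\<bar>u\<bar> / 2)" using sin3[of "\<bar>u\<bar> / 2"] assms by simp
  then have "(\<bar>u\<bar> / 6)\<^sup>2 \<le> (sin (\<bar>u\<bar> / 2))\<^sup>2" by (intro power_mono) auto
  moreover have "cos \<bar>u\<bar> = 1 - 2 * (sin (\<bar>u\<bar> / 2))\<^sup>2" using cos_double_sin[of "\<bar>u\<bar> / 2"] by simp
  ultimately show ?thesis by (simp add: power_divide)
qed

text \<open>The squared modulus is \<open>(1 - q)\<^sup>2 + 2 * q * (1 - q) * Re z + q\<^sup>2 *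
  (cmod z)\<^sup>2\<close>, so decay needs only \<open>cmod z \<le> 1\<close> and a gap between 1
  and \<open>Re z\<close>. In this form it serves the pure size factor as well as the factor
  perturbed by a contribution \<open>h i\<close>.\<close>

lemma cmod_bernoulli_char_le:
  assumes q: "0 \<le> q" "q \<le> 1" and "cmod z \<le> 1" and x: "x \<le> 1 - Re z"
  shows "cmod (of_real (1 - q) + of_real q * z) \<le> exp (- (q * (1 - q) * x))"
proof -
  have "(cmod (of_real (1 - q) + of_real q * z))\<^sup>2 = (1 - q)\<^sup>2 + 2 * (q * (1 - q)) * Re z + q\<^sup>2 * (cmod z)\<^sup>2"
    unfolding cmod_power2 by (simp add: power2_eq_square algebra_simps)
  also have "\<dots> \<le> (1 - q)\<^sup>2 + 2 * (q * (1 - q)) * (1 - x) + q\<^sup>2 * 1"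
    using assms by (intro add_mono mult_left_mono) (auto simp: power_le_one)
  also have "\<dots> = 1 + - (2 * (q * (1 - q) * x))" by (simp add: power2_eq_square algebra_simps)
  also have "\<dots> \<le> exp (- (2 * (q * (1 - q) * x)))" using exp_ge_add_one_self by blast
  also have "\<dots> = (exp (- (q * (1 - q) * x)))\<^sup>2" by (simp flip: exp_double)
  finally show ?thesis by (rule power2_le_imp_le) simp
qed

text \<open>The primitive is an arctangent. This integrand replaces the Gaussian one: it dominates
  it, has the same width \<open>1 / sqrt a\<close>, and integrates over a period in closed
  form.\<close>

lemma integral_inverse_quadratic_le:
  fixes a :: real
  assumes "0 < a"
  shows "(\<lambda>u. 1 / (1 + a * u\<^sup>2)) integrable_on {-pi..pi}"
    and "integral {-pi..pi} (\<lambda>u. 1 / (1 + a * u\<^sup>2)) \<le> pi / sqrt a"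
proof -
  define F where "F u = arctan (sqrt a * u) / sqrt a" for u
  have "(F has_vector_derivative 1 / (1 + a * u\<^sup>2)) (at u within {-pi..pi})" for u
  proof -
    have "(F has_real_derivative 1 / (1 + a * u\<^sup>2)) (at u within {-pi..pi})"
    proof -
      have "(F has_real_derivative sqrt a * (1 / (1 + (sqrt a * u)\<^sup>2)) / sqrt a) (at u within {-pi..pi})"
        unfolding F_def using assms by (auto intro!: derivative_eq_intros simp: inverse_eq_divide)
      then show ?thesis using assms by (simp add: power_mult_distrib)
    qed
    then show ?thesis by (simp add: has_real_derivative_iff_has_vector_derivative)
  qed
  then have *: "((\<lambda>u. 1 / (1 + a * u\<^sup>2)) has_integral (F pi - F (-pi))) {-pi..pi}"
    by (intro fundamental_theorem_of_calculus) auto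
  then show "(\<lambda>u. 1 / (1 + a * u\<^sup>2)) integrable_on {-pi..pi}" by blast
  have "arctan (sqrt a * pi) - arctan (- (sqrt a * pi)) \<le> pi"
    using arctan_ubound[of "sqrt a * pi"] by (simp add: arctan_minus)
  then have "F pi - F (-pi) \<le> pi / sqrt a"
    using assms by (simp add: F_def diff_divide_distrib[symmetric] divide_right_mono)
  then show "integral {-pi..pi} (\<lambda>u. 1 / (1 + a * u\<^sup>2)) \<le> pi / sqrt a"
    using * by (simp add: integral_unique)
qed

text \<open>Fourier inversion with trivial contributions: the modulus of the integrand decays like
  \<open>exp (- d * u\<^sup>2 / 18)\<close>, which has integral of order \<open>1 / sqrt d\<close>.
  For \<open>d \<le> 1\<close> the trivial bound 1 on a probability is enough.\<close>

lemma size_prob_le: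
  assumes "finite A" and q: "\<And>i. i \<in> A \<Longrightarrow> 0 \<le> q i \<and> q i \<le> 1"
  shows "size_prob A q k * sqrt (poisson_var A q + 1) \<le> 4"
proof -
  let ?d = "poisson_var A q"
  have d0: "0 \<le> ?d" using poisson_var_nonneg q by blast
  show ?thesis
  proof (cases "?d \<le> 1")
    case True
    have "size_prob A q k \<le> (\<Sum>s\<in>Pow A. poisson_weight A q s)"
      unfolding size_prob_def using poisson_weight_nonneg[OF q] by (intro sum_mono) auto
    then have "size_prob A q k \<le> 1" using poisson_moments(1)[OF assms(1)] by simp
    moreover have "sqrt (?d + 1) \<le> sqrt 4" using True by (intro real_sqrt_le_mono) simp
    ultimately have "size_prob A q k * sqrt (?d + 1) \<le> 1 * sqrt 4"
      using d0 by (intro mult_mono) auto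
    then show ?thesis by simp
  next
    case False
    let ?f = "\<lambda>u::real. exp (- (\<i> * of_real u * of_int k)) *
      (\<Prod>i\<in>A. of_real (1 - q i) + of_real (q i) * 1 * exp (\<i> * of_real u))"
    have *: "(?f has_integral (2 * of_real pi * of_real (size_prob A q k))) {-pi..pi}"
      using size_fourier_inversion[OF assms(1), of k q "\<lambda>_. 1"] by (simp add: size_prob_def)
    have "cmod (?f u) \<le> 1 / (1 + ?d / 18 * u\<^sup>2)" if "u \<in> {-pi..pi}" for u
    proof -
      have u: "\<bar>u\<bar> \<le> 4" using that pi_less_4 by auto
      have "cmod (?f u) = (\<Prod>i\<in>A. cmod (of_real (1 - q i) + of_real (q i) * exp (\<i> * of_real u)))"
        by (simp add: norm_mult prod_norm)
      also have "\<dots> \<le> (\<Prod>i\<in>A. exp (- (q i * (1 - q i) * (u\<^sup>2 / 18))))"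
        using q one_minus_cos_ge[OF u]
        by (intro prod_mono conjI cmod_bernoulli_char_le) (auto simp: Re_exp)
      also have "\<dots> = exp (- (?d / 18 * u\<^sup>2))"
        using assms(1) by (simp add: exp_sum[symmetric] poisson_var_def sum_negf sum_divide_distrib sum_distrib_right)
      also have "\<dots> \<le> 1 / (1 + ?d / 18 * u\<^sup>2)"
      proof -
        have "1 + ?d / 18 * u\<^sup>2 \<le> exp (?d / 18 * u\<^sup>2)" by (rule exp_ge_add_one_self)
        moreover have "0 < 1 + ?d / 18 * u\<^sup>2" using d0 by (simp add: add_pos_nonneg)
        ultimately show ?thesis by (simp add: exp_minus field_simps)
      qed
      finally show ?thesis .
    qed
    then have "cmod (integral {-pi..pi} ?f) \<le> integral {-pi..pi} (\<lambda>u. 1 / (1 + ?d / 18 * u\<^sup>2))"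
      using False * by (intro integral_norm_bound_integral integral_inverse_quadratic_le) auto
    also have "\<dots> \<le> pi / sqrt (?d / 18)"
      using False by (intro integral_inverse_quadratic_le) auto
    finally have "2 * pi * size_prob A q k \<le> pi / sqrt (?d / 18)"
      using integral_unique[OF *] size_prob_nonneg[of A q k] q by (simp add: norm_mult)
    then have "pi * (2 * size_prob A q k) \<le> pi * (1 / sqrt (?d / 18))" by simp
    then have "2 * size_prob A q k \<le> 1 / sqrt (?d / 18)" by (rule mult_left_le_imp_le) simp
    then have "size_prob A q k \<le> (1 / sqrt (?d / 18)) / 2" by simp
    then have "size_prob A q k * sqrt (?d + 1) \<le> (1 / sqrt (?d / 18)) / 2 * sqrt (2 * ?d)"
      using False d0 by (intro mult_mono real_sqrt_le_mono) auto
    also have "\<dots> = 3"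
    proof -
      have "sqrt (2 * ?d) = sqrt (6\<^sup>2 * (?d / 18))" by simp
      also have "\<dots> = 6 * sqrt (?d / 18)" by (simp only: real_sqrt_mult real_sqrt_abs abs_numeral)
      finally show ?thesis using False by simp
    qed
    finally show ?thesis by simp
  qed
qed

section \<open>Comparison of a single factor of the joint characteristic function\<close>

lemma cmod_exp_minus_two_terms_le:
  fixes w :: complex
  shows "cmod (exp w - (1 + w)) \<le> exp \<bar>Re w\<bar> * (cmod w)\<^sup>2"
    and "cmod (exp w - (1 + w + w\<^sup>2 / 2)) \<le> exp \<bar>Re w\<bar> * (cmod w) ^ 3 / 2"
  using Taylor_exp[of w 1] Taylor_exp[of w 2] by (simp_all add: eval_nat_numeral)

lemma cmod_exp_i_minus_terms_le:
  fixes u :: real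
  shows "cmod (exp (\<i> * of_real u) - 1) \<le> \<bar>u\<bar>"
    and "cmod (exp (\<i> * of_real u) - 1 - \<i> * of_real u) \<le> u\<^sup>2 / 2"
  using iexp_approx1[of u 0] iexp_approx1[of u 1] by (simp_all add: eval_nat_numeral algebra_simps)

text \<open>The cancellation behind the decoupling. After Taylor expansion everything of order at
  most two in \<open>m\<close>, \<open>u\<close> and \<open>z\<close> disappears, the mixed term
  because it was put into \<open>z\<close>. The exponentials and the imaginary unit are kept as free
  variables, so that what remains is pure algebra and the right-hand side lists the nine third-order
  errors.\<close>

lemma decoupling_identity:
  fixes q m v u z e w r1 t6 h i x :: complex
  assumes i: "i * i = - 1"
    and z: "z * 2 = (q * v - q\<^sup>2 * m\<^sup>2) + 2 * u * (q * (1 - q) * m)"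
    and h: "h = r1 + (1 + i * m - v / 2)"
    and x: "x = t6 + (1 + w + w\<^sup>2 / 2)"
    and w: "w = i * (q * m) - z"
  shows "(1 - q + q * h * e) - (1 - q + q * e) * x =
    q * r1 * e + q * m * (i * (e - 1 - i * u)) - q * (v / 2) * (e - 1) + i * (q * m * z) - z\<^sup>2 / 2 - t6
    - q * (e - 1) * (x - (1 + w)) + q * (e - 1) * z - q * (q * m * (i * (e - 1 - i * u)))"
proof -
  \<comment> \<open>The halves get names so that the claim becomes a polynomial identity.\<close>
  define v2 where "v2 = v / 2"
  define W where "W = w\<^sup>2 / 2"
  define Z where "Z = z\<^sup>2 / 2"
  have "v = 2 * v2" "W * 2 = w\<^sup>2" "Z * 2 = z\<^sup>2" by (auto simp: v2_def W_def Z_def)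
  then have "2 * ((1 - q + q * h * e) - (1 - q + q * e) * x) =
    2 * (q * r1 * e + q * m * (i * (e - 1 - i * u)) - q * v2 * (e - 1) + i * (q * m * z) - Z - t6
    - q * (e - 1) * (x - (1 + w)) + q * (e - 1) * z - q * (q * m * (i * (e - 1 - i * u))))"
    using assms unfolding v2_def[symmetric] W_def[symmetric] by algebra
  then show ?thesis unfolding v2_def Z_def mult_cancel_left by simp
qed

text \<open>One factor of the joint characteristic function of the conditioned sum and the sample size
  (argument \<open>u\<close>), against the factor obtained by decoupling both. The mixed second-order term
  \<open>u * q * (1 - q) * m\<close> is kept in the exponent; summed over the units it will vanish.\<close>

lemma decoupled_factor_close:
  fixes h :: complex and q m v u \<delta> :: real
  assumes q: "0 \<le> q" "q \<le> 1" and \<delta>: "0 \<le> \<delta>" "\<delta> \<le> 1" and u: "\<bar>u\<bar> \<le> 4"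
    and h: "cmod (h - (1 + \<i> * of_real m - of_real (v / 2))) \<le> \<delta> ^ 3"
    and m: "\<bar>m\<bar> \<le> \<delta>" and v: "m\<^sup>2 \<le> v" "v \<le> \<delta>\<^sup>2"
  shows "cmod ((of_real (1 - q) + of_real q * h * exp (\<i> * of_real u))
      - (of_real (1 - q) + of_real q * exp (\<i> * of_real u)) *
        exp (\<i> * of_real (q * m) - of_real ((q * v - q\<^sup>2 * m\<^sup>2) / 2 + u * (q * (1 - q) * m))))
    \<le> 151 * exp 5 * (q * \<delta> * (\<delta> + \<bar>u\<bar>)\<^sup>2)"
proof -
  define z where "z = (q * v - q\<^sup>2 * m\<^sup>2) / 2 + u * (q * (1 - q) * m)"
  define w :: complex where "w = \<i> * of_real (q * m) - of_real z"
  define e where "e = exp (\<i> * of_real u)"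
  define r1 where "r1 = h - (1 + \<i> * of_real m - of_real (v / 2))"
  define T where "T = q * \<delta> * (\<delta> + \<bar>u\<bar>)\<^sup>2"
  have T0: "0 \<le> T" using q \<delta> by (simp add: T_def)
  have T1: "q * \<delta> * y \<le> T" if "y \<le> (\<delta> + \<bar>u\<bar>)\<^sup>2" for y
    unfolding T_def using that q \<delta> by (intro mult_left_mono) auto
  have e1: "cmod e = 1" and e2: "cmod (e - 1) \<le> \<bar>u\<bar>" and e3: "cmod (e - 1 - \<i> * of_real u) \<le> u\<^sup>2 / 2"
    using cmod_exp_i_minus_terms_le[of u] by (auto simp: e_def)
  have d2: "\<delta>\<^sup>2 \<le> (\<delta> + \<bar>u\<bar>)\<^sup>2" "u\<^sup>2 \<le> (\<delta> + \<bar>u\<bar>)\<^sup>2" "\<delta> * \<bar>u\<bar> \<le> (\<delta> + \<bar>u\<bar>)\<^sup>2" "\<delta> * (\<delta> + \<bar>u\<bar>) \<le> (\<delta> + \<bar>u\<bar>)\<^sup>2"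
      "\<bar>u\<bar> * (\<delta> + \<bar>u\<bar>) \<le> (\<delta> + \<bar>u\<bar>)\<^sup>2"
    using \<delta> by (auto simp: power2_eq_square algebra_simps abs_mult[symmetric])
  have qm: "\<bar>q * m\<bar> \<le> q * \<delta>" using q m by (simp add: abs_mult mult_left_mono)
  have q1: "q * q \<le> q" using q by (simp add: mult_left_le)
  \<comment> \<open>The exponent correction \<open>z\<close> is of second order:
    \<open>\<delta>\<close> times \<open>\<delta> + \<bar>u\<bar>\<close>. Its first part is
    nonnegative because \<open>q\<^sup>2 \<le> q\<close> and
    \<open>m\<^sup>2 \<le> v\<close>.\<close>
  have z_le: "\<bar>z\<bar> \<le> q * \<delta> * (\<delta> + \<bar>u\<bar>)"
  proof -
    have a: "0 \<le> q * v - q\<^sup>2 * m\<^sup>2"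
    proof -
      have "q\<^sup>2 * m\<^sup>2 \<le> q * m\<^sup>2" using q q1 by (intro mult_right_mono) (auto simp: power2_eq_square)
      also have "\<dots> \<le> q * v" using q v by (intro mult_left_mono) auto
      finally show ?thesis by simp
    qed
    have b: "q * v - q\<^sup>2 * m\<^sup>2 \<le> q * \<delta>\<^sup>2"
    proof -
      have "q * v \<le> q * \<delta>\<^sup>2" using q v by (intro mult_left_mono) auto
      moreover have "0 \<le> q\<^sup>2 * m\<^sup>2" by simp
      ultimately show ?thesis by linarith
    qed
    have "\<bar>u * (q * (1 - q) * m)\<bar> \<le> \<bar>u\<bar> * (q * 1 * \<delta>)"
      unfolding abs_mult using q m by (intro mult_mono mult_nonneg_nonneg) auto
    moreover have "\<bar>(q * v - q\<^sup>2 * m\<^sup>2) / 2\<bar> \<le> q * \<delta>\<^sup>2" using a b by simp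
    ultimately have "\<bar>z\<bar> \<le> q * \<delta>\<^sup>2 + \<bar>u\<bar> * (q * 1 * \<delta>)" unfolding z_def by linarith
    then show ?thesis by (simp add: power2_eq_square algebra_simps)
  qed
  have z5: "\<bar>z\<bar> \<le> 5 * (q * \<delta>)"
  proof -
    have "q * \<delta> * (\<delta> + \<bar>u\<bar>) \<le> q * \<delta> * 5" using q \<delta> u by (intro mult_left_mono) auto
    then show ?thesis using z_le by simp
  qed
  have qd1: "q * \<delta> \<le> 1" "0 \<le> q * \<delta>" using mult_mono[of q 1 \<delta> 1] q \<delta> by auto
  have Rew: "exp \<bar>Re w\<bar> \<le> exp 5" using z5 qd1 by (simp add: w_def)
  have w_le: "cmod w \<le> 6 * (q * \<delta>)"
  proof -
    have "cmod w \<le> cmod (\<i> * of_real (q * m)) + cmod (of_real z :: complex)"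
      unfolding w_def by (rule norm_triangle_ineq4)
    then show ?thesis using qm z5 by (simp add: norm_mult abs_mult)
  qed
  have E0: "(1::real) \<le> exp 5" by simp
  \<comment> \<open>The nine errors of \<open>decoupling_identity\<close>. Seven are bounded by
    \<open>T\<close>; the two exponential remainders \<open>t6\<close> and \<open>t7\<close> by
    \<open>108 * exp 5 * T\<close> and \<open>36 * exp 5 * T\<close>, where \<open>exp 5\<close>
    comes from \<open>\<bar>z\<bar> \<le> 5\<close>. Together this is at most
    \<open>151 * exp 5 * T\<close>.\<close>
  define t1 where "t1 = of_real q * r1 * e"
  define t2 where "t2 = of_real (q * m) * (\<i> * (e - 1 - \<i> * of_real u))"
  define t3 where "t3 = of_real (q * (v / 2)) * (e - 1)"
  define t4 where "t4 = \<i> * of_real (q * m * z)"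
  define t5 :: complex where "t5 = of_real (z\<^sup>2 / 2)"
  define t6 where "t6 = exp w - (1 + w + w\<^sup>2 / 2)"
  define t7 where "t7 = of_real q * (e - 1) * (exp w - (1 + w))"
  define t8 where "t8 = of_real q * (e - 1) * of_real z"
  define t9 where "t9 = of_real q * t2"
  have "(of_real (1 - q) + of_real q * h * e) - (of_real (1 - q) + of_real q * e) * exp w =
     t1 + t2 - t3 + t4 - t5 - t6 - t7 + t8 - t9"
  proof -
    have hh: "h = r1 + (1 + \<i> * of_real m - of_real v / 2)" by (simp add: r1_def)
    have x: "exp w = t6 + (1 + w + w\<^sup>2 / 2)" by (simp add: t6_def)
    have zz: "of_real z * 2 = (of_real q * of_real v - (of_real q)\<^sup>2 * (of_real m)\<^sup>2) +
        2 * of_real u * (of_real q * (1 - of_real q) * of_real m :: complex)"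
      by (simp add: z_def)
    have ww: "w = \<i> * (of_real q * of_real m) - of_real z" by (simp add: w_def)
    show ?thesis
      unfolding t1_def t2_def t3_def t4_def t5_def t7_def t8_def t9_def
      using decoupling_identity[OF _ zz hh x ww, of e] by (simp add: mult.assoc)
  qed
  then have "cmod ((of_real (1 - q) + of_real q * h * e) - (of_real (1 - q) + of_real q * e) * exp w)
      \<le> cmod t1 + cmod t2 + cmod t3 + cmod t4 + cmod t5 + cmod t6 + cmod t7 + cmod t8 + cmod t9"
    by (smt (verit, ccfv_SIG) norm_triangle_ineq norm_triangle_ineq4)
  moreover have "cmod t1 \<le> T"
  proof -
    have "cmod t1 \<le> q * \<delta> ^ 3" using h q e1 by (simp add: t1_def r1_def norm_mult mult_left_mono)
    also have "\<dots> = q * \<delta> * \<delta>\<^sup>2" by (simp add: power2_eq_square power3_eq_cube)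
    finally show ?thesis using T1[OF d2(1)] by linarith
  qed
  moreover have t2: "cmod t2 \<le> T"
  proof -
    have "cmod t2 \<le> q * \<delta> * (u\<^sup>2 / 2)"
      unfolding t2_def norm_mult norm_of_real norm_ii mult_1_left using qm e3 qd1 by (intro mult_mono) auto
    moreover have "u\<^sup>2 / 2 \<le> (\<delta> + \<bar>u\<bar>)\<^sup>2" using d2(2) zero_le_power2[of u] by linarith
    ultimately show ?thesis using T1[of "u\<^sup>2 / 2"] by linarith
  qed
  moreover have "cmod t3 \<le> T"
  proof -
    have v0: "0 \<le> v" using v order_trans[OF zero_le_power2] by blast
    have "cmod t3 = q * (v / 2) * cmod (e - 1)" using q v0 by (simp add: t3_def norm_mult)
    also have "\<dots> \<le> q * (\<delta>\<^sup>2 / 2) * \<bar>u\<bar>" using q v v0 e2 by (intro mult_mono) auto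
    also have "\<dots> = q * \<delta> * (\<delta> * \<bar>u\<bar> / 2)" by (simp add: power2_eq_square)
    also have "\<dots> \<le> T"
    proof (rule T1)
      have "0 \<le> \<delta> * \<bar>u\<bar>" using \<delta> by simp
      then show "\<delta> * \<bar>u\<bar> / 2 \<le> (\<delta> + \<bar>u\<bar>)\<^sup>2" using d2(3) by linarith
    qed
    finally show ?thesis .
  qed
  moreover have "cmod t4 \<le> T"
  proof -
    have "cmod t4 = \<bar>q * m\<bar> * \<bar>z\<bar>" by (simp add: t4_def norm_mult abs_mult)
    also have "\<dots> \<le> q * \<delta> * (q * \<delta> * (\<delta> + \<bar>u\<bar>))" using qm z_le qd1 by (intro mult_mono) auto
    also have "\<dots> \<le> q * \<delta> * (1 * \<delta> * (\<delta> + \<bar>u\<bar>))"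
      using q \<delta> qd1 by (intro mult_left_mono mult_right_mono) auto
    finally show ?thesis using T1[of "\<delta> * (\<delta> + \<bar>u\<bar>)"] d2(4) by auto
  qed
  moreover have "cmod t5 \<le> T"
  proof -
    have "cmod t5 = \<bar>z\<bar>\<^sup>2 / 2" by (simp add: t5_def flip: of_real_power)
    also have "\<dots> \<le> (q * \<delta> * (\<delta> + \<bar>u\<bar>))\<^sup>2"
      using power_mono[OF z_le, of 2] zero_le_power2[of "\<bar>z\<bar>"] by linarith
    also have "\<dots> = q * \<delta> * ((q * \<delta>) * (\<delta> + \<bar>u\<bar>)\<^sup>2)" by (simp add: power2_eq_square)
    finally show ?thesis
      using T1[of "(q * \<delta>) * (\<delta> + \<bar>u\<bar>)\<^sup>2"] qd1 by (simp add: mult_left_le_one_le)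
  qed
  moreover have "cmod t6 \<le> 108 * exp 5 * T"
  proof -
    have "cmod t6 \<le> exp 5 * (6 * (q * \<delta>)) ^ 3 / 2"
      unfolding t6_def using Rew w_le
      by (intro order_trans[OF cmod_exp_minus_two_terms_le(2)] divide_right_mono mult_mono power_mono) auto
    also have "\<dots> = 108 * exp 5 * (q * \<delta> * (q * \<delta>)\<^sup>2)" by (simp add: power2_eq_square power3_eq_cube)
    also have "\<dots> \<le> 108 * exp 5 * T"
    proof -
      have "q * \<delta> \<le> \<delta>" using q \<delta> by (simp add: mult_left_le_one_le)
      then have "(q * \<delta>)\<^sup>2 \<le> \<delta>\<^sup>2" using qd1 by (intro power_mono)
      then show ?thesis using T1[of "(q * \<delta>)\<^sup>2"] d2(1) by simp
    qed
    finally show ?thesis .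
  qed
  moreover have "cmod t7 \<le> 36 * exp 5 * T"
  proof -
    have "cmod (exp w - (1 + w)) \<le> exp 5 * (6 * (q * \<delta>))\<^sup>2"
      using Rew w_le
      by (intro order_trans[OF cmod_exp_minus_two_terms_le(1)] mult_mono power_mono) auto
    then have "cmod t7 \<le> (q * \<bar>u\<bar>) * (exp 5 * (6 * (q * \<delta>))\<^sup>2)"
      unfolding t7_def norm_mult norm_of_real using q e2 by (intro mult_mono) auto
    also have "\<dots> = 36 * exp 5 * (q * \<delta> * (q * q * (\<delta> * \<bar>u\<bar>)))" by (simp add: power2_eq_square)
    also have "\<dots> \<le> 36 * exp 5 * T"
    proof -
      have "q * q * (\<delta> * \<bar>u\<bar>) \<le> 1 * (\<delta> * \<bar>u\<bar>)" using q q1 \<delta> by (intro mult_right_mono) auto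
      then show ?thesis using T1[of "q * q * (\<delta> * \<bar>u\<bar>)"] d2(3) by simp
    qed
    finally show ?thesis .
  qed
  moreover have "cmod t8 \<le> T"
  proof -
    have "cmod t8 = q * cmod (e - 1) * \<bar>z\<bar>" using q by (simp add: t8_def norm_mult)
    also have "\<dots> \<le> q * \<bar>u\<bar> * (q * \<delta> * (\<delta> + \<bar>u\<bar>))"
      using q e2 z_le by (intro mult_mono) auto
    also have "\<dots> = q * \<delta> * (q * (\<bar>u\<bar> * (\<delta> + \<bar>u\<bar>)))" by simp
    also have "\<dots> \<le> T"
    proof -
      have "q * (\<bar>u\<bar> * (\<delta> + \<bar>u\<bar>)) \<le> \<bar>u\<bar> * (\<delta> + \<bar>u\<bar>)" using q \<delta> by (simp add: mult_left_le_one_le)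
      then show ?thesis using T1[of "q * (\<bar>u\<bar> * (\<delta> + \<bar>u\<bar>))"] d2(5) by simp
    qed
    finally show ?thesis .
  qed
  moreover have "cmod t9 \<le> T"
  proof -
    have "cmod t9 = q * cmod t2" using q by (simp add: t9_def norm_mult)
    also have "\<dots> \<le> 1 * cmod t2" using q by (intro mult_right_mono) auto
    finally show ?thesis using t2 by simp
  qed
  ultimately have "cmod ((of_real (1 - q) + of_real q * h * e) - (of_real (1 - q) + of_real q * e) * exp w)
      \<le> 7 * T + 144 * (exp 5 * T)" by linarith
  also have "\<dots> \<le> 151 * (exp 5 * T)" using mult_right_mono[OF E0 T0] by linarith
  finally show ?thesis by (simp only: T_def e_def w_def z_def mult.assoc)
qed

text \<open>The true factor and the decoupled factor are dominated by the same Gaussian-type bound.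
  A common bound is what lets their products be compared without losing the decay in
  \<open>u\<close>.\<close>

lemma factor_modulus_bounds:
  fixes h :: complex and q m v u \<delta> :: real
  assumes q: "0 \<le> q" "q \<le> 1" and \<delta>: "0 \<le> \<delta>" "\<delta> \<le> 1" and u: "\<bar>u\<bar> \<le> 4"
    and h1: "cmod h \<le> 1" and h: "cmod (h - (1 + \<i> * of_real m - of_real (v / 2))) \<le> \<delta> ^ 3"
    and m: "\<bar>m\<bar> \<le> \<delta>" and v: "m\<^sup>2 \<le> v" "v \<le> \<delta>\<^sup>2"
  shows "cmod (of_real (1 - q) + of_real q * h * exp (\<i> * of_real u))
      \<le> exp (- (q * (1 - q) * (u\<^sup>2 / 36 - 38 * \<delta>\<^sup>2)))"
    and "cmod ((of_real (1 - q) + of_real q * exp (\<i> * of_real u)) *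
        exp (\<i> * of_real (q * m) - of_real ((q * v - q\<^sup>2 * m\<^sup>2) / 2 + u * (q * (1 - q) * m))))
      \<le> exp (- (q * (1 - q) * (u\<^sup>2 / 36 - 38 * \<delta>\<^sup>2)))"
proof -
  let ?e = "exp (\<i> * of_real u)"
  have cosu: "u\<^sup>2 / 18 \<le> 1 - cos u" by (rule one_minus_cos_ge[OF u])
  \<comment> \<open>Half of the decay \<open>u\<^sup>2 / 18\<close> is spent on absorbing the term
    linear in \<open>u\<close>; together with the deviation \<open>2 * \<delta>\<^sup>2\<close> of
    \<open>Re h\<close> from 1 this accounts for the constants 36 and 38.\<close>
  have am: "2 * \<delta> * \<bar>u\<bar> \<le> u\<^sup>2 / 36 + 36 * \<delta>\<^sup>2"
  proof -
    have "0 \<le> (\<bar>u\<bar> / 6 - 6 * \<delta>)\<^sup>2" by simp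
    then show ?thesis by (simp add: power2_diff power_divide power_mult_distrib)
  qed
  have am': "\<delta> * \<bar>u\<bar> \<le> u\<^sup>2 / 36 + 38 * \<delta>\<^sup>2" using am \<delta> zero_le_power2[of \<delta>] mult_nonneg_nonneg[of \<delta> "\<bar>u\<bar>"] by linarith
  have d3: "\<delta> ^ 3 \<le> \<delta>\<^sup>2" "\<delta> ^ 3 \<le> \<delta>" using \<delta> by (auto simp: power_decreasing intro: power_decreasing[of 1 3 \<delta>, simplified])
  have R: "\<bar>1 - Re h\<bar> \<le> 2 * \<delta>\<^sup>2" and I: "\<bar>Im h\<bar> \<le> 2 * \<delta>"
  proof -
    have v0: "0 \<le> v" using v zero_le_power2[of m] by linarith
    have "\<bar>Re (h - (1 + \<i> * of_real m - of_real (v / 2)))\<bar> \<le> \<delta> ^ 3"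
      using abs_Re_le_cmod h order_trans by blast
    then have "\<bar>Re h - 1 + v / 2\<bar> \<le> \<delta> ^ 3" by (simp add: algebra_simps)
    then show "\<bar>1 - Re h\<bar> \<le> 2 * \<delta>\<^sup>2" using v0 v d3 by linarith
    have "\<bar>Im (h - (1 + \<i> * of_real m - of_real (v / 2)))\<bar> \<le> \<delta> ^ 3"
      using abs_Im_le_cmod h order_trans by blast
    then show "\<bar>Im h\<bar> \<le> 2 * \<delta>" using m d3 by simp
  qed
  have "u\<^sup>2 / 36 - 38 * \<delta>\<^sup>2 \<le> 1 - Re (h * ?e)"
  proof -
    have "1 - Re (h * ?e) = 1 - cos u + (1 - Re h) * cos u + Im h * sin u"
      by (simp add: Re_exp Im_exp algebra_simps)
    moreover have "\<bar>(1 - Re h) * cos u\<bar> \<le> 2 * \<delta>\<^sup>2 * 1"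
      unfolding abs_mult using R by (intro mult_mono) auto
    moreover have "\<bar>Im h * sin u\<bar> \<le> 2 * \<delta> * \<bar>u\<bar>"
      unfolding abs_mult using I \<delta> abs_sin_x_le_abs_x[of u] by (intro mult_mono) auto
    ultimately show ?thesis using cosu am by linarith
  qed
  then show "cmod (of_real (1 - q) + of_real q * h * ?e) \<le> exp (- (q * (1 - q) * (u\<^sup>2 / 36 - 38 * \<delta>\<^sup>2)))"
    using cmod_bernoulli_char_le[OF q, of "h * ?e" "u\<^sup>2 / 36 - 38 * \<delta>\<^sup>2"] h1
    by (simp add: norm_mult mult.assoc)
  have "0 \<le> q * v - q\<^sup>2 * m\<^sup>2"
  proof -
    have "q\<^sup>2 * m\<^sup>2 \<le> q * m\<^sup>2" using q by (intro mult_right_mono) (auto simp: power2_eq_square mult_left_le)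
    also have "\<dots> \<le> q * v" using q v by (intro mult_left_mono) auto
    finally show ?thesis by simp
  qed
  moreover have "\<bar>u * (q * (1 - q) * m)\<bar> \<le> q * (1 - q) * (\<delta> * \<bar>u\<bar>)"
  proof -
    have "\<bar>u * (q * (1 - q) * m)\<bar> = (q * (1 - q)) * (\<bar>m\<bar> * \<bar>u\<bar>)" using q by (simp add: abs_mult)
    also have "\<dots> \<le> (q * (1 - q)) * (\<delta> * \<bar>u\<bar>)" using q m by (intro mult_left_mono mult_right_mono) auto
    finally show ?thesis .
  qed
  moreover have "q * (1 - q) * (\<delta> * \<bar>u\<bar>) \<le> q * (1 - q) * (u\<^sup>2 / 36 + 38 * \<delta>\<^sup>2)"
    using q am' by (intro mult_left_mono) auto
  moreover have "- (x / 2 + y) \<le> t" if "0 \<le> x" "\<bar>y\<bar> \<le> z" "z \<le> t" for x y z t :: real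
    using that by linarith
  ultimately have "- ((q * v - q\<^sup>2 * m\<^sup>2) / 2 + u * (q * (1 - q) * m)) \<le> q * (1 - q) * (u\<^sup>2 / 36 + 38 * \<delta>\<^sup>2)"
    by blast
  then have "cmod (exp (\<i> * of_real (q * m) - of_real ((q * v - q\<^sup>2 * m\<^sup>2) / 2 + u * (q * (1 - q) * m))))
      \<le> exp (q * (1 - q) * (u\<^sup>2 / 36 + 38 * \<delta>\<^sup>2))" by (simp del: of_real_mult of_real_add of_real_divide of_real_diff)
  moreover have "cmod (of_real (1 - q) + of_real q * ?e) \<le> exp (- (q * (1 - q) * (u\<^sup>2 / 18)))"
    using cosu q by (intro cmod_bernoulli_char_le) (auto simp: Re_exp)
  ultimately have "cmod ((of_real (1 - q) + of_real q * ?e) *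
        exp (\<i> * of_real (q * m) - of_real ((q * v - q\<^sup>2 * m\<^sup>2) / 2 + u * (q * (1 - q) * m))))
      \<le> exp (- (q * (1 - q) * (u\<^sup>2 / 18))) * exp (q * (1 - q) * (u\<^sup>2 / 36 + 38 * \<delta>\<^sup>2))"
    unfolding norm_mult by (intro mult_mono) auto
  also have "\<dots> = exp (- (q * (1 - q) * (u\<^sup>2 / 36 - 38 * \<delta>\<^sup>2)))"
    unfolding exp_add[symmetric] by (rule arg_cong[where f = exp]) (simp add: field_simps)
  finally show "cmod ((of_real (1 - q) + of_real q * ?e) *
        exp (\<i> * of_real (q * m) - of_real ((q * v - q\<^sup>2 * m\<^sup>2) / 2 + u * (q * (1 - q) * m))))
      \<le> exp (- (q * (1 - q) * (u\<^sup>2 / 36 - 38 * \<delta>\<^sup>2)))" .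
qed

text \<open>Dividing every factor by its bound \<open>D i\<close> reduces this to the telescoping
  inequality in the unit disc. The product of all the bounds, hence the full Gaussian decay, stays
  in front of the sum.\<close>

lemma norm_prod_diff_weighted:
  fixes a b :: "'i \<Rightarrow> complex" and D :: "'i \<Rightarrow> real"
  assumes "finite A" and D: "\<And>i. i \<in> A \<Longrightarrow> 0 < D i"
    and a: "\<And>i. i \<in> A \<Longrightarrow> cmod (a i) \<le> D i" and b: "\<And>i. i \<in> A \<Longrightarrow> cmod (b i) \<le> D i"
  shows "cmod ((\<Prod>i\<in>A. a i) - (\<Prod>i\<in>A. b i)) \<le> (\<Prod>i\<in>A. D i) * (\<Sum>i\<in>A. cmod (a i - b i) / D i)"
proof -
  have P: "0 < (\<Prod>i\<in>A. D i)" using D by (rule prod_pos)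
  have "cmod ((\<Prod>i\<in>A. a i / of_real (D i)) - (\<Prod>i\<in>A. b i / of_real (D i)))
      \<le> (\<Sum>i\<in>A. cmod (a i / of_real (D i) - b i / of_real (D i)))"
    using D a b by (intro norm_prod_diff) (auto simp: norm_divide abs_of_pos)
  also have "\<dots> = (\<Sum>i\<in>A. cmod (a i - b i) / D i)"
    using D by (intro sum.cong) (auto simp: norm_divide abs_of_pos simp flip: diff_divide_distrib)
  finally have "(\<Prod>i\<in>A. D i) * cmod ((\<Prod>i\<in>A. a i / of_real (D i)) - (\<Prod>i\<in>A. b i / of_real (D i)))
      \<le> (\<Prod>i\<in>A. D i) * (\<Sum>i\<in>A. cmod (a i - b i) / D i)" using P by simp
  moreover have "(\<Prod>i\<in>A. D i) * cmod ((\<Prod>i\<in>A. a i / of_real (D i)) - (\<Prod>i\<in>A. b i / of_real (D i))) =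
    cmod ((\<Prod>i\<in>A. a i) - (\<Prod>i\<in>A. b i))"
    using P unfolding prod_dividef of_real_prod[symmetric]
    by (simp add: norm_divide abs_of_pos del: of_real_prod flip: diff_divide_distrib)
  ultimately show ?thesis by simp
qed

text \<open>Collects the losses in the comparison of the products: \<open>151 * exp 5\<close> from
  one factor, 10368 and powers of \<open>1 + B\<close> from integrating polynomial against Gaussian
  terms, and \<open>exp (38 * B\<^sup>2)\<close> from the defect
  \<open>38 * \<delta>\<^sup>2\<close> in the moduli, summed over the units.\<close>

definition clt_const :: "real \<Rightarrow> real" where
  "clt_const B = 8 * 10368 * 151 * exp 5 * (1 + B) ^ 3 * exp (38 * B\<^sup>2)"

text \<open>In the variable \<open>x = sqrt d * \<bar>u\<bar>\<close> the left side is a quadratic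
  polynomial times a Gaussian, divided by \<open>d\<close>. Trading the Gaussian for
  \<open>1 / (1 + x\<^sup>2)\<^sup>2\<close> leaves an integrand with an arctangent as
  primitive.\<close>

lemma gaussian_weight_le:
  fixes B d u \<delta> :: real
  assumes "0 < d" "0 \<le> B" "0 \<le> \<delta>" "\<delta> \<le> B / sqrt d"
  shows "(\<delta> + \<bar>u\<bar>)\<^sup>2 * exp (- (d * u\<^sup>2 / 36)) \<le> 2 * 10368 * (1 + B)\<^sup>2 / d * (1 / (1 + d * u\<^sup>2))"
proof -
  define x where "x = sqrt d * \<bar>u\<bar>"
  have x0: "0 \<le> x" and x2: "x\<^sup>2 = d * u\<^sup>2" using assms by (auto simp: x_def power_mult_distrib)
  have "sqrt d * (\<delta> + \<bar>u\<bar>) \<le> B + x"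
  proof -
    have "sqrt d * \<delta> \<le> sqrt d * (B / sqrt d)" using assms by (intro mult_left_mono) auto
    then show ?thesis using assms by (simp add: x_def distrib_left)
  qed
  also have "B + x \<le> (1 + B) * (1 + x)" using assms x0 by (simp add: algebra_simps)
  finally have "(sqrt d * (\<delta> + \<bar>u\<bar>))\<^sup>2 \<le> ((1 + B) * (1 + x))\<^sup>2"
    using assms by (intro power_mono) auto
  then have 1: "d * (\<delta> + \<bar>u\<bar>)\<^sup>2 \<le> (1 + B)\<^sup>2 * (1 + x)\<^sup>2" using assms by (simp add: power_mult_distrib)
  have "(1 + x)\<^sup>2 \<le> 2 * (1 + x\<^sup>2)"
    using zero_le_power2[of "1 - x"] by (simp add: power2_sum power2_diff)
  then have "(1 + B)\<^sup>2 * (1 + x)\<^sup>2 \<le> (1 + B)\<^sup>2 * (2 * (1 + x\<^sup>2))" by (intro mult_left_mono) auto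
  with 1 have 2: "d * (\<delta> + \<bar>u\<bar>)\<^sup>2 \<le> 2 * (1 + B)\<^sup>2 * (1 + x\<^sup>2)" by linarith
  have 3: "(1 + x\<^sup>2)\<^sup>2 * exp (- (x\<^sup>2 / 36)) \<le> 10368"
  proof -
    \<comment> \<open>With 72 the exponent \<open>2 * y\<close> is \<open>x\<^sup>2 / 36\<close>
      plus the harmless constant 1/36; the result 10368 is \<open>2 * 72\<^sup>2\<close>.\<close>
    define y where "y = (1 + x\<^sup>2) / 72"
    have "y \<le> exp y" using exp_ge_add_one_self[of y] by linarith
    then have "y\<^sup>2 \<le> (exp y)\<^sup>2" by (intro power_mono) (auto simp: y_def)
    also have "(exp y)\<^sup>2 = exp (2 * y)" by (simp add: exp_double)
    also have "2 * y = 1 / 36 + x\<^sup>2 / 36" by (simp add: y_def field_simps)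
    finally have "y\<^sup>2 \<le> exp (1 / 36) * exp (x\<^sup>2 / 36)" by (simp add: exp_add)
    also have "exp (1 / 36) \<le> (2::real)" using exp_bound[of "1 / 36"] by (simp add: power2_eq_square)
    finally have "y\<^sup>2 \<le> 2 * exp (x\<^sup>2 / 36)" by simp
    moreover have "(1 + x\<^sup>2)\<^sup>2 = 5184 * y\<^sup>2" by (simp add: y_def power_divide)
    ultimately have "(1 + x\<^sup>2)\<^sup>2 \<le> 10368 * exp (x\<^sup>2 / 36)" by linarith
    then show ?thesis by (simp add: exp_minus divide_simps)
  qed
  have p: "0 < 1 + x\<^sup>2" by (simp add: add_pos_nonneg)
  have "d * (\<delta> + \<bar>u\<bar>)\<^sup>2 * exp (- (x\<^sup>2 / 36)) * (1 + x\<^sup>2) \<le> 2 * (1 + B)\<^sup>2 * (1 + x\<^sup>2) * exp (- (x\<^sup>2 / 36)) * (1 + x\<^sup>2)"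
    using 2 p by (intro mult_right_mono) auto
  also have "\<dots> = 2 * (1 + B)\<^sup>2 * ((1 + x\<^sup>2)\<^sup>2 * exp (- (x\<^sup>2 / 36)))" by (simp add: power2_eq_square)
  also have "\<dots> \<le> 2 * (1 + B)\<^sup>2 * 10368" using 3 by (intro mult_left_mono) auto
  finally have "(d * (\<delta> + \<bar>u\<bar>)\<^sup>2 * exp (- (x\<^sup>2 / 36)) * (1 + x\<^sup>2)) / (d * (1 + x\<^sup>2))
      \<le> (2 * (1 + B)\<^sup>2 * 10368) / (d * (1 + x\<^sup>2))"
    using assms p by (intro divide_right_mono) auto
  moreover have "(d * (\<delta> + \<bar>u\<bar>)\<^sup>2 * exp (- (x\<^sup>2 / 36)) * (1 + x\<^sup>2)) / (d * (1 + x\<^sup>2)) =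
      (\<delta> + \<bar>u\<bar>)\<^sup>2 * exp (- (x\<^sup>2 / 36))"
    using assms p by simp
  ultimately show ?thesis by (simp add: x2 mult_ac)
qed

text \<open>Both terms are Fourier integrals over the size, with products that differ factor by
  factor by a third-order quantity. Summing over the units gives the factor
  \<open>\<Sum>i\<in>A. q i\<close>. Since \<open>\<delta>\<close> and the effective range of
  \<open>u\<close> are of order \<open>1 / sqrt d\<close>, the factor
  \<open>\<delta> * (\<delta> + \<bar>u\<bar>)\<^sup>2\<close> and the integration over
  \<open>u\<close> together contribute \<open>1 / d\<^sup>2\<close>. When \<open>d\<close> and
  \<open>n\<close> are comparable this is of order \<open>1 / n\<close>, smaller by
  \<open>1 / sqrt n\<close> than the probability of a modal size.\<close>

lemma conditional_char_close:
  fixes h :: "'i \<Rightarrow> complex" and q m v :: "'i \<Rightarrow> real" and B \<delta> :: real and k :: int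
  assumes fin: "finite A" and q: "\<And>i. i \<in> A \<Longrightarrow> 0 \<le> q i \<and> q i \<le> 1"
    and \<delta>: "0 \<le> \<delta>" "\<delta> \<le> 1" and d: "0 < poisson_var A q"
    and B: "0 \<le> B" "\<delta> \<le> B / sqrt (poisson_var A q)"
    and h1: "\<And>i. i \<in> A \<Longrightarrow> cmod (h i) \<le> 1"
    and h: "\<And>i. i \<in> A \<Longrightarrow> cmod (h i - (1 + \<i> * of_real (m i) - of_real (v i / 2))) \<le> \<delta> ^ 3"
    and m: "\<And>i. i \<in> A \<Longrightarrow> \<bar>m i\<bar> \<le> \<delta>"
    and v: "\<And>i. i \<in> A \<Longrightarrow> (m i)\<^sup>2 \<le> v i" "\<And>i. i \<in> A \<Longrightarrow> v i \<le> \<delta>\<^sup>2"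
    and uncorrelated: "(\<Sum>i\<in>A. q i * (1 - q i) * m i) = 0"
  shows "cmod ((\<Sum>s\<in>Pow A. of_real (poisson_weight A q s * of_bool (int (card s) = k)) * (\<Prod>i\<in>s. h i))
      - of_real (size_prob A q k) *
        exp (\<i> * of_real (\<Sum>i\<in>A. q i * m i) - of_real ((\<Sum>i\<in>A. q i * v i - (q i)\<^sup>2 * (m i)\<^sup>2) / 2)))
    \<le> clt_const B * (\<Sum>i\<in>A. q i) / (poisson_var A q)\<^sup>2"
proof -
  define d where "d = poisson_var A q"
  define Q where "Q = (\<Sum>i\<in>A. q i)"
  let ?S = "\<Sum>s\<in>Pow A. of_real (poisson_weight A q s * of_bool (int (card s) = k)) * (\<Prod>i\<in>s. h i)"
  let ?G = "exp (\<i> * of_real (\<Sum>i\<in>A. q i * m i) - of_real ((\<Sum>i\<in>A. q i * v i - (q i)\<^sup>2 * (m i)\<^sup>2) / 2)) :: complex"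
  define a where "a u i = of_real (1 - q i) + of_real (q i) * h i * exp (\<i> * of_real u)" for u i
  define b0 where "b0 u i = of_real (1 - q i) + of_real (q i) * exp (\<i> * of_real u)" for u i
  define b where "b u i = b0 u i * exp (\<i> * of_real (q i * m i) -
      of_real ((q i * v i - (q i)\<^sup>2 * (m i)\<^sup>2) / 2 + u * (q i * (1 - q i) * m i)))" for u i
  define K where "K = 2 * (151 * exp 5) * Q * \<delta> * exp (38 * B\<^sup>2) * (2 * 10368 * (1 + B)\<^sup>2 / d)"
  have d0: "0 < d" using d by (simp add: d_def)
  have Q0: "0 \<le> Q" unfolding Q_def using q by (intro sum_nonneg) auto
  \<comment> \<open>Here the regression pays off: summed over the units, the mixed exponents
    \<open>u * q i * (1 - q i) * m i\<close> vanish, so the Gaussian factor \<open>?G\<close> does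
    not depend on \<open>u\<close> and comes out of the Fourier integral.\<close>
  have prod_b: "(\<Prod>i\<in>A. b u i) = (\<Prod>i\<in>A. b0 u i) * ?G" for u
  proof -
    have "(\<Prod>i\<in>A. b u i) = (\<Prod>i\<in>A. b0 u i) * exp (\<Sum>i\<in>A. \<i> * of_real (q i * m i) -
      of_real ((q i * v i - (q i)\<^sup>2 * (m i)\<^sup>2) / 2 + u * (q i * (1 - q i) * m i)))"
      unfolding b_def prod.distrib by (simp only: exp_sum[OF fin])
    also have "(\<Sum>i\<in>A. \<i> * of_real (q i * m i) -
        of_real ((q i * v i - (q i)\<^sup>2 * (m i)\<^sup>2) / 2 + u * (q i * (1 - q i) * m i))) =
      \<i> * of_real (\<Sum>i\<in>A. q i * m i) - of_real ((\<Sum>i\<in>A. q i * v i - (q i)\<^sup>2 * (m i)\<^sup>2) / 2 + u * (\<Sum>i\<in>A. q i * (1 - q i) * m i))"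
    proof -
      have R: "(\<Sum>i\<in>A. (q i * v i - (q i)\<^sup>2 * (m i)\<^sup>2) / 2 + u * (q i * (1 - q i) * m i)) =
          (\<Sum>i\<in>A. q i * v i - (q i)\<^sup>2 * (m i)\<^sup>2) / 2 + u * (\<Sum>i\<in>A. q i * (1 - q i) * m i)"
        by (simp only: sum.distrib sum_distrib_left sum_divide_distrib)
      show ?thesis unfolding R[symmetric] by (simp only: sum_subtractf sum_distrib_left of_real_sum)
    qed
    finally show ?thesis using uncorrelated by simp
  qed
  have "((\<lambda>u. exp (- (\<i> * of_real u * of_int k)) * (\<Prod>i\<in>A. a u i) - exp (- (\<i> * of_real u * of_int k)) * (\<Prod>i\<in>A. b0 u i) * ?G)
      has_integral (2 * of_real pi * ?S - 2 * of_real pi * of_real (size_prob A q k) * ?G)) {-pi..pi}"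
  proof (intro has_integral_diff has_integral_mult_left)
    show "((\<lambda>u. exp (- (\<i> * of_real u * of_int k)) * (\<Prod>i\<in>A. a u i)) has_integral (2 * of_real pi * ?S)) {-pi..pi}"
      unfolding a_def by (rule size_fourier_inversion[OF fin])
    show "((\<lambda>u. exp (- (\<i> * of_real u * of_int k)) * (\<Prod>i\<in>A. b0 u i)) has_integral
        (2 * of_real pi * of_real (size_prob A q k))) {-pi..pi}"
      using size_fourier_inversion[OF fin, of k q "\<lambda>_. 1"] by (simp add: size_prob_def b0_def)
  qed
  then have I: "((\<lambda>u. exp (- (\<i> * of_real u * of_int k)) * ((\<Prod>i\<in>A. a u i) - (\<Prod>i\<in>A. b u i)))
      has_integral (2 * of_real pi * (?S - of_real (size_prob A q k) * ?G))) {-pi..pi}"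
    unfolding prod_b by (simp add: algebra_simps)
  have bound: "cmod (exp (- (\<i> * of_real u * of_int k)) * ((\<Prod>i\<in>A. a u i) - (\<Prod>i\<in>A. b u i))) \<le> K * (1 / (1 + d * u\<^sup>2))"
    if "u \<in> {-pi..pi}" for u
  proof -
    have u: "\<bar>u\<bar> \<le> 4" using that pi_less_4 by auto
    define D where "D i = exp (- (q i * (1 - q i) * (u\<^sup>2 / 36 - 38 * \<delta>\<^sup>2)))" for i
    have D: "cmod (a u i) \<le> D i" "cmod (b u i) \<le> D i" if "i \<in> A" for i
      using factor_modulus_bounds[of "q i" \<delta> u "h i" "m i" "v i"] q[OF that] \<delta> u h1[OF that] h[OF that] m[OF that] v[OF that]
      by (auto simp: a_def b_def b0_def D_def)
    have D1: "cmod ((\<Prod>i\<in>A. a u i) - (\<Prod>i\<in>A. b u i)) \<le> (\<Prod>i\<in>A. D i) * (\<Sum>i\<in>A. cmod (a u i - b u i) / D i)"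
      using D fin by (intro norm_prod_diff_weighted) (auto simp: D_def)
    have "(\<Sum>i\<in>A. cmod (a u i - b u i) / D i) \<le> (\<Sum>i\<in>A. 2 * (151 * exp 5) * \<delta> * (\<delta> + \<bar>u\<bar>)\<^sup>2 * q i)"
    proof (rule sum_mono)
      fix i assume i: "i \<in> A"
      have qq: "0 \<le> q i * (1 - q i)" "q i * (1 - q i) \<le> 1"
        using q[OF i] by (auto simp: mult_le_one)
      \<comment> \<open>On one period a single exponent is at most 1/9, below \<open>ln 2\<close>;
        dividing by \<open>D i\<close> therefore costs at most a factor 2.\<close>
      have "q i * (1 - q i) * (u\<^sup>2 / 36 - 38 * \<delta>\<^sup>2) \<le> q i * (1 - q i) * (u\<^sup>2 / 36)"
        using qq by (intro mult_left_mono) auto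
      also have "\<dots> \<le> 1 / 4 * (16 / 36)"
      proof (rule mult_mono)
        show "q i * (1 - q i) \<le> 1 / 4"
          using zero_le_power2[of "q i - 1 / 2"] by (simp add: power2_eq_square algebra_simps)
        show "u\<^sup>2 / 36 \<le> 16 / 36" using abs_le_square_iff[of u 4] u by simp
      qed auto
      also have "\<dots> \<le> ln 2" using ln2_ge_two_thirds by simp
      finally have "exp (q i * (1 - q i) * (u\<^sup>2 / 36 - 38 * \<delta>\<^sup>2)) \<le> exp (ln 2)"
        by (simp del: exp_ln)
      then have "1 / D i \<le> 2" by (simp add: D_def exp_minus inverse_eq_divide)
      moreover have "cmod (a u i - b u i) \<le> 151 * exp 5 * (q i * \<delta> * (\<delta> + \<bar>u\<bar>)\<^sup>2)"
        using decoupled_factor_close[of "q i" \<delta> u "h i" "m i" "v i"] q[OF i] \<delta> u h[OF i] m[OF i] v[OF i]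
        by (auto simp: a_def b_def b0_def)
      ultimately have "cmod (a u i - b u i) * (1 / D i) \<le> 151 * exp 5 * (q i * \<delta> * (\<delta> + \<bar>u\<bar>)\<^sup>2) * 2"
        using q[OF i] \<delta> by (intro mult_mono) (auto simp: D_def)
      then show "cmod (a u i - b u i) / D i \<le> 2 * (151 * exp 5) * \<delta> * (\<delta> + \<bar>u\<bar>)\<^sup>2 * q i"
        by (simp add: mult_ac)
    qed
    also have "\<dots> = 2 * (151 * exp 5) * \<delta> * (\<delta> + \<bar>u\<bar>)\<^sup>2 * Q"
      by (simp only: Q_def sum_distrib_left)
    finally have D2: "(\<Sum>i\<in>A. cmod (a u i - b u i) / D i) \<le> 2 * (151 * exp 5) * \<delta> * (\<delta> + \<bar>u\<bar>)\<^sup>2 * Q" .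
    have D3: "(\<Prod>i\<in>A. D i) = exp (38 * (d * \<delta>\<^sup>2)) * exp (- (d * u\<^sup>2 / 36))"
    proof -
      have "(\<Prod>i\<in>A. D i) = exp (- (d * (u\<^sup>2 / 36 - 38 * \<delta>\<^sup>2)))"
        using fin by (simp add: D_def d_def poisson_var_def exp_sum[symmetric] sum_negf sum_distrib_right)
      then show ?thesis by (simp add: exp_add[symmetric] algebra_simps)
    qed
    have "(\<Prod>i\<in>A. D i) * (\<Sum>i\<in>A. cmod (a u i - b u i) / D i) \<le>
        (\<Prod>i\<in>A. D i) * (2 * (151 * exp 5) * \<delta> * (\<delta> + \<bar>u\<bar>)\<^sup>2 * Q)"
      using D2 by (intro mult_left_mono prod_nonneg) (auto simp: D_def)
    with D1 have "cmod ((\<Prod>i\<in>A. a u i) - (\<Prod>i\<in>A. b u i)) \<le>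
        (\<Prod>i\<in>A. D i) * (2 * (151 * exp 5) * \<delta> * (\<delta> + \<bar>u\<bar>)\<^sup>2 * Q)" by linarith
    also have "\<dots> = 2 * (151 * exp 5) * Q * \<delta> * exp (38 * (d * \<delta>\<^sup>2)) * ((\<delta> + \<bar>u\<bar>)\<^sup>2 * exp (- (d * u\<^sup>2 / 36)))"
      unfolding D3 by (simp only: mult_ac)
    also have "\<dots> \<le> 2 * (151 * exp 5) * Q * \<delta> * exp (38 * B\<^sup>2) * (2 * 10368 * (1 + B)\<^sup>2 / d * (1 / (1 + d * u\<^sup>2)))"
    proof (rule mult_mono[OF mult_left_mono])
      have "\<delta>\<^sup>2 \<le> (B / sqrt d)\<^sup>2" using B \<delta> by (intro power_mono) (auto simp: d_def)
      then have "d * \<delta>\<^sup>2 \<le> B\<^sup>2" using d0 by (simp add: power_divide field_simps)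
      then show "exp (38 * (d * \<delta>\<^sup>2)) \<le> exp (38 * B\<^sup>2)" by simp
      show "(\<delta> + \<bar>u\<bar>)\<^sup>2 * exp (- (d * u\<^sup>2 / 36)) \<le> 2 * 10368 * (1 + B)\<^sup>2 / d * (1 / (1 + d * u\<^sup>2))"
        using gaussian_weight_le[of d B \<delta> u] d0 B \<delta> by (simp add: d_def)
    qed (use Q0 \<delta> in auto)
    finally show ?thesis by (simp add: K_def norm_mult)
  qed
  have K0: "0 \<le> K" using Q0 \<delta> d0 B by (simp add: K_def)
  have "cmod (2 * of_real pi * (?S - of_real (size_prob A q k) * ?G)) =
      cmod (integral {-pi..pi} (\<lambda>u. exp (- (\<i> * of_real u * of_int k)) * ((\<Prod>i\<in>A. a u i) - (\<Prod>i\<in>A. b u i))))"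
    using integral_unique[OF I] by simp
  also have "\<dots> \<le> integral {-pi..pi} (\<lambda>u. K * (1 / (1 + d * u\<^sup>2)))"
    using I bound d0 by (intro integral_norm_bound_integral integrable_on_mult_right integral_inverse_quadratic_le) auto
  also have "\<dots> \<le> K * (pi / sqrt d)"
    unfolding integral_mult_right using K0 integral_inverse_quadratic_le(2)[OF d0] by (rule mult_left_mono[rotated])
  also have "cmod (2 * of_real pi * (?S - of_real (size_prob A q k) * ?G)) =
      pi * (2 * cmod (?S - of_real (size_prob A q k) * ?G))"
    unfolding norm_mult by simp
  also have "K * (pi / sqrt d) = pi * (K / sqrt d)" by simp
  finally have "2 * cmod (?S - of_real (size_prob A q k) * ?G) \<le> K / sqrt d"
    by (rule mult_left_le_imp_le) simp
  then have 1: "cmod (?S - of_real (size_prob A q k) * ?G) \<le> K / sqrt d / 2"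
    by (simp only: pos_le_divide_eq zero_less_numeral mult.commute)
  have "K / sqrt d \<le> 2 * (151 * exp 5) * Q * (B / sqrt d) * exp (38 * B\<^sup>2) * (2 * 10368 * (1 + B)\<^sup>2 / d) / sqrt d"
    unfolding K_def using Q0 B d0 \<delta> by (intro divide_right_mono mult_right_mono mult_left_mono) (auto simp: d_def)
  also have "\<dots> = 4 * 10368 * 151 * exp 5 * (B * (1 + B)\<^sup>2) * exp (38 * B\<^sup>2) * Q / d\<^sup>2"
    using d0 by (simp add: power2_eq_square field_simps)
  also have "\<dots> \<le> 4 * 10368 * 151 * exp 5 * ((1 + B) ^ 3) * exp (38 * B\<^sup>2) * Q / d\<^sup>2"
  proof -
    have "B * (1 + B)\<^sup>2 \<le> (1 + B) ^ 3" using B by (simp add: power2_eq_square power3_eq_cube mult_right_mono)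
    then show ?thesis using Q0 by (intro divide_right_mono mult_right_mono mult_left_mono) auto
  qed
  also have "\<dots> = clt_const B * Q / d\<^sup>2 / 2" by (simp add: clt_const_def)
  finally have "K / sqrt d \<le> clt_const B * Q / d\<^sup>2 / 2" .
  moreover have "0 \<le> clt_const B * Q / d\<^sup>2" using Q0 B by (simp add: clt_const_def)
  moreover have "x / 2 \<le> y" if "x \<le> y / 2" "0 \<le> y" for x y :: real using that by linarith
  ultimately have "K / sqrt d / 2 \<le> clt_const B * Q / d\<^sup>2" by blast
  with 1 show ?thesis unfolding d_def Q_def by (rule order_trans)
qed

section \<open>Rejective sampling\<close>

lemma pmf_poisson_design:
  assumes q: "\<And>i. i < N \<Longrightarrow> 0 \<le> q i \<and> q i \<le> 1"
  shows "pmf (poisson_design N q) s = (if s \<subseteq> {..<N} then poisson_weight {..<N} q s else 0)"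
proof -
  define M where "M = Pi_pmf {..<N} False (\<lambda>i. bernoulli_pmf (q i))"
  define f where "f = (\<lambda>b. {i. i < N \<and> b i})"
  have sup: "b i = False" if "b \<in> set_pmf M" "\<not> i < N" for b i
    using that set_Pi_pmf_subset[of "{..<N}" False "\<lambda>i. bernoulli_pmf (q i)"] by (auto simp: M_def)
  have "pmf (poisson_design N q) s = measure_pmf.prob M (f -` {s})"
    by (simp add: poisson_design_def M_def f_def pmf_map)
  also have "\<dots> = (if s \<subseteq> {..<N} then poisson_weight {..<N} q s else 0)"
  proof (cases "s \<subseteq> {..<N}")
    case True
    have "f -` {s} \<inter> set_pmf M = {\<lambda>i. i \<in> s} \<inter> set_pmf M"
    proof (intro equalityI subsetI; safe)
      fix b assume b: "b \<in> set_pmf M" "s = f b"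
      show "b = (\<lambda>i. i \<in> f b)" using sup[OF b(1)] by (auto simp: f_def fun_eq_iff)
    qed (use True in \<open>auto simp: f_def\<close>)
    then have "measure_pmf.prob M (f -` {s}) = pmf M (\<lambda>i. i \<in> s)"
      by (metis measure_Int_set_pmf measure_pmf_single)
    also have "\<dots> = (\<Prod>i<N. pmf (bernoulli_pmf (q i)) (i \<in> s))"
      unfolding M_def using True by (subst pmf_Pi) auto
    also have "\<dots> = (\<Prod>i<N. if i \<in> s then q i else 1 - q i)"
      using q by (intro prod.cong) auto
    also have "\<dots> = poisson_weight {..<N} q s"
    proof -
      have "{..<N} \<inter> s = s" "{..<N} \<inter> {x. x \<notin> s} = {..<N} - s" using True by auto
      then show ?thesis by (simp add: prod.If_cases poisson_weight_def Collect_mem_eq Compl_eq)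
    qed
    finally show ?thesis using True by simp
  next
    case False
    then have "f -` {s} = {}" by (auto simp: f_def)
    then show ?thesis using False by simp
  qed
  finally show ?thesis .
qed

lemma prob_poisson_design_size:
  assumes q: "\<And>i. i < N \<Longrightarrow> 0 \<le> q i \<and> q i \<le> 1"
  shows "measure_pmf.prob (poisson_design N q) {s. card s = n} = size_prob {..<N} q (int n)"
proof -
  have "{s. card s = n} \<inter> set_pmf (poisson_design N q) =
      {s \<in> Pow {..<N}. card s = n} \<inter> set_pmf (poisson_design N q)"
    using pmf_poisson_design[OF q] by (auto simp: set_pmf_eq split: if_splits)
  then have "measure_pmf.prob (poisson_design N q) {s. card s = n} =
      measure_pmf.prob (poisson_design N q) {s \<in> Pow {..<N}. card s = n}"
    by (metis measure_Int_set_pmf)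
  also have "\<dots> = (\<Sum>s | s \<in> Pow {..<N} \<and> card s = n. pmf (poisson_design N q) s)"
    by (intro measure_measure_pmf_finite) auto
  also have "\<dots> = (\<Sum>s | s \<in> Pow {..<N} \<and> card s = n. poisson_weight {..<N} q s)"
    using pmf_poisson_design[OF q] by (intro sum.cong) auto
  also have "\<dots> = size_prob {..<N} q (int n)"
    unfolding size_prob_def by (subst sum.inter_filter, simp, rule sum.cong, auto)
  finally show ?thesis .
qed

text \<open>The rejective design with its parameter exposed. Several \<open>q\<close> describe the
  same \<open>p\<close>, and the proof has to switch between them, which an existential formulation
  would hide.\<close>

definition conditional_poisson :: "nat \<Rightarrow> nat \<Rightarrow> (nat \<Rightarrow> real) \<Rightarrow> nat set pmf \<Rightarrow> bool" where
  "conditional_poisson N n q p \<longleftrightarrow>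
    (\<forall>i<N. 0 \<le> q i \<and> q i \<le> 1) \<and> 0 < size_prob {..<N} q (int n) \<and>
    (\<forall>s. pmf p s = (if s \<subseteq> {..<N} \<and> card s = n
       then poisson_weight {..<N} q s / size_prob {..<N} q (int n) else 0))"

lemma pmf_conditional_poisson:
  "conditional_poisson N n q p \<Longrightarrow> pmf p s = (if s \<subseteq> {..<N} \<and> card s = n
     then poisson_weight {..<N} q s / size_prob {..<N} q (int n) else 0)"
  by (simp add: conditional_poisson_def)

lemma rejective_design_conditional_poisson:
  assumes "is_rejective_design N n p"
  obtains q where "conditional_poisson N n q p"
proof -
  obtain q where q: "\<And>i. i < N \<Longrightarrow> 0 \<le> q i \<and> q i \<le> 1"
    and ne: "set_pmf (poisson_design N q) \<inter> {s. card s = n} \<noteq> {}"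
    and p: "p = cond_pmf (poisson_design N q) {s. card s = n}"
    using assms unfolding is_rejective_design_def by blast
  have "0 < measure_pmf.prob (poisson_design N q) {s. card s = n}"
    using ne by (metis disjoint_iff measure_pmf_posI)
  then have pos: "0 < size_prob {..<N} q (int n)" using prob_poisson_design_size[of N q n] q by simp
  moreover have "pmf p s = (if s \<subseteq> {..<N} \<and> card s = n
       then poisson_weight {..<N} q s / size_prob {..<N} q (int n) else 0)" for s
    unfolding p pmf_cond[OF ne] using pmf_poisson_design[of N q s] prob_poisson_design_size[of N q n] q
    by simp
  ultimately have "conditional_poisson N n q p" using q by (auto simp: conditional_poisson_def)
  then show ?thesis by (rule that)
qed

lemma expectation_conditional_poisson:
  fixes f :: "nat set \<Rightarrow> 'b::real_vector"
  assumes "conditional_poisson N n q p"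
  shows "(\<Sum>s\<in>Pow {..<N}. pmf p s *\<^sub>R f s) =
    (\<Sum>s\<in>Pow {..<N}. (poisson_weight {..<N} q s * of_bool (int (card s) = int n)) *\<^sub>R f s) /\<^sub>R size_prob {..<N} q (int n)"
  unfolding scaleR_sum_right
  by (rule sum.cong) (auto simp: pmf_conditional_poisson[OF assms] divide_inverse mult.commute)

lemma incl_prob_sum:
  assumes "set_pmf p \<subseteq> Pow {..<N}"
  shows "incl_prob p i = (\<Sum>s\<in>Pow {..<N}. pmf p s * of_bool (i \<in> s))"
proof -
  have "incl_prob p i = measure_pmf.prob p ({s. i \<in> s} \<inter> set_pmf p)"
    by (simp add: incl_prob_def measure_Int_set_pmf)
  also have "{s. i \<in> s} \<inter> set_pmf p = {s \<in> Pow {..<N}. i \<in> s} \<inter> set_pmf p" using assms by auto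
  also have "measure_pmf.prob p \<dots> = measure_pmf.prob p {s \<in> Pow {..<N}. i \<in> s}"
    by (rule measure_Int_set_pmf)
  also have "\<dots> = (\<Sum>s | s \<in> Pow {..<N} \<and> i \<in> s. pmf p s)" by (intro measure_measure_pmf_finite) auto
  also have "\<dots> = (\<Sum>s\<in>Pow {..<N}. pmf p s * of_bool (i \<in> s))"
    by (subst sum.inter_filter, simp, rule sum.cong, auto)
  finally show ?thesis .
qed

lemma sum_pmf_Pow:
  fixes p :: "nat set pmf"
  assumes "set_pmf p \<subseteq> Pow {..<N}"
  shows "(\<Sum>s\<in>Pow {..<N}. pmf p s) = 1"
  using assms by (intro sum_pmf_eq_1) auto

lemma expectation_linear_statistic:
  fixes c :: "nat \<Rightarrow> real"
  assumes "set_pmf p \<subseteq> Pow {..<N}"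
  shows "(\<Sum>s\<in>Pow {..<N}. pmf p s * (\<Sum>i\<in>s. c i)) = (\<Sum>i<N. incl_prob p i * c i)"
proof -
  have "(\<Sum>s\<in>Pow {..<N}. pmf p s * (\<Sum>i\<in>s. c i)) = (\<Sum>s\<in>Pow {..<N}. \<Sum>i<N. pmf p s * of_bool (i \<in> s) * c i)"
  proof (rule sum.cong[OF refl])
    fix s assume "s \<in> Pow {..<N}"
    then have "(\<Sum>i\<in>s. c i) = (\<Sum>i<N. if i \<in> s then c i else 0)"
      using sum.inter_restrict[of "{..<N}" c s] by (simp add: Int_absorb1)
    then show "pmf p s * (\<Sum>i\<in>s. c i) = (\<Sum>i<N. pmf p s * of_bool (i \<in> s) * c i)"
      by (simp only:) (auto simp: sum_distrib_left intro!: sum.cong)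
  qed
  also have "\<dots> = (\<Sum>i<N. incl_prob p i * c i)"
    by (subst sum.swap) (simp only: incl_prob_sum[OF assms] sum_distrib_right)
  finally show ?thesis .
qed

lemma conditional_poisson_support:
  assumes "conditional_poisson N n q p"
  shows "set_pmf p \<subseteq> {s. s \<subseteq> {..<N} \<and> card s = n}"
  by (auto simp: pmf_conditional_poisson[OF assms] set_pmf_eq split: if_splits)

lemma conditional_poisson_pos:
  assumes cp: "conditional_poisson N n q p" and pos: "\<And>i. i < N \<Longrightarrow> 0 < incl_prob p i" and i: "i < N"
  shows "0 < q i"
proof (rule ccontr)
  assume "\<not> 0 < q i"
  then have q0: "q i = 0" using cp i by (force simp: conditional_poisson_def)
  have "pmf p s * of_bool (i \<in> s) = 0" for s
  proof (cases "i \<in> s \<and> s \<subseteq> {..<N}")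
    case True
    then have "poisson_weight {..<N} q s = 0"
      using q0 finite_subset[of s "{..<N}"] by (auto simp: poisson_weight_def)
    then show ?thesis by (simp add: pmf_conditional_poisson[OF cp])
  qed (auto simp: pmf_conditional_poisson[OF cp])
  moreover have "set_pmf p \<subseteq> Pow {..<N}" using conditional_poisson_support[OF cp] by auto
  ultimately have "incl_prob p i = 0" by (simp only: incl_prob_sum sum.neutral_const)
  then show False using pos[OF i] by simp
qed

text \<open>A constant tilt \<open>l\<close> multiplies the weight of every sample of size
  \<open>n\<close> by the same factor, which cancels in the conditional distribution. Only the
  distribution of the size changes, by \<open>l ^ k\<close> up to normalization.\<close>

lemma conditional_poisson_tilt:
  assumes cp: "conditional_poisson N n q p" and l: "0 < l"
  shows "conditional_poisson N n (tilted (\<lambda>_. l) q) p"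
    and "size_prob {..<N} (tilted (\<lambda>_. l) q) (int k) =
      l ^ k * size_prob {..<N} q (int k) / (\<Prod>i<N. 1 - q i + l * q i)"
proof -
  let ?A = "{..<N}" and ?t = "tilted (\<lambda>_. l) q"
  have q: "\<And>i. i \<in> ?A \<Longrightarrow> 0 \<le> q i \<and> q i \<le> 1" using cp by (simp add: conditional_poisson_def)
  define Z where "Z = (\<Prod>i<N. 1 - q i + l * q i)"
  have Z: "0 < Z" unfolding Z_def using q l tilted_denominator_pos[of q _ "\<lambda>_. l"] by (intro prod_pos) auto
  have w: "l ^ card s * poisson_weight ?A q s = Z * poisson_weight ?A ?t s" if "s \<subseteq> ?A" for s
    using poisson_weight_tilted[of ?A q "\<lambda>_. l" s] q l that by (simp add: Z_def)
  have sp: "l ^ k * size_prob ?A q (int k) = Z * size_prob ?A ?t (int k)" for k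
    unfolding size_prob_def sum_distrib_left
    by (rule sum.cong) (use w in \<open>auto simp: mult.assoc[symmetric]\<close>)
  then have eq: "size_prob ?A ?t (int k) = l ^ k * size_prob ?A q (int k) / Z" for k
    using Z by (simp add: field_simps)
  then show "size_prob ?A ?t (int k) = l ^ k * size_prob ?A q (int k) / (\<Prod>i<N. 1 - q i + l * q i)"
    by (simp add: Z_def)
  show "conditional_poisson N n ?t p"
    unfolding conditional_poisson_def
  proof (intro conjI allI impI)
    fix i assume "i < N"
    then show "0 \<le> ?t i" "?t i \<le> 1" using tilted_bounds[of q i "\<lambda>_. l"] q[of i] l by auto
  next
    show "0 < size_prob ?A ?t (int n)" unfolding eq using cp l Z by (simp add: conditional_poisson_def)
  next
    fix s
    have "poisson_weight ?A q s / size_prob ?A q (int n) = poisson_weight ?A ?t s / size_prob ?A ?t (int n)"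
      if s: "s \<subseteq> ?A" "card s = n"
    proof -
      have "poisson_weight ?A ?t s = l ^ n * poisson_weight ?A q s / Z"
        using w[OF s(1)] s(2) Z by (simp add: field_simps)
      then show ?thesis unfolding eq using l Z by simp
    qed
    then show "pmf p s = (if s \<subseteq> ?A \<and> card s = n then poisson_weight ?A ?t s / size_prob ?A ?t (int n) else 0)"
      by (auto simp: pmf_conditional_poisson[OF cp])
  qed
qed

text \<open>By log-concavity the size n becomes a mode once the odds are tilted such that
  the sizes n - 1 and n are equally likely. No centering of the sample size is needed.\<close>

lemma rejective_design_mode:
  assumes rej: "is_rejective_design N n p" and pos: "\<And>i. i < N \<Longrightarrow> 0 < incl_prob p i"
    and n: "0 < n" "n < N"
  obtains q where "conditional_poisson N n q p" "\<And>k. size_prob {..<N} q k \<le> size_prob {..<N} q (int n)"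
proof -
  let ?A = "{..<N}"
  obtain q0 where cp: "conditional_poisson N n q0 p" using rejective_design_conditional_poisson[OF rej] .
  have q0: "\<And>i. i \<in> ?A \<Longrightarrow> 0 \<le> q0 i \<and> q0 i \<le> 1" and an: "0 < size_prob ?A q0 (int n)"
    using cp by (auto simp: conditional_poisson_def)
  have q0pos: "0 < q0 i" if "i < N" for i using conditional_poisson_pos[OF cp pos that] .
  \<comment> \<open>The tilt exists only if the size \<open>n - 1\<close> is possible. Otherwise
    removing a unit with \<open>q0 i < 1\<close> from a possible sample would produce a sample of
    size \<open>n - 1\<close> with positive weight, so all units of possible samples have
    \<open>q0 i = 1\<close>. A unit outside one possible sample belongs to another one, hence is
    certain, and the first sample could not have omitted it.\<close>
  have "0 < size_prob ?A q0 (int (n - 1))"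
  proof (rule ccontr)
    assume "\<not> 0 < size_prob ?A q0 (int (n - 1))"
    then have z: "size_prob ?A q0 (int (n - 1)) = 0" using size_prob_nonneg[of ?A q0 "int (n - 1)", OF q0] by linarith
    have w0: "poisson_weight ?A q0 s = 0" if "s \<subseteq> ?A" "card s = n - 1" for s
    proof -
      have "\<forall>s\<in>Pow ?A. poisson_weight ?A q0 s * of_bool (int (card s) = int (n - 1)) = 0"
        using z poisson_weight_nonneg[of ?A q0] q0 unfolding size_prob_def
        by (subst (asm) sum_nonneg_eq_0_iff) auto
      then show ?thesis using that by auto
    qed
    have one: "q0 i = 1" if s: "s \<in> set_pmf p" "i \<in> s" for s i
    proof (rule ccontr)
      assume ne: "q0 i \<noteq> 1"
      have sA: "s \<subseteq> ?A" "card s = n" using conditional_poisson_support[OF cp] s by auto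
      have fs: "finite s" using sA finite_subset by blast
      have "poisson_weight ?A q0 s \<noteq> 0"
        using s sA by (auto simp: pmf_conditional_poisson[OF cp] set_pmf_eq)
      then have "\<forall>j\<in>?A - s. 1 - q0 j \<noteq> 0" by (auto simp: poisson_weight_def)
      moreover have "?A - (s - {i}) = insert i (?A - s)" using s sA by auto
      moreover have "finite (?A - s)" "i \<notin> ?A - s" using s by auto
      moreover have "\<forall>j\<in>s - {i}. q0 j \<noteq> 0" using q0pos sA by fastforce
      moreover have "finite (s - {i})" using fs by simp
      ultimately have "poisson_weight ?A q0 (s - {i}) \<noteq> 0"
        using ne by (simp add: poisson_weight_def)
      moreover have "card (s - {i}) = n - 1" using fs s sA by simp
      ultimately show False using w0[of "s - {i}"] sA by blast
    qed
    obtain s where s: "s \<in> set_pmf p" using set_pmf_not_empty[of p] by blast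
    have sA: "s \<subseteq> ?A" "card s = n" using conditional_poisson_support[OF cp] s by auto
    have "\<exists>j. j < N \<and> j \<notin> s"
    proof (rule ccontr)
      assume "\<not> ?thesis"
      then have "s = ?A" using sA by auto
      then show False using sA n by simp
    qed
    then obtain j where j: "j < N" "j \<notin> s" by blast
    have "\<exists>s'\<in>set_pmf p. j \<in> s'"
    proof (rule ccontr)
      assume "\<not> ?thesis"
      then have "incl_prob p j = 0" unfolding incl_prob_def by (auto simp: measure_pmf_zero_iff)
      then show False using pos[OF j(1)] by simp
    qed
    then obtain s' where s': "s' \<in> set_pmf p" "j \<in> s'" by blast
    have "q0 j = 1" using one[OF s'] .
    then have "poisson_weight ?A q0 s = 0" using j by (auto simp: poisson_weight_def)
    then have "pmf p s = 0" by (simp add: pmf_conditional_poisson[OF cp])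
    then show False using s by (simp add: set_pmf_eq)
  qed
  note an1 = this
  define l where "l = size_prob ?A q0 (int (n - 1)) / size_prob ?A q0 (int n)"
  have l: "0 < l" using an an1 by (simp add: l_def)
  define q where "q = tilted (\<lambda>_. l) q0"
  have cpq: "conditional_poisson N n q p" unfolding q_def by (rule conditional_poisson_tilt[OF cp l])
  have q01: "\<And>i. i \<in> ?A \<Longrightarrow> 0 \<le> q i \<and> q i \<le> 1" and bn: "0 < size_prob ?A q (int n)"
    using cpq by (auto simp: conditional_poisson_def)
  have "l ^ n * size_prob ?A q0 (int n) = l ^ (n - 1) * size_prob ?A q0 (int (n - 1))"
    using n an by (cases n) (auto simp: l_def)
  then have eq: "size_prob ?A q (int n - 1) = size_prob ?A q (int n)"
  proof -
    have "int (n - 1) = int n - 1" using n by simp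
    then show ?thesis
      using \<open>l ^ n * _ = _\<close> conditional_poisson_tilt(2)[OF cp l, of n] conditional_poisson_tilt(2)[OF cp l, of "n - 1"]
      by (simp only: q_def)
  qed
  \<comment> \<open>Log-concavity compares outward steps with the step from \<open>n - 1\<close> to
    \<open>n\<close>, where the two probabilities are equal; hence the sequence decreases to the
    right of \<open>n\<close> and, in the next claim, to the left of \<open>n - 1\<close>.\<close>
  have up: "size_prob ?A q (j + 1) \<le> size_prob ?A q j" if "int n \<le> j" for j
  proof -
    have "size_prob ?A q (int n) * size_prob ?A q (j + 1) \<le> size_prob ?A q (int n) * size_prob ?A q j"
      using size_prob_log_concave[of ?A q "int n" j, OF finite_lessThan q01 that] unfolding eq .
    then show ?thesis using bn by (rule mult_left_le_imp_le)
  qed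
  have down: "size_prob ?A q (j - 1) \<le> size_prob ?A q j" if "j \<le> int n - 1" for j
  proof -
    have "size_prob ?A q (int n) * size_prob ?A q (j - 1) \<le> size_prob ?A q (int n) * size_prob ?A q j"
      using size_prob_log_concave[of ?A q j "int n - 1", OF finite_lessThan q01 that] unfolding eq diff_add_cancel
      by (simp only: mult.commute)
    then show ?thesis using bn by (rule mult_left_le_imp_le)
  qed
  have ups: "size_prob ?A q (int n + int j) \<le> size_prob ?A q (int n)" for j
  proof (induction j)
    case (Suc j)
    then show ?case using up[of "int n + int j"] by (simp add: algebra_simps)
  qed simp
  have downs: "size_prob ?A q (int n - 1 - int j) \<le> size_prob ?A q (int n - 1)" for j
  proof (induction j)
    case (Suc j)
    then show ?case using down[of "int n - 1 - int j"] by (simp add: algebra_simps)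
  qed simp
  have "size_prob ?A q k \<le> size_prob ?A q (int n)" for k
    using ups[of "nat (k - int n)"] downs[of "nat (int n - 1 - k)"] eq by (cases "int n \<le> k") auto
  then show ?thesis using that cpq by blast
qed

section \<open>Designs close to a rejective design\<close>

lemma exp_le_quadratic:
  fixes x :: real
  assumes "\<bar>x\<bar> \<le> 1"
  shows "exp x \<le> 1 + x + x\<^sup>2"
proof (cases "0 \<le> x")
  case True
  then show ?thesis using exp_bound[of x] assms by simp
next
  case False
  define y where "y = - x"
  have y: "0 \<le> y" using False by (simp add: y_def)
  have "1 \<le> (1 - y + y\<^sup>2) * (1 + y + y\<^sup>2 / 2)"
  proof -
    have "(1 - y + y\<^sup>2) * (1 + y + y\<^sup>2 / 2) = 1 + (y\<^sup>2 / 2 + y ^ 3 / 2 + y ^ 4 / 2)"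
      by (simp add: power2_eq_square power3_eq_cube power4_eq_xxxx field_simps)
    moreover have "0 \<le> y\<^sup>2 / 2 + y ^ 3 / 2 + y ^ 4 / 2" using y by simp
    ultimately show ?thesis by linarith
  qed
  also have "\<dots> \<le> (1 - y + y\<^sup>2) * exp y"
  proof (rule mult_left_mono[OF exp_lower_Taylor_quadratic[OF y]])
    have "0 \<le> (1 - y / 2)\<^sup>2 + 3 / 4 * y\<^sup>2" by simp
    then show "0 \<le> 1 - y + y\<^sup>2" by (simp add: power2_eq_square field_simps)
  qed
  finally have "1 * exp (- y) \<le> (1 - y + y\<^sup>2) * exp y * exp (- y)" by (intro mult_right_mono) auto
  then show ?thesis by (simp add: y_def mult.assoc exp_add[symmetric])
qed

text \<open>After centering, the linear terms of the quadratic bounds cancel and the square terms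
  add up to exactly \<open>a\<^sup>2\<close> times the variance \<open>q * (1 - q)\<close>. Having
  the variance and not just \<open>q\<close> in the exponent matters for units drawn almost
  surely.\<close>

lemma bernoulli_centered_mgf_le:
  fixes q a :: real
  assumes q: "0 \<le> q" "q \<le> 1" and a: "\<bar>a\<bar> \<le> 1"
  shows "(1 - q + exp a * q) * exp (- (a * q)) \<le> exp (a\<^sup>2 * (q * (1 - q)))"
proof -
  have 1: "exp (- (a * q)) \<le> 1 + - (a * q) + (- (a * q))\<^sup>2"
    using q a mult_mono[of "\<bar>a\<bar>" 1 q 1] by (intro exp_le_quadratic) (auto simp: abs_mult)
  have 2: "exp (a * (1 - q)) \<le> 1 + a * (1 - q) + (a * (1 - q))\<^sup>2"
    using q a mult_mono[of "\<bar>a\<bar>" 1 "1 - q" 1] by (intro exp_le_quadratic) (auto simp: abs_mult)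
  have "(1 - q + exp a * q) * exp (- (a * q)) = (1 - q) * exp (- (a * q)) + q * exp (a * (1 - q))"
    by (simp add: algebra_simps exp_add[symmetric])
  also have "\<dots> \<le> (1 - q) * (1 + - (a * q) + (- (a * q))\<^sup>2) + q * (1 + a * (1 - q) + (a * (1 - q))\<^sup>2)"
    using q 1 2 by (intro add_mono mult_left_mono) auto
  also have "\<dots> = 1 + a\<^sup>2 * (q * (1 - q))" by (simp add: power2_eq_square algebra_simps)
  also have "\<dots> \<le> exp (a\<^sup>2 * (q * (1 - q)))" by (rule exp_ge_add_one_self)
  finally show ?thesis .
qed

text \<open>Multiplying the odds by \<open>exp a\<close> with \<open>\<bar>a\<bar> \<le> 1\<close>
  changes the variance of a unit by at most \<open>exp 1\<close>, rounded to 3. Thus the local bound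
  for the tilted design can be stated with the original variance.\<close>

lemma tilted_var_ge:
  fixes q a :: real
  assumes q: "0 \<le> q" "q \<le> 1" and a: "\<bar>a\<bar> \<le> 1"
  shows "q * (1 - q) \<le> 3 * ((exp a * q / (1 - q + exp a * q)) * ((1 - q) / (1 - q + exp a * q)))"
proof -
  define z where "z = 1 - q + exp a * q"
  have z0: "0 < z" using tilted_denominator_pos[of "\<lambda>_. q" "()" "\<lambda>_. exp a"] q by (simp add: z_def)
  have e3: "exp \<bar>a\<bar> \<le> 3" using a exp_le order_trans[of "exp \<bar>a\<bar>" "exp 1" 3] by simp
  have "z\<^sup>2 \<le> 3 * exp a"
  proof (cases "0 \<le> a")
    case True
    have "z \<le> exp a * (1 - q) + exp a * q" using True q by (simp add: z_def mult_right_mono[of 1 "exp a" "1 - q", simplified])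
    then have "z \<le> exp a" by (simp add: algebra_simps)
    then have "z\<^sup>2 \<le> exp a * exp a" using z0 unfolding power2_eq_square by (intro mult_mono) auto
    also have "\<dots> \<le> 3 * exp a" using e3 True by (intro mult_right_mono) auto
    finally show ?thesis .
  next
    case False
    have "z \<le> 1" unfolding z_def using q False mult_right_mono[of "exp a" 1 q] by simp
    then have "z\<^sup>2 \<le> 1" using z0 by (simp add: power_le_one)
    also have "1 = exp \<bar>a\<bar> * exp a" using False by (simp add: exp_add[symmetric])
    also have "\<dots> \<le> 3 * exp a" using e3 by (intro mult_right_mono) auto
    finally show ?thesis .
  qed
  then have "(q * (1 - q)) * z\<^sup>2 \<le> (q * (1 - q)) * (3 * exp a)" using q by (intro mult_left_mono) auto
  then have "q * (1 - q) \<le> (q * (1 - q)) * (3 * exp a) / z\<^sup>2" using z0 by (simp add: pos_le_divide_eq)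
  also have "\<dots> = 3 * ((exp a * q / z) * ((1 - q) / z))" by (simp add: power2_eq_square)
  finally show ?thesis unfolding z_def .
qed

text \<open>The conditional exponential moment is the unconditional one times the ratio of the size
  probabilities at \<open>n\<close> after and before tilting. The local upper bound for the tilted
  design and the lower bound at the mode are both of order \<open>1 / sqrt d\<close>, so the ratio
  is bounded: \<open>3 * 4 * 8 * sqrt 3\<close> is at most 168. The centre is the Poisson mean, not
  the conditional mean.\<close>

lemma conditional_poisson_mgf_le:
  fixes c :: "nat \<Rightarrow> real"
  assumes cp: "conditional_poisson N n q p"
    and mode: "\<And>k. size_prob {..<N} q k \<le> size_prob {..<N} q (int n)"
    and c: "\<And>i. i < N \<Longrightarrow> \<bar>c i\<bar> \<le> 1" and t: "\<bar>t\<bar> \<le> 1 / sqrt (poisson_var {..<N} q + 1)"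
  shows "(\<Sum>s\<in>Pow {..<N}. pmf p s * exp (t * ((\<Sum>i\<in>s. c i) - (\<Sum>i<N. q i * c i)))) \<le> 168"
proof -
  let ?A = "{..<N}" and ?d = "poisson_var {..<N} q" and ?m = "\<Sum>i<N. q i * c i"
  have q: "\<And>i. i \<in> ?A \<Longrightarrow> 0 \<le> q i \<and> q i \<le> 1" and Pn: "0 < size_prob ?A q (int n)"
    using cp by (auto simp: conditional_poisson_def)
  have d0: "0 \<le> ?d" using poisson_var_nonneg[of ?A q] q by blast
  have t2: "t\<^sup>2 * (?d + 1) \<le> 1"
  proof -
    have "\<bar>t\<bar>\<^sup>2 \<le> (1 / sqrt (?d + 1))\<^sup>2" using t by (intro power_mono) auto
    then have "t\<^sup>2 \<le> 1 / (?d + 1)" using d0 by (simp add: power_divide)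
    then show ?thesis using d0 by (simp add: pos_le_divide_eq)
  qed
  have "1 / sqrt (?d + 1) \<le> 1" using d0 by simp
  then have t1: "\<bar>t\<bar> \<le> 1" using t by linarith
  have tc: "\<bar>t * c i\<bar> \<le> 1" "(t * c i)\<^sup>2 \<le> t\<^sup>2" if "i < N" for i
  proof -
    have "\<bar>t\<bar> * \<bar>c i\<bar> \<le> \<bar>t\<bar> * 1" using c[OF that] by (intro mult_left_mono) auto
    then show "\<bar>t * c i\<bar> \<le> 1" "(t * c i)\<^sup>2 \<le> t\<^sup>2" using t1 by (auto simp: abs_mult abs_le_square_iff[symmetric])
  qed
  let ?q' = "tilted (\<lambda>i. exp (t * c i)) q"
  let ?Z = "\<Prod>i<N. 1 - q i + exp (t * c i) * q i"
  have q': "\<And>i. i \<in> ?A \<Longrightarrow> 0 \<le> ?q' i \<and> ?q' i \<le> 1"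
    using tilted_bounds[of q _ "\<lambda>i. exp (t * c i)"] q by auto
  have var: "?d + 1 \<le> 3 * (poisson_var ?A ?q' + 1)"
  proof -
    have "?d \<le> (\<Sum>i<N. 3 * (?q' i * (1 - ?q' i)))"
      unfolding poisson_var_def
    proof (rule sum_mono)
      fix i assume i: "i \<in> ?A"
      have "1 - ?q' i = (1 - q i) / (1 - q i + exp (t * c i) * q i)"
        using tilted_complement[of q i "\<lambda>i. exp (t * c i)"] q[OF i] by simp
      moreover have "?q' i = exp (t * c i) * q i / (1 - q i + exp (t * c i) * q i)" by (simp add: tilted_def)
      ultimately show "q i * (1 - q i) \<le> 3 * (?q' i * (1 - ?q' i))"
        using tilted_var_ge[of "q i" "t * c i"] q[OF i] tc i by simp
    qed
    then show ?thesis by (simp add: poisson_var_def sum_distrib_left)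
  qed
  have "(\<Sum>s\<in>Pow ?A. pmf p s * exp (t * ((\<Sum>i\<in>s. c i) - ?m))) =
      (\<Sum>s\<in>Pow ?A. (poisson_weight ?A q s * of_bool (int (card s) = int n)) * exp (t * ((\<Sum>i\<in>s. c i) - ?m))) / size_prob ?A q (int n)"
    using expectation_conditional_poisson[OF cp, of "\<lambda>s. exp (t * ((\<Sum>i\<in>s. c i) - ?m))"] by (simp add: divide_inverse mult.commute)
  also have "(\<Sum>s\<in>Pow ?A. (poisson_weight ?A q s * of_bool (int (card s) = int n)) * exp (t * ((\<Sum>i\<in>s. c i) - ?m))) =
      exp (- (t * ?m)) * (\<Sum>s\<in>Pow ?A. poisson_weight ?A q s * of_bool (int (card s) = int n) * (\<Prod>i\<in>s. exp (t * c i)))"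
    unfolding sum_distrib_left[of "exp (- (t * ?m))"]
  proof (rule sum.cong[OF refl])
    fix s assume "s \<in> Pow ?A"
    then have "finite s" using finite_subset by auto
    then show "poisson_weight ?A q s * of_bool (int (card s) = int n) * exp (t * ((\<Sum>i\<in>s. c i) - ?m)) =
      exp (- (t * ?m)) * (poisson_weight ?A q s * of_bool (int (card s) = int n) * (\<Prod>i\<in>s. exp (t * c i)))"
      unfolding exp_sum[OF \<open>finite s\<close>, symmetric] sum_distrib_left[symmetric, of t c s] right_diff_distrib
      by (simp add: exp_diff exp_minus divide_inverse)
  qed
  also have "\<dots> = exp (- (t * ?m)) * (?Z * size_prob ?A ?q' (int n))"
    using size_prob_tilted[of ?A q "\<lambda>i. exp (t * c i)" "int n"] q by simp
  also have "\<dots> = (exp (- (t * ?m)) * ?Z) * size_prob ?A ?q' (int n)" by simp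
  also have "\<dots> / size_prob ?A q (int n) \<le> 3 * (4 / sqrt ((?d + 1) / 3)) * (8 * sqrt (?d + 1))"
  proof -
    have "exp (- (t * ?m)) * ?Z = (\<Prod>i<N. (1 - q i + exp (t * c i) * q i) * exp (- ((t * c i) * q i)))"
      by (simp add: prod.distrib exp_sum[symmetric] sum_negf sum_distrib_left mult_ac)
    also have "\<dots> \<le> (\<Prod>i<N. exp (t\<^sup>2 * (q i * (1 - q i))))"
    proof (rule prod_mono)
      fix i assume i: "i \<in> ?A"
      have "(1 - q i + exp (t * c i) * q i) * exp (- ((t * c i) * q i)) \<le> exp ((t * c i)\<^sup>2 * (q i * (1 - q i)))"
        using q[OF i] tc i by (intro bernoulli_centered_mgf_le) auto
      also have "\<dots> \<le> exp (t\<^sup>2 * (q i * (1 - q i)))"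
        using tc i q[OF i] by (auto intro: mult_right_mono)
      finally show "0 \<le> (1 - q i + exp (t * c i) * q i) * exp (- ((t * c i) * q i)) \<and>
          (1 - q i + exp (t * c i) * q i) * exp (- ((t * c i) * q i)) \<le> exp (t\<^sup>2 * (q i * (1 - q i)))"
        using q[OF i] by simp
    qed
    also have "\<dots> = exp (t\<^sup>2 * ?d)" by (simp add: exp_sum[symmetric] poisson_var_def sum_distrib_left)
    also have "\<dots> \<le> exp 1" using t2 zero_le_power2[of t] unfolding distrib_left exp_le_cancel_iff by linarith
    also have "\<dots> \<le> 3" by (rule exp_le)
    finally have A1: "exp (- (t * ?m)) * ?Z \<le> 3" .
    have v0: "0 \<le> poisson_var ?A ?q'" using poisson_var_nonneg[of ?A ?q'] q' by blast
    have "size_prob ?A ?q' (int n) * sqrt ((?d + 1) / 3) \<le> size_prob ?A ?q' (int n) * sqrt (poisson_var ?A ?q' + 1)"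
      using var size_prob_nonneg[of ?A ?q' "int n", OF q'] by (intro mult_left_mono real_sqrt_le_mono) auto
    also have "\<dots> \<le> 4" by (rule size_prob_le) (use q' in auto)
    finally have A2: "size_prob ?A ?q' (int n) \<le> 4 / sqrt ((?d + 1) / 3)" using d0 by (simp add: pos_le_divide_eq)
    have "1 \<le> 8 * sqrt (?d + 1) * size_prob ?A q (int n)" by (rule size_prob_mode_ge) (use q mode in auto)
    then have A3: "1 / size_prob ?A q (int n) \<le> 8 * sqrt (?d + 1)" using Pn by (simp add: pos_divide_le_eq)
    have "(exp (- (t * ?m)) * ?Z) * size_prob ?A ?q' (int n) * (1 / size_prob ?A q (int n)) \<le>
      3 * (4 / sqrt ((?d + 1) / 3)) * (8 * sqrt (?d + 1))"
      using A1 A2 A3 Pn d0 size_prob_nonneg[of ?A ?q' "int n", OF q'] by (intro mult_mono mult_nonneg_nonneg) auto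
    then show ?thesis by simp
  qed
  also have "\<dots> = 96 * sqrt 3" using d0 by (simp add: real_sqrt_divide)
  also have "\<dots> \<le> 96 * (7 / 4)" by (intro mult_left_mono real_le_lsqrt) (auto simp: power2_eq_square)
  finally show ?thesis by simp
qed

lemma abs_power_le_exp:
  fixes x :: real
  shows "\<bar>x\<bar> \<le> exp x + exp (- x)" "x ^ 4 \<le> 24 * (exp x + exp (- x))" "x ^ 8 \<le> 40320 * (exp x + exp (- x))"
proof -
  have e: "y ^ k \<le> fact k * exp y" if "0 \<le> y" for y :: real and k
  proof -
    have s: "(\<lambda>n. y ^ n /\<^sub>R fact n) sums exp y" by (rule exp_converges)
    have "sum (\<lambda>n. y ^ n /\<^sub>R fact n) {k} \<le> (\<Sum>n. y ^ n /\<^sub>R fact n)"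
      by (rule sum_le_suminf) (use s that in \<open>auto simp: sums_iff\<close>)
    then have "y ^ k / fact k \<le> exp y" using s by (simp add: sums_iff divide_inverse mult.commute)
    then show ?thesis by (simp add: pos_divide_le_eq mult.commute)
  qed
  have "exp \<bar>x\<bar> \<le> exp x + exp (- x)" by (simp add: abs_if)
  then show "\<bar>x\<bar> \<le> exp x + exp (- x)" "x ^ 4 \<le> 24 * (exp x + exp (- x))" "x ^ 8 \<le> 40320 * (exp x + exp (- x))"
    using e[of "\<bar>x\<bar>" 1] e[of "\<bar>x\<bar>" 4] e[of "\<bar>x\<bar>" 8] by (auto simp: power_even_abs fact_numeral)
qed

text \<open>Exponential moments at plus and minus \<open>1 / sqrt (d + 1)\<close>; hence 336, and
  \<open>40320 * 336\<close> with \<open>8!\<close> for the eighth power. The eighth moment is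
  wanted because the Cauchy--Schwarz inequality doubles the order when fourth moments are
  transferred to another design.\<close>

lemma conditional_poisson_moments:
  fixes c :: "nat \<Rightarrow> real"
  assumes cp: "conditional_poisson N n q p"
    and mode: "\<And>k. size_prob {..<N} q k \<le> size_prob {..<N} q (int n)"
    and c: "\<And>i. i < N \<Longrightarrow> \<bar>c i\<bar> \<le> 1"
  defines "d \<equiv> poisson_var {..<N} q"
  shows "(\<Sum>s\<in>Pow {..<N}. pmf p s * \<bar>(\<Sum>i\<in>s. c i) - (\<Sum>i<N. q i * c i)\<bar>) \<le> 336 * sqrt (d + 1)"
    and "(\<Sum>s\<in>Pow {..<N}. pmf p s * ((\<Sum>i\<in>s. c i) - (\<Sum>i<N. q i * c i)) ^ 8) \<le> 13547520 * (d + 1) ^ 4"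
proof -
  let ?A = "{..<N}" and ?X = "\<lambda>s. (\<Sum>i\<in>s. c i) - (\<Sum>i<N. q i * c i)"
  define t where "t = 1 / sqrt (d + 1)"
  have d0: "0 \<le> d" unfolding d_def by (rule poisson_var_nonneg) (use cp in \<open>auto simp: conditional_poisson_def\<close>)
  have t0: "0 < t" using d0 by (simp add: t_def)
  have E: "(\<Sum>s\<in>Pow ?A. pmf p s * (exp (t * ?X s) + exp (- (t * ?X s)))) \<le> 336"
  proof -
    have "\<bar>t\<bar> \<le> 1 / sqrt (poisson_var ?A q + 1)" using d0 by (simp add: t_def d_def)
    then have "(\<Sum>s\<in>Pow ?A. pmf p s * exp (t * ?X s)) \<le> 168" "(\<Sum>s\<in>Pow ?A. pmf p s * exp (- t * ?X s)) \<le> 168"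
      by (intro conditional_poisson_mgf_le[OF cp mode c]; simp)+
    then show ?thesis by (simp only: distrib_left sum.distrib minus_mult_left)
  qed
  have M: "(\<Sum>s\<in>Pow ?A. pmf p s * f (t * ?X s)) \<le> K * 336"
    if "\<And>x. f x \<le> K * (exp x + exp (- x))" "0 \<le> K" for f :: "real \<Rightarrow> real" and K
  proof -
    have "(\<Sum>s\<in>Pow ?A. pmf p s * f (t * ?X s)) \<le> (\<Sum>s\<in>Pow ?A. K * (pmf p s * (exp (t * ?X s) + exp (- (t * ?X s)))))"
    proof (rule sum_mono)
      fix s
      have "pmf p s * f (t * ?X s) \<le> pmf p s * (K * (exp (t * ?X s) + exp (- (t * ?X s))))"
        by (intro mult_left_mono that(1)) simp
      then show "pmf p s * f (t * ?X s) \<le> K * (pmf p s * (exp (t * ?X s) + exp (- (t * ?X s))))"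
        by (simp only: mult.left_commute)
    qed
    also have "\<dots> \<le> K * 336" unfolding sum_distrib_left[symmetric] using E that(2) by (rule mult_left_mono)
    finally show ?thesis .
  qed
  have "t * (\<Sum>s\<in>Pow ?A. pmf p s * \<bar>?X s\<bar>) = (\<Sum>s\<in>Pow ?A. pmf p s * \<bar>t * ?X s\<bar>)"
    using t0 by (simp add: sum_distrib_left abs_mult mult_ac)
  also have "\<dots> \<le> 1 * 336" by (rule M) (use abs_power_le_exp(1) in auto)
  finally show "(\<Sum>s\<in>Pow ?A. pmf p s * \<bar>?X s\<bar>) \<le> 336 * sqrt (d + 1)"
    using d0 by (simp add: t_def pos_divide_le_eq)
  have "t ^ 8 * (\<Sum>s\<in>Pow ?A. pmf p s * ?X s ^ 8) = (\<Sum>s\<in>Pow ?A. pmf p s * (t * ?X s) ^ 8)"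
    unfolding sum_distrib_left by (simp add: power_mult_distrib mult_ac)
  also have "\<dots> \<le> 40320 * 336" by (rule M) (use abs_power_le_exp(3) in auto)
  finally have "t ^ 8 * (\<Sum>s\<in>Pow ?A. pmf p s * ?X s ^ 8) \<le> 13547520" by simp
  moreover have "t ^ 8 = 1 / (d + 1) ^ 4"
  proof -
    have "sqrt (d + 1) ^ 8 = ((sqrt (d + 1))\<^sup>2) ^ 4" unfolding power_mult[symmetric] by simp
    then show ?thesis using d0 by (simp add: t_def power_divide)
  qed
  ultimately show "(\<Sum>s\<in>Pow ?A. pmf p s * ?X s ^ 8) \<le> 13547520 * (d + 1) ^ 4"
    using d0 by (simp add: pos_divide_le_eq)
qed

text \<open>Duality: testing with the signs of \<open>incl_prob p i - q i\<close> turns the total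
  difference into the gap between the conditional mean and the Poisson mean of one bounded sum, and
  the first absolute moment bounds that gap.\<close>

lemma conditional_poisson_incl_prob_close:
  assumes cp: "conditional_poisson N n q p"
    and mode: "\<And>k. size_prob {..<N} q k \<le> size_prob {..<N} q (int n)"
  shows "(\<Sum>i<N. \<bar>incl_prob p i - q i\<bar>) \<le> 336 * sqrt (poisson_var {..<N} q + 1)"
proof -
  define c where "c i = sgn (incl_prob p i - q i)" for i
  have sup: "set_pmf p \<subseteq> Pow {..<N}" using conditional_poisson_support[OF cp] by auto
  have "(\<Sum>i<N. \<bar>incl_prob p i - q i\<bar>) = (\<Sum>i<N. incl_prob p i * c i) - (\<Sum>i<N. q i * c i)"
    unfolding sum_subtractf[symmetric] by (rule sum.cong) (auto simp: c_def abs_sgn left_diff_distrib)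
  also have "\<dots> = (\<Sum>s\<in>Pow {..<N}. pmf p s * ((\<Sum>i\<in>s. c i) - (\<Sum>i<N. q i * c i)))"
    by (simp only: right_diff_distrib sum_subtractf expectation_linear_statistic[OF sup]
        sum_distrib_right[symmetric] sum_pmf_Pow[OF sup] mult_1_left)
  also have "\<dots> \<le> (\<Sum>s\<in>Pow {..<N}. pmf p s * \<bar>(\<Sum>i\<in>s. c i) - (\<Sum>i<N. q i * c i)\<bar>)"
    by (intro sum_mono mult_left_mono) auto
  also have "\<dots> \<le> 336 * sqrt (poisson_var {..<N} q + 1)"
    by (rule conditional_poisson_moments(1)[OF cp mode]) (simp add: c_def sgn_if)
  finally show ?thesis .
qed

lemma abs_bernoulli_var_diff_le:
  fixes a b :: real
  assumes "0 \<le> a" "a \<le> 1" "0 \<le> b" "b \<le> 1"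
  shows "\<bar>a * (1 - a) - b * (1 - b)\<bar> \<le> \<bar>a - b\<bar>"
proof -
  have "a * (1 - a) - b * (1 - b) = (a - b) * (1 - a - b)" by (simp add: algebra_simps)
  moreover have "\<bar>a - b\<bar> * \<bar>1 - a - b\<bar> \<le> \<bar>a - b\<bar> * 1" using assms by (intro mult_left_mono) auto
  ultimately show ?thesis by (simp add: abs_mult)
qed

text \<open>Transfers information on the given inclusion probabilities to the implicit
  \<open>q\<close>. Since \<open>x * (1 - x)\<close> is 1-Lipschitz, the two sums of variances
  differ by at most \<open>336 * sqrt (d + 1)\<close>, which is of lower order than \<open>d\<close>
  itself; so \<open>d\<close> is comparable with the variance computed from the inclusion
  probabilities.\<close>

lemma conditional_poisson_var_bounds:
  assumes cp: "conditional_poisson N n q p"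
    and mode: "\<And>k. size_prob {..<N} q k \<le> size_prob {..<N} q (int n)"
    and n: "0 < n"
  defines "d \<equiv> poisson_var {..<N} q"
  shows "(\<Sum>i<N. incl_prob p i * (1 - incl_prob p i)) \<le> 337 * (d + 1)"
    and "d + 1 \<le> 112900 * real n"
    and "(\<Sum>i<N. \<bar>incl_prob p i - q i\<bar>) \<le> 113232 * sqrt n"
    and "(\<Sum>i<N. q i) \<le> 113233 * real n"
proof -
  let ?p = "incl_prob p"
  have q: "0 \<le> q i" "q i \<le> 1" if "i < N" for i using cp that by (auto simp: conditional_poisson_def)
  have p: "0 \<le> ?p i" "?p i \<le> 1" for i by (auto simp: incl_prob_def)
  have d0: "0 \<le> d" unfolding d_def by (rule poisson_var_nonneg) (use q in auto)
  have sup: "set_pmf p \<subseteq> Pow {..<N}" using conditional_poisson_support[OF cp] by auto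
  have close: "(\<Sum>i<N. \<bar>?p i - q i\<bar>) \<le> 336 * sqrt (d + 1)"
    unfolding d_def by (rule conditional_poisson_incl_prob_close[OF cp mode])
  have diff: "\<bar>(\<Sum>i<N. ?p i * (1 - ?p i)) - d\<bar> \<le> 336 * sqrt (d + 1)"
  proof -
    have "\<bar>(\<Sum>i<N. ?p i * (1 - ?p i)) - d\<bar> \<le> (\<Sum>i<N. \<bar>?p i * (1 - ?p i) - q i * (1 - q i)\<bar>)"
      unfolding d_def poisson_var_def sum_subtractf[symmetric] by (rule sum_abs)
    also have "\<dots> \<le> (\<Sum>i<N. \<bar>?p i - q i\<bar>)" using p q by (intro sum_mono abs_bernoulli_var_diff_le) auto
    finally show ?thesis using close by linarith
  qed
  have total: "(\<Sum>i<N. ?p i) = real n"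
  proof -
    have "(\<Sum>i<N. ?p i * 1) = (\<Sum>s\<in>Pow {..<N}. pmf p s * (\<Sum>i\<in>s. 1))"
      by (rule expectation_linear_statistic[OF sup, symmetric])
    also have "\<dots> = (\<Sum>s\<in>Pow {..<N}. pmf p s * real n)"
      by (rule sum.cong) (auto simp: pmf_conditional_poisson[OF cp])
    finally show ?thesis by (simp add: sum_distrib_right[symmetric] sum_pmf_Pow[OF sup])
  qed
  have n1: "1 \<le> real n" using n by simp
  have "sqrt (d + 1) * 1 \<le> sqrt (d + 1) * sqrt (d + 1)" using d0 by (intro mult_left_mono) auto
  then have "sqrt (d + 1) \<le> d + 1" using d0 by simp
  moreover have "x \<le> 337 * (y + 1)" if "\<bar>x - y\<bar> \<le> 336 * z" "z \<le> y + 1" for x y z :: real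
    using that by (simp add: distrib_left)
  ultimately show "(\<Sum>i<N. ?p i * (1 - ?p i)) \<le> 337 * (d + 1)" using diff by blast
  have "(\<Sum>i<N. ?p i * (1 - ?p i)) \<le> (\<Sum>i<N. ?p i)" using p by (intro sum_mono) (simp add: mult_left_le)
  then have "d \<le> real n + 336 * sqrt (d + 1)" using diff total by linarith
  \<comment> \<open>The arithmetic-geometric mean inequality moves half of \<open>d\<close> to the
    left side. The constant 112900 is \<open>336\<^sup>2 + 4\<close>, and 113232 below is
    \<open>336 * 337\<close>.\<close>
  moreover have "336 * sqrt (d + 1) \<le> (336\<^sup>2 + (d + 1)) / 2"
    using sum_squares_bound[of 336 "sqrt (d + 1)"] d0 by simp
  ultimately have "d + 1 \<le> 2 * real n + 2 + 336\<^sup>2" by (simp add: field_simps)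
  then show d: "d + 1 \<le> 112900 * real n" using n1 by simp
  have "sqrt (d + 1) \<le> sqrt (337\<^sup>2 * real n)" using d n1 by (intro real_sqrt_le_mono) simp
  then have "sqrt (d + 1) \<le> 337 * sqrt n" by (simp add: real_sqrt_mult)
  then show cl: "(\<Sum>i<N. \<bar>?p i - q i\<bar>) \<le> 113232 * sqrt n" using close by linarith
  have "(\<Sum>i<N. q i) \<le> (\<Sum>i<N. ?p i + \<bar>?p i - q i\<bar>)" by (intro sum_mono) linarith
  moreover have "sqrt n \<le> real n"
  proof -
    have "sqrt n * 1 \<le> sqrt n * sqrt n" using n1 by (intro mult_left_mono) auto
    then show ?thesis by simp
  qed
  ultimately show "(\<Sum>i<N. q i) \<le> 113233 * real n" using total cl by (simp add: sum.distrib)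
qed

text \<open>Cauchy--Schwarz after writing the summand as \<open>\<bar>p - pr\<bar> / sqrt pr\<close>
  times \<open>sqrt pr * f\<close>. The divergence sums only over the support of \<open>pr\<close>
  and does not see mass of \<open>p\<close> elsewhere, hence the domination hypothesis.\<close>

lemma sum_pmf_diff_le:
  fixes f :: "nat set \<Rightarrow> real"
  assumes sup: "\<And>s. s \<in> Pow {..<N} \<Longrightarrow> pmf pr s = 0 \<Longrightarrow> pmf p s = 0"
    and f: "\<And>s. s \<in> Pow {..<N} \<Longrightarrow> 0 \<le> f s"
  shows "(\<Sum>s\<in>Pow {..<N}. \<bar>pmf p s - pmf pr s\<bar> * f s)
    \<le> sqrt (design_d2 N p pr) * sqrt (\<Sum>s\<in>Pow {..<N}. pmf pr s * (f s)\<^sup>2)"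
proof -
  let ?T = "{s. s \<subseteq> {..<N} \<and> pmf pr s > 0}"
  have zero: "pmf pr s = 0" if "\<not> 0 < pmf pr s" for s using that pmf_nonneg[of pr s] by linarith
  have fin: "finite ?T" by (rule finite_subset[of _ "Pow {..<N}"]) auto
  have "(\<Sum>s\<in>Pow {..<N}. \<bar>pmf p s - pmf pr s\<bar> * f s) = (\<Sum>s\<in>?T. \<bar>pmf p s - pmf pr s\<bar> * f s)"
  proof (rule sum.mono_neutral_right)
    show "\<forall>s\<in>Pow {..<N} - ?T. \<bar>pmf p s - pmf pr s\<bar> * f s = 0"
    proof
      fix s assume s: "s \<in> Pow {..<N} - ?T"
      then have "pmf pr s = 0" using zero[of s] by blast
      then show "\<bar>pmf p s - pmf pr s\<bar> * f s = 0" using sup[of s] s by simp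
    qed
  qed auto
  also have "\<dots> = (\<Sum>s\<in>?T. \<bar>\<bar>pmf p s - pmf pr s\<bar> / sqrt (pmf pr s)\<bar> * \<bar>sqrt (pmf pr s) * f s\<bar>)"
    by (rule sum.cong) (auto simp: abs_mult f)
  also have "\<dots> \<le> sqrt (\<Sum>s\<in>?T. (\<bar>pmf p s - pmf pr s\<bar> / sqrt (pmf pr s))\<^sup>2) * sqrt (\<Sum>s\<in>?T. (sqrt (pmf pr s) * f s)\<^sup>2)"
    unfolding L2_set_def[symmetric] by (rule L2_set_mult_ineq)
  also have "(\<Sum>s\<in>?T. (\<bar>pmf p s - pmf pr s\<bar> / sqrt (pmf pr s))\<^sup>2) = design_d2 N p pr"
    unfolding design_d2_def by (rule sum.cong) (auto simp: power_divide)
  also have "(\<Sum>s\<in>?T. (sqrt (pmf pr s) * f s)\<^sup>2) = (\<Sum>s\<in>?T. pmf pr s * (f s)\<^sup>2)"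
    by (rule sum.cong) (auto simp: power_mult_distrib)
  also have "\<dots> = (\<Sum>s\<in>Pow {..<N}. pmf pr s * (f s)\<^sup>2)"
    by (rule sum.mono_neutral_left) (auto dest: zero)
  finally show ?thesis .
qed

text \<open>\<open>q\<close> are the drawing probabilities of a Poisson design whose conditional distribution is the
  rejective design, and \<open>\<epsilon>\<close> is the square root of the divergence. The last condition is a central
  limit theorem: \<open>h\<close> stands for the characteristic functions of the contributions of the units, and the
  contributions have been centered by regression on the sample size.\<close>

definition approximates_poisson :: "real \<Rightarrow> nat \<Rightarrow> nat \<Rightarrow> nat set pmf \<Rightarrow> real \<Rightarrow> (nat \<Rightarrow> real) \<Rightarrow> bool" where
  "approximates_poisson K N n p \<epsilon> q \<longleftrightarrow>
    (\<forall>i<N. 0 \<le> q i \<and> q i \<le> 1) \<and>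
    0 < poisson_var {..<N} q \<and>
    (\<Sum>i<N. q i) \<le> K * n \<and>
    (\<Sum>i<N. \<bar>incl_prob p i - q i\<bar>) \<le> K * sqrt n \<and>
    (\<forall>c b. (\<forall>i<N. \<bar>c i\<bar> \<le> b) \<longrightarrow>
      (\<Sum>s\<in>Pow {..<N}. pmf p s * ((\<Sum>i\<in>s. c i) - (\<Sum>i<N. q i * c i)) ^ 4) \<le> K * (1 + \<epsilon>) * b ^ 4 * (real n)\<^sup>2) \<and>
    (\<forall>(h :: nat \<Rightarrow> complex) m v B. 0 \<le> B \<longrightarrow> B \<le> sqrt n \<longrightarrow>
      (\<forall>i<N. cmod (h i) \<le> 1 \<and> cmod (h i - (1 + \<i> * of_real (m i) - of_real (v i / 2))) \<le> (B / sqrt n) ^ 3 \<and>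
        \<bar>m i\<bar> \<le> B / sqrt n \<and> (m i)\<^sup>2 \<le> v i \<and> v i \<le> (B / sqrt n)\<^sup>2) \<longrightarrow>
      (\<Sum>i<N. q i * (1 - q i) * m i) = 0 \<longrightarrow>
      cmod ((\<Sum>s\<in>Pow {..<N}. pmf p s * (\<Prod>i\<in>s. h i)) -
        exp (\<i> * of_real (\<Sum>i<N. q i * m i) - of_real ((\<Sum>i<N. q i * v i - (q i)\<^sup>2 * (m i)\<^sup>2) / 2)))
      \<le> \<epsilon> + K * clt_const (337 * B) / sqrt n)"

text \<open>The only place where the divergence is used. The constant \<open>\<kappa>\<close> keeps
  the variance of the size of order \<open>n\<close>, so that the Fourier error
  \<open>n / d\<^sup>2\<close>, divided by a modal probability of order \<open>1 / sqrt d\<close>,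
  is of order \<open>1 / sqrt n\<close>.\<close>

lemma design_close_to_rejective:
  assumes rej: "is_rejective_design N n pr"
    and incl: "\<And>i. i < N \<Longrightarrow> incl_prob pr i = incl_prob p i"
    and pos: "\<And>i. i < N \<Longrightarrow> 0 < incl_prob p i"
    and size: "set_pmf p \<subseteq> fixed_size_samples N n"
    and n: "0 < n" "n < N"
    and \<kappa>: "0 < \<kappa>" "\<kappa> * n \<le> (\<Sum>i<N. incl_prob p i * (1 - incl_prob p i))" "674 \<le> \<kappa> * n"
  defines "K \<equiv> 3 * 10 ^ 14 + 32 * 113233 * (337 / \<kappa>) * sqrt (337 / \<kappa>)"
  shows "\<exists>q. approximates_poisson K N n p (sqrt (design_d2 N p pr)) q"
proof -
  let ?A = "{..<N}"
  have posr: "0 < incl_prob pr i" if "i < N" for i using incl pos that by simp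
  obtain q where cp: "conditional_poisson N n q pr"
    and mode: "\<And>k. size_prob ?A q k \<le> size_prob ?A q (int n)"
    using rejective_design_mode[OF rej posr n, of thesis] by blast
  define d where "d = poisson_var ?A q"
  define \<epsilon> where "\<epsilon> = sqrt (design_d2 N p pr)"
  have q: "0 \<le> q i" "q i \<le> 1" if "i < N" for i using cp that by (auto simp: conditional_poisson_def)
  have Pn: "0 < size_prob ?A q (int n)" using cp by (simp add: conditional_poisson_def)
  have supr: "set_pmf pr \<subseteq> Pow ?A" using conditional_poisson_support[OF cp] by auto
  have sup: "set_pmf p \<subseteq> Pow ?A" using size by (auto simp: fixed_size_samples_def)
  have d2: "0 \<le> design_d2 N p pr" unfolding design_d2_def by (intro sum_nonneg) auto
  have \<epsilon>0: "0 \<le> \<epsilon>" using d2 by (simp add: \<epsilon>_def)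
  note vb = conditional_poisson_var_bounds[OF cp mode n(1), folded d_def]
  have n1: "1 \<le> real n" using n by simp
  have sumeq: "(\<Sum>i<N. incl_prob pr i * (1 - incl_prob pr i)) = (\<Sum>i<N. incl_prob p i * (1 - incl_prob p i))"
    by (rule sum.cong) (auto simp: incl)
  have dn: "\<kappa> * n \<le> 337 * (d + 1)" using \<kappa>(2) vb(1) unfolding sumeq by linarith
  \<comment> \<open>The threshold 674 is twice 337, so that \<open>d + 1\<close> is at least
    2.\<close>
  have d1: "1 \<le> d" using dn \<kappa>(3) by (simp add: distrib_left)
  \<comment> \<open>Domination follows from the equality of the inclusion probabilities. If a sample
    of the right size is impossible under \<open>pr\<close>, it omits a unit with
    \<open>q i = 1\<close>. That unit is certain under \<open>pr\<close>, so its inclusion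
    probability is 1 under \<open>p\<close> too, and \<open>p\<close> gives the sample no mass
    either.\<close>
  have dom: "pmf p s = 0" if s: "s \<in> Pow ?A" "pmf pr s = 0" for s
  proof (rule ccontr)
    assume np: "pmf p s \<noteq> 0"
    then have card: "s \<subseteq> ?A" "card s = n" using size by (auto simp: fixed_size_samples_def set_pmf_eq)
    then have fs: "finite s" using finite_subset by blast
    have "poisson_weight ?A q s = 0" using s card Pn by (simp add: pmf_conditional_poisson[OF cp])
    moreover have "\<forall>i\<in>s. q i \<noteq> 0"
      using conditional_poisson_pos[OF cp posr] card by force
    ultimately obtain i where i: "i \<in> ?A" "i \<notin> s" "q i = 1"
      using fs by (auto simp: poisson_weight_def)
    have in_pr: "i \<in> s'" if "s' \<in> set_pmf pr" for s'
    proof (rule ccontr)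
      assume "i \<notin> s'"
      then have "poisson_weight ?A q s' = 0" using i by (auto simp: poisson_weight_def)
      then have "pmf pr s' = 0" by (simp add: pmf_conditional_poisson[OF cp])
      then show False using that by (simp add: set_pmf_eq)
    qed
    have "incl_prob pr i = 1" unfolding incl_prob_def
      using in_pr by (subst measure_pmf.prob_eq_1) (auto simp: AE_measure_pmf_iff)
    then have "incl_prob p i = 1" using incl i by simp
    then have "AE s in p. i \<in> s" unfolding incl_prob_def by (subst (asm) measure_pmf.prob_eq_1) auto
    then have "i \<in> s" using np by (auto simp: AE_measure_pmf_iff set_pmf_eq)
    then show False using i by simp
  qed
  have change: "(\<Sum>s\<in>Pow ?A. \<bar>pmf p s - pmf pr s\<bar> * f s) \<le> \<epsilon> * sqrt (\<Sum>s\<in>Pow ?A. pmf pr s * (f s)\<^sup>2)"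
    if "\<And>s. 0 \<le> f s" for f
    unfolding \<epsilon>_def by (rule sum_pmf_diff_le) (use dom that in auto)
  have moments: "(\<Sum>s\<in>Pow ?A. pmf p s * ((\<Sum>i\<in>s. c i) - (\<Sum>i<N. q i * c i)) ^ 4) \<le> K * (1 + \<epsilon>) * b ^ 4 * (real n)\<^sup>2"
    if c: "\<forall>i<N. \<bar>c i\<bar> \<le> b" for c b
  proof -
    have b0: "0 \<le> b" using c[rule_format, of 0] n by linarith
    define f where "f s = ((\<Sum>i\<in>s. c i) - (\<Sum>i<N. q i * c i)) ^ 4" for s
    have f0: "0 \<le> f s" for s by (simp add: f_def)
    \<comment> \<open>The eighth moment under \<open>pr\<close>, rescaled from contributions bounded
      by 1 to contributions bounded by \<open>b\<close>. For \<open>b = 0\<close> the rescaling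
      would divide by zero, but then all contributions vanish.\<close>
    have E8: "(\<Sum>s\<in>Pow ?A. pmf pr s * (f s)\<^sup>2) \<le> (5 * 10 ^ 13 * b ^ 4 * (real n)\<^sup>2)\<^sup>2"
    proof (cases "b = 0")
      case True
      then have "c i = 0" if "i < N" for i using c that by auto
      then have "f s = 0" if "s \<in> Pow ?A" for s using that by (auto simp: f_def subset_eq intro!: sum.neutral)
      then have "(\<Sum>s\<in>Pow ?A. pmf pr s * (f s)\<^sup>2) = 0" by (intro sum.neutral) simp
      then show ?thesis by simp
    next
      case False
      have "(\<Sum>s\<in>Pow ?A. pmf pr s * ((\<Sum>i\<in>s. c i / b) - (\<Sum>i<N. q i * (c i / b))) ^ 8) \<le> 13547520 * (d + 1) ^ 4"
        unfolding d_def by (rule conditional_poisson_moments(2)[OF cp mode]) (use c b0 False in auto)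
      moreover have "((\<Sum>i\<in>s. c i / b) - (\<Sum>i<N. q i * (c i / b))) ^ 8 = (f s)\<^sup>2 / b ^ 8" for s
      proof -
        have "(\<Sum>i\<in>s. c i / b) - (\<Sum>i<N. q i * (c i / b)) = ((\<Sum>i\<in>s. c i) - (\<Sum>i<N. q i * c i)) / b"
          by (simp add: sum_divide_distrib diff_divide_distrib)
        then show ?thesis by (simp add: f_def power_divide flip: power_mult)
      qed
      ultimately have "(\<Sum>s\<in>Pow ?A. pmf pr s * (f s)\<^sup>2) / b ^ 8 \<le> 13547520 * (d + 1) ^ 4"
        by (simp add: sum_divide_distrib)
      also have "\<dots> \<le> 13547520 * (112900 * real n) ^ 4"
        using vb(2) d1 by (intro mult_left_mono power_mono) auto
      also have "\<dots> \<le> (5 * 10 ^ 13 * (real n)\<^sup>2)\<^sup>2"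
        by (simp add: power_mult_distrib flip: power_mult)
      finally have "(\<Sum>s\<in>Pow ?A. pmf pr s * (f s)\<^sup>2) \<le> (5 * 10 ^ 13 * (real n)\<^sup>2)\<^sup>2 * b ^ 8"
        using b0 False by (simp add: pos_divide_le_eq)
      also have "\<dots> = (5 * 10 ^ 13 * b ^ 4 * (real n)\<^sup>2)\<^sup>2" by (simp add: power_mult_distrib flip: power_mult)
      finally show ?thesis .
    qed
    define R where "R = 5 * 10 ^ 13 * b ^ 4 * (real n)\<^sup>2"
    have R0: "0 \<le> R" using b0 by (simp add: R_def)
    have sq: "sqrt (\<Sum>s\<in>Pow ?A. pmf pr s * (f s)\<^sup>2) \<le> R"
      using E8 R0 unfolding R_def[symmetric] by (intro real_le_lsqrt sum_nonneg) auto
    have "(\<Sum>s\<in>Pow ?A. pmf p s * f s) \<le> (\<Sum>s\<in>Pow ?A. pmf pr s * f s + \<bar>pmf p s - pmf pr s\<bar> * f s)"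
    proof (rule sum_mono)
      fix s
      have "pmf p s * f s \<le> (pmf pr s + \<bar>pmf p s - pmf pr s\<bar>) * f s" by (rule mult_right_mono[OF _ f0]) linarith
      then show "pmf p s * f s \<le> pmf pr s * f s + \<bar>pmf p s - pmf pr s\<bar> * f s" by (simp only: distrib_right)
    qed
    also have "\<dots> \<le> R + \<epsilon> * R"
      unfolding sum.distrib
    proof (rule add_mono)
      have "((\<Sum>s\<in>Pow ?A. pmf pr s * f s))\<^sup>2 = (\<Sum>s\<in>Pow ?A. sqrt (pmf pr s) * (sqrt (pmf pr s) * f s))\<^sup>2"
        by (simp add: mult.assoc[symmetric])
      also have "\<dots> \<le> (\<Sum>s\<in>Pow ?A. (sqrt (pmf pr s))\<^sup>2) * (\<Sum>s\<in>Pow ?A. (sqrt (pmf pr s) * f s)\<^sup>2)"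
        by (rule Cauchy_Schwarz_ineq_sum)
      also have "\<dots> = (\<Sum>s\<in>Pow ?A. pmf pr s * (f s)\<^sup>2)"
        by (simp add: power_mult_distrib sum_pmf_Pow[OF supr])
      finally have "((\<Sum>s\<in>Pow ?A. pmf pr s * f s))\<^sup>2 \<le> R\<^sup>2" using E8 unfolding R_def[symmetric] by linarith
      then show "(\<Sum>s\<in>Pow ?A. pmf pr s * f s) \<le> R" using R0 by (rule power2_le_imp_le)
      show "(\<Sum>s\<in>Pow ?A. \<bar>pmf p s - pmf pr s\<bar> * f s) \<le> \<epsilon> * R"
        by (rule order_trans[OF change[OF f0] mult_left_mono[OF sq \<epsilon>0]])
    qed
    also have "\<dots> = 5 * 10 ^ 13 * ((1 + \<epsilon>) * b ^ 4 * (real n)\<^sup>2)" by (simp add: R_def algebra_simps)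
    also have "\<dots> \<le> K * ((1 + \<epsilon>) * b ^ 4 * (real n)\<^sup>2)"
      using \<epsilon>0 \<kappa> b0 by (intro mult_right_mono) (auto simp: K_def intro!: add_increasing2)
    finally show ?thesis by (simp add: f_def mult.assoc)
  qed
  \<comment> \<open>Two errors: replacing \<open>p\<close> by \<open>pr\<close> costs at most
    \<epsilon> because products of the \<open>h i\<close> have modulus at most 1, and the rejective
    design costs the Fourier error divided by the probability of size \<open>n\<close>.\<close>
  have clt: "cmod ((\<Sum>s\<in>Pow ?A. pmf p s * (\<Prod>i\<in>s. h i)) -
        exp (\<i> * of_real (\<Sum>i<N. q i * m i) - of_real ((\<Sum>i<N. q i * v i - (q i)\<^sup>2 * (m i)\<^sup>2) / 2)))
      \<le> \<epsilon> + K * clt_const (337 * B) / sqrt n"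
    if B: "0 \<le> B" "B \<le> sqrt n"
      and h: "\<forall>i<N. cmod (h i) \<le> 1 \<and> cmod (h i - (1 + \<i> * of_real (m i) - of_real (v i / 2))) \<le> (B / sqrt n) ^ 3 \<and>
        \<bar>m i\<bar> \<le> B / sqrt n \<and> (m i)\<^sup>2 \<le> v i \<and> v i \<le> (B / sqrt n)\<^sup>2"
      and u: "(\<Sum>i<N. q i * (1 - q i) * m i) = 0" for h :: "nat \<Rightarrow> complex" and m v B
  proof -
    let ?G = "exp (\<i> * of_real (\<Sum>i<N. q i * m i) - of_real ((\<Sum>i<N. q i * v i - (q i)\<^sup>2 * (m i)\<^sup>2) / 2)) :: complex"
    let ?S = "\<Sum>s\<in>Pow ?A. of_real (poisson_weight ?A q s * of_bool (int (card s) = int n)) * (\<Prod>i\<in>s. h i)"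
    let ?P = "size_prob ?A q (int n)"
    have "sqrt d \<le> sqrt (337\<^sup>2 * real n)" using vb(2) n1 by (intro real_sqrt_le_mono) simp
    then have sd: "sqrt d \<le> 337 * sqrt n" by (simp add: real_sqrt_mult)
    have "1 / (337 * sqrt n) \<le> 1 / sqrt d" using sd d1 n1 by (intro divide_left_mono) auto
    then have "337 * B * (1 / (337 * sqrt n)) \<le> 337 * B * (1 / sqrt d)" using B by (intro mult_left_mono) auto
    then have BB: "B / sqrt n \<le> 337 * B / sqrt d" by simp
    have "cmod (?S - of_real ?P * ?G) \<le> clt_const (337 * B) * (\<Sum>i<N. q i) / d\<^sup>2"
      unfolding d_def
    proof (rule conditional_char_close[where \<delta> = "B / sqrt n"])
      show "B / sqrt n \<le> 337 * B / sqrt (poisson_var ?A q)" using BB by (simp add: d_def)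
      show "0 < poisson_var ?A q" using d1 by (simp add: d_def)
      show "B / sqrt n \<le> 1" using B n1 by (simp add: divide_le_eq)
    qed (use B h u q in auto)
    also have "\<dots> \<le> clt_const (337 * B) * (113233 * n) / d\<^sup>2"
      using vb(4) B by (intro divide_right_mono mult_left_mono) (auto simp: clt_const_def)
    finally have 1: "cmod (?S - of_real ?P * ?G) \<le> clt_const (337 * B) * (113233 * n) / d\<^sup>2" .
    have "(\<Sum>s\<in>Pow ?A. pmf pr s * (\<Prod>i\<in>s. h i)) = ?S / of_real ?P"
      using expectation_conditional_poisson[OF cp, of "\<lambda>s. \<Prod>i\<in>s. h i"]
      by (simp add: scaleR_conv_of_real divide_inverse mult.commute)
    then have "(\<Sum>s\<in>Pow ?A. pmf pr s * (\<Prod>i\<in>s. h i)) - ?G = (?S - of_real ?P * ?G) / of_real ?P"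
      using Pn by (simp add: diff_divide_distrib)
    then have "cmod ((\<Sum>s\<in>Pow ?A. pmf pr s * (\<Prod>i\<in>s. h i)) - ?G) = cmod (?S - of_real ?P * ?G) * (1 / ?P)"
      using Pn by (simp add: norm_divide)
    also have "\<dots> \<le> (clt_const (337 * B) * (113233 * n) / d\<^sup>2) * (8 * sqrt (d + 1))"
    proof (rule mult_mono[OF 1])
      have "1 \<le> 8 * sqrt (d + 1) * ?P" unfolding d_def by (rule size_prob_mode_ge) (use q mode in auto)
      then show "1 / ?P \<le> 8 * sqrt (d + 1)" using Pn by (simp add: pos_divide_le_eq)
      show "0 \<le> clt_const (337 * B) * (113233 * n) / d\<^sup>2" using B by (simp add: clt_const_def)
    qed (use Pn in auto)
    also have "\<dots> = clt_const (337 * B) * (8 * 113233) * (n * sqrt (d + 1) / d\<^sup>2)" by simp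
    \<comment> \<open>With \<open>d\<close> of order \<open>n\<close> the quotient is of order
      \<open>1 / sqrt n\<close>; replacing \<open>d\<close> by \<open>d + 1\<close>, allowed since
      \<open>1 \<le> d\<close>, makes \<open>337 / \<kappa>\<close> bound both resulting
      ratios.\<close>
    also have "\<dots> \<le> clt_const (337 * B) * (8 * 113233) * (4 * (337 / \<kappa>) * sqrt (337 / \<kappa>) / sqrt n)"
    proof (rule mult_left_mono)
      have "d + 1 \<le> 2 * d" using d1 by simp
      then have "(d + 1)\<^sup>2 \<le> (2 * d)\<^sup>2" using d1 by (intro power_mono) auto
      then have dd: "(d + 1)\<^sup>2 \<le> 4 * d\<^sup>2" by simp
      have "n * sqrt (d + 1) / d\<^sup>2 \<le> n * sqrt (d + 1) / ((d + 1)\<^sup>2 / 4)"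
        using dd d1 by (intro divide_left_mono) auto
      also have "\<dots> = 4 * (n / (d + 1)) * (1 / sqrt (d + 1))"
      proof -
        define r where "r = sqrt (d + 1)"
        have r: "0 < r" "d + 1 = r\<^sup>2" using d1 by (auto simp: r_def)
        show ?thesis unfolding r_def[symmetric] unfolding r(2) using r(1) by (simp add: power2_eq_square field_simps)
      qed
      also have "\<dots> \<le> 4 * (337 / \<kappa>) * (sqrt (337 / \<kappa>) / sqrt n)"
      proof (intro mult_mono)
        have r: "n / (d + 1) \<le> 337 / \<kappa>" using dn \<kappa>(1) d1 by (simp add: divide_simps mult.commute)
        then show "n / (d + 1) \<le> 337 / \<kappa>" .
        have "1 / (d + 1) \<le> (337 / \<kappa>) / n" using dn \<kappa>(1) d1 n1 by (simp add: divide_simps mult.commute)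
        then have "sqrt (1 / (d + 1)) \<le> sqrt ((337 / \<kappa>) / n)" by (rule real_sqrt_le_mono)
        then show "1 / sqrt (d + 1) \<le> sqrt (337 / \<kappa>) / sqrt n" by (simp add: real_sqrt_divide real_sqrt_mult)
      qed (use \<kappa> d1 in auto)
      finally show "n * sqrt (d + 1) / d\<^sup>2 \<le> 4 * (337 / \<kappa>) * sqrt (337 / \<kappa>) / sqrt n" by simp
      show "0 \<le> clt_const (337 * B) * (8 * 113233)" using B by (simp add: clt_const_def)
    qed
    also have "\<dots> = (32 * 113233 * (337 / \<kappa>) * sqrt (337 / \<kappa>)) * (clt_const (337 * B) / sqrt n)" by simp
    also have "\<dots> \<le> K * (clt_const (337 * B) / sqrt n)"
      using B by (intro mult_right_mono) (auto simp: K_def clt_const_def)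
    finally have 2: "cmod ((\<Sum>s\<in>Pow ?A. pmf pr s * (\<Prod>i\<in>s. h i)) - ?G) \<le> K * clt_const (337 * B) / sqrt n" by simp
    have "cmod ((\<Sum>s\<in>Pow ?A. pmf p s * (\<Prod>i\<in>s. h i)) - (\<Sum>s\<in>Pow ?A. pmf pr s * (\<Prod>i\<in>s. h i)))
        = cmod (\<Sum>s\<in>Pow ?A. of_real (pmf p s - pmf pr s) * (\<Prod>i\<in>s. h i))"
      by (simp add: sum_subtractf left_diff_distrib)
    also have "\<dots> \<le> (\<Sum>s\<in>Pow ?A. \<bar>pmf p s - pmf pr s\<bar> * 1)"
    proof (rule sum_norm_le)
      fix s assume s: "s \<in> Pow ?A"
      have "cmod (\<Prod>i\<in>s. h i) \<le> 1"
        unfolding prod_norm[symmetric] using h s by (intro prod_le_1) auto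
      then have "\<bar>pmf p s - pmf pr s\<bar> * cmod (\<Prod>i\<in>s. h i) \<le> \<bar>pmf p s - pmf pr s\<bar> * 1" by (rule mult_left_mono) simp
      then show "cmod (of_real (pmf p s - pmf pr s) * (\<Prod>i\<in>s. h i)) \<le> \<bar>pmf p s - pmf pr s\<bar> * 1"
        by (simp only: norm_mult norm_of_real)
    qed
    also have "\<dots> \<le> \<epsilon>" using change[of "\<lambda>_. 1"] by (simp add: sum_pmf_Pow[OF supr])
    finally have 3: "cmod ((\<Sum>s\<in>Pow ?A. pmf p s * (\<Prod>i\<in>s. h i)) - (\<Sum>s\<in>Pow ?A. pmf pr s * (\<Prod>i\<in>s. h i))) \<le> \<epsilon>" .
    show ?thesis using norm_triangle_mono[OF 3 2] by simp
  qed
  have K1: "113233 \<le> K" unfolding K_def using \<kappa> by (intro add_increasing2) auto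
  have "(\<Sum>i<N. q i) \<le> K * n" using vb(4) mult_right_mono[OF K1, of "real n"] by linarith
  moreover have "(\<Sum>i<N. \<bar>incl_prob p i - q i\<bar>) \<le> K * sqrt n"
  proof -
    have "(\<Sum>i<N. \<bar>incl_prob p i - q i\<bar>) = (\<Sum>i<N. \<bar>incl_prob pr i - q i\<bar>)"
      by (rule sum.cong) (auto simp: incl)
    then show ?thesis using vb(3) mult_right_mono[of 113232 K "sqrt n"] K1 by simp
  qed
  ultimately have "approximates_poisson K N n p \<epsilon> q"
    unfolding approximates_poisson_def
  proof (intro conjI)
    show "\<forall>i<N. 0 \<le> q i \<and> q i \<le> 1" using q by blast
    show "0 < poisson_var {..<N} q" using d1 by (simp add: d_def)
  qed (use moments clt in blast)+
  then show ?thesis unfolding \<epsilon>_def by blast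
qed

section \<open>Two-stage samples\<close>

text \<open>Exponential moments replace the combinatorial expansion of the fourth power. At
  \<open>t = 1 / (B * sqrt n)\<close> each centered factor has mean at most
  \<open>1 + 1 / n\<close>, so the product over the \<open>n\<close> summands is at most
  \<open>exp 1\<close>; the constant is \<open>24 * (3 + 3)\<close>.\<close>

lemma (in prob_space) fourth_moment_sum_indep_le:
  fixes X :: "'i \<Rightarrow> 'a \<Rightarrow> real"
  assumes indep: "indep_vars (\<lambda>_. borel) X I" and I: "finite I" "I \<noteq> {}"
    and bound: "\<And>i \<omega>. i \<in> I \<Longrightarrow> \<omega> \<in> space M \<Longrightarrow> \<bar>X i \<omega>\<bar> \<le> B" and mean: "\<And>i. i \<in> I \<Longrightarrow> expectation (X i) = 0"
  shows "expectation (\<lambda>\<omega>. (\<Sum>i\<in>I. X i \<omega>) ^ 4) \<le> 144 * B ^ 4 * (real (card I))\<^sup>2"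
proof -
  define n where "n = real (card I)"
  have n1: "1 \<le> n" using I by (simp add: n_def card_gt_0_iff Suc_leI)
  have X[measurable]: "X i \<in> borel_measurable M" if "i \<in> I" for i using indep that by (auto simp: indep_vars_def)
  have B0: "0 \<le> B"
  proof -
    obtain \<omega> where "\<omega> \<in> space M" using not_empty by blast
    moreover obtain i where "i \<in> I" using I by blast
    ultimately show ?thesis using bound[of i \<omega>] by linarith
  qed
  show ?thesis
  proof (cases "B = 0")
    case True
    then have "expectation (\<lambda>\<omega>. (\<Sum>i\<in>I. X i \<omega>) ^ 4) = expectation (\<lambda>_. 0)"
      using bound by (intro Bochner_Integration.integral_cong) (auto intro!: sum.neutral)
    then show ?thesis by simp
  next
    case False
    then have Bp: "0 < B" using B0 by simp
    have bnd: "integrable M f" if "f \<in> borel_measurable M" "\<And>\<omega>. \<omega> \<in> space M \<Longrightarrow> \<bar>f \<omega>\<bar> \<le> K" for f :: "'a \<Rightarrow> real" and K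
      using that by (intro integrable_const_bound[of _ K]) auto
    have S: "\<bar>\<Sum>i\<in>I. X i \<omega>\<bar> \<le> n * B" if "\<omega> \<in> space M" for \<omega>
    proof -
      have "\<bar>\<Sum>i\<in>I. X i \<omega>\<bar> \<le> (\<Sum>i\<in>I. \<bar>X i \<omega>\<bar>)" by (rule sum_abs)
      also have "\<dots> \<le> (\<Sum>i\<in>I. B)" using bound that by (intro sum_mono) auto
      finally show ?thesis by (simp add: n_def)
    qed
    have mgf: "expectation (\<lambda>\<omega>. exp (t * (\<Sum>i\<in>I. X i \<omega>))) \<le> 3" if t: "\<bar>t\<bar> = 1 / (B * sqrt n)" for t
    proof -
      have t2: "t\<^sup>2 * B\<^sup>2 * n = 1"
      proof -
        have "t\<^sup>2 = (1 / (B * sqrt n))\<^sup>2" using t by (metis power2_abs)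
        then show ?thesis using Bp n1 by (simp add: power_divide power_mult_distrib)
      qed
      have "B * \<bar>t\<bar> = 1 / sqrt n" using t Bp by simp
      also have "\<dots> \<le> 1" using n1 by simp
      finally have tB: "B * \<bar>t\<bar> \<le> 1" .
      have tX: "\<bar>t * X i \<omega>\<bar> \<le> 1" if "i \<in> I" "\<omega> \<in> space M" for i \<omega>
      proof -
        have "\<bar>t * X i \<omega>\<bar> \<le> \<bar>t\<bar> * B" unfolding abs_mult using bound that by (intro mult_left_mono) auto
        then show ?thesis using tB by (simp add: mult.commute)
      qed
      have ind: "indep_vars (\<lambda>_. borel) (\<lambda>i \<omega>. exp (t * X i \<omega>)) I"
        by (rule indep_vars_compose2[OF indep]) auto
      have int: "integrable M (\<lambda>\<omega>. exp (t * X i \<omega>))" if "i \<in> I" for i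
        using that tX by (intro bnd[of _ "exp 1"]) (auto simp: abs_le_iff)
      have "expectation (\<lambda>\<omega>. exp (t * (\<Sum>i\<in>I. X i \<omega>))) = expectation (\<lambda>\<omega>. \<Prod>i\<in>I. exp (t * X i \<omega>))"
        using I by (simp add: exp_sum sum_distrib_left)
      also have "\<dots> = (\<Prod>i\<in>I. expectation (\<lambda>\<omega>. exp (t * X i \<omega>)))"
        by (rule indep_vars_lebesgue_integral) (use I ind int in auto)
      also have "\<dots> \<le> (\<Prod>i\<in>I. exp (1 / n))"
      proof (rule prod_mono)
        fix i assume i: "i \<in> I"
        have iX: "integrable M (X i)"
          using bound[OF i] i by (intro bnd[of _ B]) auto
        have "expectation (\<lambda>\<omega>. exp (t * X i \<omega>)) \<le> expectation (\<lambda>\<omega>. 1 + t * X i \<omega> + t\<^sup>2 * B\<^sup>2)"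
        proof (rule integral_mono)
          fix \<omega> assume w: "\<omega> \<in> space M"
          have "exp (t * X i \<omega>) \<le> 1 + t * X i \<omega> + (t * X i \<omega>)\<^sup>2" by (rule exp_le_quadratic[OF tX[OF i w]])
          moreover have "(X i \<omega>)\<^sup>2 \<le> B\<^sup>2" using bound[OF i w] B0 by (simp add: abs_le_square_iff[symmetric])
          then have "(t * X i \<omega>)\<^sup>2 \<le> t\<^sup>2 * B\<^sup>2" by (simp add: power_mult_distrib mult_left_mono)
          ultimately show "exp (t * X i \<omega>) \<le> 1 + t * X i \<omega> + t\<^sup>2 * B\<^sup>2" by linarith
        qed (use iX int i in auto)
        also have "\<dots> = 1 + t\<^sup>2 * B\<^sup>2" using iX mean[OF i] by (simp add: prob_space)
        also have "\<dots> \<le> exp (t\<^sup>2 * B\<^sup>2)" by (rule exp_ge_add_one_self)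
        also have "t\<^sup>2 * B\<^sup>2 = 1 / n" using t2 n1 by (simp add: divide_simps)
        finally show "0 \<le> expectation (\<lambda>\<omega>. exp (t * X i \<omega>)) \<and> expectation (\<lambda>\<omega>. exp (t * X i \<omega>)) \<le> exp (1 / n)"
          by (simp add: integral_nonneg)
      qed
      also have "\<dots> = exp 1" using n1 by (simp add: n_def exp_of_nat_mult[symmetric])
      also have "\<dots> \<le> 3" by (rule exp_le)
      finally show ?thesis .
    qed
    define t where "t = 1 / (B * sqrt n)"
    have t0: "0 < t" using Bp n1 by (simp add: t_def)
    let ?S = "\<lambda>\<omega>. \<Sum>i\<in>I. X i \<omega>"
    have intE: "integrable M (\<lambda>\<omega>. exp (c * ?S \<omega>))" for c
    proof (rule bnd)
      fix \<omega> assume "\<omega> \<in> space M"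
      then have "\<bar>c * ?S \<omega>\<bar> \<le> \<bar>c\<bar> * (n * B)" unfolding abs_mult using S by (intro mult_left_mono) auto
      then show "\<bar>exp (c * ?S \<omega>)\<bar> \<le> exp (\<bar>c\<bar> * (n * B))" by simp
    qed simp
    have int4: "integrable M (\<lambda>\<omega>. ?S \<omega> ^ 4)"
    proof (rule bnd)
      fix \<omega> assume "\<omega> \<in> space M"
      then show "\<bar>?S \<omega> ^ 4\<bar> \<le> (n * B) ^ 4" unfolding power_abs using S by (intro power_mono) auto
    qed simp
    have "t ^ 4 * expectation (\<lambda>\<omega>. ?S \<omega> ^ 4) = expectation (\<lambda>\<omega>. (t * ?S \<omega>) ^ 4)"
      by (simp add: power_mult_distrib)
    also have "\<dots> \<le> expectation (\<lambda>\<omega>. 24 * (exp (t * ?S \<omega>) + exp (- t * ?S \<omega>)))"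
      using int4 intE[of t] intE[of "- t"] abs_power_le_exp(2)[of "t * ?S _"]
      by (intro integral_mono) (auto simp: power_mult_distrib)
    also have "\<dots> = 24 * (expectation (\<lambda>\<omega>. exp (t * ?S \<omega>)) + expectation (\<lambda>\<omega>. exp (- t * ?S \<omega>)))"
      using intE[of t] intE[of "- t"] by simp
    also have "\<dots> \<le> 24 * (3 + 3)"
    proof (intro mult_left_mono add_mono)
      show "expectation (\<lambda>\<omega>. exp (t * ?S \<omega>)) \<le> 3" by (rule mgf) (use t0 in \<open>simp add: t_def\<close>)
      show "expectation (\<lambda>\<omega>. exp (- t * ?S \<omega>)) \<le> 3" by (rule mgf) (use t0 in \<open>simp add: t_def\<close>)
    qed simp
    finally have "t ^ 4 * expectation (\<lambda>\<omega>. ?S \<omega> ^ 4) \<le> 144" by simp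
    moreover have "t ^ 4 = 1 / (B ^ 4 * n\<^sup>2)"
    proof -
      have "sqrt n ^ 4 = ((sqrt n)\<^sup>2)\<^sup>2" by (simp flip: power_mult)
      then show ?thesis using n1 by (simp add: t_def power_divide power_mult_distrib)
    qed
    ultimately show ?thesis using Bp n1 by (simp add: n_def[symmetric] pos_divide_le_eq mult.assoc)
  qed
qed

section \<open>Conditioning on the first-stage sample\<close>

locale two_stage_population =
  fixes F :: "'a::euclidean_space set" and D :: "('a, 'w) two_stage"
  assumes two_stage: "two_stage_sampling F D"
    and incl_pos: "\<And>i. i < psu_count D \<Longrightarrow> 0 < pi1 D i"
    and size2_ge2: "\<And>i. i < psu_count D \<Longrightarrow> 2 \<le> size2 D i"
begin

abbreviation "N \<equiv> psu_count D"
abbreviation "n \<equiv> size1 D"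
abbreviation "M \<equiv> outcomes D"
abbreviation "S \<equiv> sample1 D"
abbreviation "p \<equiv> design1 D"

sublocale prob_space M using two_stage by (simp add: two_stage_sampling_def)

lemma sample1_in: "\<omega> \<in> space M \<Longrightarrow> S \<omega> \<in> fixed_size_samples N n"
  using two_stage measurable_space[of S M "count_space (fixed_size_samples N n)"]
  by (auto simp: two_stage_sampling_def first_stage_sampling_def)

lemma sample1_subset: "\<omega> \<in> space M \<Longrightarrow> S \<omega> \<subseteq> {..<N}"
  and sample1_card: "\<omega> \<in> space M \<Longrightarrow> card (S \<omega>) = n"
  using sample1_in by (auto simp: fixed_size_samples_def)

lemma sample1_measurable_Pow: "S \<in> measurable M (count_space (Pow {..<N}))"
proof -
  have "S \<in> measurable M (count_space (fixed_size_samples N n))"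
    using two_stage by (auto simp: two_stage_sampling_def first_stage_sampling_def)
  from measurable_compose[OF this, of "\<lambda>s. s" "count_space (Pow {..<N})"] show ?thesis
    by (auto simp: fixed_size_samples_def)
qed

lemma sample1_measurable: "S \<in> measurable M (count_space UNIV)"
  using measurable_compose[OF sample1_measurable_Pow, of "\<lambda>s. s" "count_space UNIV"] by simp

lemma sample1_event [measurable]: "{\<omega> \<in> space M. S \<omega> = s} \<in> sets M"
  using measurable_sets[OF sample1_measurable, of "{s}"] by (simp add: vimage_def Int_def conj_commute)

lemma prob_sample1: "prob {\<omega> \<in> space M. S \<omega> = s} = pmf p s"
proof -
  have "distr M (count_space UNIV) S = measure_pmf p"
    using two_stage by (simp add: two_stage_sampling_def first_stage_sampling_def)
  then have "measure (distr M (count_space UNIV) S) {s} = pmf p s" by (simp add: measure_pmf_single)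
  then show ?thesis
    by (simp add: measure_distr[OF sample1_measurable] vimage_def Int_def conj_commute)
qed

lemma design1_support: "set_pmf p \<subseteq> fixed_size_samples N n"
proof
  fix s assume "s \<in> set_pmf p"
  then have "prob {\<omega> \<in> space M. S \<omega> = s} \<noteq> 0" by (simp add: prob_sample1 set_pmf_eq)
  then have "{\<omega> \<in> space M. S \<omega> = s} \<noteq> {}" by (metis measure_empty)
  then show "s \<in> fixed_size_samples N n" using sample1_in by auto
qed

lemma design1_support_Pow: "set_pmf p \<subseteq> Pow {..<N}"
  using design1_support by (auto simp: fixed_size_samples_def)

lemma sets_given_sample1 [simp]: "sets (given_sample1 D s) = sets M"
  and space_given_sample1 [simp]: "space (given_sample1 D s) = space M"
  by (auto simp: given_sample1_def)

lemma measurable_given_sample1 [simp]: "measurable (given_sample1 D s) X = measurable M X"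
  by (rule measurable_cong_sets) simp_all

lemma prob_space_given_sample1:
  assumes "s \<in> set_pmf p"
  shows "prob_space (given_sample1 D s)"
  unfolding given_sample1_def
proof (rule prob_space_uniform_measure)
  show "emeasure M {\<omega> \<in> space M. S \<omega> = s} \<noteq> 0"
    using assms by (simp add: emeasure_eq_measure prob_sample1 set_pmf_eq)
qed simp

lemma integral_given_sample1:
  fixes Y :: "'w \<Rightarrow> 'b::{banach, second_countable_topology}"
  assumes s: "s \<in> set_pmf p" and Y: "Y \<in> borel_measurable M"
  shows "pmf p s *\<^sub>R (\<integral>\<omega>. Y \<omega> \<partial>given_sample1 D s) = (\<integral>\<omega>. indicator {\<omega> \<in> space M. S \<omega> = s} \<omega> *\<^sub>R Y \<omega> \<partial>M)"
proof -
  let ?A = "{\<omega> \<in> space M. S \<omega> = s}"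
  have p0: "0 < pmf p s" using s by (simp add: pmf_positive)
  have "given_sample1 D s = density M (\<lambda>\<omega>. ennreal (indicator ?A \<omega> / pmf p s))"
    unfolding given_sample1_def uniform_measure_def
  proof (rule density_cong)
    show "AE \<omega> in M. indicator ?A \<omega> / emeasure M ?A = ennreal (indicator ?A \<omega> / pmf p s)"
      using p0 by (auto simp: emeasure_eq_measure prob_sample1 divide_ennreal[symmetric] split: split_indicator)
  qed auto
  then have "(\<integral>\<omega>. Y \<omega> \<partial>given_sample1 D s) = (\<integral>\<omega>. (indicator ?A \<omega> / pmf p s) *\<^sub>R Y \<omega> \<partial>M)"
    using Y by (simp add: integral_density)
  also have "\<dots> = (\<integral>\<omega>. (1 / pmf p s) *\<^sub>R (indicator ?A \<omega> *\<^sub>R Y \<omega>) \<partial>M)" by simp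
  also have "\<dots> = (1 / pmf p s) *\<^sub>R (\<integral>\<omega>. indicator ?A \<omega> *\<^sub>R Y \<omega> \<partial>M)" by (rule integral_scaleR_right)
  finally show ?thesis using p0 by simp
qed

lemma measurable_by_sample1:
  assumes "\<And>s. s \<subseteq> {..<N} \<Longrightarrow> Y s \<in> measurable M L"
  shows "(\<lambda>\<omega>. Y (S \<omega>) \<omega>) \<in> measurable M L"
  by (rule measurable_compose_countable'[OF _ sample1_measurable_Pow]) (use assms in \<open>auto simp: countable_finite\<close>)

text \<open>Law of total expectation over the finitely many samples. For a sample of probability
  zero the conditional measure carries no information, but its term is multiplied by zero on the
  right and lives on a null event on the left.\<close>

lemma expectation_by_sample1:
  fixes Y :: "nat set \<Rightarrow> 'w \<Rightarrow> 'b::{banach, second_countable_topology}"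
  assumes Y: "\<And>s. s \<subseteq> {..<N} \<Longrightarrow> Y s \<in> borel_measurable M"
    and bound: "\<And>\<omega>. \<omega> \<in> space M \<Longrightarrow> norm (Y (S \<omega>) \<omega>) \<le> B"
  shows "expectation (\<lambda>\<omega>. Y (S \<omega>) \<omega>) = (\<Sum>s\<in>Pow {..<N}. pmf p s *\<^sub>R (\<integral>\<omega>. Y s \<omega> \<partial>given_sample1 D s))"
proof -
  let ?A = "\<lambda>s. {\<omega> \<in> space M. S \<omega> = s}"
  have mY: "(\<lambda>\<omega>. Y (S \<omega>) \<omega>) \<in> borel_measurable M" by (rule measurable_by_sample1[OF Y])
  have int: "integrable M (\<lambda>\<omega>. indicator (?A s) \<omega> *\<^sub>R Y (S \<omega>) \<omega>)" for s
  proof (rule integrable_const_bound[of _ B])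
    have "0 \<le> B" using not_empty bound order_trans[OF norm_ge_zero] by blast
    then show "AE \<omega> in M. norm (indicator (?A s) \<omega> *\<^sub>R Y (S \<omega>) \<omega>) \<le> B"
      using bound by (intro AE_I2) (auto split: split_indicator)
  qed (use mY in measurable)
  have "expectation (\<lambda>\<omega>. Y (S \<omega>) \<omega>) = expectation (\<lambda>\<omega>. \<Sum>s\<in>Pow {..<N}. indicator (?A s) \<omega> *\<^sub>R Y (S \<omega>) \<omega>)"
  proof (rule Bochner_Integration.integral_cong[OF refl])
    fix \<omega> assume w: "\<omega> \<in> space M"
    have "(\<Sum>s\<in>Pow {..<N}. indicator (?A s) \<omega> *\<^sub>R Y (S \<omega>) \<omega>) = (\<Sum>s\<in>Pow {..<N}. if s = S \<omega> then Y (S \<omega>) \<omega> else 0)"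
      using w by (intro sum.cong) (auto split: split_indicator)
    then show "Y (S \<omega>) \<omega> = (\<Sum>s\<in>Pow {..<N}. indicator (?A s) \<omega> *\<^sub>R Y (S \<omega>) \<omega>)"
      using sample1_subset[OF w] by (simp add: sum.delta)
  qed
  also have "\<dots> = (\<Sum>s\<in>Pow {..<N}. expectation (\<lambda>\<omega>. indicator (?A s) \<omega> *\<^sub>R Y (S \<omega>) \<omega>))"
    using int by (rule Bochner_Integration.integral_sum)
  also have "\<dots> = (\<Sum>s\<in>Pow {..<N}. pmf p s *\<^sub>R (\<integral>\<omega>. Y s \<omega> \<partial>given_sample1 D s))"
  proof (rule sum.cong[OF refl])
    fix s assume s: "s \<in> Pow {..<N}"
    have eq: "expectation (\<lambda>\<omega>. indicator (?A s) \<omega> *\<^sub>R Y (S \<omega>) \<omega>) = expectation (\<lambda>\<omega>. indicator (?A s) \<omega> *\<^sub>R Y s \<omega>)"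
      by (rule Bochner_Integration.integral_cong) (auto split: split_indicator)
    show "expectation (\<lambda>\<omega>. indicator (?A s) \<omega> *\<^sub>R Y (S \<omega>) \<omega>) = pmf p s *\<^sub>R (\<integral>\<omega>. Y s \<omega> \<partial>given_sample1 D s)"
    proof (cases "s \<in> set_pmf p")
      case True
      then show ?thesis unfolding eq using s Y by (subst integral_given_sample1) auto
    next
      case False
      then have p0: "pmf p s = 0" by (simp add: set_pmf_eq)
      then have "prob (?A s) = 0" by (simp add: prob_sample1)
      then have "?A s \<in> null_sets M" by (simp add: emeasure_eq_measure null_setsI)
      then have "AE \<omega> in M. \<omega> \<notin> ?A s" by (rule AE_not_in)
      then have "AE \<omega> in M. indicator (?A s) \<omega> *\<^sub>R Y s \<omega> = 0" by eventually_elim simp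
      then show ?thesis unfolding eq p0 by (simp add: integral_eq_zero_AE)
    qed
  qed
  finally show ?thesis .
qed

lemma expectation_of_sample1:
  fixes f :: "nat set \<Rightarrow> real"
  shows "expectation (\<lambda>\<omega>. f (S \<omega>)) = (\<Sum>s\<in>Pow {..<N}. pmf p s * f s)"
proof -
  have "expectation (\<lambda>\<omega>. f (S \<omega>)) = (\<Sum>s\<in>Pow {..<N}. pmf p s *\<^sub>R (\<integral>\<omega>. f s \<partial>given_sample1 D s))"
  proof (rule expectation_by_sample1[of "\<lambda>s _. f s" "\<Sum>s\<in>Pow {..<N}. \<bar>f s\<bar>"])
    fix \<omega> assume "\<omega> \<in> space M"
    then show "norm (f (S \<omega>)) \<le> (\<Sum>s\<in>Pow {..<N}. \<bar>f s\<bar>)"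
      using member_le_sum[of "S \<omega>" "Pow {..<N}" "\<lambda>s. \<bar>f s\<bar>"] sample1_subset by auto
  qed simp
  also have "\<dots> = (\<Sum>s\<in>Pow {..<N}. pmf p s * f s)"
  proof (rule sum.cong[OF refl])
    fix s
    show "pmf p s *\<^sub>R (\<integral>\<omega>. f s \<partial>given_sample1 D s) = pmf p s * f s"
    proof (cases "s \<in> set_pmf p")
      case True
      interpret given: prob_space "given_sample1 D s" by (rule prob_space_given_sample1[OF True])
      show ?thesis using given.prob_space by simp
    qed (simp add: set_pmf_eq)
  qed
  finally show ?thesis .
qed

section \<open>The laws of the sampled points and statistics of one PSU\<close>

definition point_law :: "nat \<Rightarrow> 'a measure" where
  "point_law i = density lebesgue (\<lambda>x. ennreal (density2 D i x))"

definition points_law :: "nat \<Rightarrow> (nat \<Rightarrow> 'a) measure" where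
  "points_law i = (\<Pi>\<^sub>M k\<in>{..<size2 D i}. point_law i)"

definition points :: "nat \<Rightarrow> 'w \<Rightarrow> nat \<Rightarrow> 'a" where
  "points i \<omega> = (\<lambda>k\<in>{..<size2 D i}. point D i k \<omega>)"

lemma density2_facts:
  assumes "i < N"
  shows "density2 D i \<in> borel_measurable lebesgue" "0 \<le> density2 D i x"
    "x \<notin> psu D i \<Longrightarrow> density2 D i x = 0" "(\<integral>\<^sup>+ x. ennreal (density2 D i x) \<partial>lebesgue) = 1"
  using two_stage assms by (auto simp: two_stage_sampling_def second_stage_sampling_def)

lemma sets_point_law [simp, measurable_cong]: "sets (point_law i) = sets lebesgue"
  and space_point_law [simp]: "space (point_law i) = UNIV"
  by (simp_all add: point_law_def)

lemma prob_space_point_law: "i < N \<Longrightarrow> prob_space (point_law i)"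
  using density2_facts(1,4)[of i] by (intro prob_spaceI) (auto simp: point_law_def emeasure_density)

lemma prob_space_points_law: "i < N \<Longrightarrow> prob_space (points_law i)"
  unfolding points_law_def by (intro prob_space_PiM prob_space_point_law)

lemma sets_points_law [simp, measurable_cong]:
  "sets (points_law i) = sets (\<Pi>\<^sub>M k\<in>{..<size2 D i}. (lebesgue :: 'a measure))"
  unfolding points_law_def by (rule sets_PiM_cong) auto

lemma supported_sample:
  assumes "i < N"
  shows "\<exists>s\<in>set_pmf p. i \<in> s"
proof (rule ccontr)
  assume "\<not> ?thesis"
  then have "set_pmf p \<inter> {s. i \<in> s} = {}" by auto
  then have "pi1 D i = 0" unfolding incl_prob_def by (simp add: measure_pmf_zero_iff)
  then show False using incl_pos[OF assms] by simp
qed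

lemma second_stage:
  assumes "s \<in> set_pmf p"
  shows "prob_space.indep_vars (given_sample1 D s) (\<lambda>_. lebesgue) (\<lambda>(i, k). point D i k) (SIGMA i:s. {..<size2 D i})"
    and "\<And>i k. i \<in> s \<Longrightarrow> k < size2 D i \<Longrightarrow>
      distributed (given_sample1 D s) lebesgue (point D i k) (\<lambda>x. ennreal (density2 D i x))"
  using two_stage assms by (auto simp: two_stage_sampling_def second_stage_sampling_def)

text \<open>Measurability is only available through the conditional law given a sample that contains
  the PSU. A positive inclusion probability provides such a sample, and conditioning does not change
  the measurable sets.\<close>

lemma point_measurable:
  assumes "i < N" "k < size2 D i"
  shows "point D i k \<in> measurable M lebesgue"
proof -
  obtain s where s: "s \<in> set_pmf p" "i \<in> s" using supported_sample[OF assms(1)] by blast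
  have "point D i k \<in> measurable (given_sample1 D s) lebesgue"
    using second_stage(2)[OF s assms(2)] by (auto simp: distributed_def)
  then show ?thesis by simp
qed

lemma points_measurable:
  assumes "i < N"
  shows "points i \<in> measurable M (\<Pi>\<^sub>M k\<in>{..<size2 D i}. lebesgue)"
  unfolding points_def using point_measurable[OF assms] by (intro measurable_restrict) auto

text \<open>Grouping the independent family of single points by PSU gives independent blocks. The
  law of a block is a product of copies of \<open>point_law i\<close>, in which the sample
  \<open>s\<close> no longer occurs; this invariance makes the second stage act like one fixed
  random contribution per unit.\<close>

lemma points_indep:
  assumes s: "s \<in> set_pmf p"
  shows "prob_space.indep_vars (given_sample1 D s) (\<lambda>i. \<Pi>\<^sub>M k\<in>{..<size2 D i}. lebesgue) points s"
    and "\<And>i. i \<in> s \<Longrightarrow> distr (given_sample1 D s) (\<Pi>\<^sub>M k\<in>{..<size2 D i}. lebesgue) (points i) = points_law i"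
proof -
  interpret given: prob_space "given_sample1 D s" by (rule prob_space_given_sample1[OF s])
  let ?X = "\<lambda>(i, k). point D i k"
  let ?K = "\<lambda>i. {i} \<times> {..<size2 D i}"
  let ?r = "\<lambda>i f. \<lambda>k\<in>{..<size2 D i}. f (i, k)"
  have sN: "s \<subseteq> {..<N}" using design1_support_Pow s by auto
  have r: "?r i \<in> measurable (\<Pi>\<^sub>M j\<in>?K i. lebesgue) (\<Pi>\<^sub>M k\<in>{..<size2 D i}. lebesgue)" for i
    by (intro measurable_restrict) auto
  have rK: "?r i (\<lambda>j\<in>?K i. ?X j \<omega>) = points i \<omega>" for i \<omega>
    by (auto simp: points_def fun_eq_iff)
  have "given.indep_vars (\<lambda>i. \<Pi>\<^sub>M j\<in>?K i. lebesgue) (\<lambda>i \<omega>. \<lambda>j\<in>?K i. ?X j \<omega>) s"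
    by (rule given.indep_vars_restrict[OF second_stage(1)[OF s]]) (auto simp: disjoint_family_on_def)
  from given.indep_vars_compose2[OF this, of ?r "\<lambda>i. \<Pi>\<^sub>M k\<in>{..<size2 D i}. lebesgue"] r
  show "given.indep_vars (\<lambda>i. \<Pi>\<^sub>M k\<in>{..<size2 D i}. lebesgue) points s"
    unfolding rK by simp
  fix i assume i: "i \<in> s"
  then have iN: "i < N" using sN by auto
  have ne: "?K i \<noteq> {}" using size2_ge2[OF iN] by (auto simp: lessThan_empty_iff)
  have sub: "?K i \<subseteq> (SIGMA i:s. {..<size2 D i})" using i by auto
  have rv: "?X j \<in> measurable (given_sample1 D s) lebesgue" if "j \<in> ?K i" for j
    using that point_measurable[OF iN] by auto
  have law: "distr (given_sample1 D s) lebesgue (?X j) = point_law i" if "j \<in> ?K i" for j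
    using that second_stage(2)[OF s i] by (auto simp: distributed_def point_law_def)
  have "distr (given_sample1 D s) (\<Pi>\<^sub>M j\<in>?K i. lebesgue) (\<lambda>\<omega>. \<lambda>j\<in>?K i. ?X j \<omega>) =
      (\<Pi>\<^sub>M j\<in>?K i. distr (given_sample1 D s) lebesgue (?X j))"
    using given.indep_vars_iff_distr_eq_PiM'[OF ne, of ?X "\<lambda>_. lebesgue"] rv
      given.indep_vars_subset[OF second_stage(1)[OF s] sub] by blast
  also have "\<dots> = (\<Pi>\<^sub>M j\<in>?K i. point_law i)" by (intro PiM_cong refl law)
  finally have joint: "distr (given_sample1 D s) (\<Pi>\<^sub>M j\<in>?K i. lebesgue) (\<lambda>\<omega>. \<lambda>j\<in>?K i. ?X j \<omega>) = (\<Pi>\<^sub>M j\<in>?K i. point_law i)" .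
  \<comment> \<open>The joint law is indexed by the pairs \<open>(i, k)\<close>; the injection of
    \<open>k\<close> into pairs renames the coordinates.\<close>
  have "points_law i = distr (\<Pi>\<^sub>M j\<in>?K i. point_law i) (\<Pi>\<^sub>M k\<in>{..<size2 D i}. point_law i) (?r i)"
    unfolding points_law_def
    by (rule distr_PiM_reindex[symmetric]) (use prob_space_point_law[OF iN] in \<open>auto simp: inj_on_def\<close>)
  also have "\<dots> = distr (\<Pi>\<^sub>M j\<in>?K i. point_law i) (\<Pi>\<^sub>M k\<in>{..<size2 D i}. lebesgue) (?r i)"
    by (rule distr_cong) (auto intro!: sets_PiM_cong)
  also have "\<dots> = distr (given_sample1 D s) (\<Pi>\<^sub>M k\<in>{..<size2 D i}. lebesgue) (?r i \<circ> (\<lambda>\<omega>. \<lambda>j\<in>?K i. ?X j \<omega>))"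
    unfolding joint[symmetric] using rv by (intro distr_distr r measurable_restrict) auto
  also have "?r i \<circ> (\<lambda>\<omega>. \<lambda>j\<in>?K i. ?X j \<omega>) = points i" by (rule ext) (simp only: comp_def rK)
  finally show "distr (given_sample1 D s) (\<Pi>\<^sub>M k\<in>{..<size2 D i}. lebesgue) (points i) = points_law i" by simp
qed

text \<open>A bounded statistic of the points of one PSU. Weighted totals, regression residuals and
  the summands of the variance estimator are all of this kind and share the moment bounds.\<close>

definition group_stat :: "(nat \<Rightarrow> (nat \<Rightarrow> 'a) \<Rightarrow> real) \<Rightarrow> real \<Rightarrow> bool" where
  "group_stat G b \<longleftrightarrow> (\<forall>i<N. G i \<in> borel_measurable (\<Pi>\<^sub>M k\<in>{..<size2 D i}. (lebesgue :: 'a measure)) \<and>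
     (\<forall>x. \<bar>G i x\<bar> \<le> b))"

definition gmean :: "(nat \<Rightarrow> (nat \<Rightarrow> 'a) \<Rightarrow> real) \<Rightarrow> nat \<Rightarrow> real" where
  "gmean G i = integral\<^sup>L (points_law i) (G i)"

lemma group_stat_measurable:
  assumes "group_stat G b" "i < N"
  shows "(\<lambda>\<omega>. G i (points i \<omega>)) \<in> borel_measurable M" "G i \<in> borel_measurable (points_law i)"
proof -
  show "(\<lambda>\<omega>. G i (points i \<omega>)) \<in> borel_measurable M"
    using assms by (intro measurable_compose[OF points_measurable]) (auto simp: group_stat_def)
  have "measurable (points_law i) (borel :: real measure) = measurable (\<Pi>\<^sub>M k\<in>{..<size2 D i}. lebesgue) borel"
    by (rule measurable_cong_sets) auto
  then show "G i \<in> borel_measurable (points_law i)" using assms by (auto simp: group_stat_def)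
qed

lemma integrable_points_law:
  fixes f :: "(nat \<Rightarrow> 'a) \<Rightarrow> 'b::{banach, second_countable_topology}"
  assumes "i < N" "f \<in> borel_measurable (points_law i)" "\<And>x. norm (f x) \<le> c"
  shows "integrable (points_law i) f"
proof -
  interpret P: prob_space "points_law i" by (rule prob_space_points_law[OF assms(1)])
  show ?thesis by (rule P.integrable_const_bound[of _ c]) (use assms in auto)
qed

lemma group_stat_nonneg: "group_stat G b \<Longrightarrow> i < N \<Longrightarrow> 0 \<le> b"
  using order_trans[OF abs_ge_zero] by (auto simp: group_stat_def)

lemma gmean_bound:
  assumes G: "group_stat G b" and i: "i < N"
  shows "\<bar>gmean G i\<bar> \<le> b"
proof -
  interpret P: prob_space "points_law i" by (rule prob_space_points_law[OF i])
  have "\<bar>gmean G i\<bar> \<le> (\<integral>x. \<bar>G i x\<bar> \<partial>points_law i)"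
    unfolding gmean_def using integral_norm_bound[of "points_law i" "G i"] by simp
  also have "\<dots> \<le> (\<integral>x. b \<partial>points_law i)"
    using G i group_stat_measurable(2)[OF G i] group_stat_nonneg[OF G i]
    by (intro integral_mono integrable_points_law[OF i, of _ b]) (auto simp: group_stat_def)
  finally show ?thesis by (simp add: P.prob_space)
qed

lemma integral_given_group:
  fixes f :: "(nat \<Rightarrow> 'a) \<Rightarrow> 'b::{banach, second_countable_topology}"
  assumes s: "s \<in> set_pmf p" "i \<in> s"
    and f: "f \<in> borel_measurable (\<Pi>\<^sub>M k\<in>{..<size2 D i}. (lebesgue :: 'a measure))"
  shows "(\<integral>\<omega>. f (points i \<omega>) \<partial>given_sample1 D s) = (\<integral>x. f x \<partial>points_law i)"
proof -
  have "i < N" using design1_support_Pow s by auto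
  then show ?thesis unfolding points_indep(2)[OF s, symmetric]
    using f points_measurable by (subst integral_distr) auto
qed

text \<open>Conditional independence factorizes the characteristic function given each sample. The
  result is an average over samples of products of one function per unit, the shape treated by
  \<open>approximates_poisson\<close>.\<close>

lemma expectation_char_group_sum:
  assumes G: "group_stat G b"
  shows "expectation (\<lambda>\<omega>. exp (\<i> * of_real (\<theta> * (\<Sum>i\<in>S \<omega>. G i (points i \<omega>))))) =
    (\<Sum>s\<in>Pow {..<N}. of_real (pmf p s) * (\<Prod>i\<in>s. \<integral>x. exp (\<i> * of_real (\<theta> * G i x)) \<partial>points_law i))"
proof -
  have meas: "(\<lambda>\<omega>. exp (\<i> * complex_of_real (\<theta> * (\<Sum>i\<in>s. G i (points i \<omega>))))) \<in> borel_measurable M" if "s \<subseteq> {..<N}" for s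
  proof -
    have [measurable]: "(\<lambda>\<omega>. \<Sum>i\<in>s. G i (points i \<omega>)) \<in> borel_measurable M"
      using group_stat_measurable(1)[OF G] that by (intro borel_measurable_sum) auto
    show ?thesis by measurable
  qed
  have "expectation (\<lambda>\<omega>. exp (\<i> * of_real (\<theta> * (\<Sum>i\<in>S \<omega>. G i (points i \<omega>))))) =
    (\<Sum>s\<in>Pow {..<N}. pmf p s *\<^sub>R (\<integral>\<omega>. exp (\<i> * of_real (\<theta> * (\<Sum>i\<in>s. G i (points i \<omega>)))) \<partial>given_sample1 D s))"
    by (rule expectation_by_sample1[where B = 1]) (use meas in auto)
  also have "\<dots> = (\<Sum>s\<in>Pow {..<N}. of_real (pmf p s) * (\<Prod>i\<in>s. \<integral>x. exp (\<i> * of_real (\<theta> * G i x)) \<partial>points_law i))"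
  proof (rule sum.cong[OF refl])
    fix s assume sP: "s \<in> Pow {..<N}"
    show "pmf p s *\<^sub>R (\<integral>\<omega>. exp (\<i> * of_real (\<theta> * (\<Sum>i\<in>s. G i (points i \<omega>)))) \<partial>given_sample1 D s) =
      of_real (pmf p s) * (\<Prod>i\<in>s. \<integral>x. exp (\<i> * of_real (\<theta> * G i x)) \<partial>points_law i)"
    proof (cases "s \<in> set_pmf p")
      case True
      interpret given: prob_space "given_sample1 D s" by (rule prob_space_given_sample1[OF True])
      have fs: "finite s" using sP finite_subset by auto
      have Gm: "(\<lambda>x. exp (\<i> * complex_of_real (\<theta> * G i x))) \<in> borel_measurable (\<Pi>\<^sub>M k\<in>{..<size2 D i}. lebesgue)"
        if "i \<in> s" for i
        using G that sP by (auto simp: group_stat_def)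
      have ind: "given.indep_vars (\<lambda>_. borel) (\<lambda>i \<omega>. exp (\<i> * complex_of_real (\<theta> * G i (points i \<omega>)))) s"
        by (rule given.indep_vars_compose2[OF points_indep(1)[OF True]]) (use Gm in auto)
      have "(\<integral>\<omega>. exp (\<i> * of_real (\<theta> * (\<Sum>i\<in>s. G i (points i \<omega>)))) \<partial>given_sample1 D s) =
          (\<integral>\<omega>. (\<Prod>i\<in>s. exp (\<i> * complex_of_real (\<theta> * G i (points i \<omega>)))) \<partial>given_sample1 D s)"
        using fs by (simp add: exp_sum[symmetric] sum_distrib_left)
      also have "\<dots> = (\<Prod>i\<in>s. \<integral>\<omega>. exp (\<i> * complex_of_real (\<theta> * G i (points i \<omega>))) \<partial>given_sample1 D s)"
      proof (rule given.indep_vars_lebesgue_integral[OF fs ind])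
        fix i assume "i \<in> s"
        then show "integrable (given_sample1 D s) (\<lambda>\<omega>. exp (\<i> * complex_of_real (\<theta> * G i (points i \<omega>))))"
          using ind by (intro given.integrable_const_bound[of _ 1]) (auto simp: given.indep_vars_def)
      qed
      also have "\<dots> = (\<Prod>i\<in>s. \<integral>x. exp (\<i> * of_real (\<theta> * G i x)) \<partial>points_law i)"
        using integral_given_group[OF True _ Gm] by (intro prod.cong) auto
      finally show ?thesis by (simp add: scaleR_conv_of_real)
    qed (simp add: set_pmf_eq)
  qed
  finally show ?thesis .
qed

text \<open>The second-stage fluctuation alone. Given the sample, the summands are independent,
  centered and bounded by \<open>2 * b\<close>, which gives \<open>144 * 2 ^ 4 = 2304\<close>; the
  bound does not depend on the sample.\<close>

lemma centered_group_sum_fourth_moment: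
  assumes G: "group_stat G b" and n: "0 < n"
  shows "expectation (\<lambda>\<omega>. (\<Sum>i\<in>S \<omega>. G i (points i \<omega>) - gmean G i) ^ 4) \<le> 2304 * b ^ 4 * (real n)\<^sup>2"
proof -
  have meas: "(\<lambda>\<omega>. (\<Sum>i\<in>s. G i (points i \<omega>) - gmean G i) ^ 4) \<in> borel_measurable M" if "s \<subseteq> {..<N}" for s
    using group_stat_measurable(1)[OF G] that by (intro borel_measurable_power borel_measurable_sum borel_measurable_diff) auto
  have X2: "\<bar>G i (points i \<omega>) - gmean G i\<bar> \<le> 2 * b" if "i < N" for i \<omega>
  proof -
    have "\<bar>G i (points i \<omega>)\<bar> \<le> b" using G that by (auto simp: group_stat_def)
    then show ?thesis using gmean_bound[OF G that] by linarith
  qed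
  have "expectation (\<lambda>\<omega>. (\<Sum>i\<in>S \<omega>. G i (points i \<omega>) - gmean G i) ^ 4) =
    (\<Sum>s\<in>Pow {..<N}. pmf p s *\<^sub>R (\<integral>\<omega>. (\<Sum>i\<in>s. G i (points i \<omega>) - gmean G i) ^ 4 \<partial>given_sample1 D s))"
  proof (rule expectation_by_sample1[where B = "(real n * (2 * b)) ^ 4"])
    fix \<omega> assume w: "\<omega> \<in> space M"
    have "\<bar>\<Sum>i\<in>S \<omega>. G i (points i \<omega>) - gmean G i\<bar> \<le> (\<Sum>i\<in>S \<omega>. \<bar>G i (points i \<omega>) - gmean G i\<bar>)" by (rule sum_abs)
    also have "\<dots> \<le> (\<Sum>i\<in>S \<omega>. 2 * b)" using X2 sample1_subset[OF w] by (intro sum_mono) auto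
    finally have "\<bar>\<Sum>i\<in>S \<omega>. G i (points i \<omega>) - gmean G i\<bar> \<le> real n * (2 * b)" by (simp add: sample1_card[OF w])
    then show "norm ((\<Sum>i\<in>S \<omega>. G i (points i \<omega>) - gmean G i) ^ 4) \<le> (real n * (2 * b)) ^ 4"
      unfolding real_norm_def power_abs by (rule power_mono) simp
  qed (use meas in auto)
  also have "\<dots> \<le> (\<Sum>s\<in>Pow {..<N}. pmf p s * (2304 * b ^ 4 * (real n)\<^sup>2))"
  proof (rule sum_mono)
    fix s assume sP: "s \<in> Pow {..<N}"
    show "pmf p s *\<^sub>R (\<integral>\<omega>. (\<Sum>i\<in>s. G i (points i \<omega>) - gmean G i) ^ 4 \<partial>given_sample1 D s)
        \<le> pmf p s * (2304 * b ^ 4 * (real n)\<^sup>2)"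
    proof (cases "s \<in> set_pmf p")
      case True
      interpret given: prob_space "given_sample1 D s" by (rule prob_space_given_sample1[OF True])
      have card: "card s = n" using design1_support True by (auto simp: fixed_size_samples_def)
      have fs: "finite s" using sP finite_subset by auto
      have Gm: "G i \<in> borel_measurable (\<Pi>\<^sub>M k\<in>{..<size2 D i}. lebesgue)" if "i \<in> s" for i
        using G that sP by (auto simp: group_stat_def)
      have ind: "given.indep_vars (\<lambda>_. borel) (\<lambda>i \<omega>. G i (points i \<omega>) - gmean G i) s"
        by (rule given.indep_vars_compose2[OF points_indep(1)[OF True]]) (use Gm in auto)
      have "given.expectation (\<lambda>\<omega>. (\<Sum>i\<in>s. G i (points i \<omega>) - gmean G i) ^ 4) \<le> 144 * (2 * b) ^ 4 * (real (card s))\<^sup>2"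
      proof (rule given.fourth_moment_sum_indep_le[OF ind fs])
        show "s \<noteq> {}" using card n by auto
        fix i assume i: "i \<in> s"
        then have iN: "i < N" using sP by auto
        show "\<bar>G i (points i \<omega>) - gmean G i\<bar> \<le> 2 * b" for \<omega> by (rule X2[OF iN])
        have "integrable (given_sample1 D s) (\<lambda>\<omega>. G i (points i \<omega>))"
          using group_stat_measurable(1)[OF G iN] G iN
          by (intro given.integrable_const_bound[of _ b]) (auto simp: group_stat_def)
        then show "given.expectation (\<lambda>\<omega>. G i (points i \<omega>) - gmean G i) = 0"
          using integral_given_group[OF True i Gm[OF i]] given.prob_space by (simp add: gmean_def)
      qed
      then show ?thesis by (simp add: card power_mult_distrib mult_left_mono)
    qed (simp add: set_pmf_eq)
  qed
  also have "\<dots> = 2304 * b ^ 4 * (real n)\<^sup>2"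
    by (simp only: sum_distrib_right[symmetric] sum_pmf_Pow[OF design1_support_Pow] mult_1_left)
  finally show ?thesis .
qed

end

text \<open>The second identity is the unbiasedness of the usual variance estimator for the variance
  of a sum. It is what will make the second-stage term of the Hajek estimator compensate the
  within-PSU variance.\<close>

lemma iid_sample_moments:
  fixes w :: "'a \<Rightarrow> real"
  assumes "prob_space \<mu>" and w: "w \<in> borel_measurable \<mu>" and b: "\<And>x. \<bar>w x\<bar> \<le> b" and n: "2 \<le> n"
  defines "P \<equiv> \<Pi>\<^sub>M k\<in>{..<n}. \<mu>" and "a \<equiv> \<integral>x. w x \<partial>\<mu>"
  defines "T \<equiv> \<lambda>x. \<Sum>k<n. w (x k)"
  shows "(\<integral>x. T x \<partial>P) = real n * a"
    and "(\<integral>x. real n / (real n - 1) * (\<Sum>k<n. (w (x k) - T x / real n)\<^sup>2) \<partial>P) = (\<integral>x. (T x)\<^sup>2 \<partial>P) - (real n * a)\<^sup>2"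
proof -
  interpret \<mu>: prob_space \<mu> by fact
  interpret coords: product_prob_space "\<lambda>_::nat. \<mu>" "{..<n}" by unfold_locales
  have pP: "prob_space P" unfolding P_def by (rule prob_space_PiM) (rule assms(1))
  interpret P: prob_space P by (rule pP)
  define s where "s = (\<integral>x. (w x)\<^sup>2 \<partial>\<mu>)"
  have iw: "integrable \<mu> w" by (rule \<mu>.integrable_const_bound[of _ b]) (use w b in auto)
  have b2: "(w x)\<^sup>2 \<le> b\<^sup>2" for x using power_mono[OF b[of x], of 2] by simp
  have iw2: "integrable \<mu> (\<lambda>x. (w x)\<^sup>2)" by (rule \<mu>.integrable_const_bound[of _ "b\<^sup>2"]) (use w b2 in auto)
  have wk[measurable]: "(\<lambda>x. w (x k)) \<in> borel_measurable P" if "k < n" for k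
    unfolding P_def using that w by (intro measurable_compose[OF measurable_component_singleton]) auto
  have one: "(\<integral>x. f (x k) \<partial>P) = (\<integral>x. f x \<partial>\<mu>)" if k: "k < n" and f: "integrable \<mu> f" for k and f :: "'a \<Rightarrow> real"
  proof -
    \<comment> \<open>A single coordinate is isolated by a product whose other factors are
      constantly 1; the same device with two coordinates gives the mixed moments.\<close>
    have "(\<integral>x. (\<Prod>j<n. (if j = k then f else (\<lambda>_. 1)) (x j)) \<partial>P) = (\<Prod>j<n. integral\<^sup>L \<mu> (if j = k then f else (\<lambda>_. 1)))"
      unfolding P_def by (rule coords.product_integral_prod) (use f in auto)
    also have "(\<lambda>x. \<Prod>j<n. (if j = k then f else (\<lambda>_. 1)) (x j)) = (\<lambda>x. f (x k))"
    proof
      fix x :: "nat \<Rightarrow> 'a"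
      have "(\<Prod>j<n. (if j = k then f else (\<lambda>_. 1)) (x j)) = (\<Prod>j<n. if j = k then f (x k) else 1)"
        by (rule prod.cong) auto
      then show "(\<Prod>j<n. (if j = k then f else (\<lambda>_. 1)) (x j)) = f (x k)" using k by (simp add: prod.delta)
    qed
    also have "(\<Prod>j<n. integral\<^sup>L \<mu> (if j = k then f else (\<lambda>_. 1))) = (\<Prod>j<n. if j = k then integral\<^sup>L \<mu> f else 1)"
      by (rule prod.cong) (auto simp: \<mu>.prob_space)
    finally show ?thesis using k by (simp add: prod.delta)
  qed
  have two: "(\<integral>x. w (x k) * w (x l) \<partial>P) = (if k = l then s else a\<^sup>2)" if k: "k < n" "l < n" for k l
  proof (cases "k = l")
    case True
    then show ?thesis using one[OF k(1) iw2] by (simp add: s_def power2_eq_square)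
  next
    case False
    have "(\<integral>x. (\<Prod>j<n. (if j = k \<or> j = l then w else (\<lambda>_. 1)) (x j)) \<partial>P) = (\<Prod>j<n. integral\<^sup>L \<mu> (if j = k \<or> j = l then w else (\<lambda>_. 1)))"
      unfolding P_def by (rule coords.product_integral_prod) (use iw in auto)
    moreover have two_prod: "(\<Prod>j<n. if j = k \<or> j = l then f j else 1) = f k * f l" for f :: "nat \<Rightarrow> real"
    proof -
      have "(\<Prod>j<n. if j = k \<or> j = l then f j else 1) = (\<Prod>j\<in>{k, l}. f j)"
        using k by (intro prod.mono_neutral_cong_right) auto
      then show ?thesis using False by simp
    qed
    moreover have "(\<Prod>j<n. (if j = k \<or> j = l then w else (\<lambda>_. 1)) (x j)) = w (x k) * w (x l)" for x
      unfolding two_prod[of "\<lambda>j. w (x j)", symmetric] by (rule prod.cong) auto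
    moreover have "(\<Prod>j<n. integral\<^sup>L \<mu> (if j = k \<or> j = l then w else (\<lambda>_. 1))) = a * a"
      unfolding two_prod[of "\<lambda>_. a", symmetric] by (rule prod.cong) (auto simp: \<mu>.prob_space a_def)
    ultimately show ?thesis using False by (simp add: power2_eq_square)
  qed
  have intk: "integrable P (\<lambda>x. w (x k))" if "k < n" for k
    by (rule P.integrable_const_bound[of _ b]) (use that b in auto)
  have intkl: "integrable P (\<lambda>x. w (x k) * w (x l))" if "k < n" "l < n" for k l
  proof (rule P.integrable_const_bound[of _ "b * b"])
    show "AE x in P. norm (w (x k) * w (x l)) \<le> b * b"
      using b order_trans[OF abs_ge_zero b] by (intro AE_I2) (auto simp: abs_mult intro!: mult_mono)
  qed (use that in measurable)
  show ET: "(\<integral>x. T x \<partial>P) = real n * a"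
    unfolding T_def using one[OF _ iw] intk by (simp add: a_def)
  have T2: "(T x)\<^sup>2 = (\<Sum>k<n. \<Sum>l<n. w (x k) * w (x l))" for x
    unfolding T_def power2_eq_square by (simp add: sum_product)
  have iT2: "integrable P (\<lambda>x. (T x)\<^sup>2)" unfolding T2 using intkl by (intro Bochner_Integration.integrable_sum) auto
  have "(\<integral>x. (T x)\<^sup>2 \<partial>P) = (\<Sum>k<n. \<Sum>l<n. if k = l then s else a\<^sup>2)"
  proof -
    have "(\<integral>x. (T x)\<^sup>2 \<partial>P) = (\<Sum>k<n. \<integral>x. (\<Sum>l<n. w (x k) * w (x l)) \<partial>P)"
      unfolding T2 by (rule Bochner_Integration.integral_sum) (auto intro!: Bochner_Integration.integrable_sum intkl)
    also have "\<dots> = (\<Sum>k<n. \<Sum>l<n. \<integral>x. w (x k) * w (x l) \<partial>P)"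
      by (intro sum.cong refl Bochner_Integration.integral_sum) (auto intro: intkl)
    also have "\<dots> = (\<Sum>k<n. \<Sum>l<n. if k = l then s else a\<^sup>2)"
      by (intro sum.cong refl) (auto simp: two)
    finally show ?thesis .
  qed
  also have "\<dots> = (\<Sum>k<n. s + (real n - 1) * a\<^sup>2)"
  proof (rule sum.cong[OF refl])
    fix k assume k: "k \<in> {..<n}"
    have "(\<Sum>l<n. if k = l then s else a\<^sup>2) = s + (\<Sum>l\<in>{..<n} - {k}. a\<^sup>2)"
      using k by (subst sum.remove[of _ k]) (auto intro!: sum.cong)
    then show "(\<Sum>l<n. if k = l then s else a\<^sup>2) = s + (real n - 1) * a\<^sup>2"
      using k by (simp add: of_nat_diff)
  qed
  finally have ET2: "(\<integral>x. (T x)\<^sup>2 \<partial>P) = n * s + n * (real n - 1) * a\<^sup>2" by (simp add: algebra_simps)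
  have n1: "1 < real n" using n by simp
  have expand: "(\<Sum>k<n. (w (x k) - T x / real n)\<^sup>2) = (\<Sum>k<n. (w (x k))\<^sup>2) - (T x)\<^sup>2 / n" for x
  proof -
    have "(\<Sum>k<n. (w (x k) - T x / real n)\<^sup>2) = (\<Sum>k<n. (w (x k))\<^sup>2 - 2 * (T x / n) * w (x k) + (T x / n)\<^sup>2)"
      by (rule sum.cong) (auto simp: power2_diff)
    also have "\<dots> = (\<Sum>k<n. (w (x k))\<^sup>2) - 2 * (T x / n) * T x + n * (T x / n)\<^sup>2"
      unfolding sum.distrib sum_subtractf sum_distrib_left[symmetric] T_def by simp
    also have "\<dots> = (\<Sum>k<n. (w (x k))\<^sup>2) - (T x)\<^sup>2 / n" using n1 by (simp add: power2_eq_square field_simps)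
    finally show ?thesis .
  qed
  have "(\<integral>x. (\<Sum>k<n. (w (x k))\<^sup>2) - (T x)\<^sup>2 / n \<partial>P) = n * s - (n * s + n * (real n - 1) * a\<^sup>2) / n"
  proof -
    have "(\<integral>x. (\<Sum>k<n. (w (x k))\<^sup>2) \<partial>P) = n * s"
      using one[OF _ iw2] intkl by (simp add: s_def power2_eq_square)
    moreover have "integrable P (\<lambda>x. \<Sum>k<n. (w (x k))\<^sup>2)"
      unfolding power2_eq_square using intkl by (intro Bochner_Integration.integrable_sum) auto
    ultimately show ?thesis using ET2 iT2 by simp
  qed
  also have "\<dots> = (real n - 1) * (s - a\<^sup>2)" using n1 by (simp add: field_simps)
  finally have "(\<integral>x. real n / (real n - 1) * (\<Sum>k<n. (w (x k) - T x / real n)\<^sup>2) \<partial>P) = real n / (real n - 1) * ((real n - 1) * (s - a\<^sup>2))"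
    unfolding expand by (simp only: integral_mult_right_zero)
  also have "\<dots> = n * (s - a\<^sup>2)" using n1 by simp
  also have "\<dots> = (\<integral>x. (T x)\<^sup>2 \<partial>P) - (real n * a)\<^sup>2" unfolding ET2 by (simp add: power2_eq_square algebra_simps)
  finally show "(\<integral>x. real n / (real n - 1) * (\<Sum>k<n. (w (x k) - T x / real n)\<^sup>2) \<partial>P) = (\<integral>x. (T x)\<^sup>2 \<partial>P) - (real n * a)\<^sup>2" .
qed

text \<open>The constants \<open>\<alpha>\<close> and \<open>\<beta>\<close> bound the weights \<open>1 / (pi1 D i * pi2 D i x)\<close> of the sampled points
  after multiplication by both sample sizes.\<close>

locale regular_population = two_stage_population F D
  for F :: "'a::euclidean_space set" and D :: "('a, 'w) two_stage" +
  fixes \<alpha> \<beta> :: real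
  assumes \<alpha>: "0 < \<alpha>" and weights: "\<And>i x. i < psu_count D \<Longrightarrow> x \<in> psu D i \<Longrightarrow>
      0 < density2 D i x \<and> \<alpha> / size1 D \<le> 1 / (pi1 D i * density2 D i x) \<and>
      1 / (pi1 D i * density2 D i x) \<le> \<beta> / size1 D"
    and size1_pos: "0 < size1 D" and \<beta>: "0 < \<beta>" and F_fin: "F \<in> lmeasurable"
begin

section \<open>Weighted draws and within-PSU estimators\<close>

lemma n_ge1: "1 \<le> real n" using size1_pos by simp

text \<open>Contribution of one sampled point to the Horvitz--Thompson estimator, with both
  inclusion probabilities already divided out. Setting it to 0 off the PSU makes it measurable and
  bounded on the whole space although \<open>r\<close> is controlled only on
  \<open>F\<close>.\<close>

definition wdraw :: "('a \<Rightarrow> real) \<Rightarrow> nat \<Rightarrow> 'a \<Rightarrow> real" where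
  "wdraw r i x = (if x \<in> psu D i then r x / (pi1 D i * pi2 D i x) else 0)"

definition wtotal :: "('a \<Rightarrow> real) \<Rightarrow> nat \<Rightarrow> (nat \<Rightarrow> 'a) \<Rightarrow> real" where
  "wtotal r i x = (\<Sum>k<size2 D i. wdraw r i (x k))"

definition wvar :: "('a \<Rightarrow> real) \<Rightarrow> nat \<Rightarrow> (nat \<Rightarrow> 'a) \<Rightarrow> real" where
  "wvar r i x = real (size2 D i) / (real (size2 D i) - 1) *
     (\<Sum>k<size2 D i. (wdraw r i (x k) - wtotal r i x / real (size2 D i))\<^sup>2)"

definition bounded_variable :: "('a \<Rightarrow> real) \<Rightarrow> real \<Rightarrow> bool" where
  "bounded_variable r B \<longleftrightarrow> r \<in> borel_measurable (lebesgue_on F) \<and> (\<forall>x\<in>F. \<bar>r x\<bar> \<le> B)"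

lemma psu_facts:
  assumes "i < N"
  shows "psu D i \<in> sets lebesgue" "psu D i \<subseteq> F"
  using two_stage assms by (auto simp: two_stage_sampling_def psu_partition_def)

lemma F_partition: "(\<Union>i<N. psu D i) = F" "disjoint_family_on (psu D) {..<N}"
  using two_stage by (auto simp: two_stage_sampling_def psu_partition_def)

lemma F_measurable: "F \<in> sets lebesgue"
  unfolding F_partition(1)[symmetric] using psu_facts by auto

lemma bounded_variable_psu:
  assumes "bounded_variable r B" "i < N"
  shows "(\<lambda>x. indicator (psu D i) x * r x) \<in> borel_measurable lebesgue"
    and "r \<in> borel_measurable (lebesgue_on (psu D i))"
proof -
  show r: "r \<in> borel_measurable (lebesgue_on (psu D i))"
    using assms psu_facts(2)[OF assms(2)] by (auto simp: bounded_variable_def intro: measurable_restrict_mono)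
  then show "(\<lambda>x. indicator (psu D i) x * r x) \<in> borel_measurable lebesgue"
    using psu_facts(1)[OF assms(2)] by (subst (asm) borel_measurable_restrict_space_iff) auto
qed

lemma wdraw_measurable:
  assumes "bounded_variable r B" "i < N"
  shows "wdraw r i \<in> borel_measurable lebesgue"
proof -
  have "wdraw r i = (\<lambda>x. (indicator (psu D i) x * r x) / (pi1 D i * pi2 D i x))"
    by (auto simp: wdraw_def fun_eq_iff)
  moreover have "pi2 D i \<in> borel_measurable lebesgue"
    using density2_facts(1)[OF assms(2)] by (simp add: pi2_def[abs_def])
  ultimately show ?thesis using bounded_variable_psu(1)[OF assms] by simp
qed

lemma weight_bounds:
  assumes "i < N" "x \<in> psu D i"
  shows "0 < pi1 D i * pi2 D i x" "\<alpha> / (n * size2 D i) \<le> 1 / (pi1 D i * pi2 D i x)"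
    "1 / (pi1 D i * pi2 D i x) \<le> \<beta> / (n * size2 D i)"
proof -
  have s: "0 < real (size2 D i)" using size2_ge2[OF assms(1)] by simp
  have eq: "1 / (pi1 D i * pi2 D i x) = (1 / (pi1 D i * density2 D i x)) / size2 D i" by (simp add: pi2_def)
  show "0 < pi1 D i * pi2 D i x" using weights[OF assms] incl_pos[OF assms(1)] s by (simp add: pi2_def)
  have "\<alpha> / n / size2 D i \<le> 1 / (pi1 D i * density2 D i x) / size2 D i"
    "1 / (pi1 D i * density2 D i x) / size2 D i \<le> \<beta> / n / size2 D i"
    using weights[OF assms] s by (intro divide_right_mono; simp)+
  then show "\<alpha> / (n * size2 D i) \<le> 1 / (pi1 D i * pi2 D i x)"
    "1 / (pi1 D i * pi2 D i x) \<le> \<beta> / (n * size2 D i)" unfolding eq by simp_all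
qed

lemma wdraw_bound:
  assumes r: "\<forall>x\<in>F. \<bar>r x\<bar> \<le> B" and i: "i < N" and B: "0 \<le> B" "0 \<le> \<beta>"
  shows "\<bar>wdraw r i x\<bar> \<le> B * \<beta> / n / size2 D i"
proof (cases "x \<in> psu D i")
  case True
  have "\<bar>wdraw r i x\<bar> = \<bar>r x\<bar> * (1 / (pi1 D i * pi2 D i x))"
    using True abs_of_pos[OF weight_bounds(1)[OF i True]] by (simp add: wdraw_def abs_divide del: abs_mult)
  also have "\<dots> \<le> B * (\<beta> / (n * size2 D i))"
    using True psu_facts(2)[OF i] r B weight_bounds(1,3)[OF i True] by (intro mult_mono) auto
  finally show ?thesis by simp
qed (use B in \<open>simp add: wdraw_def\<close>)

lemma wtotal_bound:
  assumes r: "\<forall>x\<in>F. \<bar>r x\<bar> \<le> B" and i: "i < N" and B: "0 \<le> B" "0 \<le> \<beta>"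
  shows "\<bar>wtotal r i x\<bar> \<le> B * \<beta> / n"
proof -
  have "\<bar>wtotal r i x\<bar> \<le> (\<Sum>k<size2 D i. \<bar>wdraw r i (x k)\<bar>)" unfolding wtotal_def by (rule sum_abs)
  also have "\<dots> \<le> (\<Sum>k<size2 D i. B * \<beta> / n / size2 D i)" by (intro sum_mono wdraw_bound[OF assms])
  also have "\<dots> = B * \<beta> / n" using size2_ge2[OF i] by simp
  finally show ?thesis .
qed

lemma wdraw_comp_measurable:
  assumes "bounded_variable r B" "i < N" "k < size2 D i"
  shows "(\<lambda>x. wdraw r i (x k)) \<in> borel_measurable (\<Pi>\<^sub>M k\<in>{..<size2 D i}. (lebesgue :: 'a measure))"
  by (rule measurable_compose[OF measurable_component_singleton[of k "{..<size2 D i}" "\<lambda>_. lebesgue"] wdraw_measurable[OF assms(1,2)]])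
     (use assms in auto)

lemma wtotal_measurable:
  assumes "bounded_variable r B" "i < N"
  shows "wtotal r i \<in> borel_measurable (\<Pi>\<^sub>M k\<in>{..<size2 D i}. (lebesgue :: 'a measure))"
  unfolding wtotal_def[abs_def] using wdraw_comp_measurable[OF assms] by (intro borel_measurable_sum) auto

lemma wvar_measurable:
  assumes "bounded_variable r B" "i < N"
  shows "wvar r i \<in> borel_measurable (\<Pi>\<^sub>M k\<in>{..<size2 D i}. (lebesgue :: 'a measure))"
  unfolding wvar_def[abs_def] using wdraw_comp_measurable[OF assms] wtotal_measurable[OF assms]
  by (intro borel_measurable_times borel_measurable_sum borel_measurable_power borel_measurable_diff borel_measurable_divide) auto

lemma group_stat_wtotal:
  assumes "bounded_variable r B" "0 \<le> B" "0 \<le> \<beta>"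
  shows "group_stat (wtotal r) (B * \<beta> / n)"
  unfolding group_stat_def using assms wtotal_measurable wtotal_bound by (auto simp: bounded_variable_def)

text \<open>The sampling density cancels against the weight, which is the second-stage unbiasedness
  of the Horvitz--Thompson estimator; points outside the PSU do not contribute.\<close>

lemma integral_wdraw:
  assumes r: "bounded_variable r B" and i: "i < N"
  shows "real (size2 D i) * (\<integral>x. wdraw r i x \<partial>point_law i) = total (psu D i) r / pi1 D i"
proof -
  have s: "0 < real (size2 D i)" using size2_ge2[OF i] by simp
  have "(\<integral>x. wdraw r i x \<partial>point_law i) = (\<integral>x. density2 D i x *\<^sub>R wdraw r i x \<partial>lebesgue)"
    unfolding point_law_def using wdraw_measurable[OF r i] density2_facts(1,2)[OF i]
    by (intro integral_density) auto
  also have "\<dots> = (\<integral>x. (1 / (pi1 D i * size2 D i)) * (indicator (psu D i) x * r x) \<partial>lebesgue)"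
  proof (rule Bochner_Integration.integral_cong[OF refl])
    fix x
    show "density2 D i x *\<^sub>R wdraw r i x = (1 / (pi1 D i * size2 D i)) * (indicator (psu D i) x * r x)"
      using weights[OF i, of x] by (auto simp: wdraw_def pi2_def)
  qed
  also have "\<dots> = (1 / (pi1 D i * size2 D i)) * (\<integral>x. indicator (psu D i) x * r x \<partial>lebesgue)"
    by (rule integral_mult_right_zero)
  also have "(\<integral>x. indicator (psu D i) x * r x \<partial>lebesgue) = total (psu D i) r"
    unfolding total_def using psu_facts(1)[OF i] by (simp add: integral_restrict_space)
  finally show ?thesis using s by simp
qed

lemma wtotal_moments:
  assumes r: "bounded_variable r B" and B: "0 \<le> B" "0 \<le> \<beta>" and i: "i < N"
  shows "gmean (wtotal r) i = total (psu D i) r / pi1 D i"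
    and "gmean (wvar r) i = gmean (\<lambda>i x. (wtotal r i x)\<^sup>2) i - (gmean (wtotal r) i)\<^sup>2"
proof -
  have w: "wdraw r i \<in> borel_measurable (point_law i)"
  proof -
    have "measurable (point_law i) (borel :: real measure) = measurable lebesgue borel" by (rule measurable_cong_sets) auto
    then show ?thesis using wdraw_measurable[OF r i] by simp
  qed
  have rb: "\<forall>x\<in>F. \<bar>r x\<bar> \<le> B" using r by (simp add: bounded_variable_def)
  note m = iid_sample_moments[OF prob_space_point_law[OF i] w wdraw_bound[OF rb i B] size2_ge2[OF i],
      folded points_law_def wtotal_def]
  show 1: "gmean (wtotal r) i = total (psu D i) r / pi1 D i"
    unfolding gmean_def m(1) by (rule integral_wdraw[OF r i])
  show "gmean (wvar r) i = gmean (\<lambda>i x. (wtotal r i x)\<^sup>2) i - (gmean (wtotal r) i)\<^sup>2"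
    unfolding 1 unfolding gmean_def wvar_def m(2) integral_wdraw[OF r i] ..
qed

lemma estimators_eq:
  assumes w: "\<omega> \<in> space M" and i: "i \<in> S \<omega>"
  shows "psu_total_est D r i \<omega> / pi1 D i = wtotal r i (points i \<omega>)"
    and "second_stage_var_est D r i \<omega> = (pi1 D i)\<^sup>2 * wvar r i (points i \<omega>)"
proof -
  have iN: "i < N" using sample1_subset[OF w] i by auto
  have p0: "0 < pi1 D i" by (rule incl_pos[OF iN])
  have d: "wdraw r i (points i \<omega> k) = r (point D i k \<omega>) / pi2 D i (point D i k \<omega>) / pi1 D i" if "k < size2 D i" for k
  proof -
    have "point D i k \<omega> \<in> psu D i"
      using two_stage w i that by (auto simp: two_stage_sampling_def second_stage_sampling_def)
    then show ?thesis using that by (simp add: wdraw_def points_def)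
  qed
  show 1: "psu_total_est D r i \<omega> / pi1 D i = wtotal r i (points i \<omega>)"
    unfolding psu_total_est_def wtotal_def sum_divide_distrib using d by (intro sum.cong) (auto simp: divide_inverse)
  have "(\<Sum>k<size2 D i. (r (point D i k \<omega>) / pi2 D i (point D i k \<omega>) - psu_total_est D r i \<omega> / size2 D i)\<^sup>2) =
    (pi1 D i)\<^sup>2 * (\<Sum>k<size2 D i. (wdraw r i (points i \<omega> k) - wtotal r i (points i \<omega>) / size2 D i)\<^sup>2)"
    unfolding sum_distrib_left
  proof (rule sum.cong[OF refl])
    fix k assume "k \<in> {..<size2 D i}"
    then have k: "r (point D i k \<omega>) / pi2 D i (point D i k \<omega>) = pi1 D i * wdraw r i (points i \<omega> k)"
      using d[of k] p0 by simp
    have t: "psu_total_est D r i \<omega> = pi1 D i * wtotal r i (points i \<omega>)"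
      unfolding 1[symmetric] using p0 by simp
    show "(r (point D i k \<omega>) / pi2 D i (point D i k \<omega>) - psu_total_est D r i \<omega> / size2 D i)\<^sup>2 =
      (pi1 D i)\<^sup>2 * (wdraw r i (points i \<omega> k) - wtotal r i (points i \<omega>) / size2 D i)\<^sup>2"
      unfolding k t power_mult_distrib[symmetric] by (simp add: right_diff_distrib)
  qed
  then show "second_stage_var_est D r i \<omega> = (pi1 D i)\<^sup>2 * wvar r i (points i \<omega>)"
    unfolding second_stage_var_est_def wvar_def by simp
qed

lemma horvitz_thompson_eq:
  assumes "\<omega> \<in> space M"
  shows "horvitz_thompson D r \<omega> = (\<Sum>i\<in>S \<omega>. wtotal r i (points i \<omega>))"
  unfolding horvitz_thompson_def using estimators_eq(1)[OF assms]
  by (intro sum.cong) (auto simp: divide_inverse mult.commute)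

end

section \<open>The Horvitz--Thompson estimator\<close>

lemma sqrt_power4: "0 \<le> x \<Longrightarrow> sqrt x ^ 4 = x\<^sup>2"
proof -
  assume "0 \<le> x"
  moreover have "sqrt x ^ 4 = ((sqrt x)\<^sup>2)\<^sup>2" by (simp only: power_mult[symmetric]) simp
  ultimately show ?thesis by simp
qed

lemma iexp_quadratic:
  fixes y :: real
  shows "cmod (exp (\<i> * of_real y) - (1 + \<i> * of_real y - of_real (y\<^sup>2 / 2))) \<le> \<bar>y\<bar> ^ 3 / 6"
proof -
  have "{..2::nat} = {0, 1, 2}" by auto
  then have "(\<Sum>k\<le>2. (\<i> * complex_of_real y) ^ k / fact k) = 1 + \<i> * of_real y - of_real (y\<^sup>2 / 2)"
    by (simp add: power_mult_distrib)
  then show ?thesis using iexp_approx1[of y 2] by (simp add: fact_numeral)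
qed

lemma approximates_poissonD:
  assumes "approximates_poisson K N n p \<epsilon> q"
  shows "\<forall>i<N. 0 \<le> q i \<and> q i \<le> 1" "0 < poisson_var {..<N} q" "(\<Sum>i<N. q i) \<le> K * n"
    "(\<Sum>i<N. \<bar>incl_prob p i - q i\<bar>) \<le> K * sqrt n"
proof -
  note A = assms[unfolded approximates_poisson_def]
  show "\<forall>i<N. 0 \<le> q i \<and> q i \<le> 1" using A by (elim conjE)
  show "0 < poisson_var {..<N} q" using A by (elim conjE)
  show "(\<Sum>i<N. q i) \<le> K * n" using A by (elim conjE)
  show "(\<Sum>i<N. \<bar>incl_prob p i - q i\<bar>) \<le> K * sqrt n" using A by (elim conjE)
qed

lemma approximates_poisson_fourth_moment:
  assumes "approximates_poisson K N n p \<epsilon> q" "\<And>i. i < N \<Longrightarrow> \<bar>c i\<bar> \<le> b"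
  shows "(\<Sum>s\<in>Pow {..<N}. pmf p s * ((\<Sum>i\<in>s. c i) - (\<Sum>i<N. q i * c i)) ^ 4) \<le> K * (1 + \<epsilon>) * b ^ 4 * (real n)\<^sup>2"
proof -
  have "\<forall>c b. (\<forall>i<N. \<bar>c i\<bar> \<le> b) \<longrightarrow>
      (\<Sum>s\<in>Pow {..<N}. pmf p s * ((\<Sum>i\<in>s. c i) - (\<Sum>i<N. q i * c i)) ^ 4) \<le> K * (1 + \<epsilon>) * b ^ 4 * (real n)\<^sup>2"
    using assms(1) unfolding approximates_poisson_def by (elim conjE)
  from this[THEN spec[where x = c], THEN spec[where x = b]] show ?thesis by (elim impE) (use assms(2) in simp_all)
qed

lemma approximates_poisson_char:
  fixes h :: "nat \<Rightarrow> complex"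
  assumes "approximates_poisson K N n p \<epsilon> q" "0 \<le> B" "B \<le> sqrt n"
    and "\<And>i. i < N \<Longrightarrow> cmod (h i) \<le> 1 \<and> cmod (h i - (1 + \<i> * of_real (m i) - of_real (v i / 2))) \<le> (B / sqrt n) ^ 3 \<and>
        \<bar>m i\<bar> \<le> B / sqrt n \<and> (m i)\<^sup>2 \<le> v i \<and> v i \<le> (B / sqrt n)\<^sup>2"
    and "(\<Sum>i<N. q i * (1 - q i) * m i) = 0"
  shows "cmod ((\<Sum>s\<in>Pow {..<N}. pmf p s * (\<Prod>i\<in>s. h i)) -
        exp (\<i> * of_real (\<Sum>i<N. q i * m i) - of_real ((\<Sum>i<N. q i * v i - (q i)\<^sup>2 * (m i)\<^sup>2) / 2)))
      \<le> \<epsilon> + K * clt_const (337 * B) / sqrt n"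
proof -
  have "\<forall>(h :: nat \<Rightarrow> complex) m v B. 0 \<le> B \<longrightarrow> B \<le> sqrt n \<longrightarrow>
      (\<forall>i<N. cmod (h i) \<le> 1 \<and> cmod (h i - (1 + \<i> * of_real (m i) - of_real (v i / 2))) \<le> (B / sqrt n) ^ 3 \<and>
        \<bar>m i\<bar> \<le> B / sqrt n \<and> (m i)\<^sup>2 \<le> v i \<and> v i \<le> (B / sqrt n)\<^sup>2) \<longrightarrow>
      (\<Sum>i<N. q i * (1 - q i) * m i) = 0 \<longrightarrow>
      cmod ((\<Sum>s\<in>Pow {..<N}. pmf p s * (\<Prod>i\<in>s. h i)) -
        exp (\<i> * of_real (\<Sum>i<N. q i * m i) - of_real ((\<Sum>i<N. q i * v i - (q i)\<^sup>2 * (m i)\<^sup>2) / 2)))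
      \<le> \<epsilon> + K * clt_const (337 * B) / sqrt n"
    using assms(1) unfolding approximates_poisson_def by (elim conjE)
  from this[THEN spec[where x = h], THEN spec[where x = m], THEN spec[where x = v], THEN spec[where x = B]]
  show ?thesis by (elim impE) (use assms(2-) in simp_all)
qed

lemma power4_add_le:
  fixes x y :: real
  shows "(x + y) ^ 4 \<le> 8 * (x ^ 4 + y ^ 4)"
proof -
  have 1: "(x + y)\<^sup>2 \<le> 2 * (x\<^sup>2 + y\<^sup>2)" for x y :: real
    using zero_le_power2[of "x - y"] by (simp add: power2_sum power2_diff)
  have "((x + y)\<^sup>2)\<^sup>2 \<le> (2 * (x\<^sup>2 + y\<^sup>2))\<^sup>2" by (rule power_mono[OF 1]) simp
  also have "\<dots> = 4 * (x\<^sup>2 + y\<^sup>2)\<^sup>2" by (simp only: power_mult_distrib) simp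
  also have "\<dots> \<le> 4 * (2 * ((x\<^sup>2)\<^sup>2 + (y\<^sup>2)\<^sup>2))" using 1[of "x\<^sup>2" "y\<^sup>2"] by (intro mult_left_mono) auto
  finally show ?thesis by (simp flip: power_mult)
qed

text \<open>Instead of Hoelder's inequality, the fourth power is bounded from below by its tangent
  line at \<open>\<bar>x\<bar> = c\<close>, and this pointwise inequality is integrated.\<close>

lemma (in prob_space) expectation_abs_le_of_fourth_moment:
  fixes X :: "'a \<Rightarrow> real"
  assumes int: "integrable M (\<lambda>x. X x ^ 4)" "integrable M X" and c: "0 < c" "expectation (\<lambda>x. X x ^ 4) \<le> c ^ 4"
  shows "expectation (\<lambda>x. \<bar>X x\<bar>) \<le> c"
proof -
  have pt: "\<bar>x\<bar> \<le> 3 / 4 * c + x ^ 4 / (4 * c ^ 3)" for x :: real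
  proof -
    define y where "y = \<bar>x\<bar> / c"
    \<comment> \<open>The factorization of \<open>y ^ 4 - 4 * y + 3\<close>, whose double root at 1
      expresses the tangency.\<close>
    have "0 \<le> (y - 1)\<^sup>2 * ((y + 1)\<^sup>2 + 2)" by (intro mult_nonneg_nonneg) auto
    also have "\<dots> = y ^ 4 - 4 * y + 3" by (simp add: power2_eq_square power4_eq_xxxx algebra_simps)
    finally have "y \<le> 3 / 4 + y ^ 4 / 4" by simp
    then have "c * y \<le> c * (3 / 4 + y ^ 4 / 4)" using c by (intro mult_left_mono) auto
    moreover have "c * y = \<bar>x\<bar>" using c by (simp add: y_def)
    moreover have "c * (3 / 4 + y ^ 4 / 4) = 3 / 4 * c + x ^ 4 / (4 * c ^ 3)"
      using c by (simp add: y_def power_divide distrib_left eval_nat_numeral)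
    ultimately show ?thesis by simp
  qed
  have "expectation (\<lambda>x. \<bar>X x\<bar>) \<le> expectation (\<lambda>x. 3 / 4 * c + X x ^ 4 / (4 * c ^ 3))"
    using int pt by (intro integral_mono) auto
  also have "\<dots> = 3 / 4 * c + expectation (\<lambda>x. X x ^ 4) / (4 * c ^ 3)" using int by (simp add: prob_space)
  also have "\<dots> \<le> 3 / 4 * c + c ^ 4 / (4 * c ^ 3)" using c by (intro add_left_mono divide_right_mono) auto
  also have "\<dots> = c" using c by (simp add: eval_nat_numeral)
  finally show ?thesis .
qed

context two_stage_population
begin

lemma integrable_bounded:
  fixes f :: "'w \<Rightarrow> 'b::{banach, second_countable_topology}"
  assumes "f \<in> borel_measurable M" "\<And>\<omega>. \<omega> \<in> space M \<Longrightarrow> norm (f \<omega>) \<le> c"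
  shows "integrable M f"
  by (rule integrable_const_bound[of _ c]) (use assms in auto)

lemma group_sum_measurable:
  assumes "group_stat G b"
  shows "(\<lambda>\<omega>. \<Sum>i\<in>S \<omega>. G i (points i \<omega>)) \<in> borel_measurable M"
proof (rule measurable_by_sample1[of "\<lambda>s \<omega>. \<Sum>i\<in>s. G i (points i \<omega>)"])
  fix s :: "nat set" assume "s \<subseteq> {..<N}"
  then show "(\<lambda>\<omega>. \<Sum>i\<in>s. G i (points i \<omega>)) \<in> borel_measurable M"
    by (intro borel_measurable_sum group_stat_measurable(1)[OF assms]) auto
qed

lemma group_sum_bound:
  fixes b :: real
  assumes "group_stat G b" "\<omega> \<in> space M"
  shows "\<bar>\<Sum>i\<in>S \<omega>. G i (points i \<omega>)\<bar> \<le> n * b"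
proof -
  have "\<bar>\<Sum>i\<in>S \<omega>. G i (points i \<omega>)\<bar> \<le> (\<Sum>i\<in>S \<omega>. \<bar>G i (points i \<omega>)\<bar>)" by (rule sum_abs)
  also have "\<dots> \<le> (\<Sum>i\<in>S \<omega>. b)" using assms(1) sample1_subset[OF assms(2)] by (intro sum_mono) (auto simp: group_stat_def)
  finally show ?thesis by (simp add: sample1_card[OF assms(2)])
qed

text \<open>The second part is the conditional Jensen inequality: given the sample, the second
  moment is at least the square of the conditional mean. It later bounds the variance from below by
  its first-stage component.\<close>

lemma expectation_group_sum:
  assumes G: "group_stat G b"
  shows "expectation (\<lambda>\<omega>. \<Sum>i\<in>S \<omega>. G i (points i \<omega>)) = (\<Sum>i<N. pi1 D i * gmean G i)"
    and "(\<Sum>s\<in>Pow {..<N}. pmf p s * (\<Sum>i\<in>s. gmean G i)\<^sup>2) \<le> expectation (\<lambda>\<omega>. (\<Sum>i\<in>S \<omega>. G i (points i \<omega>))\<^sup>2)"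
proof -
  have meas: "(\<lambda>\<omega>. \<Sum>i\<in>s. G i (points i \<omega>)) \<in> borel_measurable M" if "s \<subseteq> {..<N}" for s
    using group_stat_measurable(1)[OF G] that by (intro borel_measurable_sum) auto
  have given_mean: "(\<integral>\<omega>. (\<Sum>i\<in>s. G i (points i \<omega>)) \<partial>given_sample1 D s) = (\<Sum>i\<in>s. gmean G i)"
    and given_sq: "(\<Sum>i\<in>s. gmean G i)\<^sup>2 \<le> (\<integral>\<omega>. (\<Sum>i\<in>s. G i (points i \<omega>))\<^sup>2 \<partial>given_sample1 D s)"
    if s: "s \<in> set_pmf p" for s
  proof -
    interpret given: prob_space "given_sample1 D s" by (rule prob_space_given_sample1[OF s])
    have sN: "s \<subseteq> {..<N}" using s design1_support_Pow by auto
    have card: "card s = n" using design1_support s by (auto simp: fixed_size_samples_def)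
    have int: "integrable (given_sample1 D s) (\<lambda>\<omega>. G i (points i \<omega>))" if "i \<in> s" for i
      using that sN group_stat_measurable(1)[OF G] G
      by (intro given.integrable_const_bound[of _ b]) (auto simp: group_stat_def)
    have "(\<integral>\<omega>. (\<Sum>i\<in>s. G i (points i \<omega>)) \<partial>given_sample1 D s) = (\<Sum>i\<in>s. \<integral>\<omega>. G i (points i \<omega>) \<partial>given_sample1 D s)"
      using int by (rule Bochner_Integration.integral_sum)
    also have "\<dots> = (\<Sum>i\<in>s. gmean G i)"
      unfolding gmean_def by (intro sum.cong refl integral_given_group[OF s]) (use G sN in \<open>auto simp: group_stat_def\<close>)
    finally show mean: "(\<integral>\<omega>. (\<Sum>i\<in>s. G i (points i \<omega>)) \<partial>given_sample1 D s) = (\<Sum>i\<in>s. gmean G i)" .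
    let ?X = "\<lambda>\<omega>. \<Sum>i\<in>s. G i (points i \<omega>)"
    have bd: "\<bar>?X \<omega>\<bar> \<le> n * b" for \<omega>
    proof -
      have "\<bar>?X \<omega>\<bar> \<le> (\<Sum>i\<in>s. \<bar>G i (points i \<omega>)\<bar>)" by (rule sum_abs)
      also have "\<dots> \<le> (\<Sum>i\<in>s. b)" using G sN by (intro sum_mono) (auto simp: group_stat_def)
      finally show ?thesis by (simp add: card)
    qed
    have iX: "integrable (given_sample1 D s) ?X" by (rule given.integrable_const_bound[of _ "n * b"]) (use bd meas[OF sN] in auto)
    have iX2: "integrable (given_sample1 D s) (\<lambda>\<omega>. (?X \<omega>)\<^sup>2)"
    proof (rule given.integrable_const_bound[of _ "(n * b)\<^sup>2"])
      show "AE \<omega> in given_sample1 D s. norm ((?X \<omega>)\<^sup>2) \<le> (n * b)\<^sup>2"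
        using power_mono[OF bd, of _ 2] by (intro AE_I2) simp
    qed (use meas[OF sN] in simp)
    have "0 \<le> given.expectation (\<lambda>\<omega>. (?X \<omega> - (\<Sum>i\<in>s. gmean G i))\<^sup>2)" by (rule Bochner_Integration.integral_nonneg) simp
    also have "\<dots> = given.expectation (\<lambda>\<omega>. (?X \<omega>)\<^sup>2) - (\<Sum>i\<in>s. gmean G i)\<^sup>2"
      unfolding mean[symmetric] by (rule given.variance_eq[OF iX iX2])
    finally show "(\<Sum>i\<in>s. gmean G i)\<^sup>2 \<le> (\<integral>\<omega>. (?X \<omega>)\<^sup>2 \<partial>given_sample1 D s)" by simp
  qed
  have "expectation (\<lambda>\<omega>. \<Sum>i\<in>S \<omega>. G i (points i \<omega>)) =
      (\<Sum>s\<in>Pow {..<N}. pmf p s *\<^sub>R (\<integral>\<omega>. (\<Sum>i\<in>s. G i (points i \<omega>)) \<partial>given_sample1 D s))"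
    by (rule expectation_by_sample1[where B = "n * b"]) (use meas group_sum_bound[OF G] in auto)
  also have "\<dots> = (\<Sum>s\<in>Pow {..<N}. pmf p s * (\<Sum>i\<in>s. gmean G i))"
    by (rule sum.cong[OF refl]) (use given_mean in \<open>auto simp: set_pmf_eq\<close>)
  also have "\<dots> = (\<Sum>i<N. pi1 D i * gmean G i)" by (rule expectation_linear_statistic[OF design1_support_Pow])
  finally show "expectation (\<lambda>\<omega>. \<Sum>i\<in>S \<omega>. G i (points i \<omega>)) = (\<Sum>i<N. pi1 D i * gmean G i)" .
  have "expectation (\<lambda>\<omega>. (\<Sum>i\<in>S \<omega>. G i (points i \<omega>))\<^sup>2) =
      (\<Sum>s\<in>Pow {..<N}. pmf p s *\<^sub>R (\<integral>\<omega>. (\<Sum>i\<in>s. G i (points i \<omega>))\<^sup>2 \<partial>given_sample1 D s))"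
  proof (rule expectation_by_sample1[where B = "(n * b)\<^sup>2"])
    fix \<omega> assume "\<omega> \<in> space M"
    then show "norm ((\<Sum>i\<in>S \<omega>. G i (points i \<omega>))\<^sup>2) \<le> (n * b)\<^sup>2"
      using power_mono[OF group_sum_bound[OF G], of \<omega> 2] by simp
  qed (use meas in auto)
  moreover have "(\<Sum>s\<in>Pow {..<N}. pmf p s * (\<Sum>i\<in>s. gmean G i)\<^sup>2) \<le>
      (\<Sum>s\<in>Pow {..<N}. pmf p s *\<^sub>R (\<integral>\<omega>. (\<Sum>i\<in>s. G i (points i \<omega>))\<^sup>2 \<partial>given_sample1 D s))"
  proof (rule sum_mono)
    fix s
    show "pmf p s * (\<Sum>i\<in>s. gmean G i)\<^sup>2 \<le> pmf p s *\<^sub>R (\<integral>\<omega>. (\<Sum>i\<in>s. G i (points i \<omega>))\<^sup>2 \<partial>given_sample1 D s)"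
      using given_sq[of s] by (cases "s \<in> set_pmf p") (auto simp: set_pmf_eq mult_left_mono)
  qed
  ultimately show "(\<Sum>s\<in>Pow {..<N}. pmf p s * (\<Sum>i\<in>s. gmean G i)\<^sup>2) \<le> expectation (\<lambda>\<omega>. (\<Sum>i\<in>S \<omega>. G i (points i \<omega>))\<^sup>2)"
    by simp
qed

lemma sum_pi1: "(\<Sum>i<N. pi1 D i) = n"
proof -
  have "(\<Sum>i<N. pi1 D i * 1) = (\<Sum>s\<in>Pow {..<N}. pmf p s * (\<Sum>i\<in>s. 1))"
    by (rule expectation_linear_statistic[OF design1_support_Pow, symmetric])
  also have "\<dots> = (\<Sum>s\<in>Pow {..<N}. pmf p s * n)"
  proof (rule sum.cong[OF refl])
    fix s
    show "pmf p s * (\<Sum>i\<in>s. 1) = pmf p s * n"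
      using design1_support by (cases "s \<in> set_pmf p") (auto simp: set_pmf_eq fixed_size_samples_def)
  qed
  finally show ?thesis by (simp add: sum_distrib_right[symmetric] sum_pmf_Pow[OF design1_support_Pow])
qed

text \<open>The double sum of covariances is the variance, over the first stage alone, of the sum of
  \<open>total (psu D i) r / pi1 D i\<close> over the sample. This form can be compared with
  expectations over samples.\<close>

lemma first_stage_var_eq:
  "first_stage_var D r = (\<Sum>s\<in>Pow {..<N}. pmf p s * (\<Sum>i\<in>s. total (psu D i) r / pi1 D i)\<^sup>2) - (\<Sum>i<N. total (psu D i) r)\<^sup>2"
proof -
  define z where "z i = total (psu D i) r / pi1 D i" for i
  have pz: "pi1 D i * z i = total (psu D i) r" if "i < N" for i using incl_pos[OF that] by (simp add: z_def)
  have ip2: "incl_prob2 p i j = (\<Sum>s\<in>Pow {..<N}. pmf p s * (of_bool (i \<in> s) * of_bool (j \<in> s)))" for i j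
  proof -
    have "incl_prob2 p i j = measure_pmf.prob p ({s. i \<in> s \<and> j \<in> s} \<inter> set_pmf p)"
      by (simp add: incl_prob2_def measure_Int_set_pmf)
    also have "{s. i \<in> s \<and> j \<in> s} \<inter> set_pmf p = {s \<in> Pow {..<N}. i \<in> s \<and> j \<in> s} \<inter> set_pmf p"
      using design1_support_Pow by auto
    also have "measure_pmf.prob p \<dots> = measure_pmf.prob p {s \<in> Pow {..<N}. i \<in> s \<and> j \<in> s}"
      by (rule measure_Int_set_pmf)
    also have "\<dots> = (\<Sum>s | s \<in> Pow {..<N} \<and> i \<in> s \<and> j \<in> s. pmf p s)" by (intro measure_measure_pmf_finite) auto
    also have "\<dots> = (\<Sum>s\<in>Pow {..<N}. pmf p s * (of_bool (i \<in> s) * of_bool (j \<in> s)))"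
      by (subst sum.inter_filter, simp, rule sum.cong, auto)
    finally show ?thesis .
  qed
  have sq: "(\<Sum>i\<in>s. z i)\<^sup>2 = (\<Sum>i<N. \<Sum>j<N. of_bool (i \<in> s) * of_bool (j \<in> s) * (z i * z j))" if "s \<in> Pow {..<N}" for s
  proof -
    have "(\<Sum>i\<in>s. z i) = (\<Sum>i<N. if i \<in> s then z i else 0)"
      using that sum.inter_restrict[of "{..<N}" z s] by (simp add: Int_absorb1)
    also have "\<dots> = (\<Sum>i<N. of_bool (i \<in> s) * z i)" by (rule sum.cong) auto
    finally have c: "(\<Sum>i\<in>s. z i) = (\<Sum>i<N. of_bool (i \<in> s) * z i)" .
    show ?thesis unfolding c power2_eq_square sum_product by (intro sum.cong refl) (simp only: mult_ac)
  qed
  have "(\<Sum>s\<in>Pow {..<N}. pmf p s * (\<Sum>i\<in>s. z i)\<^sup>2) =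
      (\<Sum>s\<in>Pow {..<N}. \<Sum>i<N. \<Sum>j<N. pmf p s * (of_bool (i \<in> s) * of_bool (j \<in> s)) * (z i * z j))"
    by (rule sum.cong[OF refl]) (simp only: sq sum_distrib_left mult.assoc)
  also have "\<dots> = (\<Sum>i<N. \<Sum>s\<in>Pow {..<N}. \<Sum>j<N. pmf p s * (of_bool (i \<in> s) * of_bool (j \<in> s)) * (z i * z j))"
    by (rule sum.swap)
  also have "\<dots> = (\<Sum>i<N. \<Sum>j<N. \<Sum>s\<in>Pow {..<N}. pmf p s * (of_bool (i \<in> s) * of_bool (j \<in> s)) * (z i * z j))"
    by (intro sum.cong refl sum.swap)
  also have "\<dots> = (\<Sum>i<N. \<Sum>j<N. incl_prob2 p i j * (z i * z j))"
    by (simp only: ip2 sum_distrib_right)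
  finally have A: "(\<Sum>s\<in>Pow {..<N}. pmf p s * (\<Sum>i\<in>s. z i)\<^sup>2) = (\<Sum>i<N. \<Sum>j<N. incl_prob2 p i j * (z i * z j))" .
  have B: "(\<Sum>i<N. total (psu D i) r)\<^sup>2 = (\<Sum>i<N. \<Sum>j<N. (pi1 D i * pi1 D j) * (z i * z j))"
  proof -
    have "(\<Sum>i<N. total (psu D i) r) = (\<Sum>i<N. pi1 D i * z i)" by (rule sum.cong) (auto simp: pz)
    then show ?thesis by (simp add: power2_eq_square sum_product mult_ac)
  qed
  show ?thesis
    unfolding z_def[symmetric] A B first_stage_var_def incl_cov_def sum_subtractf[symmetric]
    by (intro sum.cong refl) (simp add: algebra_simps)
qed

end

context regular_population
begin

abbreviation hT :: "('a \<Rightarrow> real) \<Rightarrow> 'w \<Rightarrow> real" where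
  "hT r \<omega> \<equiv> (\<Sum>i\<in>S \<omega>. wtotal r i (points i \<omega>))"

lemma bounded_variable_integrable:
  assumes r: "bounded_variable r B" and F: "F \<in> lmeasurable"
  shows "integrable (lebesgue_on F) r"
proof -
  interpret FM: finite_measure "lebesgue_on F" using F by (rule finite_measure_lebesgue_on)
  show ?thesis using r F_measurable
    by (intro FM.integrable_const_bound[of _ B]) (auto simp: bounded_variable_def)
qed

lemma sum_psu_total:
  assumes r: "bounded_variable r B" and F: "F \<in> lmeasurable"
  shows "(\<Sum>i<N. total (psu D i) r) = total F r"
proof -
  have int: "integrable lebesgue (\<lambda>x. indicator F x *\<^sub>R r x)"
    using bounded_variable_integrable[OF assms] F_measurable by (simp add: integrable_restrict_space)
  have inti: "integrable lebesgue (\<lambda>x. indicator (psu D i) x *\<^sub>R r x)" if "i < N" for i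
  proof -
    have "(\<lambda>x. indicator (psu D i) x *\<^sub>R (indicator F x *\<^sub>R r x)) = (\<lambda>x. indicator (psu D i) x *\<^sub>R r x)"
      using psu_facts(2)[OF that] by (auto simp: fun_eq_iff split: split_indicator)
    then show ?thesis using integrable_mult_indicator[OF psu_facts(1)[OF that] int] by simp
  qed
  have "(\<Sum>i<N. total (psu D i) r) = (\<Sum>i<N. \<integral>x. indicator (psu D i) x *\<^sub>R r x \<partial>lebesgue)"
    unfolding total_def using psu_facts(1) by (intro sum.cong refl integral_restrict_space) auto
  also have "\<dots> = (\<integral>x. (\<Sum>i<N. indicator (psu D i) x *\<^sub>R r x) \<partial>lebesgue)"
    using inti by (intro Bochner_Integration.integral_sum[symmetric]) auto
  also have "\<dots> = (\<integral>x. indicator F x *\<^sub>R r x \<partial>lebesgue)"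
  proof (rule Bochner_Integration.integral_cong[OF refl])
    fix x
    have "(\<Sum>i<N. indicator (psu D i) x) = (indicator F x :: real)"
      unfolding F_partition(1)[symmetric] by (rule indicator_UN_disjoint[OF _ F_partition(2), symmetric]) simp
    then show "(\<Sum>i<N. indicator (psu D i) x *\<^sub>R r x) = indicator F x *\<^sub>R r x"
      by (simp add: sum_distrib_right[symmetric])
  qed
  also have "\<dots> = total F r" unfolding total_def using F_measurable by (intro integral_restrict_space[symmetric]) auto
  finally show ?thesis .
qed

end

text \<open>\<open>hT\<close> is the Horvitz--Thompson estimator, \<open>sreg\<close> the coefficient \<open>R\<close> of the regression on the
  sample size under the Poisson design, and \<open>svar\<close> the variance of the residual.\<close>

locale approximated_population = regular_population F D \<alpha> \<beta>
  for F :: "'a::euclidean_space set" and D :: "('a, 'w) two_stage" and \<alpha> \<beta> :: real +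
  fixes K \<epsilon> :: real and q :: "nat \<Rightarrow> real"
  assumes approx: "approximates_poisson K (psu_count D) (size1 D) (design1 D) \<epsilon> q"
    and K: "1 \<le> K" and \<epsilon>: "0 \<le> \<epsilon>" "\<epsilon> \<le> 1"
begin

section \<open>Moments of sums over the sampled PSUs\<close>

definition C4 :: real where "C4 = 8 * (2304 + 2 * K)"

lemma q_facts: "i < N \<Longrightarrow> 0 \<le> q i" "i < N \<Longrightarrow> q i \<le> 1"
  and q_sum: "(\<Sum>i<N. q i) \<le> K * n"
  and q_close: "(\<Sum>i<N. \<bar>pi1 D i - q i\<bar>) \<le> K * sqrt n"
  and q_var: "0 < poisson_var {..<N} q"
  using approximates_poissonD[OF approx] by blast+

lemma C4_ge1: "1 \<le> C4" using K by (simp add: C4_def)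

text \<open>The exchange rate between inclusion probabilities and drawing probabilities. With
  contributions of order \<open>1 / n\<close> it costs \<open>1 / sqrt n\<close>, the same order as
  the standard deviation; hence some centers need a finer argument later.\<close>

lemma weighted_q_close:
  assumes "\<And>i. i < N \<Longrightarrow> \<bar>c i\<bar> \<le> b" "0 \<le> b"
  shows "\<bar>\<Sum>i<N. (pi1 D i - q i) * c i\<bar> \<le> b * (K * sqrt n)"
proof -
  have "\<bar>\<Sum>i<N. (pi1 D i - q i) * c i\<bar> \<le> (\<Sum>i<N. \<bar>(pi1 D i - q i) * c i\<bar>)" by (rule sum_abs)
  also have "\<dots> \<le> (\<Sum>i<N. \<bar>pi1 D i - q i\<bar> * b)"
    unfolding abs_mult using assms by (intro sum_mono mult_left_mono) auto
  also have "\<dots> = b * (\<Sum>i<N. \<bar>pi1 D i - q i\<bar>)" by (simp add: sum_distrib_left mult.commute)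
  also have "\<dots> \<le> b * (K * sqrt n)" using q_close assms(2) by (rule mult_left_mono)
  finally show ?thesis .
qed

text \<open>Splits the deviation into the second-stage noise given the sample and the first-stage
  fluctuation of the conditional means. The constant \<open>C4\<close> adds 2304 for the former and
  \<open>2 * K\<close> for the latter, as \<open>1 + \<epsilon> \<le> 2\<close>, times 8 for the
  fourth power of a sum.\<close>

lemma group_sum_fourth_moment:
  assumes G: "group_stat G b"
  shows "expectation (\<lambda>\<omega>. ((\<Sum>i\<in>S \<omega>. G i (points i \<omega>)) - (\<Sum>i<N. q i * gmean G i)) ^ 4) \<le> C4 * b ^ 4 * (real n)\<^sup>2"
proof -
  let ?z = "gmean G"
  let ?X = "\<lambda>\<omega>. \<Sum>i\<in>S \<omega>. G i (points i \<omega>) - ?z i"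
  let ?Y = "\<lambda>s. (\<Sum>i\<in>s. ?z i) - (\<Sum>i<N. q i * ?z i)"
  have mX: "?X \<in> borel_measurable M"
  proof (rule measurable_by_sample1[of "\<lambda>s \<omega>. \<Sum>i\<in>s. G i (points i \<omega>) - ?z i"])
    fix s :: "nat set" assume "s \<subseteq> {..<N}"
    then show "(\<lambda>\<omega>. \<Sum>i\<in>s. G i (points i \<omega>) - ?z i) \<in> borel_measurable M"
      by (intro borel_measurable_sum borel_measurable_diff group_stat_measurable(1)[OF G]) auto
  qed
  have mY: "(\<lambda>\<omega>. ?Y (S \<omega>)) \<in> borel_measurable M"
    by (rule measurable_by_sample1[of "\<lambda>s _. ?Y s"]) simp
  have gb: "\<bar>?z i\<bar> \<le> b" "\<bar>G i x\<bar> \<le> b" if "i < N" for i x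
    using gmean_bound[OF G that] G that by (auto simp: group_stat_def)
  have Xb: "\<bar>?X \<omega>\<bar> \<le> n * (2 * b)" if w: "\<omega> \<in> space M" for \<omega>
  proof -
    have "\<bar>?X \<omega>\<bar> \<le> (\<Sum>i\<in>S \<omega>. \<bar>G i (points i \<omega>) - ?z i\<bar>)" by (rule sum_abs)
    also have "\<dots> \<le> (\<Sum>i\<in>S \<omega>. 2 * b)"
    proof (rule sum_mono)
      fix i assume "i \<in> S \<omega>"
      then have "i < N" using sample1_subset[OF w] by auto
      then show "\<bar>G i (points i \<omega>) - ?z i\<bar> \<le> 2 * b" using gb(1)[of i] gb(2)[of i "points i \<omega>"] by linarith
    qed
    finally show ?thesis by (simp add: sample1_card[OF w])
  qed
  have iX: "integrable M (\<lambda>\<omega>. ?X \<omega> ^ 4)"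
  proof (rule integrable_bounded)
    fix \<omega> assume "\<omega> \<in> space M"
    then show "norm (?X \<omega> ^ 4) \<le> (n * (2 * b)) ^ 4"
      unfolding real_norm_def power_abs by (intro power_mono Xb) auto
  qed (use mX in simp)
  have iY: "integrable M (\<lambda>\<omega>. ?Y (S \<omega>) ^ 4)"
  proof (rule integrable_bounded)
    fix \<omega> assume "\<omega> \<in> space M"
    then show "norm (?Y (S \<omega>) ^ 4) \<le> (\<Sum>s\<in>Pow {..<N}. \<bar>?Y s ^ 4\<bar>)"
      using member_le_sum[of "S \<omega>" "Pow {..<N}" "\<lambda>s. \<bar>?Y s ^ 4\<bar>"] sample1_subset by auto
  qed (use mY in simp)
  have "expectation (\<lambda>\<omega>. ((\<Sum>i\<in>S \<omega>. G i (points i \<omega>)) - (\<Sum>i<N. q i * ?z i)) ^ 4) =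
      expectation (\<lambda>\<omega>. (?X \<omega> + ?Y (S \<omega>)) ^ 4)" by (simp add: sum_subtractf)
  also have "\<dots> \<le> expectation (\<lambda>\<omega>. 8 * (?X \<omega> ^ 4 + ?Y (S \<omega>) ^ 4))"
  proof (rule integral_mono_AE')
    show "integrable M (\<lambda>\<omega>. 8 * (?X \<omega> ^ 4 + ?Y (S \<omega>) ^ 4))" using iX iY by simp
    show "AE \<omega> in M. (?X \<omega> + ?Y (S \<omega>)) ^ 4 \<le> 8 * (?X \<omega> ^ 4 + ?Y (S \<omega>) ^ 4)"
      by (intro AE_I2 power4_add_le)
    show "AE \<omega> in M. 0 \<le> 8 * (?X \<omega> ^ 4 + ?Y (S \<omega>) ^ 4)" by (intro AE_I2) simp
  qed
  also have "\<dots> = 8 * (expectation (\<lambda>\<omega>. ?X \<omega> ^ 4) + expectation (\<lambda>\<omega>. ?Y (S \<omega>) ^ 4))" using iX iY by simp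
  also have "\<dots> \<le> 8 * (2304 * b ^ 4 * (real n)\<^sup>2 + 2 * K * b ^ 4 * (real n)\<^sup>2)"
  proof (intro mult_left_mono add_mono)
    show "expectation (\<lambda>\<omega>. ?X \<omega> ^ 4) \<le> 2304 * b ^ 4 * (real n)\<^sup>2"
      by (rule centered_group_sum_fourth_moment[OF G size1_pos])
    have "expectation (\<lambda>\<omega>. ?Y (S \<omega>) ^ 4) = (\<Sum>s\<in>Pow {..<N}. pmf p s * ?Y s ^ 4)"
      by (rule expectation_of_sample1)
    also have "\<dots> \<le> K * (1 + \<epsilon>) * b ^ 4 * (real n)\<^sup>2"
      by (rule approximates_poisson_fourth_moment[OF approx gb(1)])
    also have "\<dots> \<le> K * 2 * b ^ 4 * (real n)\<^sup>2"
      using K \<epsilon> by (intro mult_right_mono mult_left_mono) auto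
    finally show "expectation (\<lambda>\<omega>. ?Y (S \<omega>) ^ 4) \<le> 2 * K * b ^ 4 * (real n)\<^sup>2" by (simp add: mult_ac)
  qed simp
  finally show ?thesis by (simp add: C4_def algebra_simps)
qed

lemma group_sum_abs_moment:
  assumes G: "group_stat G b" and b: "0 < b"
  shows "expectation (\<lambda>\<omega>. \<bar>(\<Sum>i\<in>S \<omega>. G i (points i \<omega>)) - (\<Sum>i<N. q i * gmean G i)\<bar>) \<le> C4 * b * sqrt n"
proof (rule expectation_abs_le_of_fourth_moment)
  let ?X = "\<lambda>\<omega>. (\<Sum>i\<in>S \<omega>. G i (points i \<omega>)) - (\<Sum>i<N. q i * gmean G i)"
  have m: "?X \<in> borel_measurable M" using group_sum_measurable[OF G] by simp
  have bd: "\<bar>?X \<omega>\<bar> \<le> n * b + \<bar>\<Sum>i<N. q i * gmean G i\<bar>" if "\<omega> \<in> space M" for \<omega>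
    using group_sum_bound[OF G that] by linarith
  show "integrable M ?X" by (rule integrable_bounded[OF m]) (use bd in auto)
  show "integrable M (\<lambda>\<omega>. ?X \<omega> ^ 4)"
  proof (rule integrable_bounded)
    fix \<omega> assume "\<omega> \<in> space M"
    then show "norm (?X \<omega> ^ 4) \<le> (n * b + \<bar>\<Sum>i<N. q i * gmean G i\<bar>) ^ 4"
      unfolding real_norm_def power_abs by (intro power_mono bd) auto
  qed (use m in simp)
  show "0 < C4 * b * sqrt n" using C4_ge1 b n_ge1 by simp
  have "C4 * 1 ^ 3 \<le> C4 * C4 ^ 3" using C4_ge1 by (intro mult_left_mono power_mono) auto
  then have "C4 \<le> C4 ^ 4" by (simp add: eval_nat_numeral)
  then have "C4 * (b ^ 4 * (real n)\<^sup>2) \<le> C4 ^ 4 * (b ^ 4 * (real n)\<^sup>2)" by (intro mult_right_mono) auto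
  moreover have "(real n)\<^sup>2 = sqrt n ^ 4" by (simp add: sqrt_power4)
  ultimately show "expectation (\<lambda>\<omega>. ?X \<omega> ^ 4) \<le> (C4 * b * sqrt n) ^ 4"
    using group_sum_fourth_moment[OF G] by (simp add: power_mult_distrib mult.assoc)
qed

lemma pi1_gmean:
  assumes r: "bounded_variable r B" and B: "0 < B" and i: "i < N"
  shows "pi1 D i * gmean (wtotal r) i = total (psu D i) r"
  using wtotal_moments(1)[OF r _ _ i] B \<beta> incl_pos[OF i] by simp

text \<open>The previous bound is centered at the Poisson mean. Moving the centre to the true total
  changes it by a multiple of \<open>1 / sqrt n\<close>, which does not alter the order of the
  fourth moment.\<close>

lemma hT_fourth_moment:
  assumes r: "bounded_variable r B" and B: "0 < B"
  shows "expectation (\<lambda>\<omega>. (hT r \<omega> - total F r) ^ 4) \<le> 8 * (C4 + K ^ 4) * (B * \<beta>) ^ 4 / (real n)\<^sup>2"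
proof -
  define b where "b = B * \<beta> / n"
  have b0: "0 < b" using B \<beta> n_ge1 by (simp add: b_def)
  have G: "group_stat (wtotal r) b" unfolding b_def by (rule group_stat_wtotal[OF r]) (use B \<beta> in auto)
  have gm: "gmean (wtotal r) i = total (psu D i) r / pi1 D i" if "i < N" for i
    by (rule wtotal_moments(1)[OF r _ _ that]) (use B \<beta> in auto)
  define m where "m = (\<Sum>i<N. q i * gmean (wtotal r) i)"
  have "(\<Sum>i<N. (pi1 D i - q i) * gmean (wtotal r) i) = total F r - m"
  proof -
    have "(\<Sum>i<N. pi1 D i * gmean (wtotal r) i) = (\<Sum>i<N. total (psu D i) r)"
      using pi1_gmean[OF r B] by (intro sum.cong) auto
    also have "\<dots> = total F r" by (rule sum_psu_total[OF r F_fin])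
    finally show ?thesis by (simp add: m_def left_diff_distrib sum_subtractf)
  qed
  then have close: "\<bar>m - total F r\<bar> \<le> b * (K * sqrt n)"
    using weighted_q_close[of "gmean (wtotal r)" b] gmean_bound[OF G] b0 by (simp add: abs_minus_commute)
  have meas: "hT r \<in> borel_measurable M" by (rule group_sum_measurable[OF G])
  have i4: "integrable M (\<lambda>\<omega>. (hT r \<omega> - m) ^ 4)"
  proof (rule integrable_bounded)
    fix \<omega> assume w: "\<omega> \<in> space M"
    have "\<bar>hT r \<omega> - m\<bar> \<le> n * b + \<bar>m\<bar>" using group_sum_bound[OF G w] by linarith
    then show "norm ((hT r \<omega> - m) ^ 4) \<le> (n * b + \<bar>m\<bar>) ^ 4" unfolding real_norm_def power_abs by (intro power_mono) auto
  qed (use meas in simp)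
  have "expectation (\<lambda>\<omega>. (hT r \<omega> - total F r) ^ 4) \<le> expectation (\<lambda>\<omega>. 8 * ((hT r \<omega> - m) ^ 4 + (m - total F r) ^ 4))"
  proof (rule integral_mono_AE')
    show "AE \<omega> in M. (hT r \<omega> - total F r) ^ 4 \<le> 8 * ((hT r \<omega> - m) ^ 4 + (m - total F r) ^ 4)"
      using power4_add_le[of "hT r _ - m" "m - total F r"] by (intro AE_I2) simp
  qed (use i4 in auto)
  also have "\<dots> = 8 * (expectation (\<lambda>\<omega>. (hT r \<omega> - m) ^ 4) + (m - total F r) ^ 4)" using i4 by (simp add: prob_space)
  also have "\<dots> \<le> 8 * (C4 * b ^ 4 * (real n)\<^sup>2 + (b * (K * sqrt n)) ^ 4)"
  proof (intro mult_left_mono add_mono)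
    show "expectation (\<lambda>\<omega>. (hT r \<omega> - m) ^ 4) \<le> C4 * b ^ 4 * (real n)\<^sup>2"
      unfolding m_def by (rule group_sum_fourth_moment[OF G])
    show "(m - total F r) ^ 4 \<le> (b * (K * sqrt n)) ^ 4"
      using power_mono[OF close, of 4] by simp
  qed simp
  also have "\<dots> = 8 * (C4 + K ^ 4) * (B * \<beta>) ^ 4 / (real n)\<^sup>2"
    using n_ge1 by (simp add: b_def power_mult_distrib power_divide sqrt_power4 eval_nat_numeral field_simps)
  finally show ?thesis .
qed

text \<open>The last claim is stated for variables of total zero, for which the second moment is the
  variance; this is the case of the linearized variable.\<close>

lemma hT_facts:
  assumes r: "bounded_variable r B" and B: "0 < B"
  shows "hT r \<in> borel_measurable M" "\<And>\<omega>. \<omega> \<in> space M \<Longrightarrow> \<bar>hT r \<omega>\<bar> \<le> B * \<beta>"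
    and "expectation (hT r) = total F r"
    and "total F r = 0 \<Longrightarrow> first_stage_var D r \<le> expectation (\<lambda>\<omega>. (hT r \<omega>)\<^sup>2)"
proof -
  have G: "group_stat (wtotal r) (B * \<beta> / n)" by (rule group_stat_wtotal[OF r]) (use B \<beta> in auto)
  have gm: "gmean (wtotal r) i = total (psu D i) r / pi1 D i" if "i < N" for i
    by (rule wtotal_moments(1)[OF r _ _ that]) (use B \<beta> in auto)
  show "hT r \<in> borel_measurable M" by (rule group_sum_measurable[OF G])
  show "\<bar>hT r \<omega>\<bar> \<le> B * \<beta>" if "\<omega> \<in> space M" for \<omega>
    using group_sum_bound[OF G that] n_ge1 by simp
  have "(\<Sum>i<N. pi1 D i * gmean (wtotal r) i) = (\<Sum>i<N. total (psu D i) r)"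
    using pi1_gmean[OF r B] by (intro sum.cong) auto
  then show "expectation (hT r) = total F r"
    using expectation_group_sum(1)[OF G] sum_psu_total[OF r F_fin] by simp
  assume z: "total F r = 0"
  have "(\<Sum>s\<in>Pow {..<N}. pmf p s * (\<Sum>i\<in>s. total (psu D i) r / pi1 D i)\<^sup>2) =
      (\<Sum>s\<in>Pow {..<N}. pmf p s * (\<Sum>i\<in>s. gmean (wtotal r) i)\<^sup>2)"
  proof (rule sum.cong[OF refl])
    fix s assume "s \<in> Pow {..<N}"
    then have "(\<Sum>i\<in>s. total (psu D i) r / pi1 D i) = (\<Sum>i\<in>s. gmean (wtotal r) i)"
      using gm by (intro sum.cong) auto
    then show "pmf p s * (\<Sum>i\<in>s. total (psu D i) r / pi1 D i)\<^sup>2 = pmf p s * (\<Sum>i\<in>s. gmean (wtotal r) i)\<^sup>2" by simp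
  qed
  then show "first_stage_var D r \<le> expectation (\<lambda>\<omega>. (hT r \<omega>)\<^sup>2)"
    unfolding first_stage_var_eq sum_psu_total[OF r F_fin] z using expectation_group_sum(2)[OF G] by simp
qed

section \<open>Regression of the contributions on the sample size\<close>

definition sreg :: "('a \<Rightarrow> real) \<Rightarrow> real" where
  "sreg r = (\<Sum>i<N. q i * (1 - q i) * gmean (wtotal r) i) / poisson_var {..<N} q"

definition resid :: "('a \<Rightarrow> real) \<Rightarrow> nat \<Rightarrow> (nat \<Rightarrow> 'a) \<Rightarrow> real" where
  "resid r i x = wtotal r i x - sreg r"

definition svar :: "('a \<Rightarrow> real) \<Rightarrow> real" where
  "svar r = (\<Sum>i<N. q i * gmean (\<lambda>i x. (resid r i x)\<^sup>2) i - (q i)\<^sup>2 * (gmean (resid r) i)\<^sup>2)"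

text \<open>The centre delivered by the Fourier argument: the Poisson mean of the residuals plus the
  constant \<open>n * sreg r\<close> removed by the regression. It need not equal
  \<open>total F r\<close>; that the gap is small even after multiplication by \<open>sqrt n\<close>
  is a result, not a definition.\<close>

definition scenter :: "('a \<Rightarrow> real) \<Rightarrow> real" where
  "scenter r = real n * sreg r + (\<Sum>i<N. q i * gmean (resid r) i)"

context
  fixes r :: "'a \<Rightarrow> real" and B :: real
  assumes r: "bounded_variable r B" and B: "0 < B"
begin

lemma G_wtotal: "group_stat (wtotal r) (B * \<beta> / n)"
  by (rule group_stat_wtotal[OF r]) (use B \<beta> in auto)

lemma sreg_bound: "\<bar>sreg r\<bar> \<le> B * \<beta> / n"
proof -
  have "\<bar>\<Sum>i<N. q i * (1 - q i) * gmean (wtotal r) i\<bar> \<le> (\<Sum>i<N. \<bar>q i * (1 - q i) * gmean (wtotal r) i\<bar>)" by (rule sum_abs)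
  also have "\<dots> \<le> (\<Sum>i<N. q i * (1 - q i) * (B * \<beta> / n))"
  proof (rule sum_mono)
    fix i assume "i \<in> {..<N}"
    then have i: "i < N" by simp
    have q0: "0 \<le> q i * (1 - q i)" using q_facts[OF i] by simp
    have "\<bar>q i * (1 - q i) * gmean (wtotal r) i\<bar> = q i * (1 - q i) * \<bar>gmean (wtotal r) i\<bar>"
      unfolding abs_mult[of "q i * (1 - q i)"] abs_of_nonneg[OF q0] ..
    also have "\<dots> \<le> q i * (1 - q i) * (B * \<beta> / n)" by (rule mult_left_mono[OF gmean_bound[OF G_wtotal i] q0])
    finally show "\<bar>q i * (1 - q i) * gmean (wtotal r) i\<bar> \<le> q i * (1 - q i) * (B * \<beta> / n)" .
  qed
  also have "\<dots> = poisson_var {..<N} q * (B * \<beta> / n)" by (simp only: poisson_var_def sum_distrib_right)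
  finally have "\<bar>\<Sum>i<N. q i * (1 - q i) * gmean (wtotal r) i\<bar> / poisson_var {..<N} q \<le> B * \<beta> / n"
    using q_var by (simp only: pos_divide_le_eq mult.commute)
  then show ?thesis using q_var by (simp add: sreg_def abs_divide)
qed

lemma G_resid: "group_stat (resid r) (2 * (B * \<beta> / n))"
  unfolding group_stat_def
proof (intro allI impI conjI)
  fix i assume i: "i < N"
  show "resid r i \<in> borel_measurable (\<Pi>\<^sub>M k\<in>{..<size2 D i}. lebesgue)"
    unfolding resid_def[abs_def] using G_wtotal i by (auto simp: group_stat_def)
  show "\<bar>resid r i x\<bar> \<le> 2 * (B * \<beta> / n)" for x
  proof -
    have "\<bar>wtotal r i x\<bar> \<le> B * \<beta> / n" using G_wtotal i by (auto simp: group_stat_def)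
    then show ?thesis using sreg_bound by (simp only: resid_def)
  qed
qed

lemma integrable_resid:
  assumes "i < N"
  shows "integrable (points_law i) (resid r i)" "integrable (points_law i) (\<lambda>x. (resid r i x)\<^sup>2)"
    "integrable (points_law i) (wtotal r i)" "integrable (points_law i) (\<lambda>x. (wtotal r i x)\<^sup>2)"
proof -
  have b: "\<bar>resid r i x\<bar> \<le> 2 * (B * \<beta> / n)" "\<bar>wtotal r i x\<bar> \<le> B * \<beta> / n" for x
    using G_resid G_wtotal assms by (auto simp: group_stat_def)
  note m = group_stat_measurable(2)[OF G_resid assms] group_stat_measurable(2)[OF G_wtotal assms]
  show "integrable (points_law i) (resid r i)" "integrable (points_law i) (wtotal r i)"
    using b m by (auto intro!: integrable_points_law[OF assms])
  show "integrable (points_law i) (\<lambda>x. (resid r i x)\<^sup>2)"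
    using m power_mono[OF b(1), of _ 2] by (intro integrable_points_law[OF assms, of _ "(2 * (B * \<beta> / n))\<^sup>2"]) auto
  show "integrable (points_law i) (\<lambda>x. (wtotal r i x)\<^sup>2)"
    using m power_mono[OF b(2), of _ 2] by (intro integrable_points_law[OF assms, of _ "(B * \<beta> / n)\<^sup>2"]) auto
qed

lemma gmean_resid:
  assumes "i < N"
  shows "gmean (resid r) i = gmean (wtotal r) i - sreg r"
    and "(gmean (resid r) i)\<^sup>2 \<le> gmean (\<lambda>i x. (resid r i x)\<^sup>2) i"
    and "gmean (\<lambda>i x. (resid r i x)\<^sup>2) i - (gmean (resid r) i)\<^sup>2 = gmean (wvar r) i"
    and "gmean (\<lambda>i x. (resid r i x)\<^sup>2) i \<le> (2 * (B * \<beta> / n))\<^sup>2"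
proof -
  interpret P: prob_space "points_law i" by (rule prob_space_points_law[OF assms])
  note int = integrable_resid[OF assms]
  show 1: "gmean (resid r) i = gmean (wtotal r) i - sreg r"
    unfolding gmean_def resid_def using int(3) P.prob_space by simp
  have v: "P.expectation (\<lambda>x. (X x - P.expectation X)\<^sup>2) = P.expectation (\<lambda>x. (X x)\<^sup>2) - (P.expectation X)\<^sup>2"
    if "integrable (points_law i) X" "integrable (points_law i) (\<lambda>x. (X x)\<^sup>2)" for X :: "(nat \<Rightarrow> 'a) \<Rightarrow> real"
    by (rule P.variance_eq[OF that])
  have "0 \<le> P.expectation (\<lambda>x. (resid r i x - gmean (resid r) i)\<^sup>2)" by (rule Bochner_Integration.integral_nonneg) simp
  then show "(gmean (resid r) i)\<^sup>2 \<le> gmean (\<lambda>i x. (resid r i x)\<^sup>2) i"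
    using v[OF int(1,2)] by (simp add: gmean_def)
  have "P.expectation (\<lambda>x. (resid r i x - gmean (resid r) i)\<^sup>2) = P.expectation (\<lambda>x. (wtotal r i x - gmean (wtotal r) i)\<^sup>2)"
    unfolding 1 by (simp add: resid_def)
  then show "gmean (\<lambda>i x. (resid r i x)\<^sup>2) i - (gmean (resid r) i)\<^sup>2 = gmean (wvar r) i"
    using v[OF int(1,2)] v[OF int(3,4)] wtotal_moments(2)[OF r _ _ assms] B \<beta> by (simp add: gmean_def)
  have "group_stat (\<lambda>i x. (resid r i x)\<^sup>2) ((2 * (B * \<beta> / n))\<^sup>2)"
    unfolding group_stat_def
  proof (intro allI impI conjI)
    fix j x assume j: "j < N"
    show "(\<lambda>x. (resid r j x)\<^sup>2) \<in> borel_measurable (\<Pi>\<^sub>M k\<in>{..<size2 D j}. lebesgue)"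
      using G_resid j by (auto simp: group_stat_def)
    have "\<bar>resid r j x\<bar> \<le> 2 * (B * \<beta> / n)" using G_resid j by (auto simp: group_stat_def)
    from power_mono[OF this, of 2] show "\<bar>(resid r j x)\<^sup>2\<bar> \<le> (2 * (B * \<beta> / n))\<^sup>2" by simp
  qed
  from gmean_bound[OF this assms] show "gmean (\<lambda>i x. (resid r i x)\<^sup>2) i \<le> (2 * (B * \<beta> / n))\<^sup>2" by simp
qed

text \<open>The normal equation of the regression: under the Poisson design the residual sum has
  covariance zero with the sample size.\<close>

lemma resid_uncorrelated: "(\<Sum>i<N. q i * (1 - q i) * gmean (resid r) i) = 0"
proof -
  have "(\<Sum>i<N. q i * (1 - q i) * gmean (resid r) i) =
      (\<Sum>i<N. q i * (1 - q i) * gmean (wtotal r) i) - poisson_var {..<N} q * sreg r"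
    unfolding poisson_var_def sum_distrib_right sum_subtractf[symmetric]
    by (intro sum.cong refl) (simp add: gmean_resid(1) right_diff_distrib)
  also have "\<dots> = 0" using q_var by (simp add: sreg_def)
  finally show ?thesis .
qed

text \<open>Applies the limit theorem for units with \<open>h i\<close> the characteristic function
  of the residual of PSU \<open>i\<close> at \<open>\<theta> * sqrt n\<close>. Residuals are of
  order \<open>1 / n\<close>, so the arguments are at most \<open>B' / sqrt n\<close>, and the
  second-order Taylor expansion of \<open>h i\<close> has an error of third order.\<close>

lemma hT_char_close:
  fixes \<theta> :: real
  assumes \<theta>: "2 * \<bar>\<theta>\<bar> * (B * \<beta>) \<le> sqrt n"
  shows "cmod (expectation (\<lambda>\<omega>. exp (\<i> * of_real (\<theta> * (sqrt n * (hT r \<omega> - scenter r))))) - exp (- of_real (\<theta>\<^sup>2 * (n * svar r) / 2)))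
    \<le> \<epsilon> + K * clt_const (337 * (2 * \<bar>\<theta>\<bar> * (B * \<beta>))) / sqrt n"
proof -
  define t where "t = \<theta> * sqrt n"
  define B' where "B' = 2 * \<bar>\<theta>\<bar> * (B * \<beta>)"
  define h where "h i = (\<integral>x. exp (\<i> * of_real (t * resid r i x)) \<partial>points_law i)" for i
  define m where "m i = t * gmean (resid r) i" for i
  define v where "v i = t\<^sup>2 * gmean (\<lambda>i x. (resid r i x)\<^sup>2) i" for i
  have B'0: "0 \<le> B'" using B \<beta> by (simp add: B'_def)
  have sn: "0 < sqrt n" "sqrt n * sqrt n = n" using n_ge1 by auto
  have tb: "\<bar>t\<bar> * (2 * (B * \<beta> / n)) = B' / sqrt n"
  proof -
    have "x * y * (2 * (z / (y * y))) = 2 * x * z / y" if "0 < y" for x y z :: real using that by simp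
    from this[OF sn(1), of "\<bar>\<theta>\<bar>" "B * \<beta>"] have "\<bar>\<theta>\<bar> * sqrt n * (2 * (B * \<beta> / n)) = B' / sqrt n"
      unfolding sn(2) B'_def .
    moreover have "\<bar>t\<bar> = \<bar>\<theta>\<bar> * sqrt n" by (simp add: t_def abs_mult)
    ultimately show ?thesis by (simp only:)
  qed
  have tr: "\<bar>t * resid r i x\<bar> \<le> B' / sqrt n" if "i < N" for i x
  proof -
    have "\<bar>resid r i x\<bar> \<le> 2 * (B * \<beta> / n)" using G_resid that by (auto simp: group_stat_def)
    then have "\<bar>t\<bar> * \<bar>resid r i x\<bar> \<le> \<bar>t\<bar> * (2 * (B * \<beta> / n))" by (rule mult_left_mono) simp
    then show ?thesis unfolding tb abs_mult .
  qed
  have hyp: "cmod (h i) \<le> 1 \<and> cmod (h i - (1 + \<i> * of_real (m i) - of_real (v i / 2))) \<le> (B' / sqrt n) ^ 3 \<and>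
        \<bar>m i\<bar> \<le> B' / sqrt n \<and> (m i)\<^sup>2 \<le> v i \<and> v i \<le> (B' / sqrt n)\<^sup>2" if i: "i < N" for i
  proof (intro conjI)
    interpret P: prob_space "points_law i" by (rule prob_space_points_law[OF i])
    note int = integrable_resid[OF i]
    have im: "(\<lambda>x. exp (\<i> * complex_of_real (t * resid r i x))) \<in> borel_measurable (points_law i)"
      using group_stat_measurable(2)[OF G_resid i] by simp
    have ie: "integrable (points_law i) (\<lambda>x. exp (\<i> * complex_of_real (t * resid r i x)))"
      by (rule integrable_points_law[OF i im, of 1]) simp
    have "cmod (h i) \<le> (\<integral>x. cmod (exp (\<i> * complex_of_real (t * resid r i x))) \<partial>points_law i)"
      unfolding h_def by (rule integral_norm_bound)
    also have "\<dots> = 1" using P.prob_space by simp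
    finally show "cmod (h i) \<le> 1" .
    have poly: "(\<integral>x. 1 + \<i> * of_real (t * resid r i x) - of_real ((t * resid r i x)\<^sup>2 / 2) \<partial>points_law i) =
        1 + \<i> * of_real (m i) - of_real (v i / 2)"
    proof -
      have ii: "integrable (points_law i) (\<lambda>x. complex_of_real (t * resid r i x))"
        "integrable (points_law i) (\<lambda>x. complex_of_real ((t * resid r i x)\<^sup>2 / 2))"
        by (intro integrable_of_real; use int in \<open>simp add: power_mult_distrib\<close>)+
      have e: "(\<integral>x. complex_of_real (t * resid r i x) \<partial>points_law i) = of_real (m i)"
        "(\<integral>x. complex_of_real ((t * resid r i x)\<^sup>2 / 2) \<partial>points_law i) = of_real (v i / 2)"
        unfolding integral_complex_of_real by (simp_all add: m_def v_def gmean_def power_mult_distrib)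
      have "(\<integral>x. 1 + \<i> * of_real (t * resid r i x) - of_real ((t * resid r i x)\<^sup>2 / 2) \<partial>points_law i) =
        (\<integral>x. 1 \<partial>points_law i) + (\<integral>x. \<i> * complex_of_real (t * resid r i x) \<partial>points_law i) - (\<integral>x. complex_of_real ((t * resid r i x)\<^sup>2 / 2) \<partial>points_law i)"
        using ii by (subst Bochner_Integration.integral_diff, auto simp del: of_real_mult of_real_divide)
      then show ?thesis unfolding integral_mult_right_zero e using P.prob_space by simp
    qed
    have ip: "integrable (points_law i) (\<lambda>x. 1 + \<i> * of_real (t * resid r i x) - of_real ((t * resid r i x)\<^sup>2 / 2))"
      using int by (intro Bochner_Integration.integrable_diff Bochner_Integration.integrable_add integrable_mult_right integrable_of_real)
         (auto simp: power_mult_distrib)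
    have "cmod (h i - (1 + \<i> * of_real (m i) - of_real (v i / 2))) =
        cmod (\<integral>x. exp (\<i> * complex_of_real (t * resid r i x)) - (1 + \<i> * of_real (t * resid r i x) - of_real ((t * resid r i x)\<^sup>2 / 2)) \<partial>points_law i)"
      unfolding poly[symmetric] h_def using ie ip by simp
    also have "\<dots> \<le> (\<integral>x. cmod (exp (\<i> * complex_of_real (t * resid r i x)) - (1 + \<i> * of_real (t * resid r i x) - of_real ((t * resid r i x)\<^sup>2 / 2))) \<partial>points_law i)"
      by (rule integral_norm_bound)
    also have "\<dots> \<le> (\<integral>x. (B' / sqrt n) ^ 3 \<partial>points_law i)"
    proof (rule integral_mono)
      fix x
      have "cmod (exp (\<i> * complex_of_real (t * resid r i x)) - (1 + \<i> * of_real (t * resid r i x) - of_real ((t * resid r i x)\<^sup>2 / 2)))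
          \<le> \<bar>t * resid r i x\<bar> ^ 3 / 6" by (rule iexp_quadratic)
      also have "\<dots> \<le> (B' / sqrt n) ^ 3"
        using power_mono[OF tr[OF i], of x 3] zero_le_power[of "\<bar>t * resid r i x\<bar>" 3] by linarith
      finally show "cmod (exp (\<i> * complex_of_real (t * resid r i x)) - (1 + \<i> * of_real (t * resid r i x) - of_real ((t * resid r i x)\<^sup>2 / 2)))
          \<le> (B' / sqrt n) ^ 3" .
    qed (use ie ip in auto)
    also have "\<dots> = (B' / sqrt n) ^ 3" using P.prob_space by simp
    finally show "cmod (h i - (1 + \<i> * of_real (m i) - of_real (v i / 2))) \<le> (B' / sqrt n) ^ 3" .
    have "\<bar>t\<bar> * \<bar>gmean (resid r) i\<bar> \<le> \<bar>t\<bar> * (2 * (B * \<beta> / n))" by (rule mult_left_mono[OF gmean_bound[OF G_resid i]]) simp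
    then show "\<bar>m i\<bar> \<le> B' / sqrt n" unfolding tb m_def abs_mult .
    show "(m i)\<^sup>2 \<le> v i" unfolding m_def v_def power_mult_distrib using gmean_resid(2)[OF i] by (rule mult_left_mono) simp
    have "v i \<le> t\<^sup>2 * (2 * (B * \<beta> / n))\<^sup>2" unfolding v_def using gmean_resid(4)[OF i] by (rule mult_left_mono) simp
    also have "\<dots> = (\<bar>t\<bar> * (2 * (B * \<beta> / n)))\<^sup>2" by (simp only: power_mult_distrib power2_abs)
    finally show "v i \<le> (B' / sqrt n)\<^sup>2" unfolding tb .
  qed
  have unc: "(\<Sum>i<N. q i * (1 - q i) * m i) = 0"
  proof -
    have "(\<Sum>i<N. q i * (1 - q i) * m i) = t * (\<Sum>i<N. q i * (1 - q i) * gmean (resid r) i)"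
      unfolding m_def sum_distrib_left by (intro sum.cong refl) simp
    then show ?thesis by (simp add: resid_uncorrelated)
  qed
  let ?c = "t * (\<Sum>i<N. q i * gmean (resid r) i)"
  have "cmod ((\<Sum>s\<in>Pow {..<N}. pmf p s * (\<Prod>i\<in>s. h i)) -
        exp (\<i> * of_real (\<Sum>i<N. q i * m i) - of_real ((\<Sum>i<N. q i * v i - (q i)\<^sup>2 * (m i)\<^sup>2) / 2)))
      \<le> \<epsilon> + K * clt_const (337 * B') / sqrt n"
    by (rule approximates_poisson_char[OF approx B'0 _ hyp unc]) (use \<theta> in \<open>auto simp: B'_def\<close>)
  also have "(\<Sum>i<N. q i * m i) = ?c" unfolding m_def sum_distrib_left by (intro sum.cong refl) simp
  also have "(\<Sum>i<N. q i * v i - (q i)\<^sup>2 * (m i)\<^sup>2) = t\<^sup>2 * svar r"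
    unfolding v_def m_def svar_def sum_distrib_left by (intro sum.cong refl) (simp add: power_mult_distrib right_diff_distrib)
  also have "t\<^sup>2 * svar r = \<theta>\<^sup>2 * (n * svar r)" by (simp add: t_def power_mult_distrib)
  also have "(\<Sum>s\<in>Pow {..<N}. pmf p s * (\<Prod>i\<in>s. h i)) = expectation (\<lambda>\<omega>. exp (\<i> * of_real (t * (\<Sum>i\<in>S \<omega>. resid r i (points i \<omega>)))))"
    unfolding h_def by (rule expectation_char_group_sum[OF G_resid, symmetric])
  finally have main: "cmod (expectation (\<lambda>\<omega>. exp (\<i> * of_real (t * (\<Sum>i\<in>S \<omega>. resid r i (points i \<omega>))))) -
      exp (\<i> * of_real ?c - of_real (\<theta>\<^sup>2 * (n * svar r) / 2))) \<le> \<epsilon> + K * clt_const (337 * B') / sqrt n" .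
  have "expectation (\<lambda>\<omega>. exp (\<i> * of_real (\<theta> * (sqrt n * (hT r \<omega> - scenter r))))) =
      expectation (\<lambda>\<omega>. exp (- (\<i> * of_real ?c)) * exp (\<i> * of_real (t * (\<Sum>i\<in>S \<omega>. resid r i (points i \<omega>)))))"
  proof (rule Bochner_Integration.integral_cong[OF refl])
    fix \<omega> assume w: "\<omega> \<in> space M"
    \<comment> \<open>Fixed sample size: subtracting the regression coefficient from every unit only
      shifts the estimator by the constant \<open>n * sreg r\<close>.\<close>
    have "(\<Sum>i\<in>S \<omega>. resid r i (points i \<omega>)) = hT r \<omega> - n * sreg r"
      by (simp add: resid_def sum_subtractf sample1_card[OF w])
    then have hTe: "hT r \<omega> = (\<Sum>i\<in>S \<omega>. resid r i (points i \<omega>)) + n * sreg r" by simp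
    have "\<theta> * (sqrt n * (hT r \<omega> - scenter r)) = t * (\<Sum>i\<in>S \<omega>. resid r i (points i \<omega>)) - ?c"
      unfolding hTe scenter_def t_def by (simp add: algebra_simps)
    then have "\<i> * of_real (\<theta> * (sqrt n * (hT r \<omega> - scenter r))) = - (\<i> * of_real ?c) + \<i> * of_real (t * (\<Sum>i\<in>S \<omega>. resid r i (points i \<omega>)))"
      by (simp only: of_real_diff right_diff_distrib) simp
    then show "exp (\<i> * of_real (\<theta> * (sqrt n * (hT r \<omega> - scenter r)))) =
        exp (- (\<i> * of_real ?c)) * exp (\<i> * of_real (t * (\<Sum>i\<in>S \<omega>. resid r i (points i \<omega>))))"
      by (simp only: exp_add)
  qed
  also have "\<dots> = exp (- (\<i> * of_real ?c)) * expectation (\<lambda>\<omega>. exp (\<i> * of_real (t * (\<Sum>i\<in>S \<omega>. resid r i (points i \<omega>)))))"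
    by (rule integral_mult_right_zero)
  finally have "expectation (\<lambda>\<omega>. exp (\<i> * of_real (\<theta> * (sqrt n * (hT r \<omega> - scenter r))))) - exp (- of_real (\<theta>\<^sup>2 * (n * svar r) / 2)) =
      exp (- (\<i> * of_real ?c)) * (expectation (\<lambda>\<omega>. exp (\<i> * of_real (t * (\<Sum>i\<in>S \<omega>. resid r i (points i \<omega>))))) -
      exp (\<i> * of_real ?c - of_real (\<theta>\<^sup>2 * (n * svar r) / 2)))"
    by (simp only: right_diff_distrib exp_add[symmetric]) (simp only: add_diff_eq left_minus diff_0 minus_add_cancel)
  moreover have "cmod (exp (- (\<i> * of_real ?c))) = 1" using norm_exp_i_times[of "- ?c"] by simp
  ultimately show ?thesis using main by (simp only: norm_mult mult_1_left B'_def)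
qed

end

end

section \<open>The Hajek variance estimator\<close>

context regular_population
begin

lemma wvar_bound:
  assumes r: "\<forall>x\<in>F. \<bar>r x\<bar> \<le> B" and B: "0 < B" and i: "i < N"
  shows "\<bar>wvar r i x\<bar> \<le> 8 * (B * \<beta> / n)\<^sup>2"
proof -
  define k where "k = real (size2 D i)"
  define b where "b = B * \<beta> / n"
  have k2: "2 \<le> k" using size2_ge2[OF i] by (simp add: k_def)
  have b0: "0 \<le> b" using B \<beta> by (simp add: b_def)
  have "\<bar>wdraw r i (x j) - wtotal r i x / k\<bar> \<le> 2 * b / k" for j
  proof -
    have "\<bar>wdraw r i (x j)\<bar> \<le> b / k" using wdraw_bound[OF r i, of "x j"] B \<beta> by (simp add: b_def k_def)
    moreover have "\<bar>wtotal r i x / k\<bar> \<le> b / k"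
    proof -
      have "\<bar>wtotal r i x\<bar> / k \<le> b / k"
        using wtotal_bound[OF r i, of x] B \<beta> k2 by (intro divide_right_mono) (auto simp: b_def)
      then show ?thesis using k2 by (simp add: abs_divide)
    qed
    ultimately show ?thesis by linarith
  qed
  then have sq: "(wdraw r i (x j) - wtotal r i x / k)\<^sup>2 \<le> (2 * b / k)\<^sup>2" for j
    using power_mono[of "\<bar>wdraw r i (x j) - wtotal r i x / k\<bar>" "2 * b / k" 2] by simp
  have kk: "0 \<le> k / (k - 1)" "k / (k - 1) \<le> 2" using k2 by (auto simp: divide_le_eq)
  have s0: "0 \<le> (\<Sum>j<size2 D i. (wdraw r i (x j) - wtotal r i x / k)\<^sup>2)" by (intro sum_nonneg) simp
  have "(\<Sum>j<size2 D i. (wdraw r i (x j) - wtotal r i x / k)\<^sup>2) \<le> (\<Sum>j<size2 D i. (2 * b / k)\<^sup>2)" by (rule sum_mono[OF sq])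
  also have "\<dots> = 4 * b\<^sup>2 / k" using k2 by (simp add: k_def[symmetric] power2_eq_square)
  also have "\<dots> \<le> 4 * b\<^sup>2 / 1" using k2 by (intro divide_left_mono) auto
  finally have "k / (k - 1) * (\<Sum>j<size2 D i. (wdraw r i (x j) - wtotal r i x / k)\<^sup>2) \<le> 2 * (4 * b\<^sup>2)"
    using kk s0 by (intro mult_mono) auto
  then show ?thesis
    unfolding wvar_def k_def[symmetric] b_def[symmetric] abs_of_nonneg[OF mult_nonneg_nonneg[OF kk(1) s0]] by simp
qed

definition hratio :: "('a \<Rightarrow> real) \<Rightarrow> 'w \<Rightarrow> real" where
  "hratio r \<omega> = (\<Sum>i\<in>S \<omega>. (1 - pi1 D i) * wtotal r i (points i \<omega>)) / (\<Sum>i\<in>S \<omega>. 1 - pi1 D i)"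

lemma hajek_eq:
  assumes w: "\<omega> \<in> space M"
  shows "hajek_var_est D r \<omega> = (\<Sum>i\<in>S \<omega>. (1 - pi1 D i) * (wtotal r i (points i \<omega>) - hratio r \<omega>)\<^sup>2) +
    (\<Sum>i\<in>S \<omega>. pi1 D i * wvar r i (points i \<omega>))"
proof -
  have h: "hajek_ratio D r \<omega> = hratio r \<omega>"
    unfolding hajek_ratio_def hratio_def using estimators_eq(1)[OF w]
    by (intro arg_cong2[where f = "(/)"] sum.cong refl) simp
  have "second_stage_var_est D r i \<omega> / pi1 D i = pi1 D i * wvar r i (points i \<omega>)" if "i \<in> S \<omega>" for i
  proof -
    have "0 < pi1 D i" using incl_pos sample1_subset[OF w] that by auto
    then show ?thesis unfolding estimators_eq(2)[OF w that] by (simp add: power2_eq_square)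
  qed
  then show ?thesis
    unfolding hajek_var_est_def h using estimators_eq(1)[OF w]
    by (intro arg_cong2[where f = "(+)"] sum.cong refl) simp_all
qed

lemma pi1_bounds: "0 \<le> pi1 D i" "pi1 D i \<le> 1"
  by (auto simp: incl_prob_def)

lemma hratio_bound:
  assumes r: "\<forall>x\<in>F. \<bar>r x\<bar> \<le> B" and B: "0 \<le> B" and w: "\<omega> \<in> space M"
  shows "\<bar>hratio r \<omega>\<bar> \<le> B * \<beta> / n"
proof -
  let ?W = "\<Sum>i\<in>S \<omega>. 1 - pi1 D i"
  have b0: "0 \<le> B * \<beta> / n" using B \<beta> by simp
  have W0: "0 \<le> ?W" using pi1_bounds by (intro sum_nonneg) simp
  have "\<bar>\<Sum>i\<in>S \<omega>. (1 - pi1 D i) * wtotal r i (points i \<omega>)\<bar> \<le> (\<Sum>i\<in>S \<omega>. \<bar>(1 - pi1 D i) * wtotal r i (points i \<omega>)\<bar>)" by (rule sum_abs)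
  also have "\<dots> \<le> (\<Sum>i\<in>S \<omega>. (1 - pi1 D i) * (B * \<beta> / n))"
  proof (rule sum_mono)
    fix i assume "i \<in> S \<omega>"
    then have i: "i < N" using sample1_subset[OF w] by auto
    have "\<bar>(1 - pi1 D i) * wtotal r i (points i \<omega>)\<bar> = (1 - pi1 D i) * \<bar>wtotal r i (points i \<omega>)\<bar>"
      using pi1_bounds[of i] by (simp add: abs_mult)
    also have "\<dots> \<le> (1 - pi1 D i) * (B * \<beta> / n)"
      using pi1_bounds[of i] wtotal_bound[OF r i B] \<beta> by (intro mult_left_mono) auto
    finally show "\<bar>(1 - pi1 D i) * wtotal r i (points i \<omega>)\<bar> \<le> (1 - pi1 D i) * (B * \<beta> / n)" .
  qed
  also have "\<dots> = (B * \<beta> / n) * ?W" by (simp only: sum_distrib_right[symmetric] mult.commute)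
  finally have num: "\<bar>\<Sum>i\<in>S \<omega>. (1 - pi1 D i) * wtotal r i (points i \<omega>)\<bar> \<le> (B * \<beta> / n) * ?W" .
  show ?thesis
  \<comment> \<open>If all sampled PSUs are selected with certainty, the denominator is 0 and the
    ratio is 0 by the convention for division, which satisfies the bound.\<close>
  proof (cases "?W = 0")
    case True
    then show ?thesis using b0 by (simp add: hratio_def)
  next
    case False
    then have "0 < ?W" using W0 by simp
    then show ?thesis unfolding hratio_def abs_divide using num by (simp add: pos_divide_le_eq del: times_divide_eq_left)
  qed
qed

lemma wtotal_diff: "wtotal r i x - wtotal r' i x = wtotal (\<lambda>x. r x - r' x) i x"
  and wdraw_diff: "wdraw r i y - wdraw r' i y = wdraw (\<lambda>x. r x - r' x) i y"
  by (auto simp: wtotal_def wdraw_def sum_subtractf[symmetric] diff_divide_distrib intro!: sum.cong)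

lemma hratio_diff: "hratio r \<omega> - hratio r' \<omega> = hratio (\<lambda>x. r x - r' x) \<omega>"
  unfolding hratio_def diff_divide_distrib[symmetric] sum_subtractf[symmetric] right_diff_distrib[symmetric] wtotal_diff ..

lemma abs_square_diff_le:
  fixes a a' c e :: real
  assumes "\<bar>a - a'\<bar> \<le> e" "\<bar>a\<bar> \<le> c" "\<bar>a'\<bar> \<le> c"
  shows "\<bar>a\<^sup>2 - a'\<^sup>2\<bar> \<le> e * (2 * c)"
proof -
  have "a\<^sup>2 - a'\<^sup>2 = (a - a') * (a + a')" by (simp add: power2_eq_square algebra_simps)
  moreover have "\<bar>a - a'\<bar> * \<bar>a + a'\<bar> \<le> e * (2 * c)" using assms by (intro mult_mono) auto
  ultimately show ?thesis by (simp add: abs_mult)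
qed

text \<open>Both parts of the estimator are quadratic in the variable, so a uniform change by \<eta>
  changes them by at most a multiple of \<open>\<eta> * B\<close>: 8 for the first-stage part and 16
  for the second-stage part. The bound holds pathwise, which permits a variable that depends on the
  sample.\<close>

lemma hajek_lipschitz:
  assumes r: "\<forall>x\<in>F. \<bar>r x\<bar> \<le> B" and r': "\<forall>x\<in>F. \<bar>r' x\<bar> \<le> B" and d: "\<forall>x\<in>F. \<bar>r x - r' x\<bar> \<le> \<eta>"
    and B: "0 \<le> B" "0 \<le> \<eta>" and w: "\<omega> \<in> space M"
  shows "\<bar>n * hajek_var_est D r \<omega> - n * hajek_var_est D r' \<omega>\<bar> \<le> 24 * \<eta> * B * \<beta>\<^sup>2"
proof -
  define b where "b = B * \<beta> / n"
  define e where "e = \<eta> * \<beta> / n"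
  have be0: "0 \<le> b" "0 \<le> e" using B \<beta> by (auto simp: b_def e_def)
  note bd = wtotal_bound[OF r _ B(1)] wtotal_bound[OF r' _ B(1)] wtotal_bound[OF d _ B(2)]
  have A1: "\<bar>(1 - pi1 D i) * (wtotal r i (points i \<omega>) - hratio r \<omega>)\<^sup>2 - (1 - pi1 D i) * (wtotal r' i (points i \<omega>) - hratio r' \<omega>)\<^sup>2\<bar>
      \<le> 8 * e * b" if i: "i < N" for i
  proof -
    have "\<bar>(wtotal r i (points i \<omega>) - hratio r \<omega>)\<^sup>2 - (wtotal r' i (points i \<omega>) - hratio r' \<omega>)\<^sup>2\<bar> \<le> (2 * e) * (2 * (2 * b))"
    proof (rule abs_square_diff_le)
      have "\<bar>wtotal r i (points i \<omega>) - wtotal r' i (points i \<omega>)\<bar> \<le> e" "\<bar>hratio r \<omega> - hratio r' \<omega>\<bar> \<le> e"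
        unfolding wtotal_diff hratio_diff e_def using bd(3)[OF i] hratio_bound[OF d B(2) w] \<beta> by auto
      then show "\<bar>wtotal r i (points i \<omega>) - hratio r \<omega> - (wtotal r' i (points i \<omega>) - hratio r' \<omega>)\<bar> \<le> 2 * e" by linarith
      show "\<bar>wtotal r i (points i \<omega>) - hratio r \<omega>\<bar> \<le> 2 * b"
        using bd(1)[OF i, of "points i \<omega>"] hratio_bound[OF r B(1) w] \<beta> unfolding b_def by linarith
      show "\<bar>wtotal r' i (points i \<omega>) - hratio r' \<omega>\<bar> \<le> 2 * b"
        using bd(2)[OF i, of "points i \<omega>"] hratio_bound[OF r' B(1) w] \<beta> unfolding b_def by linarith
    qed
    then have "(1 - pi1 D i) * \<bar>(wtotal r i (points i \<omega>) - hratio r \<omega>)\<^sup>2 - (wtotal r' i (points i \<omega>) - hratio r' \<omega>)\<^sup>2\<bar> \<le> 1 * ((2 * e) * (2 * (2 * b)))"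
      using pi1_bounds[of i] by (intro mult_mono) auto
    then show ?thesis unfolding right_diff_distrib[symmetric] abs_mult using pi1_bounds[of i] by simp
  qed
  have A2: "\<bar>pi1 D i * wvar r i x - pi1 D i * wvar r' i x\<bar> \<le> 16 * e * b" if i: "i < N" for i x
  proof -
    define k where "k = real (size2 D i)"
    have k2: "2 \<le> k" using size2_ge2[OF i] by (simp add: k_def)
    have kk: "0 \<le> k / (k - 1)" "k / (k - 1) \<le> 2" using k2 by (auto simp: divide_le_eq)
    note wb = wdraw_bound[OF r i B(1), folded k_def b_def] wdraw_bound[OF r' i B(1), folded k_def b_def]
      wdraw_bound[OF d i B(2), folded k_def e_def]
    have tb: "\<bar>wtotal r i x / k\<bar> \<le> b / k" "\<bar>wtotal r' i x / k\<bar> \<le> b / k" "\<bar>wtotal r i x / k - wtotal r' i x / k\<bar> \<le> e / k"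
    proof -
      have "\<bar>wtotal r i x\<bar> / k \<le> b / k" "\<bar>wtotal r' i x\<bar> / k \<le> b / k" "\<bar>wtotal r i x - wtotal r' i x\<bar> / k \<le> e / k"
        unfolding wtotal_diff using bd(1)[OF i, of x] bd(2)[OF i, of x] bd(3)[OF i, of x] \<beta> k2
        by (intro divide_right_mono; simp add: b_def e_def)+
      then show "\<bar>wtotal r i x / k\<bar> \<le> b / k" "\<bar>wtotal r' i x / k\<bar> \<le> b / k" "\<bar>wtotal r i x / k - wtotal r' i x / k\<bar> \<le> e / k"
        using k2 by (simp_all add: abs_divide flip: diff_divide_distrib)
    qed
    have sq: "\<bar>(wdraw r i (x j) - wtotal r i x / k)\<^sup>2 - (wdraw r' i (x j) - wtotal r' i x / k)\<^sup>2\<bar> \<le> (2 * (e / k)) * (2 * (2 * (b / k)))" for j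
    proof (rule abs_square_diff_le)
      have "\<bar>wdraw r i (x j) - wdraw r' i (x j)\<bar> \<le> e / k" unfolding wdraw_diff using wb(3) \<beta> by simp
      then show "\<bar>wdraw r i (x j) - wtotal r i x / k - (wdraw r' i (x j) - wtotal r' i x / k)\<bar> \<le> 2 * (e / k)" using tb(3) by linarith
      show "\<bar>wdraw r i (x j) - wtotal r i x / k\<bar> \<le> 2 * (b / k)" using wb(1)[of "x j"] \<beta> tb(1) by linarith
      show "\<bar>wdraw r' i (x j) - wtotal r' i x / k\<bar> \<le> 2 * (b / k)" using wb(2)[of "x j"] \<beta> tb(2) by linarith
    qed
    let ?s = "\<lambda>r. \<Sum>j<size2 D i. (wdraw r i (x j) - wtotal r i x / k)\<^sup>2"
    have "\<bar>?s r - ?s r'\<bar> \<le> (\<Sum>j<size2 D i. \<bar>(wdraw r i (x j) - wtotal r i x / k)\<^sup>2 - (wdraw r' i (x j) - wtotal r' i x / k)\<^sup>2\<bar>)"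
      unfolding sum_subtractf[symmetric] by (rule sum_abs)
    also have "\<dots> \<le> (\<Sum>j<size2 D i. (2 * (e / k)) * (2 * (2 * (b / k))))" by (rule sum_mono[OF sq])
    also have "\<dots> = 8 * e * b / k" using k2 by (simp add: k_def[symmetric])
    also have "\<dots> \<le> 8 * e * b / 1" using k2 be0 by (intro divide_left_mono) auto
    finally have "k / (k - 1) * \<bar>?s r - ?s r'\<bar> \<le> 2 * (8 * e * b)" using kk by (intro mult_mono) auto
    then have "\<bar>wvar r i x - wvar r' i x\<bar> \<le> 2 * (8 * e * b)"
      unfolding wvar_def k_def[symmetric] right_diff_distrib[symmetric] abs_mult abs_of_nonneg[OF kk(1)] .
    then have "pi1 D i * \<bar>wvar r i x - wvar r' i x\<bar> \<le> 1 * (2 * (8 * e * b))" using pi1_bounds[of i] by (intro mult_mono) auto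
    then show ?thesis unfolding right_diff_distrib[symmetric] abs_mult using pi1_bounds[of i] by simp
  qed
  have sumbound: "\<bar>(\<Sum>i\<in>S \<omega>. f i) - (\<Sum>i\<in>S \<omega>. g i)\<bar> \<le> n * c" if "\<And>i. i < N \<Longrightarrow> \<bar>f i - g i\<bar> \<le> c" for f g :: "nat \<Rightarrow> real" and c :: real
  proof -
    have "\<bar>(\<Sum>i\<in>S \<omega>. f i) - (\<Sum>i\<in>S \<omega>. g i)\<bar> \<le> (\<Sum>i\<in>S \<omega>. \<bar>f i - g i\<bar>)"
      unfolding sum_subtractf[symmetric] by (rule sum_abs)
    also have "\<dots> \<le> (\<Sum>i\<in>S \<omega>. c)" using that sample1_subset[OF w] by (intro sum_mono) auto
    finally show ?thesis by (simp add: sample1_card[OF w])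
  qed
  have "\<bar>hajek_var_est D r \<omega> - hajek_var_est D r' \<omega>\<bar> \<le> n * (8 * e * b) + n * (16 * e * b)"
  proof -
    have "\<bar>(\<Sum>i\<in>S \<omega>. (1 - pi1 D i) * (wtotal r i (points i \<omega>) - hratio r \<omega>)\<^sup>2) -
        (\<Sum>i\<in>S \<omega>. (1 - pi1 D i) * (wtotal r' i (points i \<omega>) - hratio r' \<omega>)\<^sup>2)\<bar> \<le> n * (8 * e * b)"
      by (rule sumbound) (rule A1)
    moreover have "\<bar>(\<Sum>i\<in>S \<omega>. pi1 D i * wvar r i (points i \<omega>)) - (\<Sum>i\<in>S \<omega>. pi1 D i * wvar r' i (points i \<omega>))\<bar> \<le> n * (16 * e * b)"
      by (rule sumbound) (rule A2)
    ultimately show ?thesis unfolding hajek_eq[OF w] by linarith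
  qed
  then have "n * \<bar>hajek_var_est D r \<omega> - hajek_var_est D r' \<omega>\<bar> \<le> n * (n * (8 * e * b) + n * (16 * e * b))"
    by (rule mult_left_mono) simp
  also have "\<dots> = 24 * \<eta> * B * \<beta>\<^sup>2" using n_ge1 by (simp add: e_def b_def power2_eq_square)
  finally show ?thesis unfolding right_diff_distrib[symmetric] abs_mult by simp
qed

text \<open>The variable may depend on the outcome, as the estimated linearized variable does;
  therefore measurability is assumed for each weighted draw and propagated through the finitely many
  samples.\<close>

lemma hajek_measurable:
  assumes m: "\<And>i k. i < N \<Longrightarrow> k < size2 D i \<Longrightarrow> (\<lambda>\<omega>. wdraw (r \<omega>) i (points i \<omega> k)) \<in> borel_measurable M"
  shows "(\<lambda>\<omega>. hajek_var_est D (r \<omega>) \<omega>) \<in> borel_measurable M"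
proof -
  have t[measurable]: "(\<lambda>\<omega>. wtotal (r \<omega>) i (points i \<omega>)) \<in> borel_measurable M" if "i < N" for i
    unfolding wtotal_def using m[OF that] by (intro borel_measurable_sum) auto
  have v: "(\<lambda>\<omega>. wvar (r \<omega>) i (points i \<omega>)) \<in> borel_measurable M" if "i < N" for i
    unfolding wvar_def using m[OF that] t[OF that]
    by (intro borel_measurable_times borel_measurable_sum borel_measurable_power borel_measurable_diff borel_measurable_divide) auto
  define R where "R s \<omega> = (\<Sum>i\<in>s. (1 - pi1 D i) * wtotal (r \<omega>) i (points i \<omega>)) / (\<Sum>i\<in>s. 1 - pi1 D i)" for s \<omega>
  define H where "H s \<omega> = (\<Sum>i\<in>s. (1 - pi1 D i) * (wtotal (r \<omega>) i (points i \<omega>) - R s \<omega>)\<^sup>2) +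
    (\<Sum>i\<in>s. pi1 D i * wvar (r \<omega>) i (points i \<omega>))" for s \<omega>
  have R: "R s \<in> borel_measurable M" if "s \<subseteq> {..<N}" for s
    unfolding R_def[abs_def] using t that
    by (intro borel_measurable_times borel_measurable_sum borel_measurable_divide) auto
  have "H s \<in> borel_measurable M" if "s \<subseteq> {..<N}" for s
    unfolding H_def[abs_def] using t v that R[OF that]
    by (intro borel_measurable_add borel_measurable_times borel_measurable_sum borel_measurable_power borel_measurable_diff) auto
  then have "(\<lambda>\<omega>. H (S \<omega>) \<omega>) \<in> borel_measurable M" by (rule measurable_by_sample1[of H])
  moreover have "hajek_var_est D (r \<omega>) \<omega> = H (S \<omega>) \<omega>" if "\<omega> \<in> space M" for \<omega>
    unfolding hajek_eq[OF that] H_def R_def hratio_def ..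
  ultimately show ?thesis by (subst measurable_cong[of _ _ "\<lambda>\<omega>. H (S \<omega>) \<omega>"]) auto
qed

text \<open>The Lipschitz estimate against the zero variable, at which the estimator
  vanishes.\<close>

lemma hajek_bound:
  assumes rb: "\<forall>x\<in>F. \<bar>r x\<bar> \<le> B" and B: "0 < B" and w: "\<omega> \<in> space M"
  shows "\<bar>n * hajek_var_est D r \<omega>\<bar> \<le> 24 * B * B * \<beta>\<^sup>2"
proof -
  have "hajek_var_est D (\<lambda>_. 0) \<omega> = 0"
  proof -
    have "wdraw (\<lambda>_. 0) i y = 0" for i y by (simp add: wdraw_def)
    then show ?thesis by (simp add: hajek_eq[OF w] hratio_def wtotal_def wvar_def)
  qed
  then show ?thesis using hajek_lipschitz[OF rb, of "\<lambda>_. 0" B \<omega>] rb B w by simp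
qed

end

section \<open>The variance of the Horvitz--Thompson estimator and the limit of the Hajek
  estimator\<close>

context approximated_population
begin

context
  fixes r :: "'a \<Rightarrow> real" and B :: real
  assumes r: "bounded_variable r B" and B: "0 < B"
begin

lemma svar_bounds: "0 \<le> n * svar r" "n * svar r \<le> 4 * K * (B * \<beta>)\<^sup>2"
proof -
  have i: "0 \<le> q i * gmean (\<lambda>i x. (resid r i x)\<^sup>2) i - (q i)\<^sup>2 * (gmean (resid r) i)\<^sup>2"
    "q i * gmean (\<lambda>i x. (resid r i x)\<^sup>2) i - (q i)\<^sup>2 * (gmean (resid r) i)\<^sup>2 \<le> q i * (2 * (B * \<beta> / n))\<^sup>2" if "i < N" for i
  proof -
    note g = gmean_resid[OF r B that]
    have q2: "(q i)\<^sup>2 \<le> q i" using q_facts[OF that] by (simp add: power2_eq_square mult_left_le)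
    have "(q i)\<^sup>2 * (gmean (resid r) i)\<^sup>2 \<le> q i * (gmean (resid r) i)\<^sup>2" by (rule mult_right_mono[OF q2]) simp
    also have "\<dots> \<le> q i * gmean (\<lambda>i x. (resid r i x)\<^sup>2) i" by (rule mult_left_mono[OF g(2) q_facts(1)[OF that]])
    finally show "0 \<le> q i * gmean (\<lambda>i x. (resid r i x)\<^sup>2) i - (q i)\<^sup>2 * (gmean (resid r) i)\<^sup>2" by simp
    have "q i * gmean (\<lambda>i x. (resid r i x)\<^sup>2) i \<le> q i * (2 * (B * \<beta> / n))\<^sup>2" by (rule mult_left_mono[OF g(4) q_facts(1)[OF that]])
    moreover have "0 \<le> (q i)\<^sup>2 * (gmean (resid r) i)\<^sup>2" by simp
    ultimately show "q i * gmean (\<lambda>i x. (resid r i x)\<^sup>2) i - (q i)\<^sup>2 * (gmean (resid r) i)\<^sup>2 \<le> q i * (2 * (B * \<beta> / n))\<^sup>2" by linarith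
  qed
  have "0 \<le> svar r" unfolding svar_def using i(1) by (intro sum_nonneg) auto
  then show "0 \<le> n * svar r" by simp
  have "svar r \<le> (\<Sum>i<N. q i * (2 * (B * \<beta> / n))\<^sup>2)" unfolding svar_def using i(2) by (intro sum_mono) auto
  also have "\<dots> = (\<Sum>i<N. q i) * (2 * (B * \<beta> / n))\<^sup>2" by (rule sum_distrib_right[symmetric])
  also have "\<dots> \<le> (K * n) * (2 * (B * \<beta> / n))\<^sup>2" by (rule mult_right_mono[OF q_sum]) simp
  finally have "n * svar r \<le> n * ((K * n) * (2 * (B * \<beta> / n))\<^sup>2)" by (rule mult_left_mono) simp
  also have "\<dots> = 4 * K * (B * \<beta>)\<^sup>2" using n_ge1 by (simp add: power2_eq_square)
  finally show "n * svar r \<le> 4 * K * (B * \<beta>)\<^sup>2" .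
qed

definition C6 :: real where "C6 = 8 * (8 * (C4 + K ^ 4) + 16 * K ^ 4) * (B * \<beta>) ^ 4"

text \<open>The residual means are of order \<open>1 / n\<close> and the probabilities differ by
  \<open>O(sqrt n)\<close> in total, so this crude estimate gives only boundedness. That suffices
  for the fourth moments of the normalized deviation.\<close>

lemma scenter_close: "\<bar>sqrt n * (total F r - scenter r)\<bar> \<le> 2 * (B * \<beta>) * K"
proof -
  have "total F r = (\<Sum>i<N. pi1 D i * gmean (wtotal r) i)"
    unfolding sum_psu_total[OF r F_fin, symmetric] using pi1_gmean[OF r B] by (intro sum.cong) auto
  also have "\<dots> = (\<Sum>i<N. pi1 D i * gmean (resid r) i) + n * sreg r"
    unfolding sum_pi1[symmetric] sum_distrib_right sum.distrib[symmetric]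
    by (intro sum.cong refl) (simp add: gmean_resid(1)[OF r B] right_diff_distrib)
  finally have "total F r - scenter r = (\<Sum>i<N. (pi1 D i - q i) * gmean (resid r) i)"
    by (simp add: scenter_def left_diff_distrib sum_subtractf)
  then have "\<bar>total F r - scenter r\<bar> \<le> 2 * (B * \<beta> / n) * (K * sqrt n)"
    using weighted_q_close[of "gmean (resid r)" "2 * (B * \<beta> / n)"] gmean_bound[OF G_resid[OF r B]] B \<beta> by simp
  then have "sqrt n * \<bar>total F r - scenter r\<bar> \<le> sqrt n * (2 * (B * \<beta> / n) * (K * sqrt n))" by (rule mult_left_mono) simp
  also have "\<dots> = 2 * (B * \<beta>) * K"
  proof -
    have "x * (2 * (z / (x * x)) * (y * x)) = 2 * z * y" if "0 < x" for x y z :: real using that by simp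
    from this[of "sqrt n" "B * \<beta>" K] show ?thesis using n_ge1 by simp
  qed
  finally show ?thesis by (simp add: abs_mult)
qed

abbreviation (input) "X \<equiv> \<lambda>\<omega>. sqrt n * (hT r \<omega> - scenter r)"

lemma X_facts:
  shows "X \<in> borel_measurable M" "integrable M X" "integrable M (\<lambda>\<omega>. (X \<omega>)\<^sup>2)" "integrable M (\<lambda>\<omega>. X \<omega> ^ 4)"
    and "expectation X = sqrt n * (total F r - scenter r)" "expectation (\<lambda>\<omega>. X \<omega> ^ 4) \<le> C6"
    and "integrable M (hT r)" "integrable M (\<lambda>\<omega>. (hT r \<omega> - total F r)\<^sup>2)" "integrable M (\<lambda>\<omega>. (hT r \<omega> - total F r) ^ 4)"
proof -
  note h = hT_facts[OF r B]
  have bint: "integrable M (\<lambda>\<omega>. (c * (hT r \<omega> - a)) ^ k)" for c a k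
  proof (rule integrable_bounded)
    fix \<omega> assume w: "\<omega> \<in> space M"
    have "\<bar>c * (hT r \<omega> - a)\<bar> \<le> \<bar>c\<bar> * (B * \<beta> + \<bar>a\<bar>)"
      unfolding abs_mult using h(2)[OF w] by (intro mult_left_mono) auto
    then show "norm ((c * (hT r \<omega> - a)) ^ k) \<le> (\<bar>c\<bar> * (B * \<beta> + \<bar>a\<bar>)) ^ k"
      unfolding real_norm_def power_abs by (intro power_mono) auto
  qed (use h(1) in simp)
  show "X \<in> borel_measurable M" using h(1) by simp
  show iX: "integrable M X" using bint[of "sqrt n" "scenter r" 1] by simp
  show "integrable M (\<lambda>\<omega>. (X \<omega>)\<^sup>2)" "integrable M (\<lambda>\<omega>. X \<omega> ^ 4)" by (rule bint)+
  show ih: "integrable M (hT r)" using bint[of 1 0 1] by simp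
  show "integrable M (\<lambda>\<omega>. (hT r \<omega> - total F r)\<^sup>2)" using bint[of 1 _ 2] by simp
  show i4: "integrable M (\<lambda>\<omega>. (hT r \<omega> - total F r) ^ 4)" using bint[of 1 _ 4] by simp
  show "expectation X = sqrt n * (total F r - scenter r)" using ih h(3) by (simp add: prob_space)
  have "expectation (\<lambda>\<omega>. X \<omega> ^ 4) \<le> expectation (\<lambda>\<omega>. 8 * ((real n)\<^sup>2 * (hT r \<omega> - total F r) ^ 4 + (sqrt n * (total F r - scenter r)) ^ 4))"
  proof (rule integral_mono_AE')
    show "AE \<omega> in M. X \<omega> ^ 4 \<le> 8 * ((real n)\<^sup>2 * (hT r \<omega> - total F r) ^ 4 + (sqrt n * (total F r - scenter r)) ^ 4)"
    proof (rule AE_I2)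
      fix \<omega>
      have "X \<omega> = sqrt n * (hT r \<omega> - total F r) + sqrt n * (total F r - scenter r)" by (simp add: algebra_simps)
      then have "X \<omega> ^ 4 \<le> 8 * ((sqrt n * (hT r \<omega> - total F r)) ^ 4 + (sqrt n * (total F r - scenter r)) ^ 4)"
        using power4_add_le by simp
      then show "X \<omega> ^ 4 \<le> 8 * ((real n)\<^sup>2 * (hT r \<omega> - total F r) ^ 4 + (sqrt n * (total F r - scenter r)) ^ 4)"
        by (simp add: power_mult_distrib sqrt_power4)
    qed
  qed (use i4 in auto)
  also have "\<dots> = 8 * ((real n)\<^sup>2 * expectation (\<lambda>\<omega>. (hT r \<omega> - total F r) ^ 4) + (sqrt n * (total F r - scenter r)) ^ 4)"
    using i4 by (simp add: prob_space)
  also have "\<dots> \<le> 8 * ((real n)\<^sup>2 * (8 * (C4 + K ^ 4) * (B * \<beta>) ^ 4 / (real n)\<^sup>2) + (2 * (B * \<beta>) * K) ^ 4)"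
  proof (intro mult_left_mono add_mono hT_fourth_moment[OF r B])
    show "(sqrt n * (total F r - scenter r)) ^ 4 \<le> (2 * (B * \<beta>) * K) ^ 4"
      using power_mono[OF scenter_close, of 4] by simp
  qed auto
  also have "\<dots> = C6"
  proof -
    have "(real n)\<^sup>2 * (y / (real n)\<^sup>2) = y" for y :: real using n_ge1 by simp
    then show ?thesis by (simp add: C6_def power_mult_distrib) (simp add: algebra_simps)
  qed
  finally show "expectation (\<lambda>\<omega>. X \<omega> ^ 4) \<le> C6" .
qed

text \<open>Numerical differentiation of the characteristic function at 0: the imaginary part at
  \<theta> recovers the mean and the real part the second moment, with remainders controlled
  uniformly by the fourth moment. Dividing the error \<open>err\<close> by \<theta> or
  \<open>\<theta>\<^sup>2\<close> is harmless as long as \<theta> stays fixed while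
  \<open>err\<close> tends to 0.\<close>

lemma X_moments_close:
  fixes \<theta> :: real
  assumes \<theta>: "0 < \<theta>" "2 * \<theta> * (B * \<beta>) \<le> sqrt n"
  defines "err \<equiv> \<epsilon> + K * clt_const (337 * (2 * \<theta> * (B * \<beta>))) / sqrt n"
  shows "\<bar>sqrt n * (total F r - scenter r)\<bar> \<le> err / \<theta> + \<theta> * (1 + C6)"
    and "\<bar>expectation (\<lambda>\<omega>. (X \<omega>)\<^sup>2) - n * svar r\<bar> \<le> 2 * err / \<theta>\<^sup>2 + \<theta>\<^sup>2 * (C6 + (4 * K * (B * \<beta>)\<^sup>2)\<^sup>2)"
proof -
  define v where "v = n * svar r"
  note v = svar_bounds[folded v_def]
  note x = X_facts
  let ?E = "expectation (\<lambda>\<omega>. exp (\<i> * of_real (\<theta> * X \<omega>)))"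
  have main: "cmod (?E - exp (- of_real (\<theta>\<^sup>2 * v / 2))) \<le> err"
    using hT_char_close[OF r B, of \<theta>] \<theta> unfolding err_def v_def by simp
  have iE: "integrable M (\<lambda>\<omega>. exp (\<i> * complex_of_real (\<theta> * X \<omega>)))"
  proof (rule integrable_bounded[of _ 1])
    show "(\<lambda>\<omega>. exp (\<i> * complex_of_real (\<theta> * X \<omega>))) \<in> borel_measurable M"
      by (rule measurable_compose[OF x(1), of "\<lambda>y. exp (\<i> * complex_of_real (\<theta> * y))"]) measurable
  qed simp
  have Re: "Re ?E = expectation (\<lambda>\<omega>. cos (\<theta> * X \<omega>))" and Im: "Im ?E = expectation (\<lambda>\<omega>. sin (\<theta> * X \<omega>))"
    using integral_Re[OF iE] integral_Im[OF iE] by (simp_all add: Re_exp Im_exp)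
  have ic: "integrable M (\<lambda>\<omega>. cos (\<theta> * X \<omega>))" "integrable M (\<lambda>\<omega>. sin (\<theta> * X \<omega>))"
    by (rule integrable_bounded[of _ 1]; use x(1) in simp)+
  \<comment> \<open>The Gaussian characteristic function is real, so the expected sine is small by
    itself; this forces the mean of the normalized deviation to be small.\<close>
  have "\<bar>Im (?E - exp (- of_real (\<theta>\<^sup>2 * v / 2)))\<bar> \<le> err" using abs_Im_le_cmod main by (rule order_trans)
  then have imle: "\<bar>expectation (\<lambda>\<omega>. sin (\<theta> * X \<omega>))\<bar> \<le> err"
    using Im by (simp add: Im_exp flip: of_real_minus exp_of_real del: of_real_mult of_real_divide of_real_power)
  have "\<bar>Re (?E - exp (- of_real (\<theta>\<^sup>2 * v / 2)))\<bar> \<le> err" using abs_Re_le_cmod main by (rule order_trans)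
  then have rele: "\<bar>expectation (\<lambda>\<omega>. cos (\<theta> * X \<omega>)) - exp (- (\<theta>\<^sup>2 * v / 2))\<bar> \<le> err"
    using Re by (simp add: Re_exp flip: of_real_minus exp_of_real del: of_real_mult of_real_divide of_real_power)
  have sin2: "\<bar>sin y - y\<bar> \<le> y\<^sup>2 / 2" for y :: real
  proof -
    have "cmod (exp (\<i> * of_real y) - 1 - \<i> * of_real y) \<le> y\<^sup>2 / 2" by (rule cmod_exp_i_minus_terms_le)
    then have "\<bar>Im (exp (\<i> * of_real y) - 1 - \<i> * of_real y)\<bar> \<le> y\<^sup>2 / 2" using abs_Im_le_cmod order_trans by blast
    then show ?thesis by (simp add: Im_exp)
  qed
  have cos4: "\<bar>cos y - (1 - y\<^sup>2 / 2)\<bar> \<le> y ^ 4 / 24" for y :: real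
  proof -
    have "{..3::nat} = {0, 1, 2, 3}" by auto
    then have "(\<Sum>k\<le>3. (\<i> * complex_of_real y) ^ k / fact k) = 1 + \<i> * of_real y - of_real (y\<^sup>2 / 2) - \<i> * of_real (y ^ 3 / 6)"
      by (simp add: power_mult_distrib fact_numeral power3_eq_cube)
    then have "cmod (iexp y - (1 + \<i> * of_real y - of_real (y\<^sup>2 / 2) - \<i> * of_real (y ^ 3 / 6))) \<le> \<bar>y\<bar> ^ 4 / 24"
      using iexp_approx1[of y 3] by (simp add: fact_numeral)
    then have "\<bar>Re (iexp y - (1 + \<i> * of_real y - of_real (y\<^sup>2 / 2) - \<i> * of_real (y ^ 3 / 6)))\<bar> \<le> \<bar>y\<bar> ^ 4 / 24"
      using abs_Re_le_cmod order_trans by blast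
    then show ?thesis by (simp add: Re_exp algebra_simps)
  qed
  have E2: "expectation (\<lambda>\<omega>. (X \<omega>)\<^sup>2) \<le> 1 + C6"
  proof -
    have "expectation (\<lambda>\<omega>. (X \<omega>)\<^sup>2) \<le> expectation (\<lambda>\<omega>. 1 + X \<omega> ^ 4)"
    proof (rule integral_mono)
      fix \<omega>
      have "0 \<le> ((X \<omega>)\<^sup>2 - 1)\<^sup>2" by simp
      then have "2 * (X \<omega>)\<^sup>2 \<le> 1 + ((X \<omega>)\<^sup>2)\<^sup>2" by (simp add: power2_diff)
      moreover have "((X \<omega>)\<^sup>2)\<^sup>2 = X \<omega> ^ 4" unfolding power_mult[symmetric] by simp
      moreover have "0 \<le> (X \<omega>)\<^sup>2" by simp
      ultimately show "(X \<omega>)\<^sup>2 \<le> 1 + X \<omega> ^ 4" by linarith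
    qed (use x in auto)
    also have "\<dots> = 1 + expectation (\<lambda>\<omega>. X \<omega> ^ 4)" using x(4) by (simp add: prob_space)
    finally show ?thesis using x(6) by linarith
  qed
  have C60: "0 \<le> C6" using C4_ge1 K B \<beta> by (simp add: C6_def)
  have "\<bar>expectation (\<lambda>\<omega>. sin (\<theta> * X \<omega>)) - \<theta> * expectation X\<bar> = \<bar>expectation (\<lambda>\<omega>. sin (\<theta> * X \<omega>) - \<theta> * X \<omega>)\<bar>"
    using x(2) ic by simp
  also have "\<dots> \<le> expectation (\<lambda>\<omega>. \<bar>sin (\<theta> * X \<omega>) - \<theta> * X \<omega>\<bar>)"
    using integral_norm_bound[of M "\<lambda>\<omega>. sin (\<theta> * X \<omega>) - \<theta> * X \<omega>"] by simp
  also have "\<dots> \<le> expectation (\<lambda>\<omega>. \<theta>\<^sup>2 * (X \<omega>)\<^sup>2 / 2)"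
    using sin2[of "\<theta> * X _"] x ic by (intro integral_mono) (auto simp: power_mult_distrib)
  also have "\<dots> = \<theta>\<^sup>2 * expectation (\<lambda>\<omega>. (X \<omega>)\<^sup>2) / 2" by simp
  also have "\<dots> \<le> \<theta>\<^sup>2 * (1 + C6)"   proof -
    have "x / 2 \<le> y" if "x \<le> y" "0 \<le> y" for x y :: real using that by linarith
    from this[OF mult_left_mono[OF E2, of "\<theta>\<^sup>2"]] show ?thesis using C60 by simp
  qed
  finally have s1: "\<bar>expectation (\<lambda>\<omega>. sin (\<theta> * X \<omega>)) - \<theta> * expectation X\<bar> \<le> \<theta>\<^sup>2 * (1 + C6)" .
  have "\<theta> * \<bar>expectation X\<bar> = \<bar>\<theta> * expectation X\<bar>" using \<theta> by (simp add: abs_mult)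
  also have "\<dots> \<le> err + \<theta>\<^sup>2 * (1 + C6)" using s1 imle by linarith
  finally have "\<bar>expectation X\<bar> \<le> (err + \<theta>\<^sup>2 * (1 + C6)) / \<theta>" using \<theta> by (simp only: pos_le_divide_eq mult.commute)
  also have "\<dots> = err / \<theta> + \<theta> * (1 + C6)" using \<theta> by (simp add: add_divide_distrib power2_eq_square)
  finally show "\<bar>sqrt n * (total F r - scenter r)\<bar> \<le> err / \<theta> + \<theta> * (1 + C6)" unfolding x(5) .
  have "\<bar>expectation (\<lambda>\<omega>. cos (\<theta> * X \<omega>)) - (1 - \<theta>\<^sup>2 * expectation (\<lambda>\<omega>. (X \<omega>)\<^sup>2) / 2)\<bar> =
      \<bar>expectation (\<lambda>\<omega>. cos (\<theta> * X \<omega>) - (1 - (\<theta> * X \<omega>)\<^sup>2 / 2))\<bar>"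
    using x(3) ic by (simp add: power_mult_distrib prob_space)
  also have "\<dots> \<le> expectation (\<lambda>\<omega>. \<bar>cos (\<theta> * X \<omega>) - (1 - (\<theta> * X \<omega>)\<^sup>2 / 2)\<bar>)"
    using integral_norm_bound[of M "\<lambda>\<omega>. cos (\<theta> * X \<omega>) - (1 - (\<theta> * X \<omega>)\<^sup>2 / 2)"] by simp
  also have "\<dots> \<le> expectation (\<lambda>\<omega>. \<theta> ^ 4 * X \<omega> ^ 4 / 24)"
  proof (rule integral_mono)
    fix \<omega> show "\<bar>cos (\<theta> * X \<omega>) - (1 - (\<theta> * X \<omega>)\<^sup>2 / 2)\<bar> \<le> \<theta> ^ 4 * X \<omega> ^ 4 / 24"
      using cos4[of "\<theta> * X \<omega>"] by (simp only: power_mult_distrib)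
  qed (use x(3,4) ic in \<open>auto simp: power_mult_distrib\<close>)
  also have "\<dots> = \<theta> ^ 4 * expectation (\<lambda>\<omega>. X \<omega> ^ 4) / 24" by simp
  also have "\<dots> \<le> \<theta> ^ 4 * C6 / 24" using mult_left_mono[OF x(6), of "\<theta> ^ 4"] by simp
  finally have c1: "\<bar>expectation (\<lambda>\<omega>. cos (\<theta> * X \<omega>)) - (1 - \<theta>\<^sup>2 * expectation (\<lambda>\<omega>. (X \<omega>)\<^sup>2) / 2)\<bar> \<le> \<theta> ^ 4 * C6 / 24" .
  have c2: "\<bar>exp (- y) - (1 - y)\<bar> \<le> y\<^sup>2" if "0 \<le> y" for y :: real
  proof -
    have "1 - y \<le> exp (- y)" using exp_ge_add_one_self[of "- y"] by simp
    moreover have "exp (- y) \<le> 1 - y + y\<^sup>2"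
    proof (cases "y \<le> 1")
      case True
      then show ?thesis using exp_le_quadratic[of "- y"] that by simp
    next
      case False
      then have "exp (- y) \<le> 1" "y * 1 \<le> y * y" by (auto intro: mult_left_mono)
      then show ?thesis unfolding power2_eq_square by linarith
    qed
    ultimately show ?thesis by linarith
  qed
  have "\<bar>exp (- (\<theta>\<^sup>2 * v / 2)) - (1 - \<theta>\<^sup>2 * v / 2)\<bar> \<le> (\<theta>\<^sup>2 * v / 2)\<^sup>2" by (rule c2) (use v in simp)
  also have "\<dots> = \<theta> ^ 4 * v\<^sup>2 / 4" by (simp add: power_mult_distrib power_divide flip: power_mult)
  also have "\<dots> \<le> \<theta> ^ 4 * (4 * K * (B * \<beta>)\<^sup>2)\<^sup>2 / 4"
    using power_mono[OF v(2) v(1), of 2] by (intro divide_right_mono mult_left_mono) auto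
  finally have c3: "\<bar>exp (- (\<theta>\<^sup>2 * v / 2)) - (1 - \<theta>\<^sup>2 * v / 2)\<bar> \<le> \<theta> ^ 4 * (4 * K * (B * \<beta>)\<^sup>2)\<^sup>2 / 4" .
  let ?d = "expectation (\<lambda>\<omega>. (X \<omega>)\<^sup>2) - v" and ?V = "(4 * K * (B * \<beta>)\<^sup>2)\<^sup>2"
  have "\<bar>\<theta>\<^sup>2 * expectation (\<lambda>\<omega>. (X \<omega>)\<^sup>2) / 2 - \<theta>\<^sup>2 * v / 2\<bar> \<le> err + \<theta> ^ 4 * C6 / 24 + \<theta> ^ 4 * ?V / 4"
    using rele c1 c3 by linarith
  moreover have "\<bar>\<theta>\<^sup>2 * expectation (\<lambda>\<omega>. (X \<omega>)\<^sup>2) / 2 - \<theta>\<^sup>2 * v / 2\<bar> = \<theta>\<^sup>2 * \<bar>?d\<bar> / 2"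
  proof -
    have "\<theta>\<^sup>2 * expectation (\<lambda>\<omega>. (X \<omega>)\<^sup>2) / 2 - \<theta>\<^sup>2 * v / 2 = (\<theta>\<^sup>2 / 2) * ?d" by (simp add: algebra_simps)
    then show ?thesis by (simp only: abs_mult) simp
  qed
  moreover have "0 \<le> \<theta> ^ 4 * C6" "0 \<le> \<theta> ^ 4 * ?V" using C60 by auto
  ultimately have "\<theta>\<^sup>2 * \<bar>?d\<bar> \<le> 2 * err + (\<theta> ^ 4 * C6 + \<theta> ^ 4 * ?V)" by linarith
  also have "\<dots> = \<theta>\<^sup>2 * (2 * err / \<theta>\<^sup>2 + \<theta>\<^sup>2 * (C6 + ?V))"
    using \<theta> by (simp add: power2_eq_square power4_eq_xxxx algebra_simps)
  finally show "\<bar>expectation (\<lambda>\<omega>. (X \<omega>)\<^sup>2) - n * svar r\<bar> \<le> 2 * err / \<theta>\<^sup>2 + \<theta>\<^sup>2 * (C6 + ?V)"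
    unfolding v_def using \<theta> by (simp del: times_divide_eq_right)
qed

lemma hT_variance_eq:
  "n * expectation (\<lambda>\<omega>. (hT r \<omega> - total F r)\<^sup>2) = expectation (\<lambda>\<omega>. (X \<omega>)\<^sup>2) - (sqrt n * (total F r - scenter r))\<^sup>2"
proof -
  note x = X_facts
  have "expectation (\<lambda>\<omega>. (X \<omega> - expectation X)\<^sup>2) = expectation (\<lambda>\<omega>. (X \<omega>)\<^sup>2) - (expectation X)\<^sup>2"
    by (rule variance_eq[OF x(2,3)])
  moreover have "expectation (\<lambda>\<omega>. (X \<omega> - expectation X)\<^sup>2) = expectation (\<lambda>\<omega>. n * (hT r \<omega> - total F r)\<^sup>2)"
  proof (rule Bochner_Integration.integral_cong[OF refl])
    fix \<omega>
    have "X \<omega> - expectation X = sqrt n * (hT r \<omega> - total F r)" unfolding x(5) by (simp add: algebra_simps)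
    then show "(X \<omega> - expectation X)\<^sup>2 = n * (hT r \<omega> - total F r)\<^sup>2" by (simp add: power_mult_distrib)
  qed
  ultimately have "expectation (\<lambda>\<omega>. n * (hT r \<omega> - total F r)\<^sup>2) = expectation (\<lambda>\<omega>. (X \<omega>)\<^sup>2) - (expectation X)\<^sup>2"
    by (simp only:)
  then have "expectation (\<lambda>\<omega>. n * (hT r \<omega> - total F r)\<^sup>2) = expectation (\<lambda>\<omega>. (X \<omega>)\<^sup>2) - (sqrt n * (total F r - scenter r))\<^sup>2"
    unfolding x(5) .
  then show ?thesis unfolding integral_mult_right_zero .
qed

end

text \<open>Expanding the squares around the deterministic \<open>sreg r\<close> instead of the
  random ratio leaves the sum of \<open>G1\<close> minus \<open>R' - R\<close> times the sum of
  \<open>G3\<close>. In the Poisson model the first sum has mean \<open>svar r\<close> and the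
  second has mean 0, up to errors of relative order \<open>1 / sqrt n\<close>. Bounds on first
  absolute moments then give the rate.\<close>

lemma hajek_consistent:
  assumes r: "bounded_variable r B" and B: "0 < B"
  shows "integrable M (\<lambda>\<omega>. n * hajek_var_est D r \<omega>)"
    and "expectation (\<lambda>\<omega>. \<bar>n * hajek_var_est D r \<omega> - n * svar r\<bar>) \<le> (B * \<beta>)\<^sup>2 * (16 * C4 + 8 * K) / sqrt n"
proof -
  define b where "b = B * \<beta> / n"
  have b0: "0 < b" using B \<beta> n_ge1 by (simp add: b_def)
  have rb: "\<forall>x\<in>F. \<bar>r x\<bar> \<le> B" using r by (simp add: bounded_variable_def)
  note resid = G_resid[OF r B, folded b_def]
  have wdm: "(\<lambda>\<omega>. wdraw r i (points i \<omega> k)) \<in> borel_measurable M" if "i < N" "k < size2 D i" for i k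
    by (rule measurable_compose[OF points_measurable[OF that(1)] wdraw_comp_measurable[OF r that]])
  have hm: "hajek_var_est D r \<in> borel_measurable M" by (rule hajek_measurable[of "\<lambda>_. r"]) (rule wdm)
  note hb = hajek_bound[OF rb B]
  show "integrable M (\<lambda>\<omega>. n * hajek_var_est D r \<omega>)" by (rule integrable_bounded) (use hm hb in auto)
  \<comment> \<open>By unbiasedness, the second-stage term turns the mean of \<open>G1\<close> into
    the second moment of the residual minus \<open>pi1 D i\<close> times its squared mean. This
    matches the summand of \<open>svar\<close>, with \<open>pi1 D i\<close> in place of one factor
    \<open>q i\<close>.\<close>
  define G1 where "G1 i x = (1 - pi1 D i) * (resid r i x)\<^sup>2 + pi1 D i * wvar r i x" for i x
  define G3 where "G3 i x = (1 - pi1 D i) * resid r i x" for i x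
  have g1: "group_stat G1 (12 * b\<^sup>2)"
    unfolding group_stat_def
  proof (intro allI impI conjI)
    fix i x assume i: "i < N"
    show "G1 i \<in> borel_measurable (\<Pi>\<^sub>M k\<in>{..<size2 D i}. lebesgue)"
      unfolding G1_def[abs_def] using resid wvar_measurable[OF r i] i by (auto simp: group_stat_def)
    have "\<bar>resid r i x\<bar> \<le> 2 * b" using resid i by (auto simp: group_stat_def)
    from power_mono[OF this, of 2] have "(resid r i x)\<^sup>2 \<le> 4 * b\<^sup>2" by (simp add: power_mult_distrib)
    then have "\<bar>(1 - pi1 D i) * (resid r i x)\<^sup>2\<bar> \<le> 1 * (4 * b\<^sup>2)"
      unfolding abs_mult using pi1_bounds[of i] by (intro mult_mono) auto
    moreover have "\<bar>pi1 D i * wvar r i x\<bar> \<le> 1 * (8 * b\<^sup>2)"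
      unfolding abs_mult using pi1_bounds[of i] wvar_bound[OF rb B i, of x, folded b_def] by (intro mult_mono) auto
    ultimately show "\<bar>G1 i x\<bar> \<le> 12 * b\<^sup>2" unfolding G1_def by linarith
  qed
  have g3: "group_stat G3 (2 * b)"
    unfolding group_stat_def
  proof (intro allI impI conjI)
    fix i x assume i: "i < N"
    show "G3 i \<in> borel_measurable (\<Pi>\<^sub>M k\<in>{..<size2 D i}. lebesgue)"
      unfolding G3_def[abs_def] using resid i by (auto simp: group_stat_def)
    have "\<bar>resid r i x\<bar> \<le> 2 * b" using resid i by (auto simp: group_stat_def)
    then have "\<bar>(1 - pi1 D i) * resid r i x\<bar> \<le> 1 * (2 * b)"
      unfolding abs_mult using pi1_bounds[of i] by (intro mult_mono) auto
    then show "\<bar>G3 i x\<bar> \<le> 2 * b" by (simp add: G3_def)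
  qed
  have gm1: "gmean G1 i = gmean (\<lambda>i x. (resid r i x)\<^sup>2) i - pi1 D i * (gmean (resid r) i)\<^sup>2" if i: "i < N" for i
  proof -
    have iv: "integrable (points_law i) (wvar r i)"
    proof (rule integrable_points_law[OF i])
      have "measurable (points_law i) (borel :: real measure) = measurable (\<Pi>\<^sub>M k\<in>{..<size2 D i}. lebesgue) borel"
        by (rule measurable_cong_sets) auto
      then show "wvar r i \<in> borel_measurable (points_law i)" using wvar_measurable[OF r i] by simp
      show "norm (wvar r i x) \<le> 8 * (B * \<beta> / n)\<^sup>2" for x using wvar_bound[OF rb B i, of x] by simp
    qed
    have "gmean G1 i = (1 - pi1 D i) * gmean (\<lambda>i x. (resid r i x)\<^sup>2) i + pi1 D i * gmean (wvar r) i"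
      unfolding gmean_def G1_def[abs_def] using integrable_resid(2)[OF r B i] iv by simp
    then show ?thesis unfolding gmean_resid(3)[OF r B i, symmetric] by (simp add: algebra_simps)
  qed
  have gm3: "gmean G3 i = (1 - pi1 D i) * gmean (resid r) i" if i: "i < N" for i
    unfolding gmean_def G3_def[abs_def] by simp
  have gb: "\<bar>gmean (resid r) i\<bar> \<le> 2 * b" if "i < N" for i by (rule gmean_bound[OF resid that])
  have close1: "\<bar>(\<Sum>i<N. q i * gmean G1 i) - svar r\<bar> \<le> 4 * b\<^sup>2 * (K * sqrt n)"
  proof -
    have "(\<Sum>i<N. q i * gmean G1 i) - svar r = (\<Sum>i<N. (pi1 D i - q i) * (- (q i * (gmean (resid r) i)\<^sup>2)))"
      unfolding svar_def sum_subtractf[symmetric]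
      by (intro sum.cong refl) (simp add: gm1 power2_eq_square algebra_simps)
    also have "\<bar>\<dots>\<bar> \<le> 4 * b\<^sup>2 * (K * sqrt n)"
    proof (rule weighted_q_close)
      fix i assume i: "i < N"
      from power_mono[OF gb[OF i], of 2] have "(gmean (resid r) i)\<^sup>2 \<le> 4 * b\<^sup>2" by (simp add: power_mult_distrib)
      then have "q i * (gmean (resid r) i)\<^sup>2 \<le> 1 * (4 * b\<^sup>2)" using q_facts[OF i] by (intro mult_mono) auto
      then show "\<bar>- (q i * (gmean (resid r) i)\<^sup>2)\<bar> \<le> 4 * b\<^sup>2" using q_facts[OF i] by simp
    qed simp
    finally show ?thesis .
  qed
  have close3: "\<bar>\<Sum>i<N. q i * gmean G3 i\<bar> \<le> 2 * b * (K * sqrt n)"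
  proof -
    \<comment> \<open>Subtracting the normal equation, which is zero, leaves only differences
      \<open>pi1 D i - q i\<close>.\<close>
    have "(\<Sum>i<N. q i * gmean G3 i) = (\<Sum>i<N. q i * gmean G3 i) - (\<Sum>i<N. q i * (1 - q i) * gmean (resid r) i)"
      by (simp add: resid_uncorrelated[OF r B])
    also have "\<dots> = (\<Sum>i<N. (pi1 D i - q i) * (- (q i * gmean (resid r) i)))"
      unfolding sum_subtractf[symmetric] by (intro sum.cong refl) (simp add: gm3 algebra_simps)
    also have "\<bar>\<dots>\<bar> \<le> 2 * b * (K * sqrt n)"
    proof (rule weighted_q_close)
      fix i assume i: "i < N"
      have "\<bar>q i\<bar> * \<bar>gmean (resid r) i\<bar> \<le> 1 * (2 * b)" using gb[OF i] q_facts[OF i] by (intro mult_mono) auto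
      then show "\<bar>- (q i * gmean (resid r) i)\<bar> \<le> 2 * b" by (simp add: abs_mult)
    qed (use b0 in simp)
    finally show ?thesis .
  qed
  let ?T1 = "\<lambda>\<omega>. (\<Sum>i\<in>S \<omega>. G1 i (points i \<omega>)) - (\<Sum>i<N. q i * gmean G1 i)"
  let ?T3 = "\<lambda>\<omega>. (\<Sum>i\<in>S \<omega>. G3 i (points i \<omega>)) - (\<Sum>i<N. q i * gmean G3 i)"
  have pt: "\<bar>hajek_var_est D r \<omega> - svar r\<bar> \<le> \<bar>?T1 \<omega>\<bar> + 4 * b\<^sup>2 * (K * sqrt n) + 2 * b * (\<bar>?T3 \<omega>\<bar> + 2 * b * (K * sqrt n))"
    if w: "\<omega> \<in> space M" for \<omega>
  proof -
    define R where "R = sreg r"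
    define R' where "R' = hratio r \<omega>"
    define W where "W = (\<Sum>i\<in>S \<omega>. 1 - pi1 D i)"
    let ?x = "\<lambda>i. wtotal r i (points i \<omega>)"
    have fS: "finite (S \<omega>)" using sample1_subset[OF w] finite_subset by blast
    \<comment> \<open>The weighted residuals measure the error of the estimated ratio. When
      \<open>W = 0\<close> all weights vanish and both sides are 0.\<close>
    have T3: "(\<Sum>i\<in>S \<omega>. G3 i (points i \<omega>)) = (R' - R) * W"
    proof -
      have "(\<Sum>i\<in>S \<omega>. (1 - pi1 D i) * ?x i) = R' * W"
      proof (cases "W = 0")
        case True
        then have "\<forall>i\<in>S \<omega>. 1 - pi1 D i = 0" unfolding W_def using pi1_bounds fS
          by (subst (asm) sum_nonneg_eq_0_iff) auto
        then show ?thesis using True by simp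
      qed (simp add: R'_def hratio_def W_def)
      then show ?thesis
        by (simp add: G3_def resid_def R_def W_def right_diff_distrib left_diff_distrib sum_subtractf sum_distrib_left mult.commute)
    qed
    \<comment> \<open>The identity for squared deviations around a weighted mean: the cross term and
      the square term combine into one product of two small quantities.\<close>
    have "(\<Sum>i\<in>S \<omega>. (1 - pi1 D i) * (?x i - R')\<^sup>2) =
        (\<Sum>i\<in>S \<omega>. (1 - pi1 D i) * (?x i - R)\<^sup>2 - 2 * (R' - R) * ((1 - pi1 D i) * (?x i - R)) + (R' - R)\<^sup>2 * (1 - pi1 D i))"
      by (intro sum.cong refl) (simp add: power2_eq_square algebra_simps)
    also have "\<dots> = (\<Sum>i\<in>S \<omega>. (1 - pi1 D i) * (?x i - R)\<^sup>2) - 2 * (R' - R) * (\<Sum>i\<in>S \<omega>. G3 i (points i \<omega>)) + (R' - R)\<^sup>2 * W"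
      by (simp only: sum.distrib sum_subtractf sum_distrib_left[symmetric] G3_def resid_def R_def W_def)
    also have "\<dots> = (\<Sum>i\<in>S \<omega>. (1 - pi1 D i) * (?x i - R)\<^sup>2) - (R' - R) * (\<Sum>i\<in>S \<omega>. G3 i (points i \<omega>))"
      unfolding T3 by (simp add: power2_eq_square)
    finally have "hajek_var_est D r \<omega> = (\<Sum>i\<in>S \<omega>. G1 i (points i \<omega>)) - (R' - R) * (\<Sum>i\<in>S \<omega>. G3 i (points i \<omega>))"
      unfolding hajek_eq[OF w] R'_def[symmetric] by (simp add: G1_def resid_def R_def sum.distrib)
    moreover have "\<bar>(R' - R) * (\<Sum>i\<in>S \<omega>. G3 i (points i \<omega>))\<bar> \<le> 2 * b * (\<bar>?T3 \<omega>\<bar> + 2 * b * (K * sqrt n))"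
      unfolding abs_mult
    proof (rule mult_mono)
      show "\<bar>R' - R\<bar> \<le> 2 * b"
        using hratio_bound[OF rb _ w] sreg_bound[OF r B] B unfolding R'_def R_def b_def by linarith
      show "\<bar>\<Sum>i\<in>S \<omega>. G3 i (points i \<omega>)\<bar> \<le> \<bar>?T3 \<omega>\<bar> + 2 * b * (K * sqrt n)" using close3 by linarith
    qed (use b0 in auto)
    ultimately show ?thesis using close1 by linarith
  qed
  have bint: "integrable M (\<lambda>\<omega>. (\<Sum>i\<in>S \<omega>. G i (points i \<omega>)) - a)" if "group_stat G c" for G c a
  proof -
    have "integrable M (\<lambda>\<omega>. \<Sum>i\<in>S \<omega>. G i (points i \<omega>))"
      by (rule integrable_bounded[OF group_sum_measurable[OF that], of "n * c"]) (use group_sum_bound[OF that] in simp)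
    then show ?thesis by simp
  qed
  have "expectation (\<lambda>\<omega>. \<bar>n * hajek_var_est D r \<omega> - n * svar r\<bar>) \<le>
      expectation (\<lambda>\<omega>. n * (\<bar>?T1 \<omega>\<bar> + 4 * b\<^sup>2 * (K * sqrt n) + 2 * b * (\<bar>?T3 \<omega>\<bar> + 2 * b * (K * sqrt n))))"
  proof (rule integral_mono_AE')
    show "AE \<omega> in M. \<bar>n * hajek_var_est D r \<omega> - n * svar r\<bar> \<le>
        n * (\<bar>?T1 \<omega>\<bar> + 4 * b\<^sup>2 * (K * sqrt n) + 2 * b * (\<bar>?T3 \<omega>\<bar> + 2 * b * (K * sqrt n)))"
      unfolding right_diff_distrib[symmetric] abs_mult abs_of_nat by (intro AE_I2 mult_left_mono pt) auto
    show "AE \<omega> in M. 0 \<le> n * (\<bar>?T1 \<omega>\<bar> + 4 * b\<^sup>2 * (K * sqrt n) + 2 * b * (\<bar>?T3 \<omega>\<bar> + 2 * b * (K * sqrt n)))"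
      using b0 K by (intro AE_I2 mult_nonneg_nonneg add_nonneg_nonneg) auto
  qed (use bint[OF g1] bint[OF g3] in auto)
  also have "\<dots> = n * (expectation (\<lambda>\<omega>. \<bar>?T1 \<omega>\<bar>) + 4 * b\<^sup>2 * (K * sqrt n) + 2 * b * (expectation (\<lambda>\<omega>. \<bar>?T3 \<omega>\<bar>) + 2 * b * (K * sqrt n)))"
    using bint[OF g1] bint[OF g3] by (simp add: prob_space)
  also have "\<dots> \<le> n * (C4 * (12 * b\<^sup>2) * sqrt n + 4 * b\<^sup>2 * (K * sqrt n) + 2 * b * (C4 * (2 * b) * sqrt n + 2 * b * (K * sqrt n)))"
    using group_sum_abs_moment[OF g1] group_sum_abs_moment[OF g3] b0 K by (intro mult_left_mono add_mono) auto
  also have "\<dots> = (n * b)\<^sup>2 * (16 * C4 + 8 * K) * (sqrt n / n)"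
    using n_ge1 by (simp add: power2_eq_square field_simps)
  also have "n * b = B * \<beta>" using n_ge1 by (simp add: b_def)
  also have "sqrt n / n = 1 / sqrt n"
  proof -
    have "x / (x * x) = 1 / x" if "0 < x" for x :: real using that by simp
    from this[of "sqrt n"] show ?thesis using n_ge1 by simp
  qed
  finally show "expectation (\<lambda>\<omega>. \<bar>n * hajek_var_est D r \<omega> - n * svar r\<bar>) \<le> (B * \<beta>)\<^sup>2 * (16 * C4 + 8 * K) / sqrt n" by simp
qed

end

section \<open>The plug-in estimator\<close>

lemma gradient_eqI:
  fixes g :: "'q::euclidean_space \<Rightarrow> real"
  assumes "GDERIV g a :> D"
  shows "gradient g a = D"
  unfolding gradient_def
proof (rule the_equality)
  fix D' assume "GDERIV g a :> D'"
  then have "(\<lambda>h. h \<bullet> D') = (\<lambda>h. h \<bullet> D)"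
    using assms unfolding gderiv_def by (rule has_derivative_unique)
  then have "(D' - D) \<bullet> D' = (D' - D) \<bullet> D" by meson
  then have "(D' - D) \<bullet> (D' - D) = 0" by (simp add: inner_diff_right)
  then show "D' = D" by simp
qed fact

lemma differentiable_gderiv:
  fixes g :: "'q::euclidean_space \<Rightarrow> real"
  assumes "g differentiable (at a)"
  shows "GDERIV g a :> gradient g a"
proof -
  obtain f' where f': "(g has_derivative f') (at a)" using assms by (auto simp: differentiable_def)
  then interpret bounded_linear f' by (rule has_derivative_bounded_linear)
  define D where "D = (\<Sum>e\<in>Basis. f' e *\<^sub>R e)"
  have "f' h = h \<bullet> D" for h
  proof -
    have "f' h = f' (\<Sum>e\<in>Basis. (h \<bullet> e) *\<^sub>R e)" by (simp add: euclidean_representation)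
    also have "\<dots> = (\<Sum>e\<in>Basis. (h \<bullet> e) * f' e)" by (simp add: sum scaleR)
    also have "\<dots> = h \<bullet> D" by (simp add: D_def inner_sum_right mult.commute)
    finally show ?thesis .
  qed
  then have "f' = (\<lambda>h. h \<bullet> D)" by auto
  then have "GDERIV g a :> D" using f' by (simp add: gderiv_def)
  then show ?thesis using gradient_eqI by metis
qed

text \<open>The gradient is homogeneous of degree -1, by the chain rule for scaling. Euler's
  identity follows since \<open>g\<close> is constant along the ray through \<open>a\<close>, so its
  derivative in that direction vanishes.\<close>

lemma gderiv_homogeneous:
  fixes g :: "'q::euclidean_space \<Rightarrow> real"
  assumes hom: "homogeneous_degree_0 g" and g: "g differentiable (at a)"
  shows "0 < c \<Longrightarrow> gradient g (c *\<^sub>R a) = gradient g a /\<^sub>R c" and "gradient g a \<bullet> a = 0"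
proof -
  have D: "(g has_derivative (\<lambda>h. h \<bullet> gradient g a)) (at a)"
    using differentiable_gderiv[OF g] by (simp add: gderiv_def)
  show "gradient g (c *\<^sub>R a) = gradient g a /\<^sub>R c" if c: "0 < c"
  proof (rule gradient_eqI)
    have "((\<lambda>x. x /\<^sub>R c) has_derivative (\<lambda>h. h /\<^sub>R c)) (at (c *\<^sub>R a))"
      by (auto intro!: derivative_eq_intros)
    moreover have "(g has_derivative (\<lambda>h. h \<bullet> gradient g a)) (at ((c *\<^sub>R a) /\<^sub>R c))" using D c by simp
    ultimately have "((\<lambda>x. g (x /\<^sub>R c)) has_derivative (\<lambda>h. (h /\<^sub>R c) \<bullet> gradient g a)) (at (c *\<^sub>R a))"
      by (rule has_derivative_compose)
    moreover have "(\<lambda>x. g (x /\<^sub>R c)) = g" using hom c by (auto simp: homogeneous_degree_0_def)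
    moreover have "(\<lambda>h. (h /\<^sub>R c) \<bullet> gradient g a) = (\<lambda>h. h \<bullet> (gradient g a /\<^sub>R c))" by (auto simp: mult.commute)
    ultimately show "GDERIV g (c *\<^sub>R a) :> gradient g a /\<^sub>R c" by (simp add: gderiv_def)
  qed
  have "((\<lambda>t. t *\<^sub>R a) has_derivative (\<lambda>h. h *\<^sub>R a)) (at (1::real))" by (auto intro!: derivative_eq_intros)
  moreover have "(g has_derivative (\<lambda>h. h \<bullet> gradient g a)) (at (1 *\<^sub>R a))" using D by simp
  ultimately have "((\<lambda>t. g (t *\<^sub>R a)) has_derivative (\<lambda>h. (h *\<^sub>R a) \<bullet> gradient g a)) (at (1::real))"
    by (rule has_derivative_compose)
  then have "((\<lambda>t. g (t *\<^sub>R a)) has_real_derivative (a \<bullet> gradient g a)) (at 1)"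
    by (rule has_derivative_imp_has_field_derivative) simp
  moreover have "((\<lambda>t. g (t *\<^sub>R a)) has_real_derivative 0) (at 1)"
  proof (rule has_field_derivative_transform_within_open[where S = "{0<..}"])
    show "((\<lambda>_. g a) has_real_derivative 0) (at 1)" by simp
    show "g a = g (t *\<^sub>R a)" if "t \<in> {0<..}" for t using hom that by (simp add: homogeneous_degree_0_def)
  qed auto
  ultimately show "gradient g a \<bullet> a = 0" using DERIV_unique by (metis inner_commute)
qed

text \<open>Mean value theorem along the segment, which convexity keeps inside \<open>C\<close>,
  where the gradient is Lipschitz. The intermediate point is at distance at most
  \<open>norm (b - a)\<close> from \<open>a\<close>.\<close>

lemma gradient_taylor:
  fixes g :: "'q::euclidean_space \<Rightarrow> real"
  assumes C: "convex C" and g: "\<And>a. a \<in> C \<Longrightarrow> g differentiable (at a)"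
    and lip: "\<And>a b. a \<in> C \<Longrightarrow> b \<in> C \<Longrightarrow> norm (gradient g b - gradient g a) \<le> k * norm (b - a)" and k: "0 \<le> k"
    and ab: "a \<in> C" "b \<in> C"
  shows "\<bar>g b - g a - gradient g a \<bullet> (b - a)\<bar> \<le> k * (norm (b - a))\<^sup>2"
proof -
  define y where "y t = a + t *\<^sub>R (b - a)" for t :: real
  have yC: "y t \<in> C" if "0 \<le> t" "t \<le> 1" for t
  proof -
    have "y t = (1 - t) *\<^sub>R a + t *\<^sub>R b" by (simp add: y_def algebra_simps)
    then show ?thesis using convexD[OF C ab, of "1 - t" t] that by simp
  qed
  define \<phi> where "\<phi> t = g (y t) - t * (gradient g a \<bullet> (b - a))" for t
  have D: "(\<phi> has_real_derivative (gradient g (y t) - gradient g a) \<bullet> (b - a)) (at t)" if t: "0 \<le> t" "t \<le> 1" for t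
  proof -
    have "(y has_derivative (\<lambda>h. h *\<^sub>R (b - a))) (at t)" unfolding y_def by (auto intro!: derivative_eq_intros)
    moreover have "(g has_derivative (\<lambda>h. h \<bullet> gradient g (y t))) (at (y t))"
      using differentiable_gderiv[OF g[OF yC[OF t]]] by (simp add: gderiv_def)
    ultimately have "((\<lambda>t. g (y t)) has_derivative (\<lambda>h. (h *\<^sub>R (b - a)) \<bullet> gradient g (y t))) (at t)"
      by (rule has_derivative_compose)
    then have "((\<lambda>t. g (y t)) has_real_derivative ((b - a) \<bullet> gradient g (y t))) (at t)"
      by (rule has_derivative_imp_has_field_derivative) simp
    then show ?thesis unfolding \<phi>_def
      by (auto intro!: derivative_eq_intros simp: inner_diff_left inner_diff_right inner_commute)
  qed
  obtain z where z: "0 < z" "z < 1" "\<phi> 1 - \<phi> 0 = (1 - 0) * ((gradient g (y z) - gradient g a) \<bullet> (b - a))"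
    using MVT2[of 0 1 \<phi> "\<lambda>t. (gradient g (y t) - gradient g a) \<bullet> (b - a)"] D by auto
  have "\<phi> 1 - \<phi> 0 = g b - g a - gradient g a \<bullet> (b - a)" by (simp add: \<phi>_def y_def)
  then have "\<bar>g b - g a - gradient g a \<bullet> (b - a)\<bar> = \<bar>(gradient g (y z) - gradient g a) \<bullet> (b - a)\<bar>" using z by simp
  also have "\<dots> \<le> norm (gradient g (y z) - gradient g a) * norm (b - a)" by (rule Cauchy_Schwarz_ineq2)
  also have "\<dots> \<le> (k * norm (b - a)) * norm (b - a)"
  proof (rule mult_right_mono)
    have "norm (gradient g (y z) - gradient g a) \<le> k * norm (y z - a)" using lip[OF ab(1) yC[of z]] z by simp
    also have "norm (y z - a) \<le> 1 * norm (b - a)" using z unfolding y_def by (simp add: mult_left_le_one_le)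
    finally show "norm (gradient g (y z) - gradient g a) \<le> k * norm (b - a)" using k by (simp add: mult_left_mono)
  qed simp
  finally show ?thesis by (simp add: power2_eq_square mult.assoc)
qed

section \<open>The ratio form of the plug-in estimator\<close>

locale plugin_population = regular_population F D \<alpha> \<beta>
  for F :: "'a::euclidean_space set" and D :: "('a, 'w) two_stage" and \<alpha> \<beta> :: real +
  fixes \<rho> :: "'a \<Rightarrow> 'q::euclidean_space" and g :: "'q \<Rightarrow> real" and C :: "'q set" and k \<Gamma> R :: real
  assumes hom: "homogeneous_degree_0 g" and conv: "convex C" and closed_C: "closed C"
    and \<rho>C: "\<And>x. x \<in> F \<Longrightarrow> \<rho> x \<in> C" and \<rho>_measurable: "\<rho> \<in> borel_measurable (lebesgue_on F)"
    and A_pos: "0 < measure lebesgue F" and mean_C: "total F \<rho> /\<^sub>R measure lebesgue F \<in> C"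
    and g_diff: "\<And>a. a \<in> C \<Longrightarrow> g differentiable (at a)"
    and g_lip: "\<And>a b. a \<in> C \<Longrightarrow> b \<in> C \<Longrightarrow> norm (gradient g b - gradient g a) \<le> k * norm (b - a)" and k: "0 \<le> k"
    and \<Gamma>: "\<And>a. a \<in> C \<Longrightarrow> norm (gradient g a) \<le> \<Gamma>" and R: "1 \<le> R" "\<And>a. a \<in> C \<Longrightarrow> norm a \<le> R"
begin

abbreviation "A \<equiv> measure lebesgue F"
abbreviation "\<mu> \<equiv> total F \<rho> /\<^sub>R A"
abbreviation "HT \<equiv> horvitz_thompson D \<rho>"
abbreviation "size_est \<equiv> hT (\<lambda>_. 1)"
abbreviation "mean_est \<equiv> \<lambda>\<omega>. HT \<omega> /\<^sub>R size_est \<omega>"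
abbreviation "lin \<equiv> lin_var F \<rho> g"

text \<open>One bound for all variables fed to the Horvitz--Thompson and Hajek estimators: the
  components of \<rho>, the constant 1, the linearized variable (gradient at most
  \<open>\<Gamma> / A\<close>) and its estimated version (gradient at most
  \<open>\<Gamma> / \<alpha>\<close>).\<close>

definition bd :: real where "bd = R * (1 + \<Gamma> / \<alpha> + \<Gamma> / A)"

lemma \<Gamma>0: "0 \<le> \<Gamma>" by (rule order_trans[OF norm_ge_zero \<Gamma>[OF mean_C]])

lemma bd_ge: "R \<le> bd" "1 \<le> bd" "\<Gamma> / A * R \<le> bd" "\<Gamma> / \<alpha> * R \<le> bd" "0 < bd"
proof -
  have x: "0 \<le> \<Gamma> / \<alpha> * R" "0 \<le> \<Gamma> / A * R" using \<Gamma>0 \<alpha> A_pos R by auto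
  have e: "bd = R + \<Gamma> / \<alpha> * R + \<Gamma> / A * R" by (simp add: bd_def distrib_left mult.commute)
  show "R \<le> bd" "1 \<le> bd" "\<Gamma> / A * R \<le> bd" "\<Gamma> / \<alpha> * R \<le> bd" "0 < bd" unfolding e using x R(1) by linarith+
qed

lemma gradient_total: "gradient g (total F \<rho>) = gradient g \<mu> /\<^sub>R A"
  using gderiv_homogeneous(1)[OF hom g_diff[OF mean_C] A_pos] A_pos by simp

lemma g_total: "g (total F \<rho>) = g \<mu>"
  using hom A_pos by (simp add: homogeneous_degree_0_def)

lemma bounded_inner: "bounded_variable (\<lambda>x. c \<bullet> \<rho> x) (norm c * R)"
  unfolding bounded_variable_def
proof (intro conjI ballI)
  show "(\<lambda>x. c \<bullet> \<rho> x) \<in> borel_measurable (lebesgue_on F)" using \<rho>_measurable by measurable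
  fix x assume "x \<in> F"
  then have "norm (\<rho> x) \<le> R" using \<rho>C R by blast
  then have "norm c * norm (\<rho> x) \<le> norm c * R" by (rule mult_left_mono) simp
  then show "\<bar>c \<bullet> \<rho> x\<bar> \<le> norm c * R" using Cauchy_Schwarz_ineq2[of c "\<rho> x"] by linarith
qed

lemma bounded_variable_mono: "bounded_variable r b \<Longrightarrow> b \<le> b' \<Longrightarrow> bounded_variable r b'"
  unfolding bounded_variable_def by force

lemma bounded_component: "e \<in> Basis \<Longrightarrow> bounded_variable (\<lambda>x. \<rho> x \<bullet> e) bd"
  using bounded_variable_mono[OF bounded_inner[of e], of bd] bd_ge(1) by (simp add: inner_commute)

lemma bounded_one: "bounded_variable (\<lambda>_. 1) bd"
  using bd_ge(2) by (simp add: bounded_variable_def)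

lemma lin_eq: "lin x = (gradient g \<mu> /\<^sub>R A) \<bullet> \<rho> x"
  by (simp add: lin_var_def gradient_total)

lemma bounded_lin: "bounded_variable lin bd"
proof -
  have "norm (gradient g \<mu> /\<^sub>R A) * R \<le> \<Gamma> / A * R"
    using \<Gamma>[OF mean_C] A_pos R(1) by (intro mult_right_mono) (auto simp: divide_inverse mult.commute)
  then show ?thesis unfolding lin_eq[abs_def] using bd_ge(3) by (intro bounded_variable_mono[OF bounded_inner]) linarith
qed

lemma total_inner: "total F (\<lambda>x. c \<bullet> \<rho> x) = c \<bullet> total F \<rho>"
proof -
  have "integrable (lebesgue_on F) \<rho>"
  proof -
    interpret FM: finite_measure "lebesgue_on F" using F_fin by (rule finite_measure_lebesgue_on)
    show ?thesis using \<rho>_measurable \<rho>C R F_measurable by (intro FM.integrable_const_bound[of _ R]) auto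
  qed
  then show ?thesis unfolding total_def by (rule integral_inner_right)
qed

text \<open>Euler's identity at the mean. Consequently the estimator of the linearized total is
  already centered, and its second moment is its variance.\<close>

lemma total_lin: "total F lin = 0"
proof -
  have "gradient g \<mu> \<bullet> \<mu> = 0" by (rule gderiv_homogeneous(2)[OF hom g_diff[OF mean_C]])
  then have "gradient g \<mu> \<bullet> total F \<rho> = 0" using A_pos by (simp add: inner_scaleR_right)
  then show ?thesis unfolding lin_eq[abs_def] total_inner by (simp add: inner_scaleR_left)
qed

lemma HT_inner:
  assumes w: "\<omega> \<in> space M"
  shows "c \<bullet> HT \<omega> = hT (\<lambda>x. c \<bullet> \<rho> x) \<omega>"
proof -
  have "c \<bullet> psu_total_est D \<rho> i \<omega> = psu_total_est D (\<lambda>x. c \<bullet> \<rho> x) i \<omega>" for i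
    unfolding psu_total_est_def by (simp add: inner_sum_right)
  then have "c \<bullet> HT \<omega> = horvitz_thompson D (\<lambda>x. c \<bullet> \<rho> x) \<omega>"
    unfolding horvitz_thompson_def by (simp add: inner_sum_right)
  then show ?thesis using horvitz_thompson_eq[OF w] by simp
qed

text \<open>Every weight lies between \<alpha> and \<beta>, divided by both sample sizes, and the
  sample sizes are fixed. The bounds hold at every outcome, so dividing by the estimated measure is
  safe without truncation.\<close>

lemma size_est_bounds:
  assumes w: "\<omega> \<in> space M"
  shows "\<alpha> \<le> size_est \<omega>" "size_est \<omega> \<le> \<beta>"
proof -
  have t: "\<alpha> / n \<le> wtotal (\<lambda>_. 1) i (points i \<omega>)" "wtotal (\<lambda>_. 1) i (points i \<omega>) \<le> \<beta> / n" if i: "i \<in> S \<omega>" for i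
  proof -
    have iN: "i < N" using sample1_subset[OF w] i by auto
    have s: "0 < real (size2 D i)" using size2_ge2[OF iN] by simp
    have d: "wdraw (\<lambda>_. 1) i (points i \<omega> j) = 1 / (pi1 D i * pi2 D i (points i \<omega> j))" "points i \<omega> j \<in> psu D i" if "j < size2 D i" for j
    proof -
      have "point D i j \<omega> \<in> psu D i"
        using two_stage w i that by (auto simp: two_stage_sampling_def second_stage_sampling_def)
      then show "wdraw (\<lambda>_. 1) i (points i \<omega> j) = 1 / (pi1 D i * pi2 D i (points i \<omega> j))" "points i \<omega> j \<in> psu D i"
        using that by (simp_all add: wdraw_def points_def)
    qed
    have e: "(\<Sum>j<size2 D i. c / (real n * size2 D i)) = c / n" for c using s by simp
    have "(\<Sum>j<size2 D i. \<alpha> / (real n * size2 D i)) \<le> wtotal (\<lambda>_. 1) i (points i \<omega>)"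
      "wtotal (\<lambda>_. 1) i (points i \<omega>) \<le> (\<Sum>j<size2 D i. \<beta> / (real n * size2 D i))"
      unfolding wtotal_def using d(1) weight_bounds(2,3)[OF iN d(2)] by (intro sum_mono; simp)+
    then show "\<alpha> / n \<le> wtotal (\<lambda>_. 1) i (points i \<omega>)" "wtotal (\<lambda>_. 1) i (points i \<omega>) \<le> \<beta> / n"
      unfolding e by blast+
  qed
  have e: "(\<Sum>i\<in>S \<omega>. c / n) = c" for c using n_ge1 by (simp add: sample1_card[OF w])
  have "(\<Sum>i\<in>S \<omega>. \<alpha> / n) \<le> size_est \<omega>" "size_est \<omega> \<le> (\<Sum>i\<in>S \<omega>. \<beta> / n)" using t by (intro sum_mono; simp)+
  then show "\<alpha> \<le> size_est \<omega>" "size_est \<omega> \<le> \<beta>" unfolding e by blast+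
qed

lemma size_est_pos: "\<omega> \<in> space M \<Longrightarrow> 0 < size_est \<omega>"
  using size_est_bounds(1) \<alpha> by force

lemma HT_eq: "\<omega> \<in> space M \<Longrightarrow> HT \<omega> = size_est \<omega> *\<^sub>R mean_est \<omega>"
  using size_est_pos[of \<omega>] by simp

lemma mean_est_in:
  assumes w: "\<omega> \<in> space M"
  shows "mean_est \<omega> \<in> C"
proof -
  let ?I = "SIGMA i:S \<omega>. {..<size2 D i}"
  let ?v = "\<lambda>(i, j). 1 / (pi1 D i * pi2 D i (point D i j \<omega>))"
  have fS: "finite (S \<omega>)" using sample1_subset[OF w] finite_subset by blast
  have fI: "finite ?I" using fS by auto
  have p: "point D i j \<omega> \<in> psu D i" "i < N" if "i \<in> S \<omega>" "j < size2 D i" for i j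
    using two_stage w that sample1_subset[OF w] by (auto simp: two_stage_sampling_def second_stage_sampling_def)
  have v0: "0 \<le> ?v x" if "x \<in> ?I" for x
  proof -
    obtain i j where x: "x = (i, j)" "i \<in> S \<omega>" "j < size2 D i" using \<open>x \<in> ?I\<close> by (metis SigmaE lessThan_iff)
    show ?thesis using weight_bounds(1)[OF p(2)[OF x(2,3)] p(1)[OF x(2,3)]] unfolding x(1) by (simp add: less_imp_le)
  qed
  have sz: "size_est \<omega> = (\<Sum>x\<in>?I. ?v x)"
  proof -
    have "size_est \<omega> = horvitz_thompson D (\<lambda>_. 1) \<omega>" by (rule horvitz_thompson_eq[OF w, symmetric])
    also have "\<dots> = (\<Sum>i\<in>S \<omega>. \<Sum>j<size2 D i. 1 / (pi1 D i * pi2 D i (point D i j \<omega>)))"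
      unfolding horvitz_thompson_def psu_total_est_def by (simp add: sum_distrib_left divide_inverse mult.commute)
    also have "\<dots> = (\<Sum>x\<in>?I. ?v x)" using fS by (subst sum.Sigma) auto
    finally show ?thesis .
  qed
  have "HT \<omega> = (\<Sum>i\<in>S \<omega>. \<Sum>j<size2 D i. (1 / (pi1 D i * pi2 D i (point D i j \<omega>))) *\<^sub>R \<rho> (point D i j \<omega>))"
    unfolding horvitz_thompson_def psu_total_est_def by (simp add: scaleR_sum_right divide_inverse mult.commute)
  also have "\<dots> = (\<Sum>x\<in>?I. ?v x *\<^sub>R \<rho> (point D (fst x) (snd x) \<omega>))" using fS by (subst sum.Sigma) (auto intro!: sum.cong)
  finally have "mean_est \<omega> = (\<Sum>x\<in>?I. (?v x / size_est \<omega>) *\<^sub>R \<rho> (point D (fst x) (snd x) \<omega>))"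
    by (simp add: scaleR_sum_right divide_inverse mult.commute)
  also have "\<dots> \<in> C"
  proof (rule convex_sum[OF fI conv])
    show "(\<Sum>x\<in>?I. ?v x / size_est \<omega>) = 1"
      unfolding sum_divide_distrib[symmetric] sz[symmetric] using size_est_pos[OF w] by simp
    show "0 \<le> ?v x / size_est \<omega>" if "x \<in> ?I" for x using v0[OF that] size_est_pos[OF w] by (intro divide_nonneg_pos) auto
    show "\<rho> (point D (fst x) (snd x) \<omega>) \<in> C" if "x \<in> ?I" for x
    proof -
      obtain i j where x: "x = (i, j)" "i \<in> S \<omega>" "j < size2 D i" using \<open>x \<in> ?I\<close> by (metis SigmaE lessThan_iff)
      have "point D i j \<omega> \<in> F" using p(1)[OF x(2,3)] psu_facts(2)[OF p(2)[OF x(2,3)]] by blast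
      then show ?thesis using \<rho>C x by simp
    qed
  qed
  finally show ?thesis .
qed

lemma plugin_est_eq:
  assumes w: "\<omega> \<in> space M"
  shows "plugin_est D \<rho> g \<omega> = g (mean_est \<omega>)" "gradient g (HT \<omega>) = gradient g (mean_est \<omega>) /\<^sub>R size_est \<omega>"
proof -
  show "plugin_est D \<rho> g \<omega> = g (mean_est \<omega>)"
    using hom size_est_pos[OF w] by (simp add: plugin_est_def homogeneous_degree_0_def)
  have "gradient g (size_est \<omega> *\<^sub>R mean_est \<omega>) = gradient g (mean_est \<omega>) /\<^sub>R size_est \<omega>"
    by (rule gderiv_homogeneous(1)[OF hom g_diff[OF mean_est_in[OF w]] size_est_pos[OF w]])
  then show "gradient g (HT \<omega>) = gradient g (mean_est \<omega>) /\<^sub>R size_est \<omega>" by (simp only: HT_eq[OF w, symmetric])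
qed

lemma hT_measurable: "bounded_variable r b \<Longrightarrow> 0 \<le> b \<Longrightarrow> hT r \<in> borel_measurable M"
  using group_sum_measurable[OF group_stat_wtotal] \<beta> by (simp add: less_imp_le)

lemma HT_measurable: "HT \<in> borel_measurable M"
proof (subst borel_measurable_euclidean_space, intro ballI)
  fix e :: 'q assume e: "e \<in> Basis"
  have "hT (\<lambda>x. e \<bullet> \<rho> x) \<in> borel_measurable M"
    using hT_measurable[OF bounded_inner[of e]] R(1) e by simp
  moreover have "HT \<omega> \<bullet> e = hT (\<lambda>x. e \<bullet> \<rho> x) \<omega>" if "\<omega> \<in> space M" for \<omega>
    using HT_inner[OF that, of e] by (simp add: inner_commute)
  ultimately show "(\<lambda>\<omega>. HT \<omega> \<bullet> e) \<in> borel_measurable M" by (subst measurable_cong) auto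
qed

lemma mean_est_measurable: "mean_est \<in> borel_measurable M"
  using HT_measurable hT_measurable[OF bounded_one] bd_ge(5) by simp

text \<open>Continuity is available only on \<open>C\<close>. Extending by zero off the closed set
  gives a Borel function on the whole space, and the estimated mean never leaves
  \<open>C\<close>.\<close>

lemma measurable_on_C:
  fixes f :: "'q \<Rightarrow> 'b::{second_countable_topology, real_normed_vector}"
  assumes "continuous_on C f"
  shows "(\<lambda>\<omega>. f (mean_est \<omega>)) \<in> borel_measurable M"
proof -
  have "(\<lambda>x. indicator C x *\<^sub>R f x) \<in> borel_measurable borel"
    using closed_C assms by (intro borel_measurable_continuous_on_indicator) auto
  then have "(\<lambda>\<omega>. indicator C (mean_est \<omega>) *\<^sub>R f (mean_est \<omega>)) \<in> borel_measurable M"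
    by (rule measurable_compose[OF mean_est_measurable])
  then show ?thesis using mean_est_in by (subst measurable_cong[of _ _ "\<lambda>\<omega>. indicator C (mean_est \<omega>) *\<^sub>R f (mean_est \<omega>)"]) auto
qed

lemma continuous_g: "continuous_on C g" "continuous_on C (gradient g)"
proof -
  show "continuous_on C g"
    using g_diff by (intro continuous_at_imp_continuous_on) (auto intro: differentiable_imp_continuous_within)
  have "k-lipschitz_on C (gradient g)"
    using g_lip k by (intro lipschitz_onI) (auto simp: dist_norm norm_minus_commute)
  then show "continuous_on C (gradient g)" by (rule lipschitz_on_continuous_on)
qed

lemma plugin_est_measurable: "plugin_est D \<rho> g \<in> borel_measurable M"
  using measurable_on_C[OF continuous_g(1)] by (subst measurable_cong[OF plugin_est_eq(1)]) auto

lemma gradient_HT_measurable: "(\<lambda>\<omega>. gradient g (HT \<omega>)) \<in> borel_measurable M"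
  using measurable_on_C[OF continuous_g(2)] hT_measurable[OF bounded_one] bd_ge(5)
  by (subst measurable_cong[OF plugin_est_eq(2)]) auto

lemma lin_est_bound:
  assumes w: "\<omega> \<in> space M"
  shows "\<forall>x\<in>F. \<bar>lin_var_est D \<rho> g \<omega> x\<bar> \<le> bd"
proof
  fix x assume x: "x \<in> F"
  have "norm (gradient g (HT \<omega>)) = norm (gradient g (mean_est \<omega>)) / size_est \<omega>"
    unfolding plugin_est_eq(2)[OF w] using size_est_pos[OF w] by (simp add: divide_inverse mult.commute)
  also have "\<dots> \<le> \<Gamma> / \<alpha>"
    using \<Gamma>[OF mean_est_in[OF w]] size_est_bounds(1)[OF w] \<alpha> \<Gamma>0 by (intro frac_le) auto
  finally have "norm (gradient g (HT \<omega>)) * norm (\<rho> x) \<le> \<Gamma> / \<alpha> * R"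
    using R(2)[OF \<rho>C[OF x]] \<Gamma>0 \<alpha> by (intro mult_mono) auto
  then show "\<bar>lin_var_est D \<rho> g \<omega> x\<bar> \<le> bd"
    using Cauchy_Schwarz_ineq2[of "gradient g (HT \<omega>)" "\<rho> x"] bd_ge(4) by (simp add: lin_var_est_def)
qed

lemma plugin_hajek_facts:
  shows "plugin_hajek D \<rho> g \<in> borel_measurable M" "integrable M (plugin_hajek D \<rho> g)"
proof -
  show m: "plugin_hajek D \<rho> g \<in> borel_measurable M"
    unfolding plugin_hajek_def[abs_def]
  proof (rule hajek_measurable)
    fix i j assume ij: "i < N" "j < size2 D i"
    \<comment> \<open>Expanding in coordinates separates the random gradient from fixed functions of
      the sampled points; each factor is then measurable on its own.\<close>
    have wd: "wdraw (lin_var_est D \<rho> g \<omega>) i y = (\<Sum>e\<in>Basis. (gradient g (HT \<omega>) \<bullet> e) * wdraw (\<lambda>x. \<rho> x \<bullet> e) i y)" for \<omega> y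
    proof -
      have "gradient g (HT \<omega>) \<bullet> \<rho> y = (\<Sum>e\<in>Basis. (gradient g (HT \<omega>) \<bullet> e) * (\<rho> y \<bullet> e))" by (rule euclidean_inner)
      then show ?thesis by (simp add: wdraw_def lin_var_est_def sum_divide_distrib)
    qed
    have "(\<lambda>\<omega>. wdraw (\<lambda>x. \<rho> x \<bullet> e) i (points i \<omega> j)) \<in> borel_measurable M" if "e \<in> Basis" for e
      by (rule measurable_compose[OF points_measurable[OF ij(1)] wdraw_comp_measurable[OF bounded_component[OF that] ij]])
    then show "(\<lambda>\<omega>. wdraw (lin_var_est D \<rho> g \<omega>) i (points i \<omega> j)) \<in> borel_measurable M"
      unfolding wd using gradient_HT_measurable
      by (intro borel_measurable_sum borel_measurable_times borel_measurable_inner) auto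
  qed
  have "integrable M (\<lambda>\<omega>. n * plugin_hajek D \<rho> g \<omega>)"
  proof (rule integrable_bounded)
    fix \<omega> assume w: "\<omega> \<in> space M"
    show "norm (n * plugin_hajek D \<rho> g \<omega>) \<le> 24 * bd * bd * \<beta>\<^sup>2"
      unfolding plugin_hajek_def real_norm_def by (rule hajek_bound[OF lin_est_bound[OF w] bd_ge(5) w])
  qed (use m in simp)
  then show "integrable M (plugin_hajek D \<rho> g)" using n_ge1 by simp
qed

end

section \<open>Elementary moment inequalities and bounded random variables\<close>

lemma sum_abs_power4_le:
  fixes a :: "'i \<Rightarrow> real"
  assumes "finite I"
  shows "(\<Sum>i\<in>I. \<bar>a i\<bar>) ^ 4 \<le> real (card I) ^ 3 * (\<Sum>i\<in>I. a i ^ 4)"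
proof -
  have s: "(\<Sum>i\<in>I. b i)\<^sup>2 \<le> card I * (\<Sum>i\<in>I. (b i)\<^sup>2)" for b :: "'i \<Rightarrow> real"
    using Cauchy_Schwarz_ineq_sum[of "\<lambda>_. 1" b I] by simp
  have "(\<Sum>i\<in>I. \<bar>a i\<bar>) ^ 4 = ((\<Sum>i\<in>I. \<bar>a i\<bar>)\<^sup>2)\<^sup>2" by (simp flip: power_mult)
  also have "\<dots> \<le> (card I * (\<Sum>i\<in>I. (a i)\<^sup>2))\<^sup>2" using s[of "\<lambda>i. \<bar>a i\<bar>"] by (intro power_mono) auto
  also have "\<dots> = (real (card I))\<^sup>2 * (\<Sum>i\<in>I. (a i)\<^sup>2)\<^sup>2" by (simp add: power_mult_distrib)
  also have "\<dots> \<le> (real (card I))\<^sup>2 * (card I * (\<Sum>i\<in>I. ((a i)\<^sup>2)\<^sup>2))" by (rule mult_left_mono[OF s]) simp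
  also have "\<dots> = real (card I) ^ 3 * (\<Sum>i\<in>I. a i ^ 4)" by (simp add: power2_eq_square power3_eq_cube power4_eq_xxxx mult.assoc)
  finally show ?thesis .
qed

lemma two_mult_le_weighted_squares:
  fixes x y c :: real
  assumes "0 < c"
  shows "2 * x * y \<le> x\<^sup>2 / c + c * y\<^sup>2"
proof -
  have "0 \<le> (x / sqrt c - sqrt c * y)\<^sup>2" by simp
  also have "\<dots> = x\<^sup>2 / c + c * y\<^sup>2 - 2 * x * y"
    using assms by (simp add: power2_diff power_divide power_mult_distrib)
  finally show ?thesis by simp
qed

context two_stage_population
begin

text \<open>Boundedness for one fixed member of the sequence, closed under arithmetic, settles all
  questions of integrability. The bound is existential; rates come from the moments.\<close>

definition bounded_rv :: "('w \<Rightarrow> real) \<Rightarrow> bool" where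
  "bounded_rv f \<longleftrightarrow> f \<in> borel_measurable M \<and> (\<exists>b. \<forall>\<omega>\<in>space M. \<bar>f \<omega>\<bar> \<le> b)"

lemma bounded_rvI: "f \<in> borel_measurable M \<Longrightarrow> (\<And>\<omega>. \<omega> \<in> space M \<Longrightarrow> \<bar>f \<omega>\<bar> \<le> b) \<Longrightarrow> bounded_rv f"
  unfolding bounded_rv_def by blast

lemma bounded_rv_integrable: "bounded_rv f \<Longrightarrow> integrable M f"
  unfolding bounded_rv_def by (elim conjE exE) (rule integrable_bounded, auto)

lemma bounded_rv_const: "bounded_rv (\<lambda>_. c)"
  by (rule bounded_rvI[of _ "\<bar>c\<bar>"]) auto

lemma bounded_rv_abs: "bounded_rv f \<Longrightarrow> bounded_rv (\<lambda>\<omega>. \<bar>f \<omega>\<bar>)"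
  unfolding bounded_rv_def by auto

lemma bounded_rv_add:
  assumes "bounded_rv f" "bounded_rv h"
  shows "bounded_rv (\<lambda>\<omega>. f \<omega> + h \<omega>)"
proof -
  obtain a b where ab: "\<And>\<omega>. \<omega> \<in> space M \<Longrightarrow> \<bar>f \<omega>\<bar> \<le> a" "\<And>\<omega>. \<omega> \<in> space M \<Longrightarrow> \<bar>h \<omega>\<bar> \<le> b"
    using assms unfolding bounded_rv_def by blast
  show ?thesis
  proof (rule bounded_rvI[of _ "a + b"])
    show "(\<lambda>\<omega>. f \<omega> + h \<omega>) \<in> borel_measurable M" using assms by (intro borel_measurable_add) (auto simp: bounded_rv_def)
    show "\<bar>f \<omega> + h \<omega>\<bar> \<le> a + b" if "\<omega> \<in> space M" for \<omega> using ab(1)[OF that] ab(2)[OF that] by linarith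
  qed
qed

lemma bounded_rv_mult:
  assumes "bounded_rv f" "bounded_rv h"
  shows "bounded_rv (\<lambda>\<omega>. f \<omega> * h \<omega>)"
proof -
  obtain a b where ab: "\<And>\<omega>. \<omega> \<in> space M \<Longrightarrow> \<bar>f \<omega>\<bar> \<le> a" "\<And>\<omega>. \<omega> \<in> space M \<Longrightarrow> \<bar>h \<omega>\<bar> \<le> b"
    using assms unfolding bounded_rv_def by blast
  show ?thesis
  proof (rule bounded_rvI[of _ "\<bar>a\<bar> * \<bar>b\<bar>"])
    show "(\<lambda>\<omega>. f \<omega> * h \<omega>) \<in> borel_measurable M" using assms by (intro borel_measurable_times) (auto simp: bounded_rv_def)
    show "\<bar>f \<omega> * h \<omega>\<bar> \<le> \<bar>a\<bar> * \<bar>b\<bar>" if "\<omega> \<in> space M" for \<omega>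
      unfolding abs_mult using ab(1)[OF that] ab(2)[OF that] by (intro mult_mono) linarith+
  qed
qed

lemma bounded_rv_diff: "bounded_rv f \<Longrightarrow> bounded_rv h \<Longrightarrow> bounded_rv (\<lambda>\<omega>. f \<omega> - h \<omega>)"
  using bounded_rv_add[of f "\<lambda>\<omega>. (-1) * h \<omega>"] bounded_rv_mult[OF bounded_rv_const[of "-1"], of h] by simp

lemma bounded_rv_power: "bounded_rv f \<Longrightarrow> bounded_rv (\<lambda>\<omega>. f \<omega> ^ m)"
  by (induction m) (simp_all add: bounded_rv_const bounded_rv_mult)

lemma bounded_rv_sum: "(\<And>i. i \<in> I \<Longrightarrow> bounded_rv (f i)) \<Longrightarrow> bounded_rv (\<lambda>\<omega>. \<Sum>i\<in>I. f i \<omega>)"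
  by (induction I rule: infinite_finite_induct) (simp_all add: bounded_rv_const bounded_rv_add)

lemmas bounded_rv_intros = bounded_rv_const bounded_rv_abs bounded_rv_add bounded_rv_mult bounded_rv_diff
  bounded_rv_power bounded_rv_sum

lemma expectation_bounded_mono:
  assumes "bounded_rv f" "bounded_rv h" "\<And>\<omega>. \<omega> \<in> space M \<Longrightarrow> f \<omega> \<le> h \<omega>"
  shows "expectation f \<le> expectation h"
  using assms by (intro integral_mono bounded_rv_integrable) auto

text \<open>A weighted arithmetic-geometric mean inequality, with weight \<open>n\<close> chosen so
  that both terms are of order \<open>1 / n\<close>.\<close>

lemma expectation_square_le_of_fourth:
  assumes f: "bounded_rv f" and c: "expectation (\<lambda>\<omega>. f \<omega> ^ 4) \<le> c / (real n)\<^sup>2" and n: "0 < n"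
  shows "expectation (\<lambda>\<omega>. (f \<omega>)\<^sup>2) \<le> (1 + c) / 2 / n"
proof -
  have "expectation (\<lambda>\<omega>. (f \<omega>)\<^sup>2) \<le> expectation (\<lambda>\<omega>. 1 / (2 * n) + n / 2 * f \<omega> ^ 4)"
  proof (rule expectation_bounded_mono)
    show "(f \<omega>)\<^sup>2 \<le> 1 / (2 * n) + n / 2 * f \<omega> ^ 4" for \<omega>
    proof -
      have "((f \<omega>)\<^sup>2)\<^sup>2 = f \<omega> ^ 4" by (simp flip: power_mult)
      then show ?thesis using two_mult_le_weighted_squares[of "real n" 1 "(f \<omega>)\<^sup>2"] n by simp
    qed
  qed (intro bounded_rv_intros f)+
  also have "\<dots> = 1 / (2 * n) + n / 2 * expectation (\<lambda>\<omega>. f \<omega> ^ 4)"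
    using bounded_rv_integrable[OF bounded_rv_power[OF f, of 4]] by (simp add: prob_space)
  also have "\<dots> \<le> 1 / (2 * n) + n / 2 * (c / (real n)\<^sup>2)" by (intro add_left_mono mult_left_mono[OF c]) simp
  also have "\<dots> = (1 + c) / 2 / n" using n by (simp add: field_simps power2_eq_square)
  finally show ?thesis .
qed

lemma expectation_abs_le_of_square:
  assumes f: "bounded_rv f" and c: "expectation (\<lambda>\<omega>. (f \<omega>)\<^sup>2) \<le> c / d\<^sup>2" and d: "0 < d"
  shows "expectation (\<lambda>\<omega>. \<bar>f \<omega>\<bar>) \<le> (1 + c) / 2 / d"
proof -
  have "expectation (\<lambda>\<omega>. \<bar>f \<omega>\<bar>) \<le> expectation (\<lambda>\<omega>. 1 / (2 * d) + d / 2 * (f \<omega>)\<^sup>2)"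
  proof (rule expectation_bounded_mono)
    show "\<bar>f \<omega>\<bar> \<le> 1 / (2 * d) + d / 2 * (f \<omega>)\<^sup>2" for \<omega>
      using two_mult_le_weighted_squares[of d 1 "\<bar>f \<omega>\<bar>"] d by simp
  qed (intro bounded_rv_intros f)+
  also have "\<dots> = 1 / (2 * d) + d / 2 * expectation (\<lambda>\<omega>. (f \<omega>)\<^sup>2)"
    using bounded_rv_integrable[OF bounded_rv_power[OF f, of 2]] by (simp add: prob_space)
  also have "\<dots> \<le> 1 / (2 * d) + d / 2 * (c / d\<^sup>2)" using d by (intro add_left_mono mult_left_mono[OF c]) simp
  also have "\<dots> = (1 + c) / 2 / d" using d by (simp add: field_simps power2_eq_square)
  finally show ?thesis .
qed

end

section \<open>Pathwise bounds for the linearization error\<close>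

context plugin_population
begin

text \<open>The estimator of the measure of \<open>F\<close> is included, because homogeneity of \<open>g\<close> is used to pass
  from totals to means.\<close>

definition est_dev :: "'w \<Rightarrow> real" where
  "est_dev \<omega> = \<bar>size_est \<omega> - A\<bar> + (\<Sum>e\<in>Basis. \<bar>hT (\<lambda>x. \<rho> x \<bullet> e) \<omega> - total F (\<lambda>x. \<rho> x \<bullet> e)\<bar>)"

lemma est_dev_nonneg: "0 \<le> est_dev \<omega>" unfolding est_dev_def by (intro add_nonneg_nonneg sum_nonneg) auto

lemma size_est_close: "\<bar>size_est \<omega> - A\<bar> \<le> est_dev \<omega>"
  unfolding est_dev_def by (simp add: sum_nonneg)

lemma HT_close:
  assumes w: "\<omega> \<in> space M"
  shows "\<bar>size_est \<omega> - A\<bar> + norm (HT \<omega> - total F \<rho>) \<le> est_dev \<omega>"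
proof -
  have e: "(HT \<omega> - total F \<rho>) \<bullet> e = hT (\<lambda>x. \<rho> x \<bullet> e) \<omega> - total F (\<lambda>x. \<rho> x \<bullet> e)" for e
    using HT_inner[OF w, of e] total_inner[of e] by (simp add: inner_diff_right inner_commute[of _ e])
  show ?thesis using norm_le_l1[of "HT \<omega> - total F \<rho>"] unfolding e est_dev_def by simp
qed

lemma mean_est_close:
  assumes w: "\<omega> \<in> space M"
  shows "norm (mean_est \<omega> - \<mu>) \<le> R / \<alpha> * est_dev \<omega>"
proof -
  note s = size_est_pos[OF w] size_est_bounds(1)[OF w]
  have "mean_est \<omega> - \<mu> = ((HT \<omega> - total F \<rho>) - (size_est \<omega> - A) *\<^sub>R \<mu>) /\<^sub>R size_est \<omega>"
    using s A_pos by (simp add: algebra_simps)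
  then have "norm (mean_est \<omega> - \<mu>) = norm ((HT \<omega> - total F \<rho>) - (size_est \<omega> - A) *\<^sub>R \<mu>) / size_est \<omega>"
    using s by (simp add: divide_inverse mult.commute)
  also have "\<dots> \<le> R * est_dev \<omega> / \<alpha>"
  proof (rule frac_le)
    have "norm ((HT \<omega> - total F \<rho>) - (size_est \<omega> - A) *\<^sub>R \<mu>) \<le> norm (HT \<omega> - total F \<rho>) + \<bar>size_est \<omega> - A\<bar> * norm \<mu>"
      by (rule order_trans[OF norm_triangle_ineq4]) (simp only: norm_scaleR order_refl)
    also have "\<dots> \<le> R * norm (HT \<omega> - total F \<rho>) + R * \<bar>size_est \<omega> - A\<bar>"
      using mult_right_mono[OF R(1), of "norm (HT \<omega> - total F \<rho>)"] mult_left_mono[OF R(2)[OF mean_C], of "\<bar>size_est \<omega> - A\<bar>"]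
      by (simp add: mult.commute)
    also have "\<dots> \<le> R * est_dev \<omega>" unfolding distrib_left[symmetric]
      using HT_close[OF w] R(1) by (intro mult_left_mono) auto
    finally show "norm ((HT \<omega> - total F \<rho>) - (size_est \<omega> - A) *\<^sub>R \<mu>) \<le> R * est_dev \<omega>" .
  qed (use s \<alpha> R est_dev_nonneg in auto)
  finally show ?thesis by simp
qed

text \<open>Lipschitz constant of the gradient at the estimated totals: the first term comes from
  the change of the gradient between means, the second from dividing by the estimated instead of the
  true measure.\<close>

definition c\<gamma> :: real where "c\<gamma> = k * R / \<alpha>\<^sup>2 + \<Gamma> / (\<alpha> * A)"

lemma c\<gamma>0: "0 \<le> c\<gamma>" using k R \<alpha> \<Gamma>0 A_pos by (simp add: c\<gamma>_def)

lemma gradient_close: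
  assumes w: "\<omega> \<in> space M"
  shows "norm (gradient g (HT \<omega>) - gradient g (total F \<rho>)) \<le> c\<gamma> * est_dev \<omega>"
proof -
  note s = size_est_pos[OF w] size_est_bounds(1)[OF w]
  let ?Z = "mean_est \<omega>" and ?s = "size_est \<omega>"
  have "gradient g (HT \<omega>) - gradient g (total F \<rho>) =
      (gradient g ?Z - gradient g \<mu>) /\<^sub>R ?s + ((A - ?s) / (?s * A)) *\<^sub>R gradient g \<mu>"
  proof -
    have "(A - ?s) / (?s * A) = inverse ?s - inverse A" using s A_pos by (simp add: field_simps)
    then show ?thesis unfolding plugin_est_eq(2)[OF w] gradient_total by (simp add: scaleR_diff_left scaleR_diff_right)
  qed
  also have "norm \<dots> \<le> k * R / \<alpha>\<^sup>2 * est_dev \<omega> + \<Gamma> / (\<alpha> * A) * est_dev \<omega>"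
  proof (rule norm_triangle_mono)
    have "norm ((gradient g ?Z - gradient g \<mu>) /\<^sub>R ?s) = norm (gradient g ?Z - gradient g \<mu>) / ?s"
      using s by (simp add: divide_inverse mult.commute)
    also have "\<dots> \<le> (k * (R / \<alpha> * est_dev \<omega>)) / \<alpha>"
    proof (rule frac_le)
      have "norm (gradient g ?Z - gradient g \<mu>) \<le> k * norm (?Z - \<mu>)" by (rule g_lip[OF mean_C mean_est_in[OF w]])
      also have "\<dots> \<le> k * (R / \<alpha> * est_dev \<omega>)" by (rule mult_left_mono[OF mean_est_close[OF w] k])
      finally show "norm (gradient g ?Z - gradient g \<mu>) \<le> k * (R / \<alpha> * est_dev \<omega>)" .
    qed (use s \<alpha> R k est_dev_nonneg in auto)
    finally show "norm ((gradient g ?Z - gradient g \<mu>) /\<^sub>R ?s) \<le> k * R / \<alpha>\<^sup>2 * est_dev \<omega>"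
      by (simp add: power2_eq_square)
    have "norm (((A - ?s) / (?s * A)) *\<^sub>R gradient g \<mu>) = \<bar>?s - A\<bar> * norm (gradient g \<mu>) / (?s * A)"
      using s A_pos by (simp add: abs_mult abs_minus_commute)
    also have "\<dots> \<le> (est_dev \<omega> * \<Gamma>) / (\<alpha> * A)"
      using s A_pos \<alpha> est_dev_nonneg[of \<omega>] \<Gamma>0 size_est_close[of \<omega>] \<Gamma>[OF mean_C] by (intro frac_le mult_mono) auto
    finally show "norm (((A - ?s) / (?s * A)) *\<^sub>R gradient g \<mu>) \<le> \<Gamma> / (\<alpha> * A) * est_dev \<omega>" by (simp add: mult.commute)
  qed
  finally show ?thesis by (simp add: c\<gamma>_def distrib_right)
qed

abbreviation plugin_dev :: "'w \<Rightarrow> real" where "plugin_dev \<equiv> \<lambda>\<omega>. plugin_est D \<rho> g \<omega> - plugin_param F \<rho> g"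
abbreviation lin_rem :: "'w \<Rightarrow> real" where "lin_rem \<equiv> \<lambda>\<omega>. plugin_dev \<omega> - hT lin \<omega>"

text \<open>Two quadratic errors: the Taylor remainder on \<open>C\<close>, and the replacement of
  the estimated measure by \<open>A\<close> in the linear term. The latter is a product of two small
  deviations because Euler's identity removes the part along the mean.\<close>

lemma lin_rem_bound:
  assumes w: "\<omega> \<in> space M"
  shows "\<bar>lin_rem \<omega>\<bar> \<le> est_dev \<omega> * \<bar>hT lin \<omega>\<bar> / \<alpha> + k * (R / \<alpha>)\<^sup>2 * (est_dev \<omega>)\<^sup>2"
proof -
  note s = size_est_pos[OF w] size_est_bounds(1)[OF w]
  let ?Z = "mean_est \<omega>" and ?s = "size_est \<omega>"
  have L: "hT lin \<omega> = (gradient g \<mu> \<bullet> HT \<omega>) / A"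
    unfolding lin_eq[abs_def] HT_inner[OF w, symmetric] by (simp add: divide_inverse mult.commute)
  have "gradient g \<mu> \<bullet> (?Z - \<mu>) = gradient g \<mu> \<bullet> HT \<omega> / ?s"
    using gderiv_homogeneous(2)[OF hom g_diff[OF mean_C]] unfolding inner_diff_right
    by (simp add: divide_inverse mult.commute)
  also have "\<dots> = A / ?s * hT lin \<omega>" unfolding L using A_pos by simp
  finally have 1: "gradient g \<mu> \<bullet> (?Z - \<mu>) - hT lin \<omega> = (A - ?s) * hT lin \<omega> / ?s"
    using s by (simp add: field_simps)
  have "\<bar>(A - ?s) * hT lin \<omega> / ?s\<bar> = \<bar>?s - A\<bar> * \<bar>hT lin \<omega>\<bar> / ?s" using s by (simp add: abs_mult abs_minus_commute)
  also have "\<dots> \<le> est_dev \<omega> * \<bar>hT lin \<omega>\<bar> / \<alpha>"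
    using s \<alpha> est_dev_nonneg[of \<omega>] size_est_close[of \<omega>] by (intro frac_le mult_mono) auto
  finally have 2: "\<bar>gradient g \<mu> \<bullet> (?Z - \<mu>) - hT lin \<omega>\<bar> \<le> est_dev \<omega> * \<bar>hT lin \<omega>\<bar> / \<alpha>" unfolding 1 .
  have "\<bar>g ?Z - g \<mu> - gradient g \<mu> \<bullet> (?Z - \<mu>)\<bar> \<le> k * (norm (?Z - \<mu>))\<^sup>2"
    by (rule gradient_taylor[OF conv g_diff g_lip k mean_C mean_est_in[OF w]])
  also have "\<dots> \<le> k * (R / \<alpha> * est_dev \<omega>)\<^sup>2"
    using mean_est_close[OF w] k by (intro mult_left_mono power_mono) auto
  also have "\<dots> = k * (R / \<alpha>)\<^sup>2 * (est_dev \<omega>)\<^sup>2" by (simp only: power_mult_distrib mult.assoc)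
  finally have 3: "\<bar>g ?Z - g \<mu> - gradient g \<mu> \<bullet> (?Z - \<mu>)\<bar> \<le> k * (R / \<alpha>)\<^sup>2 * (est_dev \<omega>)\<^sup>2" .
  have "plugin_dev \<omega> = g ?Z - g \<mu>" unfolding plugin_param_def g_total plugin_est_eq(1)[OF w] ..
  then show ?thesis using 2 3 by linarith
qed

lemma plugin_hajek_close:
  assumes w: "\<omega> \<in> space M"
  shows "\<bar>n * plugin_hajek D \<rho> g \<omega> - n * hajek_var_est D lin \<omega>\<bar> \<le> 24 * (c\<gamma> * R) * bd * \<beta>\<^sup>2 * est_dev \<omega>"
proof -
  have "\<bar>n * plugin_hajek D \<rho> g \<omega> - n * hajek_var_est D lin \<omega>\<bar> \<le> 24 * (c\<gamma> * est_dev \<omega> * R) * bd * \<beta>\<^sup>2"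
    unfolding plugin_hajek_def
  proof (rule hajek_lipschitz[OF lin_est_bound[OF w] _ _ _ _ w])
    show "\<forall>x\<in>F. \<bar>lin x\<bar> \<le> bd" using bounded_lin by (simp add: bounded_variable_def)
    show "\<forall>x\<in>F. \<bar>lin_var_est D \<rho> g \<omega> x - lin x\<bar> \<le> c\<gamma> * est_dev \<omega> * R"
    proof
      fix x assume x: "x \<in> F"
      have "\<bar>lin_var_est D \<rho> g \<omega> x - lin x\<bar> = \<bar>(gradient g (HT \<omega>) - gradient g (total F \<rho>)) \<bullet> \<rho> x\<bar>"
        by (simp add: lin_var_est_def lin_var_def inner_diff_left)
      also have "\<dots> \<le> norm (gradient g (HT \<omega>) - gradient g (total F \<rho>)) * norm (\<rho> x)" by (rule Cauchy_Schwarz_ineq2)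
      also have "\<dots> \<le> c\<gamma> * est_dev \<omega> * R"
        using gradient_close[OF w] R(2)[OF \<rho>C[OF x]] c\<gamma>0 est_dev_nonneg[of \<omega>] by (intro mult_mono) auto
      finally show "\<bar>lin_var_est D \<rho> g \<omega> x - lin x\<bar> \<le> c\<gamma> * est_dev \<omega> * R" .
    qed
    show "0 \<le> bd" using bd_ge(5) by simp
    show "0 \<le> c\<gamma> * est_dev \<omega> * R" using c\<gamma>0 est_dev_nonneg R(1) by simp
  qed
  then show ?thesis by (simp add: mult_ac)
qed

end

section \<open>Moments, variance and characteristic function of the plug-in estimator\<close>

locale approximated_plugin = approximated_population F D \<alpha> \<beta> K \<epsilon> q + plugin_population F D \<alpha> \<beta> \<rho> g C k \<Gamma> R
  for F :: "'a::euclidean_space set" and D :: "('a, 'w) two_stage" and \<alpha> \<beta> K \<epsilon> :: real and q :: "nat \<Rightarrow> real"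
    and \<rho> :: "'a \<Rightarrow> 'q::euclidean_space" and g :: "'q \<Rightarrow> real" and C :: "'q set" and k \<Gamma> R :: real
begin

definition c0 :: real where "c0 = 8 * (C4 + K ^ 4) * (bd * \<beta>) ^ 4"
definition cY :: real where "cY = 8 * (1 + real DIM('q) ^ 4) * c0"
definition cR :: real where "cR = (cY + c0) / \<alpha>\<^sup>2 + 2 * (k * (R / \<alpha>)\<^sup>2)\<^sup>2 * cY"

lemma c_nonneg: "0 \<le> c0" "0 \<le> cY" "0 \<le> cR"
proof -
  show "0 \<le> c0" using C4_ge1 K by (simp add: c0_def)
  then show "0 \<le> cY" by (simp add: cY_def)
  with \<open>0 \<le> c0\<close> show "0 \<le> cR" by (simp add: cR_def)
qed

lemma hT_fourth: "bounded_variable r bd \<Longrightarrow> expectation (\<lambda>\<omega>. (hT r \<omega> - total F r) ^ 4) \<le> c0 / (real n)\<^sup>2"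
  unfolding c0_def by (rule hT_fourth_moment[OF _ bd_ge(5)])

lemma bounded_rv_hT: "bounded_variable r bd \<Longrightarrow> bounded_rv (hT r)"
  using hT_facts(1,2)[OF _ bd_ge(5)] by (rule bounded_rvI)

lemma total_one: "total F (\<lambda>_. 1::real) = A"
  using F_measurable by (simp add: total_def measure_restrict_space)

lemma bounded_rv_est_dev: "bounded_rv est_dev"
  unfolding est_dev_def[abs_def]
  using bounded_rv_hT[OF bounded_one] bounded_rv_hT[OF bounded_component] by (intro bounded_rv_intros) auto

lemma est_dev_fourth_moment: "expectation (\<lambda>\<omega>. est_dev \<omega> ^ 4) \<le> cY / (real n)\<^sup>2"
proof -
  let ?u = "\<lambda>\<omega>. size_est \<omega> - A" and ?v = "\<lambda>e \<omega>. hT (\<lambda>x. \<rho> x \<bullet> e) \<omega> - total F (\<lambda>x. \<rho> x \<bullet> e)"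
  have b: "bounded_rv ?u" "bounded_rv (?v e)" if "e \<in> Basis" for e
    using bounded_rv_hT[OF bounded_one] bounded_rv_hT[OF bounded_component[OF that]] by (intro bounded_rv_intros; simp)+
  obtain e0 :: 'q where e0: "e0 \<in> Basis" using nonempty_Basis by blast
  note bu = b(1)[OF e0]
  let ?d = "real DIM('q)"
  have bs: "bounded_rv (\<lambda>\<omega>. 8 * (?u \<omega> ^ 4 + ?d ^ 3 * (\<Sum>e\<in>Basis. ?v e \<omega> ^ 4)))"
    by (rule bounded_rv_mult[OF bounded_rv_const] bounded_rv_add bounded_rv_sum bounded_rv_power bu b(2) | assumption)+
  have "expectation (\<lambda>\<omega>. est_dev \<omega> ^ 4) \<le> expectation (\<lambda>\<omega>. 8 * (?u \<omega> ^ 4 + ?d ^ 3 * (\<Sum>e\<in>Basis. ?v e \<omega> ^ 4)))"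
  proof (rule expectation_bounded_mono[OF bounded_rv_power[OF bounded_rv_est_dev] bs])
    fix \<omega>
    have "(est_dev \<omega>) ^ 4 \<le> 8 * (\<bar>?u \<omega>\<bar> ^ 4 + (\<Sum>e\<in>Basis. \<bar>?v e \<omega>\<bar>) ^ 4)" unfolding est_dev_def by (rule power4_add_le)
    also have "\<dots> \<le> 8 * (?u \<omega> ^ 4 + ?d ^ 3 * (\<Sum>e\<in>Basis. ?v e \<omega> ^ 4))"
      using sum_abs_power4_le[OF finite_Basis, of "\<lambda>e. ?v e \<omega>"] by (simp add: power_even_abs_numeral)
    finally show "est_dev \<omega> ^ 4 \<le> 8 * (?u \<omega> ^ 4 + ?d ^ 3 * (\<Sum>e\<in>Basis. ?v e \<omega> ^ 4))" .
  qed
  also have "\<dots> = 8 * (expectation (\<lambda>\<omega>. ?u \<omega> ^ 4) + ?d ^ 3 * (\<Sum>e\<in>Basis. expectation (\<lambda>\<omega>. ?v e \<omega> ^ 4)))"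
  proof -
    have i: "integrable M (\<lambda>\<omega>. ?u \<omega> ^ 4)" "\<And>e. e \<in> Basis \<Longrightarrow> integrable M (\<lambda>\<omega>. ?v e \<omega> ^ 4)"
      using bounded_rv_power[OF bu] bounded_rv_power[OF b(2)] bounded_rv_integrable by blast+
    show ?thesis using i by (simp add: Bochner_Integration.integral_sum)
  qed
  also have "\<dots> \<le> 8 * (c0 / (real n)\<^sup>2 + ?d ^ 3 * (\<Sum>e\<in>(Basis :: 'q set). c0 / (real n)\<^sup>2))"
    using hT_fourth[OF bounded_one] hT_fourth[OF bounded_component] unfolding total_one
    by (intro mult_left_mono add_mono sum_mono) auto
  also have "\<dots> = cY / (real n)\<^sup>2"
    by (simp add: cY_def power4_eq_xxxx power3_eq_cube distrib_left distrib_right add_divide_distrib)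
  finally show ?thesis .
qed

lemma lin_facts: "bounded_rv (hT lin)" "expectation (hT lin) = 0" "expectation (\<lambda>\<omega>. hT lin \<omega> ^ 4) \<le> c0 / (real n)\<^sup>2"
  using bounded_rv_hT[OF bounded_lin] hT_facts(3)[OF bounded_lin bd_ge(5)] hT_fourth[OF bounded_lin]
  unfolding total_lin by simp_all

lemma bounded_rv_lin_rem: "bounded_rv lin_rem"
proof -
  let ?h = "\<lambda>\<omega>. est_dev \<omega> * \<bar>hT lin \<omega>\<bar> * (1 / \<alpha>) + k * (R / \<alpha>)\<^sup>2 * (est_dev \<omega>)\<^sup>2"
  have "bounded_rv ?h" using bounded_rv_est_dev lin_facts(1) by (intro bounded_rv_intros)
  then obtain b where b: "\<bar>?h \<omega>\<bar> \<le> b" if "\<omega> \<in> space M" for \<omega> unfolding bounded_rv_def by blast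
  show ?thesis
  proof (rule bounded_rvI)
    show "\<bar>lin_rem \<omega>\<bar> \<le> b" if "\<omega> \<in> space M" for \<omega> using lin_rem_bound[OF that] b[OF that] by simp
    show "lin_rem \<in> borel_measurable M"
      using plugin_est_measurable lin_facts(1) by (intro borel_measurable_diff) (auto simp: bounded_rv_def)
  qed
qed

lemma bounded_rv_plugin_dev: "bounded_rv plugin_dev"
  using bounded_rv_add[OF bounded_rv_lin_rem lin_facts(1)] by simp

lemma lin_rem_second_moment: "expectation (\<lambda>\<omega>. (lin_rem \<omega>)\<^sup>2) \<le> cR / (real n)\<^sup>2"
proof -
  define c where "c = k * (R / \<alpha>)\<^sup>2"
  have "expectation (\<lambda>\<omega>. (lin_rem \<omega>)\<^sup>2) \<le> expectation (\<lambda>\<omega>. 1 / \<alpha>\<^sup>2 * (est_dev \<omega> ^ 4 + hT lin \<omega> ^ 4) + 2 * c\<^sup>2 * est_dev \<omega> ^ 4)"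
  proof (rule expectation_bounded_mono)
    fix \<omega> assume w: "\<omega> \<in> space M"
    define y l where "y = est_dev \<omega>" and "l = \<bar>hT lin \<omega>\<bar>"
    have "\<bar>lin_rem \<omega>\<bar>\<^sup>2 \<le> (y * l / \<alpha> + c * y\<^sup>2)\<^sup>2"
      using lin_rem_bound[OF w] unfolding y_def l_def c_def by (rule power_mono) simp
    then have "(lin_rem \<omega>)\<^sup>2 \<le> (y * l / \<alpha> + c * y\<^sup>2)\<^sup>2" by (simp only: power2_abs)
    also have "\<dots> \<le> 2 * (y * l / \<alpha>)\<^sup>2 + 2 * (c * y\<^sup>2)\<^sup>2"
      using two_mult_le_weighted_squares[of 1 "y * l / \<alpha>" "c * y\<^sup>2"] by (simp add: power2_sum)
    also have "2 * (y * l / \<alpha>)\<^sup>2 = 1 / \<alpha>\<^sup>2 * (2 * y\<^sup>2 * l\<^sup>2)" by (simp add: power_divide power_mult_distrib)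
    also have "\<dots> \<le> 1 / \<alpha>\<^sup>2 * ((y\<^sup>2)\<^sup>2 + (l\<^sup>2)\<^sup>2)"
      using two_mult_le_weighted_squares[of 1 "y\<^sup>2" "l\<^sup>2"] by (intro mult_left_mono) auto
    also have "(y\<^sup>2)\<^sup>2 = est_dev \<omega> ^ 4" by (simp add: y_def flip: power_mult)
    also have "(l\<^sup>2)\<^sup>2 = hT lin \<omega> ^ 4" by (simp add: l_def flip: power_mult)
    also have "2 * (c * y\<^sup>2)\<^sup>2 = 2 * c\<^sup>2 * est_dev \<omega> ^ 4" by (simp add: y_def power_mult_distrib flip: power_mult)
    finally show "(lin_rem \<omega>)\<^sup>2 \<le> 1 / \<alpha>\<^sup>2 * (est_dev \<omega> ^ 4 + hT lin \<omega> ^ 4) + 2 * c\<^sup>2 * est_dev \<omega> ^ 4" by simp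
  qed (intro bounded_rv_intros bounded_rv_est_dev lin_facts(1) bounded_rv_lin_rem)+
  also have "\<dots> = 1 / \<alpha>\<^sup>2 * (expectation (\<lambda>\<omega>. est_dev \<omega> ^ 4) + expectation (\<lambda>\<omega>. hT lin \<omega> ^ 4)) + 2 * c\<^sup>2 * expectation (\<lambda>\<omega>. est_dev \<omega> ^ 4)"
    using bounded_rv_integrable[OF bounded_rv_power[OF bounded_rv_est_dev, of 4]] bounded_rv_integrable[OF bounded_rv_power[OF lin_facts(1), of 4]]
    by simp
  also have "\<dots> \<le> 1 / \<alpha>\<^sup>2 * (cY / (real n)\<^sup>2 + c0 / (real n)\<^sup>2) + 2 * c\<^sup>2 * (cY / (real n)\<^sup>2)"
    using est_dev_fourth_moment lin_facts(3) by (intro add_mono mult_left_mono) auto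
  also have "\<dots> = cR / (real n)\<^sup>2" by (simp add: cR_def c_def add_divide_distrib mult.commute)
  finally show ?thesis .
qed

lemma first_moments:
  shows "sqrt n * expectation (\<lambda>\<omega>. \<bar>lin_rem \<omega>\<bar>) \<le> (1 + cR) / sqrt n"
    and "expectation est_dev \<le> (1 + cY) / sqrt n"
    and "n * expectation (\<lambda>\<omega>. (hT lin \<omega>)\<^sup>2) \<le> 1 + c0"
proof -
  have n: "0 < real n" "0 < n" "1 \<le> real n" using n_ge1 by auto
  have "expectation (\<lambda>\<omega>. \<bar>lin_rem \<omega>\<bar>) \<le> (1 + cR) / 2 / n"
    by (rule expectation_abs_le_of_square[OF bounded_rv_lin_rem lin_rem_second_moment n(1)])
  also have "\<dots> \<le> (1 + cR) / n" using c_nonneg(3) by (intro divide_right_mono) auto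
  finally have "sqrt n * expectation (\<lambda>\<omega>. \<bar>lin_rem \<omega>\<bar>) \<le> sqrt n * ((1 + cR) / n)" by (rule mult_left_mono) simp
  also have "\<dots> = (1 + cR) / sqrt n" using n(1) by (simp add: real_div_sqrt field_simps)
  finally show "sqrt n * expectation (\<lambda>\<omega>. \<bar>lin_rem \<omega>\<bar>) \<le> (1 + cR) / sqrt n" .
  have "expectation (\<lambda>\<omega>. (est_dev \<omega>)\<^sup>2) \<le> (1 + cY) / 2 / n" by (rule expectation_square_le_of_fourth[OF bounded_rv_est_dev est_dev_fourth_moment n(2)])
  then have "expectation (\<lambda>\<omega>. \<bar>est_dev \<omega>\<bar>) \<le> (1 + (1 + cY) / 2) / 2 / sqrt n"
    using n(1) by (intro expectation_abs_le_of_square[OF bounded_rv_est_dev]) auto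
  also have "\<dots> \<le> (1 + cY) / sqrt n" using c_nonneg(2) by (intro divide_right_mono) auto
  finally show "expectation est_dev \<le> (1 + cY) / sqrt n" using est_dev_nonneg by simp
  have "expectation (\<lambda>\<omega>. (hT lin \<omega>)\<^sup>2) \<le> (1 + c0) / 2 / n" by (rule expectation_square_le_of_fourth[OF lin_facts(1,3) n(2)])
  then have "n * expectation (\<lambda>\<omega>. (hT lin \<omega>)\<^sup>2) \<le> n * ((1 + c0) / 2 / n)" by (rule mult_left_mono) simp
  also have "\<dots> \<le> 1 + c0" using n(1) c_nonneg(1) by simp
  finally show "n * expectation (\<lambda>\<omega>. (hT lin \<omega>)\<^sup>2) \<le> 1 + c0" .
qed

lemma plugin_var_eq: "plugin_var D \<rho> g = expectation (\<lambda>\<omega>. (plugin_dev \<omega>)\<^sup>2) - (expectation plugin_dev)\<^sup>2"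
proof -
  note i = bounded_rv_integrable[OF bounded_rv_plugin_dev] bounded_rv_integrable[OF bounded_rv_power[OF bounded_rv_plugin_dev, of 2]]
  have iP: "integrable M (plugin_est D \<rho> g)"
    using bounded_rv_integrable[OF bounded_rv_add[OF bounded_rv_plugin_dev bounded_rv_const[of "plugin_param F \<rho> g"]]] by simp
  have "expectation plugin_dev = expectation (plugin_est D \<rho> g) - plugin_param F \<rho> g" using iP by (simp add: prob_space)
  then have "plugin_var D \<rho> g = variance plugin_dev" unfolding plugin_var_def by simp
  also have "\<dots> = expectation (\<lambda>\<omega>. (plugin_dev \<omega>)\<^sup>2) - (expectation plugin_dev)\<^sup>2" by (rule variance_eq[OF i])
  finally show ?thesis .
qed

text \<open>The linear part is of order \<open>1 / sqrt n\<close> and the remainder of order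
  \<open>1 / n\<close>, both in mean square. Weighting the squares by \<open>sqrt n\<close> in the
  cross term balances the two, and after multiplication by \<open>n\<close> all errors are of order
  \<open>1 / sqrt n\<close>.\<close>

lemma plugin_var_close: "\<bar>n * plugin_var D \<rho> g - n * expectation (\<lambda>\<omega>. (hT lin \<omega>)\<^sup>2)\<bar> \<le> (1 + c0 + 4 * cR) / sqrt n"
proof -
  let ?L = "hT lin" and ?E = expectation
  have n: "0 < real n" "1 \<le> real n" using n_ge1 by auto
  have sn: "0 < sqrt n" "sqrt n * sqrt n = n" using n(1) by auto
  have sn2: "sqrt n \<le> n" using mult_left_mono[of 1 "sqrt n" "sqrt n"] n sn by simp
  have int: "integrable M ?L" "integrable M lin_rem" "integrable M (\<lambda>\<omega>. (?L \<omega>)\<^sup>2)" "integrable M (\<lambda>\<omega>. (lin_rem \<omega>)\<^sup>2)"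
    "integrable M (\<lambda>\<omega>. ?L \<omega> * lin_rem \<omega>)" "integrable M (\<lambda>\<omega>. \<bar>?L \<omega> * lin_rem \<omega>\<bar>)"
    by (intro bounded_rv_integrable bounded_rv_intros lin_facts(1) bounded_rv_lin_rem)+
  have EW: "?E plugin_dev = ?E lin_rem" using int(1,2) lin_facts(2) Bochner_Integration.integral_add[OF int(1,2)] by simp
  have "?E (\<lambda>\<omega>. (plugin_dev \<omega>)\<^sup>2) = ?E (\<lambda>\<omega>. (?L \<omega>)\<^sup>2 + 2 * (?L \<omega> * lin_rem \<omega>) + (lin_rem \<omega>)\<^sup>2)"
    by (intro Bochner_Integration.integral_cong refl) (simp add: power2_eq_square algebra_simps)
  also have "\<dots> = ?E (\<lambda>\<omega>. (?L \<omega>)\<^sup>2) + 2 * ?E (\<lambda>\<omega>. ?L \<omega> * lin_rem \<omega>) + ?E (\<lambda>\<omega>. (lin_rem \<omega>)\<^sup>2)"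
    using int by (simp del: integral_diff Bochner_Integration.integral_diff)
  finally have V: "plugin_var D \<rho> g - ?E (\<lambda>\<omega>. (?L \<omega>)\<^sup>2) = 2 * ?E (\<lambda>\<omega>. ?L \<omega> * lin_rem \<omega>) + ?E (\<lambda>\<omega>. (lin_rem \<omega>)\<^sup>2) - (?E lin_rem)\<^sup>2"
    unfolding plugin_var_eq EW by simp
  have R2: "n * ?E (\<lambda>\<omega>. (lin_rem \<omega>)\<^sup>2) \<le> cR / sqrt n"
  proof -
    have "n * ?E (\<lambda>\<omega>. (lin_rem \<omega>)\<^sup>2) \<le> n * (cR / (real n)\<^sup>2)" by (rule mult_left_mono[OF lin_rem_second_moment]) simp
    also have "\<dots> = cR / n" using n by (simp add: power2_eq_square)
    also have "\<dots> \<le> cR / sqrt n" using sn(1) sn2 c_nonneg(3) n by (intro divide_left_mono) auto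
    finally show ?thesis .
  qed
  have var: "0 \<le> ?E (\<lambda>\<omega>. (lin_rem \<omega>)\<^sup>2) - (?E lin_rem)\<^sup>2"
    unfolding variance_eq[OF int(2,4), symmetric] by (rule integral_nonneg_AE) simp
  have LR: "2 * \<bar>?E (\<lambda>\<omega>. ?L \<omega> * lin_rem \<omega>)\<bar> \<le> ?E (\<lambda>\<omega>. (?L \<omega>)\<^sup>2) / sqrt n + sqrt n * ?E (\<lambda>\<omega>. (lin_rem \<omega>)\<^sup>2)"
  proof -
    have "2 * \<bar>?E (\<lambda>\<omega>. ?L \<omega> * lin_rem \<omega>)\<bar> \<le> 2 * ?E (\<lambda>\<omega>. \<bar>?L \<omega> * lin_rem \<omega>\<bar>)" using integral_abs_bound by simp
    also have "\<dots> = ?E (\<lambda>\<omega>. 2 * \<bar>?L \<omega> * lin_rem \<omega>\<bar>)" by (rule integral_mult_right_zero[symmetric])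
    also have "\<dots> \<le> ?E (\<lambda>\<omega>. (?L \<omega>)\<^sup>2 / sqrt n + sqrt n * (lin_rem \<omega>)\<^sup>2)"
    proof (rule integral_mono)
      show "2 * \<bar>?L \<omega> * lin_rem \<omega>\<bar> \<le> (?L \<omega>)\<^sup>2 / sqrt n + sqrt n * (lin_rem \<omega>)\<^sup>2" for \<omega>
        using two_mult_le_weighted_squares[OF sn(1), of "\<bar>?L \<omega>\<bar>" "\<bar>lin_rem \<omega>\<bar>"] by (simp add: abs_mult)
    qed (use int in \<open>simp_all del: integrable_diff Bochner_Integration.integrable_diff\<close>)
    also have "\<dots> = ?E (\<lambda>\<omega>. (?L \<omega>)\<^sup>2) / sqrt n + sqrt n * ?E (\<lambda>\<omega>. (lin_rem \<omega>)\<^sup>2)" using int by simp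
    finally show ?thesis .
  qed
  have nLR: "n * (2 * \<bar>?E (\<lambda>\<omega>. ?L \<omega> * lin_rem \<omega>)\<bar>) \<le> (1 + c0) / sqrt n + cR / sqrt n"
  proof -
    have "n * (2 * \<bar>?E (\<lambda>\<omega>. ?L \<omega> * lin_rem \<omega>)\<bar>) \<le> n * (?E (\<lambda>\<omega>. (?L \<omega>)\<^sup>2) / sqrt n + sqrt n * ?E (\<lambda>\<omega>. (lin_rem \<omega>)\<^sup>2))"
      by (rule mult_left_mono[OF LR]) simp
    also have "\<dots> = (n * ?E (\<lambda>\<omega>. (?L \<omega>)\<^sup>2)) / sqrt n + (n * sqrt n) * ?E (\<lambda>\<omega>. (lin_rem \<omega>)\<^sup>2)" by (simp add: distrib_left)
    also have "\<dots> \<le> (1 + c0) / sqrt n + (n * sqrt n) * (cR / (real n)\<^sup>2)"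
      using first_moments(3) lin_rem_second_moment by (intro add_mono divide_right_mono mult_left_mono) auto
    also have "(n * sqrt n) * (cR / (real n)\<^sup>2) = cR / sqrt n"
    proof -
      have "(n * sqrt n) * sqrt n = (real n)\<^sup>2" using sn(2) by (simp add: power2_eq_square)
      then have "(n * sqrt n) / (real n)\<^sup>2 = 1 / sqrt n" using sn(1) n by (simp add: field_simps)
      moreover have "(n * sqrt n) * (cR / (real n)\<^sup>2) = cR * ((n * sqrt n) / (real n)\<^sup>2)" by simp
      ultimately show ?thesis by simp
    qed
    finally show ?thesis .
  qed
  have "\<bar>n * (plugin_var D \<rho> g - ?E (\<lambda>\<omega>. (?L \<omega>)\<^sup>2))\<bar>
      \<le> n * (2 * \<bar>?E (\<lambda>\<omega>. ?L \<omega> * lin_rem \<omega>)\<bar>) + n * ?E (\<lambda>\<omega>. (lin_rem \<omega>)\<^sup>2)"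
  proof -
    have "\<bar>plugin_var D \<rho> g - ?E (\<lambda>\<omega>. (?L \<omega>)\<^sup>2)\<bar> \<le> 2 * \<bar>?E (\<lambda>\<omega>. ?L \<omega> * lin_rem \<omega>)\<bar> + ?E (\<lambda>\<omega>. (lin_rem \<omega>)\<^sup>2)"
      unfolding V using var zero_le_power2[of "?E lin_rem"] by linarith
    then have "n * \<bar>plugin_var D \<rho> g - ?E (\<lambda>\<omega>. (?L \<omega>)\<^sup>2)\<bar> \<le> n * (2 * \<bar>?E (\<lambda>\<omega>. ?L \<omega> * lin_rem \<omega>)\<bar> + ?E (\<lambda>\<omega>. (lin_rem \<omega>)\<^sup>2))"
      by (rule mult_left_mono) simp
    then show ?thesis by (simp only: abs_mult abs_of_nat distrib_left)
  qed
  also have "\<dots> \<le> (1 + c0) / sqrt n + cR / sqrt n + cR / sqrt n" using nLR R2 by linarith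
  also have "\<dots> = (1 + c0 + 2 * cR) / sqrt n" by (simp add: add_divide_distrib)
  also have "\<dots> \<le> (1 + c0 + 4 * cR) / sqrt n" using c_nonneg(3) by (intro divide_right_mono) auto
  finally show ?thesis by (simp only: right_diff_distrib)
qed

lemma plugin_var_svar:
  fixes \<theta> :: real
  assumes \<theta>: "0 < \<theta>" "2 * \<theta> * (bd * \<beta>) \<le> sqrt n"
  defines "err \<equiv> \<epsilon> + K * clt_const (337 * (2 * \<theta> * (bd * \<beta>))) / sqrt n"
  shows "\<bar>n * plugin_var D \<rho> g - n * svar lin\<bar> \<le> (1 + c0 + 4 * cR) / sqrt n
    + (2 * err / \<theta>\<^sup>2 + \<theta>\<^sup>2 * (C6 bd + (4 * K * (bd * \<beta>)\<^sup>2)\<^sup>2)) + (err / \<theta> + \<theta> * (1 + C6 bd))\<^sup>2"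
proof -
  note x = X_moments_close[OF bounded_lin bd_ge(5) \<theta>, folded err_def]
  have "(sqrt n * (total F lin - scenter lin))\<^sup>2 \<le> (err / \<theta> + \<theta> * (1 + C6 bd))\<^sup>2"
    using power_mono[OF x(1) abs_ge_zero, of 2] by simp
  moreover have "0 \<le> (sqrt n * (total F lin - scenter lin))\<^sup>2" by simp
  ultimately show ?thesis
    using x(2) plugin_var_close hT_variance_eq[OF bounded_lin bd_ge(5)] unfolding total_lin diff_zero by linarith
qed

text \<open>Non-degeneracy is passed on from the first-stage component to the true variance by
  conditional Jensen, without comparing \<open>svar\<close> with the first-stage component.\<close>

lemma plugin_var_lower: "n * first_stage_var D lin \<le> n * plugin_var D \<rho> g + (1 + c0 + 4 * cR) / sqrt n"
proof -
  have "n * first_stage_var D lin \<le> n * expectation (\<lambda>\<omega>. (hT lin \<omega>)\<^sup>2)"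
    by (rule mult_left_mono[OF hT_facts(4)[OF bounded_lin bd_ge(5) total_lin]]) simp
  then show ?thesis using plugin_var_close by linarith
qed

lemma plugin_hajek_consistent:
  "expectation (\<lambda>\<omega>. \<bar>n * plugin_hajek D \<rho> g \<omega> - n * plugin_var D \<rho> g\<bar>)
    \<le> (24 * (c\<gamma> * R) * bd * \<beta>\<^sup>2 * (1 + cY) + (bd * \<beta>)\<^sup>2 * (16 * C4 + 8 * K)) / sqrt n + \<bar>n * plugin_var D \<rho> g - n * svar lin\<bar>"
proof -
  let ?c = "24 * (c\<gamma> * R) * bd * \<beta>\<^sup>2" and ?v = "\<bar>n * plugin_var D \<rho> g - n * svar lin\<bar>"
  note h = hajek_consistent[OF bounded_lin bd_ge(5)]
  have i: "integrable M est_dev" "integrable M (\<lambda>\<omega>. \<bar>n * hajek_var_est D lin \<omega> - n * svar lin\<bar>)"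
    using bounded_rv_integrable[OF bounded_rv_est_dev] h(1) by auto
  have "expectation (\<lambda>\<omega>. \<bar>n * plugin_hajek D \<rho> g \<omega> - n * plugin_var D \<rho> g\<bar>)
      \<le> expectation (\<lambda>\<omega>. ?c * est_dev \<omega> + \<bar>n * hajek_var_est D lin \<omega> - n * svar lin\<bar> + ?v)"
  proof (rule integral_mono)
    show "integrable M (\<lambda>\<omega>. \<bar>n * plugin_hajek D \<rho> g \<omega> - n * plugin_var D \<rho> g\<bar>)" using plugin_hajek_facts(2) by auto
    show "integrable M (\<lambda>\<omega>. ?c * est_dev \<omega> + \<bar>n * hajek_var_est D lin \<omega> - n * svar lin\<bar> + ?v)" using i by auto
    show "\<bar>n * plugin_hajek D \<rho> g \<omega> - n * plugin_var D \<rho> g\<bar> \<le> ?c * est_dev \<omega> + \<bar>n * hajek_var_est D lin \<omega> - n * svar lin\<bar> + ?v"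
      if "\<omega> \<in> space M" for \<omega> using plugin_hajek_close[OF that] by linarith
  qed
  also have "\<dots> = ?c * expectation est_dev + expectation (\<lambda>\<omega>. \<bar>n * hajek_var_est D lin \<omega> - n * svar lin\<bar>) + ?v"
    using i by (simp add: prob_space)
  also have "\<dots> \<le> ?c * ((1 + cY) / sqrt n) + (bd * \<beta>)\<^sup>2 * (16 * C4 + 8 * K) / sqrt n + ?v"
    using h(2) first_moments(2) c\<gamma>0 R(1) bd_ge(5) by (intro add_mono mult_left_mono) auto
  finally show ?thesis by (simp only: add_divide_distrib[of "?c * (1 + cY)"] times_divide_eq_right)
qed

text \<open>Changing the argument of the unimodular exponential costs at most the absolute change.
  It is spent on the linearization remainder and on the gap between the centre of the Fourier
  argument and the total, which is 0 here.\<close>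

lemma plugin_char_close:
  fixes \<theta> :: real
  assumes \<theta>: "2 * \<bar>\<theta>\<bar> * (bd * \<beta>) \<le> sqrt n"
  shows "cmod (expectation (\<lambda>\<omega>. exp (\<i> * of_real (\<theta> * (sqrt n * plugin_dev \<omega>)))) - exp (- of_real (\<theta>\<^sup>2 * (n * svar lin) / 2)))
    \<le> \<epsilon> + K * clt_const (337 * (2 * \<bar>\<theta>\<bar> * (bd * \<beta>))) / sqrt n
      + \<bar>\<theta>\<bar> * ((1 + cR) / sqrt n + \<bar>sqrt n * (total F lin - scenter lin)\<bar>)"
proof -
  let ?x = "\<lambda>\<omega>. \<theta> * (sqrt n * plugin_dev \<omega>)" and ?y = "\<lambda>\<omega>. \<theta> * (sqrt n * (hT lin \<omega> - scenter lin))"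
  let ?\<delta> = "\<bar>sqrt n * (total F lin - scenter lin)\<bar>"
  have m: "plugin_dev \<in> borel_measurable M" "hT lin \<in> borel_measurable M" using bounded_rv_plugin_dev lin_facts(1) by (simp_all add: bounded_rv_def)
  have i: "integrable M (\<lambda>\<omega>. exp (\<i> * complex_of_real (?x \<omega>)))" "integrable M (\<lambda>\<omega>. exp (\<i> * complex_of_real (?y \<omega>)))"
  proof -
    have "integrable M (\<lambda>\<omega>. exp (\<i> * complex_of_real (f \<omega>)))" if "f \<in> borel_measurable M" for f
      by (rule integrable_bounded[of _ 1]) (use that in simp_all)
    moreover have "?x \<in> borel_measurable M" "?y \<in> borel_measurable M"
      by (rule borel_measurable_times[OF borel_measurable_const borel_measurable_times[OF borel_measurable_const m(1)]],
          rule borel_measurable_times[OF borel_measurable_const borel_measurable_times[OF borel_measurable_const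
            borel_measurable_diff[OF m(2) borel_measurable_const]]])
    ultimately show "integrable M (\<lambda>\<omega>. exp (\<i> * complex_of_real (?x \<omega>)))" "integrable M (\<lambda>\<omega>. exp (\<i> * complex_of_real (?y \<omega>)))"
      by blast+
  qed
  have "cmod (expectation (\<lambda>\<omega>. exp (\<i> * of_real (?x \<omega>))) - expectation (\<lambda>\<omega>. exp (\<i> * of_real (?y \<omega>))))
      = cmod (expectation (\<lambda>\<omega>. exp (\<i> * of_real (?x \<omega>)) - exp (\<i> * of_real (?y \<omega>))))"
    by (simp only: Bochner_Integration.integral_diff[OF i])
  also have "\<dots> \<le> expectation (\<lambda>\<omega>. cmod (exp (\<i> * of_real (?x \<omega>)) - exp (\<i> * of_real (?y \<omega>))))" by (rule integral_norm_bound)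
  also have "\<dots> \<le> expectation (\<lambda>\<omega>. \<bar>\<theta>\<bar> * sqrt n * \<bar>lin_rem \<omega>\<bar> + \<bar>\<theta>\<bar> * ?\<delta>)"
  proof (rule integral_mono)
    show "integrable M (\<lambda>\<omega>. cmod (exp (\<i> * of_real (?x \<omega>)) - exp (\<i> * of_real (?y \<omega>))))" using i by (intro integrable_norm Bochner_Integration.integrable_diff)
    show "integrable M (\<lambda>\<omega>. \<bar>\<theta>\<bar> * sqrt n * \<bar>lin_rem \<omega>\<bar> + \<bar>\<theta>\<bar> * ?\<delta>)"
      by (intro bounded_rv_integrable bounded_rv_intros bounded_rv_lin_rem)
    fix \<omega>
    have "exp (\<i> * complex_of_real (?x \<omega>)) - exp (\<i> * of_real (?y \<omega>)) = exp (\<i> * of_real (?y \<omega>)) * (exp (\<i> * of_real (?x \<omega> - ?y \<omega>)) - 1)"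
    proof -
      have "exp (\<i> * complex_of_real a) = exp (\<i> * of_real b) * exp (\<i> * of_real (a - b))" for a b
        by (simp add: exp_add[symmetric] algebra_simps)
      from this[of "?x \<omega>" "?y \<omega>"]
      show ?thesis by (simp only: right_diff_distrib[of "exp _"] mult_1_right)
    qed
    then have "cmod (exp (\<i> * complex_of_real (?x \<omega>)) - exp (\<i> * of_real (?y \<omega>))) = cmod (exp (\<i> * of_real (?x \<omega> - ?y \<omega>)) - 1)"
      by (simp only: norm_mult norm_exp_i_times mult_1)
    also have "\<dots> \<le> \<bar>?x \<omega> - ?y \<omega>\<bar>" using iexp_approx1[of "?x \<omega> - ?y \<omega>" 0] by simp
    also have "?x \<omega> - ?y \<omega> = \<theta> * (sqrt n * lin_rem \<omega> - sqrt n * (total F lin - scenter lin))"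
      unfolding total_lin by (simp add: algebra_simps)
    also have "\<bar>\<dots>\<bar> \<le> \<bar>\<theta>\<bar> * (sqrt n * \<bar>lin_rem \<omega>\<bar> + ?\<delta>)"
    proof -
      have "\<bar>sqrt n * lin_rem \<omega> - sqrt n * (total F lin - scenter lin)\<bar> \<le> \<bar>sqrt n * lin_rem \<omega>\<bar> + ?\<delta>" by (rule abs_triangle_ineq4)
      also have "\<bar>sqrt n * lin_rem \<omega>\<bar> = sqrt n * \<bar>lin_rem \<omega>\<bar>" by (simp add: abs_mult)
      finally show ?thesis unfolding abs_mult[of \<theta>] by (intro mult_left_mono) auto
    qed
    finally show "cmod (exp (\<i> * of_real (?x \<omega>)) - exp (\<i> * of_real (?y \<omega>))) \<le> \<bar>\<theta>\<bar> * sqrt n * \<bar>lin_rem \<omega>\<bar> + \<bar>\<theta>\<bar> * ?\<delta>"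
      by (simp only: distrib_left mult.assoc)
  qed
  also have "\<dots> = \<bar>\<theta>\<bar> * (sqrt n * expectation (\<lambda>\<omega>. \<bar>lin_rem \<omega>\<bar>) + ?\<delta>)"
    using bounded_rv_integrable[OF bounded_rv_abs[OF bounded_rv_lin_rem]] by (simp add: prob_space distrib_left mult.assoc)
  also have "\<dots> \<le> \<bar>\<theta>\<bar> * ((1 + cR) / sqrt n + ?\<delta>)" using first_moments(1) by (intro mult_left_mono) auto
  finally have 1: "cmod (expectation (\<lambda>\<omega>. exp (\<i> * of_real (?x \<omega>))) - expectation (\<lambda>\<omega>. exp (\<i> * of_real (?y \<omega>))))
    \<le> \<bar>\<theta>\<bar> * ((1 + cR) / sqrt n + ?\<delta>)" .
  note 2 = hT_char_close[OF bounded_lin bd_ge(5) \<theta>]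
  have tri: "cmod (a - c) \<le> cmod (a - b) + cmod (b - c)" for a b c :: complex
    using norm_triangle_ineq[of "a - b" "b - c"] by simp
  show ?thesis using order_trans[OF tri add_mono[OF 1 2]] by (simp only: add.commute)
qed

lemma scenter_small:
  fixes \<theta> :: real
  assumes \<theta>: "0 < \<theta>" "2 * \<theta> * (bd * \<beta>) \<le> sqrt n"
  shows "\<bar>sqrt n * (total F lin - scenter lin)\<bar>
    \<le> (\<epsilon> + K * clt_const (337 * (2 * \<theta> * (bd * \<beta>))) / sqrt n) / \<theta> + \<theta> * (1 + C6 bd)"
  by (rule X_moments_close(1)[OF bounded_lin bd_ge(5) \<theta>])

end

section \<open>Limits\<close>

text \<open>Interchange of two limits. The error bounds contain negative powers of \<theta> in front
  of terms that vanish along the sequence, and positive powers of \<theta> that do not; hence first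
  the sequence, then \<theta>.\<close>

lemma tendsto_0_by_parameter:
  fixes x :: "nat \<Rightarrow> real" and a :: "real \<Rightarrow> nat \<Rightarrow> real" and b :: "real \<Rightarrow> real"
  assumes x: "\<And>\<theta>. 0 < \<theta> \<Longrightarrow> \<forall>\<^sub>F t in sequentially. \<bar>x t\<bar> \<le> a \<theta> t"
    and a: "\<And>\<theta>. 0 < \<theta> \<Longrightarrow> a \<theta> \<longlonglongrightarrow> b \<theta>" and b: "(b \<longlongrightarrow> 0) (at_right 0)"
  shows "x \<longlonglongrightarrow> 0"
proof (rule tendstoI)
  fix e :: real assume e: "0 < e"
  have "\<forall>\<^sub>F \<theta> in at_right 0. b \<theta> < e" using order_tendstoD(2)[OF b e] .
  moreover have "\<forall>\<^sub>F \<theta> :: real in at_right 0. 0 < \<theta>" by (rule eventually_at_right_less)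
  ultimately have "\<forall>\<^sub>F \<theta> in at_right 0. b \<theta> < e \<and> 0 < \<theta>" by (rule eventually_conj)
  then obtain \<theta> where \<theta>: "b \<theta> < e" "0 < \<theta>" using eventually_happens trivial_limit_at_right_real by blast
  show "\<forall>\<^sub>F t in sequentially. dist (x t) 0 < e"
    using order_tendstoD(2)[OF a[OF \<theta>(2)] \<theta>(1)] x[OF \<theta>(2)] by eventually_elim simp
qed

lemma clt_const_mono: "0 \<le> B \<Longrightarrow> B \<le> B' \<Longrightarrow> clt_const B \<le> clt_const B'"
  unfolding clt_const_def by (intro mult_mono power_mono) auto

text \<open>Only \<open>D\<close>, \<open>\<epsilon>\<close> and \<open>q\<close> vary along the
  sequence; every constant is a function of the shared parameters. The lower bound \<open>m3\<close>
  keeps the normalized variance away from 0, which permits dividing by the true variance.\<close>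

lemma plugin_limits:
  fixes D :: "nat \<Rightarrow> ('a::euclidean_space, 'w) two_stage" and \<rho> :: "'a \<Rightarrow> 'q::euclidean_space"
  assumes AP: "\<forall>\<^sub>F t in sequentially. approximated_plugin F (D t) \<alpha> \<beta> K (\<epsilon> t) (q t) \<rho> g C k \<Gamma> R"
    and \<epsilon>: "\<epsilon> \<longlonglongrightarrow> 0" and n: "filterlim (\<lambda>t. size1 (D t)) at_top sequentially"
    and m3: "0 < m3" "\<And>t. m3 \<le> real (size1 (D t)) * first_stage_var (D t) (lin_var F \<rho> g)"
  shows "\<forall>\<^sub>F t in sequentially. m3 / 2 \<le> real (size1 (D t)) * plugin_var (D t) \<rho> g"
    and "(\<lambda>t. \<integral>\<omega>. \<bar>real (size1 (D t)) * plugin_hajek (D t) \<rho> g \<omega> - real (size1 (D t)) * plugin_var (D t) \<rho> g\<bar> \<partial>outcomes (D t)) \<longlonglongrightarrow> 0"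
    and "(\<lambda>t. \<integral>\<omega>. exp (\<i> * complex_of_real (s * ((plugin_est (D t) \<rho> g \<omega> - plugin_param F \<rho> g) / sqrt (plugin_var (D t) \<rho> g)))) \<partial>outcomes (D t))
      \<longlonglongrightarrow> exp (- (s\<^sup>2 / 2))"
proof -
  let ?n = "\<lambda>t. real (size1 (D t))" and ?lin = "lin_var F \<rho> g"
  \<comment> \<open>One member of the sequence suffices to read off the facts about the shared
    constants.\<close>
  obtain t0 where t0: "approximated_plugin F (D t0) \<alpha> \<beta> K (\<epsilon> t0) (q t0) \<rho> g C k \<Gamma> R"
    using eventually_happens[OF AP] by auto
  define b where "b = plugin_population.bd F \<alpha> \<Gamma> R * \<beta>"
  define c1 where "c1 = 1 + approximated_plugin.c0 F \<alpha> \<beta> K \<Gamma> R + 4 * approximated_plugin.cR TYPE('q) F \<alpha> \<beta> K k \<Gamma> R"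
  define c2 where "c2 = approximated_population.C6 \<beta> K (plugin_population.bd F \<alpha> \<Gamma> R) + (4 * K * b\<^sup>2)\<^sup>2"
  define c3 where "c3 = 1 + approximated_population.C6 \<beta> K (plugin_population.bd F \<alpha> \<Gamma> R)"
  define G where "G \<theta> = clt_const (337 * (2 * \<theta> * b))" for \<theta>
  define x where "x t = ?n t * plugin_var (D t) \<rho> g" for t
  define v where "v t = ?n t * approximated_population.svar (D t) (q t) ?lin" for t
  define \<delta> where "\<delta> t = sqrt (?n t) * (total F ?lin - approximated_population.scenter (D t) (q t) ?lin)" for t
  have b: "0 < b" and K: "1 \<le> K"
  proof -
    interpret approximated_plugin F "D t0" \<alpha> \<beta> K "\<epsilon> t0" "q t0" \<rho> g C k \<Gamma> R by (rule t0)
    show "0 < b" using bd_ge(5) \<beta> by (simp add: b_def)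
    show "1 \<le> K" by (rule K)
  qed
  have "filterlim (\<lambda>t. sqrt (?n t)) at_top sequentially"
    by (rule filterlim_compose[OF sqrt_at_top filterlim_compose[OF filterlim_real_sequentially n]])
  then have lim_n: "(\<lambda>t. c / sqrt (?n t)) \<longlonglongrightarrow> 0" and ev_n: "\<forall>\<^sub>F t in sequentially. c \<le> sqrt (?n t)" for c
    by (auto intro: real_tendsto_divide_at_top simp: filterlim_at_top)
  have lim_err: "(\<lambda>t. \<epsilon> t + K * G \<theta> / sqrt (?n t)) \<longlonglongrightarrow> 0" for \<theta>
    using tendsto_add[OF \<epsilon> lim_n] by simp
  have \<delta>: "\<delta> \<longlonglongrightarrow> 0"
  proof (rule tendsto_0_by_parameter)
    fix \<theta> :: real assume \<theta>: "0 < \<theta>"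
    show "\<forall>\<^sub>F t in sequentially. \<bar>\<delta> t\<bar> \<le> (\<epsilon> t + K * G \<theta> / sqrt (?n t)) / \<theta> + \<theta> * c3"
      using AP ev_n[of "2 * \<theta> * b"]
    proof eventually_elim
      case (elim t)
      show ?case using approximated_plugin.scenter_small[OF elim(1) \<theta>, folded b_def, OF elim(2)] unfolding \<delta>_def G_def c3_def .
    qed
    show "(\<lambda>t. (\<epsilon> t + K * G \<theta> / sqrt (?n t)) / \<theta> + \<theta> * c3) \<longlonglongrightarrow> \<theta> * c3"
      using tendsto_add[OF tendsto_divide[OF lim_err tendsto_const, of \<theta> \<theta>] tendsto_const[of "\<theta> * c3"]] \<theta> by simp
  next
    have "((\<lambda>\<theta>. \<theta> * c3) \<longlongrightarrow> 0 * c3) (at_right 0)" by (intro tendsto_intros)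
    then show "((\<lambda>\<theta>. \<theta> * c3) \<longlongrightarrow> 0) (at_right 0)" by simp
  qed
  have xv: "(\<lambda>t. x t - v t) \<longlonglongrightarrow> 0"
  proof (rule tendsto_0_by_parameter)
    fix \<theta> :: real assume \<theta>: "0 < \<theta>"
    let ?e = "\<lambda>t. \<epsilon> t + K * G \<theta> / sqrt (?n t)"
    show "\<forall>\<^sub>F t in sequentially. \<bar>x t - v t\<bar> \<le> c1 / sqrt (?n t) + (2 * ?e t / \<theta>\<^sup>2 + \<theta>\<^sup>2 * c2) + (?e t / \<theta> + \<theta> * c3)\<^sup>2"
      using AP ev_n[of "2 * \<theta> * b"]
    proof eventually_elim
      case (elim t)
      show ?case
        using approximated_plugin.plugin_var_svar[OF elim(1) \<theta>, folded b_def, OF elim(2)]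
        unfolding x_def v_def G_def c1_def c2_def c3_def .
    qed
    have "(\<lambda>t. c1 / sqrt (?n t) + (2 * ?e t / \<theta>\<^sup>2 + \<theta>\<^sup>2 * c2) + (?e t / \<theta> + \<theta> * c3)\<^sup>2)
        \<longlonglongrightarrow> 0 + (2 * 0 / \<theta>\<^sup>2 + \<theta>\<^sup>2 * c2) + (0 / \<theta> + \<theta> * c3)\<^sup>2"
      using \<theta> by (intro tendsto_add tendsto_power tendsto_divide tendsto_mult lim_n lim_err tendsto_const) auto
    then show "(\<lambda>t. c1 / sqrt (?n t) + (2 * ?e t / \<theta>\<^sup>2 + \<theta>\<^sup>2 * c2) + (?e t / \<theta> + \<theta> * c3)\<^sup>2)
        \<longlonglongrightarrow> \<theta>\<^sup>2 * c2 + (\<theta> * c3)\<^sup>2" by simp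
  next
    have "((\<lambda>\<theta>. \<theta>\<^sup>2 * c2 + (\<theta> * c3)\<^sup>2) \<longlongrightarrow> 0\<^sup>2 * c2 + (0 * c3)\<^sup>2) (at_right 0)" by (intro tendsto_intros)
    then show "((\<lambda>\<theta>. \<theta>\<^sup>2 * c2 + (\<theta> * c3)\<^sup>2) \<longlongrightarrow> 0) (at_right 0)" by simp
  qed
  have low: "\<forall>\<^sub>F t in sequentially. m3 / 2 \<le> x t"
  proof -
    have "\<forall>\<^sub>F t in sequentially. c1 / sqrt (?n t) < m3 / 2" using order_tendstoD(2)[OF lim_n] m3(1) by simp
    then show ?thesis using AP
    proof eventually_elim
      case (elim t)
      show ?case
        using approximated_plugin.plugin_var_lower[OF elim(2), folded c1_def] elim(1) m3(2)[of t] unfolding x_def by linarith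
    qed
  qed
  then show "\<forall>\<^sub>F t in sequentially. m3 / 2 \<le> ?n t * plugin_var (D t) \<rho> g" unfolding x_def .
  define c4 where "c4 = 24 * (plugin_population.c\<gamma> F \<alpha> k \<Gamma> R * R) * plugin_population.bd F \<alpha> \<Gamma> R * \<beta>\<^sup>2 *
      (1 + approximated_plugin.cY TYPE('q) F \<alpha> \<beta> K \<Gamma> R) + b\<^sup>2 * (16 * approximated_population.C4 K + 8 * K)"
  show "(\<lambda>t. \<integral>\<omega>. \<bar>?n t * plugin_hajek (D t) \<rho> g \<omega> - ?n t * plugin_var (D t) \<rho> g\<bar> \<partial>outcomes (D t)) \<longlonglongrightarrow> 0"
  proof (rule Lim_null_comparison)
    show "\<forall>\<^sub>F t in sequentially. norm (\<integral>\<omega>. \<bar>?n t * plugin_hajek (D t) \<rho> g \<omega> - ?n t * plugin_var (D t) \<rho> g\<bar> \<partial>outcomes (D t))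
        \<le> c4 / sqrt (?n t) + \<bar>x t - v t\<bar>"
      using AP
    proof eventually_elim
      case (elim t)
      have "0 \<le> (\<integral>\<omega>. \<bar>?n t * plugin_hajek (D t) \<rho> g \<omega> - ?n t * plugin_var (D t) \<rho> g\<bar> \<partial>outcomes (D t))"
        by (rule integral_nonneg_AE) simp
      then show ?case
        using approximated_plugin.plugin_hajek_consistent[OF elim] unfolding x_def v_def c4_def b_def real_norm_def by (simp only: abs_of_nonneg)
    qed
    show "(\<lambda>t. c4 / sqrt (?n t) + \<bar>x t - v t\<bar>) \<longlonglongrightarrow> 0"
      using tendsto_add[OF lim_n tendsto_rabs[OF xv]] by simp
  qed
  let ?E = "\<lambda>t. \<integral>\<omega>. exp (\<i> * complex_of_real (s * ((plugin_est (D t) \<rho> g \<omega> - plugin_param F \<rho> g) / sqrt (plugin_var (D t) \<rho> g)))) \<partial>outcomes (D t)"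
  \<comment> \<open>Standardizing by the true variance means an argument
    \<open>s / sqrt (x t)\<close> that varies with \<open>t\<close>. Non-degeneracy bounds it by
    \<open>\<theta>m\<close>, and monotonicity of \<open>clt_const\<close> makes the error
    uniform.\<close>
  define \<theta>m where "\<theta>m = \<bar>s\<bar> / sqrt (m3 / 2)"
  have \<theta>m: "0 \<le> \<theta>m" using m3(1) by (simp add: \<theta>m_def)
  define c5 where "c5 = 1 + approximated_plugin.cR TYPE('q) F \<alpha> \<beta> K k \<Gamma> R"
  have close: "(\<lambda>t. ?E t - exp (- of_real (s\<^sup>2 * (v t / x t) / 2))) \<longlonglongrightarrow> 0"
  proof (rule Lim_null_comparison)
    show "\<forall>\<^sub>F t in sequentially. norm (?E t - exp (- of_real (s\<^sup>2 * (v t / x t) / 2)))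
        \<le> \<epsilon> t + K * G \<theta>m / sqrt (?n t) + \<theta>m * (c5 / sqrt (?n t) + \<bar>\<delta> t\<bar>)"
      using AP low ev_n[of "2 * \<theta>m * b"]
    proof eventually_elim
      case (elim t)
      interpret approximated_plugin F "D t" \<alpha> \<beta> K "\<epsilon> t" "q t" \<rho> g C k \<Gamma> R by (rule elim(1))
      define \<theta> where "\<theta> = s / sqrt (x t)"
      have x0: "0 < x t" and n0: "0 < ?n t" using elim(2) m3(1) n_ge1 by auto
      have "\<bar>\<theta>\<bar> = \<bar>s\<bar> / sqrt (x t)" using x0 by (simp add: \<theta>_def)
      also have "\<dots> \<le> \<theta>m" unfolding \<theta>m_def using elim(2) m3(1) by (intro divide_left_mono) auto
      finally have \<theta>: "\<bar>\<theta>\<bar> \<le> \<theta>m" .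
      have \<theta>b: "2 * \<bar>\<theta>\<bar> * b \<le> 2 * \<theta>m * b" using \<theta> b by (intro mult_right_mono) auto
      have th: "\<theta> * (sqrt (?n t) * w) = s * (w / sqrt (plugin_var (D t) \<rho> g))" for w
        using n0 by (simp add: \<theta>_def x_def real_sqrt_mult)
      have th2: "\<theta>\<^sup>2 * v t / 2 = s\<^sup>2 * (v t / x t) / 2" using x0 by (simp add: \<theta>_def power_divide)
      have "norm (?E t - exp (- of_real (s\<^sup>2 * (v t / x t) / 2)))
          \<le> \<epsilon> t + K * clt_const (337 * (2 * \<bar>\<theta>\<bar> * b)) / sqrt (?n t) + \<bar>\<theta>\<bar> * (c5 / sqrt (?n t) + \<bar>\<delta> t\<bar>)"
        using plugin_char_close[of \<theta>, folded b_def, OF order_trans[OF \<theta>b elim(3)]]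
        unfolding th v_def[symmetric] th2 \<delta>_def c5_def .
      also have "\<dots> \<le> \<epsilon> t + K * G \<theta>m / sqrt (?n t) + \<theta>m * (c5 / sqrt (?n t) + \<bar>\<delta> t\<bar>)"
      proof (intro add_mono mult_right_mono \<theta> order_refl divide_right_mono mult_left_mono)
        show "clt_const (337 * (2 * \<bar>\<theta>\<bar> * b)) \<le> G \<theta>m" unfolding G_def using \<theta>b b by (intro clt_const_mono) auto
        show "0 \<le> c5 / sqrt (?n t) + \<bar>\<delta> t\<bar>" using c_nonneg(3) by (simp add: c5_def)
      qed (use K in auto)
      finally show ?case .
    qed
    show "(\<lambda>t. \<epsilon> t + K * G \<theta>m / sqrt (?n t) + \<theta>m * (c5 / sqrt (?n t) + \<bar>\<delta> t\<bar>)) \<longlonglongrightarrow> 0"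
      using tendsto_add[OF lim_err tendsto_mult[OF tendsto_const tendsto_add[OF lim_n tendsto_rabs[OF \<delta>]]]] by simp
  qed
  \<comment> \<open>The Gaussian limit has variance \<open>v t\<close> while the standardization
    uses \<open>x t\<close>; their difference tends to 0 and \<open>x t\<close> stays above
    \<open>m3 / 2\<close>, so the ratio tends to 1. Neither of them need converge.\<close>
  have "(\<lambda>t. (x t - v t) / x t) \<longlonglongrightarrow> 0"
  proof (rule Lim_null_comparison)
    show "\<forall>\<^sub>F t in sequentially. norm ((x t - v t) / x t) \<le> \<bar>x t - v t\<bar> / (m3 / 2)"
      using low
    proof eventually_elim
      case (elim t)
      then have "\<bar>x t - v t\<bar> / x t \<le> \<bar>x t - v t\<bar> / (m3 / 2)" using m3(1) by (intro divide_left_mono) auto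
      then show ?case using elim m3(1) by simp
    qed
    show "(\<lambda>t. \<bar>x t - v t\<bar> / (m3 / 2)) \<longlonglongrightarrow> 0"
      using tendsto_divide[OF tendsto_rabs[OF xv] tendsto_const, of "m3 / 2"] m3(1) by simp
  qed
  then have "(\<lambda>t. 1 - (x t - v t) / x t) \<longlonglongrightarrow> 1 - 0" by (intro tendsto_diff tendsto_const)
  moreover have "\<forall>\<^sub>F t in sequentially. 1 - (x t - v t) / x t = v t / x t"
    using low by eventually_elim (use m3(1) in \<open>simp add: field_simps\<close>)
  ultimately have vx: "(\<lambda>t. v t / x t) \<longlonglongrightarrow> 1" using tendsto_cong by force
  have "(\<lambda>t. exp (- complex_of_real (s\<^sup>2 * (v t / x t) / 2))) \<longlonglongrightarrow> exp (- complex_of_real (s\<^sup>2 * 1 / 2))"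
    by (intro tendsto_intros vx) auto
  from tendsto_add[OF close this] show "?E \<longlonglongrightarrow> exp (- (s\<^sup>2 / 2))" by (simp flip: exp_of_real)
qed

section \<open>Constants from the regularity assumptions\<close>

lemma design_d2_nonneg: "0 \<le> design_d2 N p pr"
  unfolding design_d2_def by (intro sum_nonneg) simp

text \<open>The number of PSUs cancels: inclusion probabilities are of order \<open>n / N\<close>
  and the densities, being of the order of the inverse PSU measure, of order \<open>N\<close>. What
  is left gives \<alpha> from the upper bounds and \<beta> from the lower ones.\<close>

lemma regular_population_sequence:
  fixes D :: "nat \<Rightarrow> ('a::euclidean_space, 'w) two_stage"
  assumes F: "F \<in> lmeasurable" "0 < measure lebesgue F" and two: "\<And>t. two_stage_sampling F (D t)"
    and fs: "first_stage_regular D" and ss: "second_stage_regular F D"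
  obtains \<alpha> \<beta> \<kappa> :: real where "\<And>t. regular_population F (D t) \<alpha> \<beta>" "0 < \<kappa>" "\<And>t. size1 (D t) < psu_count (D t)"
    "\<And>t. \<kappa> * real (size1 (D t)) \<le> (\<Sum>i<psu_count (D t). pi1 (D t) i * (1 - pi1 (D t) i))"
proof -
  obtain f0 c C where f0: "f0 < 1" and c: "0 < c" "c \<le> C"
    and n: "\<And>t. real (size1 (D t)) / real (psu_count (D t)) \<le> f0"
    and pi: "\<And>t i. i < psu_count (D t) \<Longrightarrow> c \<le> real (psu_count (D t)) / real (size1 (D t)) * pi1 (D t) i"
      "\<And>t i. i < psu_count (D t) \<Longrightarrow> real (psu_count (D t)) / real (size1 (D t)) * pi1 (D t) i \<le> C"
    using fs unfolding first_stage_regular_def by blast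
  obtain \<kappa> K \<phi> \<Phi> c1 C1 where \<phi>: "0 < \<phi>" "\<phi> \<le> \<Phi>" and c1: "0 < c1" "c1 \<le> C1"
    and ss': "\<forall>t. \<forall>i<psu_count (D t).
           \<kappa> * mean_size2 (D t) \<le> real (size2 (D t) i) \<and>
           real (size2 (D t) i) \<le> K * mean_size2 (D t) \<and>
           \<phi> * measure lebesgue F / real (psu_count (D t)) \<le> psu_measure (D t) i \<and>
           psu_measure (D t) i \<le> \<Phi> * measure lebesgue F / real (psu_count (D t)) \<and>
           (\<forall>x \<in> psu (D t) i.
              c1 / psu_measure (D t) i \<le> density2 (D t) i x \<and>
              density2 (D t) i x \<le> C1 / psu_measure (D t) i) \<and>
           2 \<le> size2 (D t) i"
    using ss unfolding second_stage_regular_def by (elim exE conjE) (rule that)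
  have size: "\<phi> * measure lebesgue F / real (psu_count (D t)) \<le> psu_measure (D t) i"
      "psu_measure (D t) i \<le> \<Phi> * measure lebesgue F / real (psu_count (D t))"
    and two2: "2 \<le> size2 (D t) i"
    if "i < psu_count (D t)" for t i using ss' that by simp_all
  have dens: "c1 / psu_measure (D t) i \<le> density2 (D t) i x" "density2 (D t) i x \<le> C1 / psu_measure (D t) i"
    if "i < psu_count (D t)" "x \<in> psu (D t) i" for t i x using ss' that by simp_all
  let ?A = "measure lebesgue F"
  define \<alpha> where "\<alpha> = \<phi> * ?A / (C * C1)"
  define \<beta> where "\<beta> = \<Phi> * ?A / (c * c1)"
  have ab: "0 < \<alpha>" "0 < \<beta>" using c c1 \<phi> F(2) by (simp_all add: \<alpha>_def \<beta>_def)
  have N: "0 < real (psu_count (D t))" for t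
  proof (rule ccontr)
    assume "\<not> 0 < real (psu_count (D t))"
    then have "F = {}" using two[of t] by (simp add: two_stage_sampling_def psu_partition_def)
    then show False using F(2) by simp
  qed
  \<comment> \<open>An empty sample is excluded by the lower bound on the normalized inclusion
    probabilities: division by a zero sample size yields 0, which is not at least
    \<open>c\<close>.\<close>
  have n0: "0 < real (size1 (D t))" for t
  proof (rule ccontr)
    assume "\<not> 0 < real (size1 (D t))"
    then show False using pi(1)[of 0 t] N[of t] c by simp
  qed
  have n0': "0 < size1 (D t)" for t using n0[of t] by (simp only: of_nat_0_less_iff)
  have nN: "real (size1 (D t)) \<le> f0 * real (psu_count (D t))" for t using n[of t] N[of t] by (simp add: pos_divide_le_eq)
  have nN': "size1 (D t) < psu_count (D t)" for t
  proof -
    have "f0 * real (psu_count (D t)) < 1 * real (psu_count (D t))" using f0 N[of t] by (intro mult_strict_right_mono)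
    then show ?thesis using nN[of t] by simp
  qed
  have p: "c * size1 (D t) / psu_count (D t) \<le> pi1 (D t) i" "pi1 (D t) i \<le> C * size1 (D t) / psu_count (D t)" "0 < pi1 (D t) i"
    if "i < psu_count (D t)" for t i
  proof -
    show 1: "c * size1 (D t) / psu_count (D t) \<le> pi1 (D t) i" and "pi1 (D t) i \<le> C * size1 (D t) / psu_count (D t)"
      using pi[OF that] n0[of t] N[of t] by (simp_all add: field_simps)
    have "0 < c * size1 (D t) / psu_count (D t)" using c n0[of t] N[of t] by simp
    then show "0 < pi1 (D t) i" using 1 by linarith
  qed
  have reg: "regular_population F (D t) \<alpha> \<beta>" for t
  proof (intro regular_population.intro two_stage_population.intro regular_population_axioms.intro two ab F(1) p(3) two2 n0')
    fix i x assume i: "i < psu_count (D t)" and x: "x \<in> psu (D t) i"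
    let ?a = "psu_measure (D t) i" and ?d = "density2 (D t) i x" and ?p = "pi1 (D t) i" and ?N = "real (psu_count (D t))" and ?n = "real (size1 (D t))"
    have "0 < \<phi> * ?A / ?N" using \<phi> F(2) N[of t] by simp
    then have a: "0 < ?a" using size(1)[OF i] by linarith
    have "0 < c1 / ?a" using a c1 by simp
    then have d: "0 < ?d" using dens(1)[OF i x] by linarith
    have "\<alpha> / ?n * (?p * ?d) \<le> \<alpha> / ?n * ((C * ?n / ?N) * (C1 / (\<phi> * ?A / ?N)))"
    proof (intro mult_left_mono mult_mono p(2)[OF i])
      have "?d \<le> C1 / ?a" by (rule dens(2)[OF i x])
      also have "\<dots> \<le> C1 / (\<phi> * ?A / ?N)" using size(1)[OF i] \<open>0 < \<phi> * ?A / ?N\<close> a c1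
        by (intro divide_left_mono mult_pos_pos) auto
      finally show "?d \<le> C1 / (\<phi> * ?A / ?N)" .
    qed (use c d ab n0[of t] N[of t] in auto)
    also have "\<dots> = 1" using c c1 \<phi> F(2) N[of t] n0[of t] by (simp add: \<alpha>_def)
    finally have l: "\<alpha> / ?n \<le> 1 / (?p * ?d)" using d p(3)[OF i] by (simp add: pos_le_divide_eq)
    have "1 = \<beta> / ?n * ((c * ?n / ?N) * (c1 / (\<Phi> * ?A / ?N)))"
      using c c1 \<phi> F(2) N[of t] n0[of t] by (simp add: \<beta>_def)
    also have "\<dots> \<le> \<beta> / ?n * (?p * ?d)"
    proof (intro mult_left_mono mult_mono p(1)[OF i])
      have "c1 / (\<Phi> * ?A / ?N) \<le> c1 / ?a" using size(2)[OF i] a c1 \<phi> F(2) N[of t]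
        by (intro divide_left_mono mult_pos_pos divide_pos_pos) auto
      also have "\<dots> \<le> ?d" by (rule dens(1)[OF i x])
      finally show "c1 / (\<Phi> * ?A / ?N) \<le> ?d" .
    qed (use c c1 \<phi> F(2) d ab n0[of t] N[of t] p(3)[OF i] in auto)
    finally have "1 / (?p * ?d) \<le> \<beta> / ?n" using d p(3)[OF i] by (simp add: pos_divide_le_eq)
    with d l show "0 < ?d \<and> \<alpha> / ?n \<le> 1 / (?p * ?d) \<and> 1 / (?p * ?d) \<le> \<beta> / ?n" by blast
  qed
  \<comment> \<open>Here \<open>\<kappa>\<close> is \<open>c * (1 - f0)\<close>: each factor
    \<open>pi1\<close> is at least \<open>c * n / N\<close>, and the complements sum to
    \<open>N - n\<close>, which is at least \<open>(1 - f0) * N\<close>.\<close>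
  have kap: "(c * (1 - f0)) * real (size1 (D t)) \<le> (\<Sum>i<psu_count (D t). pi1 (D t) i * (1 - pi1 (D t) i))" for t
  proof -
    interpret regular_population F "D t" \<alpha> \<beta> by (rule reg)
    let ?N = "real (psu_count (D t))" and ?n = "real (size1 (D t))"
    have "(c * (1 - f0)) * ?n = (c * ?n / ?N) * (?N - f0 * ?N)" using N[of t] by (simp add: field_simps)
    also have "\<dots> \<le> (c * ?n / ?N) * (?N - ?n)" using nN[of t] c N[of t] by (intro mult_left_mono) auto
    also have "\<dots> = (\<Sum>i<psu_count (D t). (c * ?n / ?N) * (1 - pi1 (D t) i))"
      unfolding sum_distrib_left[symmetric] sum_subtractf sum_pi1 by simp
    also have "\<dots> \<le> (\<Sum>i<psu_count (D t). pi1 (D t) i * (1 - pi1 (D t) i))"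
    proof (intro sum_mono mult_right_mono)
      fix i assume i: "i \<in> {..<psu_count (D t)}"
      show "c * ?n / ?N \<le> pi1 (D t) i" using p(1) i by simp
      show "0 \<le> 1 - pi1 (D t) i" by (simp add: incl_prob_def)
    qed
    finally show ?thesis .
  qed
  show ?thesis by (rule that[OF reg _ nN' kap]) (use c f0 in simp)
qed

theorem proposition8:
  fixes F :: "'a::euclidean_space set"
    and D :: "nat \<Rightarrow> ('a, 'w) two_stage"
    and pr :: "nat \<Rightarrow> nat set pmf"
    and \<rho> :: "'a \<Rightarrow> 'q::euclidean_space"
    and g :: "'q \<Rightarrow> real"
    and C :: "'q set"
    and m3 :: real
  assumes "bounded F" and "F \<in> sets lebesgue" and "0 < measure lebesgue F"
    and "\<And>t. two_stage_sampling F (D t)"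
    and "filterlim (\<lambda>t. psu_count (D t)) at_top sequentially"
    and "filterlim (\<lambda>t. size1 (D t)) at_top sequentially"
    and "\<And>\<epsilon>. 0 < \<epsilon> \<Longrightarrow> \<forall>\<^sub>F t in sequentially. \<forall>i<psu_count (D t). diameter (psu (D t) i) < \<epsilon>"
    and "\<And>t. is_rejective_design (psu_count (D t)) (size1 (D t)) (pr t)"
    and "\<And>t i. i < psu_count (D t) \<Longrightarrow> incl_prob (pr t) i = incl_prob (design1 (D t)) i"
    and "(\<lambda>t. design_d2 (psu_count (D t)) (design1 (D t)) (pr t)) \<longlonglongrightarrow> 0"
    and "first_stage_regular D"
    and "second_stage_regular F D"
    and "\<rho> \<in> borel_measurable (lebesgue_on F)"
    and "homogeneous_degree_0 g"
    and "plugin_regular F \<rho> g C"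
    and "0 < m3"
    and "\<And>t. m3 \<le> real (size1 (D t)) * first_stage_var (D t) (lin_var F \<rho> g)"
  shows "weak_conv_m
           (\<lambda>t. distr (outcomes (D t)) borel
              (\<lambda>\<omega>. (plugin_est (D t) \<rho> g \<omega> - plugin_param F \<rho> g) / sqrt (plugin_var (D t) \<rho> g)))
           std_normal_distribution \<and>
         (\<forall>t. integrable (outcomes (D t)) (plugin_hajek (D t) \<rho> g)) \<and>
         (\<lambda>t. prob_space.expectation (outcomes (D t))
              (\<lambda>\<omega>. (1 / (measure lebesgue F)\<^sup>2) * real (size1 (D t)) *
                    \<bar>plugin_hajek (D t) \<rho> g \<omega> - plugin_var (D t) \<rho> g\<bar>)) \<longlonglongrightarrow> 0 \<and>
         converges_in_prob (\<lambda>t. outcomes (D t))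
           (\<lambda>t \<omega>. plugin_hajek (D t) \<rho> g \<omega> / plugin_var (D t) \<rho> g) 1"
proof -
  have F_fin: "F \<in> lmeasurable" using assms(1,2) by (rule bounded_set_imp_lmeasurable)
  obtain \<alpha> \<beta> \<kappa> :: real where reg: "\<And>t. regular_population F (D t) \<alpha> \<beta>" and \<kappa>: "0 < \<kappa>" and nN: "\<And>t. size1 (D t) < psu_count (D t)"
    and \<kappa>n: "\<And>t. \<kappa> * real (size1 (D t)) \<le> (\<Sum>i<psu_count (D t). pi1 (D t) i * (1 - pi1 (D t) i))"
    by (rule regular_population_sequence[OF F_fin assms(3,4,11,12)]) (rule that)
  have conv: "convex C" and cpt: "compact C" and \<rho>C: "\<forall>x\<in>F. \<rho> x \<in> C"
    and int: "total F \<rho> /\<^sub>R measure lebesgue F \<in> interior C" and diff: "\<forall>a\<in>C. g differentiable (at a)"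
    and ex_k: "\<exists>K>0. \<forall>a\<in>C. \<forall>b\<in>C. norm (gradient g b - gradient g a) \<le> K * norm (b - a)"
    using assms(15) unfolding plugin_regular_def by blast+
  obtain k where k: "0 < k" and lip: "\<forall>a\<in>C. \<forall>b\<in>C. norm (gradient g b - gradient g a) \<le> k * norm (b - a)" using ex_k by blast
  define \<mu> where "\<mu> = total F \<rho> /\<^sub>R measure lebesgue F"
  have \<mu>: "\<mu> \<in> C" using int interior_subset unfolding \<mu>_def by blast
  obtain R0 where R0: "\<forall>a\<in>C. norm a \<le> R0" using compact_imp_bounded[OF cpt] unfolding bounded_iff by blast
  define R where "R = max 1 R0"
  have R: "1 \<le> R" "\<And>a. a \<in> C \<Longrightarrow> norm a \<le> R" using R0 by (auto simp: R_def max_def intro: order_trans)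
  \<comment> \<open>The Lipschitz condition and the bounded diameter of \<open>C\<close> bound the
    gradient everywhere by its norm at the mean plus \<open>k\<close> times
    \<open>2 * R\<close>.\<close>
  define \<Gamma> where "\<Gamma> = norm (gradient g \<mu>) + k * (2 * R)"
  have \<Gamma>: "norm (gradient g a) \<le> \<Gamma>" if a: "a \<in> C" for a
  proof -
    have "norm (gradient g a - gradient g \<mu>) \<le> k * norm (a - \<mu>)" using lip \<mu> a by blast
    also have "norm (a - \<mu>) \<le> 2 * R" using norm_triangle_ineq4[of a \<mu>] R(2)[OF a] R(2)[OF \<mu>] by linarith
    finally have "norm (gradient g a - gradient g \<mu>) \<le> k * (2 * R)" using k by (simp add: mult_left_mono)
    then show ?thesis using norm_triangle_ineq2[of "gradient g a" "gradient g \<mu>"] by (simp add: \<Gamma>_def)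
  qed
  have PP: "plugin_population F (D t) \<alpha> \<beta> \<rho> g C k \<Gamma> R" for t
  proof (intro plugin_population.intro plugin_population_axioms.intro reg)
    show "closed C" using cpt by (rule compact_imp_closed)
    show "total F \<rho> /\<^sub>R measure lebesgue F \<in> C" using \<mu> unfolding \<mu>_def .
    show "norm (gradient g b - gradient g a) \<le> k * norm (b - a)" if "a \<in> C" "b \<in> C" for a b using lip that by blast
  qed (use assms(3,13,14) conv \<rho>C diff k \<Gamma> R in auto)
  define K where "K = 3 * 10 ^ 14 + 32 * 113233 * (337 / \<kappa>) * sqrt (337 / \<kappa>)"
  have K: "1 \<le> K" using \<kappa> by (simp add: K_def)
  define \<epsilon> where "\<epsilon> t = sqrt (design_d2 (psu_count (D t)) (design1 (D t)) (pr t))" for t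
  have \<epsilon>: "\<epsilon> \<longlonglongrightarrow> 0" using tendsto_real_sqrt[OF assms(10)] by (simp add: \<epsilon>_def[abs_def])
  \<comment> \<open>The approximation is available only once the sample is large. Making this a
    premise inside the existence claim allows choosing one sequence of parameters for all
    \<open>t\<close>.\<close>
  have "\<forall>t. \<exists>q. 674 \<le> \<kappa> * real (size1 (D t)) \<longrightarrow> approximates_poisson K (psu_count (D t)) (size1 (D t)) (design1 (D t)) (\<epsilon> t) q"
  proof
    fix t
    interpret regular_population F "D t" \<alpha> \<beta> by (rule reg)
    show "\<exists>q. 674 \<le> \<kappa> * real (size1 (D t)) \<longrightarrow> approximates_poisson K (psu_count (D t)) (size1 (D t)) (design1 (D t)) (\<epsilon> t) q"
      using design_close_to_rejective[OF assms(8) assms(9) incl_pos design1_support size1_pos nN \<kappa> \<kappa>n, folded K_def]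
      unfolding \<epsilon>_def by blast
  qed
  from choice[OF this] obtain q where q: "\<And>t. 674 \<le> \<kappa> * real (size1 (D t)) \<Longrightarrow> approximates_poisson K (psu_count (D t)) (size1 (D t)) (design1 (D t)) (\<epsilon> t) (q t)" by blast
  have real_n: "filterlim (\<lambda>t. real (size1 (D t))) at_top sequentially"
    by (rule filterlim_compose[OF filterlim_real_sequentially assms(6)])
  have "\<forall>\<^sub>F t in sequentially. 674 / \<kappa> \<le> real (size1 (D t))" using real_n by (simp add: filterlim_at_top)
  then have AP: "\<forall>\<^sub>F t in sequentially. approximated_plugin F (D t) \<alpha> \<beta> K (\<epsilon> t) (q t) \<rho> g C k \<Gamma> R"
    using order_tendstoD(2)[OF \<epsilon> zero_less_one]
  proof eventually_elim
    case (elim t)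
    show ?case
    proof (intro approximated_plugin.intro PP approximated_population.intro approximated_population_axioms.intro reg K)
      show "approximates_poisson K (psu_count (D t)) (size1 (D t)) (design1 (D t)) (\<epsilon> t) (q t)"
        using elim(1) \<kappa> by (intro q) (simp add: pos_divide_le_eq mult.commute)
      show "0 \<le> \<epsilon> t" unfolding \<epsilon>_def using design_d2_nonneg by simp
      show "\<epsilon> t \<le> 1" using elim(2) by simp
    qed
  qed
  note lim = plugin_limits[OF AP \<epsilon> assms(6,16,17)]
  let ?n = "\<lambda>t. real (size1 (D t))" and ?V = "\<lambda>t. plugin_var (D t) \<rho> g" and ?H = "\<lambda>t. plugin_hajek (D t) \<rho> g"
  have ps: "prob_space (outcomes (D t))" for t using assms(4) by (simp add: two_stage_sampling_def)
  note est_m = plugin_population.plugin_est_measurable[OF PP] and haj = plugin_population.plugin_hajek_facts[OF PP]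
  let ?W = "\<lambda>t \<omega>. (plugin_est (D t) \<rho> g \<omega> - plugin_param F \<rho> g) / sqrt (?V t)"
  have Wm: "?W t \<in> borel_measurable (outcomes (D t))" for t
    by (intro borel_measurable_divide borel_measurable_diff est_m borel_measurable_const)
  \<comment> \<open>Levy's continuity theorem turns the pointwise limit of the characteristic
    functions into convergence in distribution.\<close>
  have "weak_conv_m (\<lambda>t. distr (outcomes (D t)) borel (?W t)) std_normal_distribution"
  proof (rule levy_continuity)
    show "real_distribution (distr (outcomes (D t)) borel (?W t))" for t
      using prob_space.real_distribution_distr[OF ps Wm] .
    show "real_distribution std_normal_distribution" by (rule real_dist_normal_dist)
    fix s
    have "char (distr (outcomes (D t)) borel (?W t)) s = (\<integral>\<omega>. exp (\<i> * complex_of_real (s * ?W t \<omega>)) \<partial>outcomes (D t))" for t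
      unfolding char_def by (subst integral_distr[OF Wm]) auto
    then show "(\<lambda>t. char (distr (outcomes (D t)) borel (?W t)) s) \<longlonglongrightarrow> char std_normal_distribution s"
      using lim(3)[of s] by (simp add: char_std_normal_distribution)
  qed
  moreover have "\<forall>t. integrable (outcomes (D t)) (?H t)" using haj(2) by blast
  moreover have "(\<lambda>t. prob_space.expectation (outcomes (D t)) (\<lambda>\<omega>. (1 / (measure lebesgue F)\<^sup>2) * ?n t * \<bar>?H t \<omega> - ?V t\<bar>)) \<longlonglongrightarrow> 0"
  proof -
    have "(1 / (measure lebesgue F)\<^sup>2) * ?n t * \<bar>?H t \<omega> - ?V t\<bar> = (1 / (measure lebesgue F)\<^sup>2) * \<bar>?n t * ?H t \<omega> - ?n t * ?V t\<bar>" for t \<omega>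
      unfolding right_diff_distrib[symmetric] abs_mult by simp
    then have "(\<lambda>t. \<integral>\<omega>. (1 / (measure lebesgue F)\<^sup>2) * ?n t * \<bar>?H t \<omega> - ?V t\<bar> \<partial>outcomes (D t))
        = (\<lambda>t. (1 / (measure lebesgue F)\<^sup>2) * (\<integral>\<omega>. \<bar>?n t * ?H t \<omega> - ?n t * ?V t\<bar> \<partial>outcomes (D t)))"
      by (simp only: integral_mult_right_zero)
    then show ?thesis using tendsto_mult_right_zero[OF lim(2), of "1 / (measure lebesgue F)\<^sup>2"] by (simp only:)
  qed
  \<comment> \<open>Markov's inequality from the convergence in mean. Multiplying the relative error
    by \<open>n\<close> times the variance, which is eventually at least \<open>m3 / 2\<close>,
    relates it to the absolute error.\<close>
  moreover have "converges_in_prob (\<lambda>t. outcomes (D t)) (\<lambda>t \<omega>. ?H t \<omega> / ?V t) 1"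
    unfolding converges_in_prob_def
  proof (intro conjI allI impI)
    show "(\<lambda>\<omega>. ?H t \<omega> / ?V t) \<in> borel_measurable (outcomes (D t))" for t
      by (intro borel_measurable_divide haj(1) borel_measurable_const)
    fix \<eta> :: real assume \<eta>: "0 < \<eta>"
    let ?I = "\<lambda>t. \<integral>\<omega>. \<bar>?n t * ?H t \<omega> - ?n t * ?V t\<bar> \<partial>outcomes (D t)"
    have c: "0 < \<eta> * (m3 / 2)" using \<eta> assms(16) by simp
    show "(\<lambda>t. measure (outcomes (D t)) {\<omega> \<in> space (outcomes (D t)). \<eta> < \<bar>?H t \<omega> / ?V t - 1\<bar>}) \<longlonglongrightarrow> 0"
    proof (rule Lim_null_comparison)
      have "(\<lambda>t. ?I t / (\<eta> * (m3 / 2))) \<longlonglongrightarrow> 0 / (\<eta> * (m3 / 2))"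
        by (rule tendsto_divide[OF lim(2) tendsto_const]) (use \<eta> assms(16) in simp)
      then show "(\<lambda>t. ?I t / (\<eta> * (m3 / 2))) \<longlonglongrightarrow> 0" by (simp only: div_0)
      show "\<forall>\<^sub>F t in sequentially. norm (measure (outcomes (D t)) {\<omega> \<in> space (outcomes (D t)). \<eta> < \<bar>?H t \<omega> / ?V t - 1\<bar>})
          \<le> ?I t / (\<eta> * (m3 / 2))"
        using lim(1)
      proof eventually_elim
        case (elim t)
        interpret P: prob_space "outcomes (D t)" by (rule ps)
        have x0: "0 < ?n t * ?V t" using elim assms(16) by linarith
        have i: "integrable (outcomes (D t)) (\<lambda>\<omega>. \<bar>?n t * ?H t \<omega> - ?n t * ?V t\<bar>)" using haj(2) by auto
        have "measure (outcomes (D t)) {\<omega> \<in> space (outcomes (D t)). \<eta> < \<bar>?H t \<omega> / ?V t - 1\<bar>}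
            \<le> measure (outcomes (D t)) {\<omega> \<in> space (outcomes (D t)). \<eta> * (m3 / 2) \<le> \<bar>?n t * ?H t \<omega> - ?n t * ?V t\<bar>}"
        proof (rule P.finite_measure_mono)
          show "{\<omega> \<in> space (outcomes (D t)). \<eta> < \<bar>?H t \<omega> / ?V t - 1\<bar>} \<subseteq>
              {\<omega> \<in> space (outcomes (D t)). \<eta> * (m3 / 2) \<le> \<bar>?n t * ?H t \<omega> - ?n t * ?V t\<bar>}"
          proof safe
            fix \<omega> assume h: "\<eta> < \<bar>?H t \<omega> / ?V t - 1\<bar>"
            have V: "?V t \<noteq> 0" using x0 by auto
            have "\<eta> * (m3 / 2) \<le> \<bar>?H t \<omega> / ?V t - 1\<bar> * (?n t * ?V t)" using h elim \<eta> assms(16) by (intro mult_mono) auto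
            also have "\<dots> = \<bar>(?H t \<omega> / ?V t - 1) * (?n t * ?V t)\<bar>" unfolding abs_mult[of "?H t \<omega> / ?V t - 1"] abs_of_pos[OF x0] ..
            also have "(?H t \<omega> / ?V t - 1) * (?n t * ?V t) = ?n t * ?H t \<omega> - ?n t * ?V t" using V by (simp add: field_simps)
            finally show "\<eta> * (m3 / 2) \<le> \<bar>?n t * ?H t \<omega> - ?n t * ?V t\<bar>" .
          qed
          show "{\<omega> \<in> space (outcomes (D t)). \<eta> * (m3 / 2) \<le> \<bar>?n t * ?H t \<omega> - ?n t * ?V t\<bar>} \<in> sets (outcomes (D t))"
            using borel_measurable_integrable[OF i] by (intro borel_measurable_le borel_measurable_const)
        qed
        also have "\<dots> \<le> ?I t / (\<eta> * (m3 / 2))"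
          by (rule integral_Markov_inequality_measure[OF i sets.top _ c]) simp
        finally show ?case by simp
      qed
    qed
  qed
  ultimately show ?thesis by blast
qed

end
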